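(* Let $1<p,q<\infty$, $0<\delta<1$, and $m>-\left|\frac1q-\frac12\right|\delta n$. Let $\sigma_\delta$ be the symbol defined below and $\sigma_\delta^*$ its adjoint symbol. Then $\sigma_\delta$ and $\sigma_\delta^*$ belong to $S^m_{1,\delta}$. Moreover, if $q\ge2$ then $\sigma_\delta(X,D)$ is not bounded on $M^{p,q}(\mathbb{R}^n)$, and if $q\le 2$ then $\sigma_\delta^*(X,D)$ is not bounded on $M^{p,q}(\mathbb{R}^n)$.
   Context: Fourier transform: $\widehat f(\xi)=\mathcal{F}f(\xi)=\int_{\mathbb{R}^n}e^{-i\xi\cdot x}f(x)\,dx$, $\mathcal{F}^{-1}f(x)=(2\pi)^{-n}\int e^{ix\cdot\xi}f(\xi)\,d\xi$. For $m\in\mathbb{R}$, $0\le\delta\le\rho\le1$, $S^m_{\rho,\delta}$ consists of all $\sigma\in C^\infty(\mathbb{R}^n\times\mathbb{R}^n)$ with $|\partial_\xi^\alpha\partial_x^\beta\sigma(x,\xi)|\le C_{\alpha,\beta}(1+|\xi|)^{m-\rho|\alpha|+\delta|\beta|}$ for all multi-indices $\alpha,\beta$; $\sigma(X,D)f(x)=(2\pi)^{-n}\int e^{ix\cdot\xi}\sigma(x,\xi)\widehat f(\xi)\,d\xi$ for $f\in\mathcal{S}(\mathbb{R}^n)$. For $\sigma\in S^m_{\rho,\delta}$ with $\delta<1$, the adjoint symbol is the oscillatory integral $\sigma^*(x,\xi)=\lim_{\epsilon\to0}(2\pi)^{-n}\iint e^{-iy\cdot\zeta}\chi(\epsilon y,\epsilon\zeta)\overline{\sigma(x+y,\xi+\zeta)}\,dy\,d\zeta$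 (any $\chi\in\mathcal{S}(\mathbb{R}^{2n})$ with $\chi(0,0)=1$); it satisfies $(\sigma(X,D)f,g)=(f,\sigma^*(X,D)g)$ for $f,g\in\mathcal{S}$, where $(f,g)=\int f\bar g$. Modulation spaces: fix $\gamma\in\mathcal{S}(\mathbb{R}^n)\setminus\{0\}$; $V_\gamma f(x,\xi)=(f,M_\xi T_x\gamma)$ with $M_\xi\gamma(t)=e^{i\xi\cdot t}\gamma(t)$, $T_x\gamma(t)=\gamma(t-x)$; $M^{p,q}(\mathbb{R}^n)=\{f\in\mathcal{S}':\|f\|_{M^{p,q}}=(\int(\int|V_\gamma f(x,\xi)|^pdx)^{q/p}d\xi)^{1/q}<\infty\}$; "bounded on $M^{p,q}$" means $\|\sigma(X,D)f\|_{M^{p,q}}\le C\|f\|_{M^{p,q}}$ for all $f\in\mathcal{S}$. The symbol $\sigma_\delta$: let $\varphi,\eta\in\mathcal{S}(\mathbb{R}^n)$ be real-valued, $\varphi$ radial, $\operatorname{supp}\varphi\subset\{|\xi|\le1/8\}$, $\int\varphi=1$, $\operatorname{supp}\eta\subset\{2^{-1/2}\le|\xi|\le2^{1/2}\}$, $\eta=1$ on $\{2^{-1/4}\le|\xi|\le2^{1/4}\}$; $\Phi=\mathcal{F}^{-1}\varphi$. Choose $j_0\in\{0,1,2,\dots\}$ with $1+2^{j_0(\delta-1)+1}\le2^{1/4}$, $1-2^{j_0(\delta-1)+1}\ge2^{-1/4}$, $2^{-j_0\delta/2}\sqrt n\le2^{-3}$. Then $\sigma_\delta(x,\xi)=\sum_{j=j_0}^\infty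 2^{jm}\Big(\sum_{k\in\mathbb{Z}^n,\,0<|k|\le2^{j\delta/2}}e^{-ik\cdot(2^{j\delta/2}x-k)}\Phi(2^{j\delta/2}x-k)\Big)\eta(2^{-j}\xi)$, and $\sigma_\delta^*$ is its adjoint symbol. *)

theory Defs
  imports "HOL-Analysis.Analysis"
begin

definition dirderiv :: "'a::real_normed_vector \<Rightarrow> ('a \<Rightarrow> 'b::real_normed_vector) \<Rightarrow> 'a \<Rightarrow> 'b" where
  "dirderiv v f x = vector_derivative (\<lambda>t::real. f (x + t *\<^sub>R v)) (at 0)"

fun diffs :: "'a::real_normed_vector list \<Rightarrow> ('a \<Rightarrow> 'b::real_normed_vector) \<Rightarrow> 'a \<Rightarrow> 'b" where
  "diffs [] f = f"
| "diffs (v # vs) f = dirderiv v (diffs vs f)"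

definition smooth :: "('a::euclidean_space \<Rightarrow> 'b::real_normed_vector) \<Rightarrow> bool" where
  "smooth f \<longleftrightarrow> (\<forall>vs. set vs \<subseteq> Basis \<longrightarrow>
      continuous_on UNIV (diffs vs f) \<and>
      (\<forall>v\<in>Basis. \<forall>x. (\<lambda>t::real. diffs vs f (x + t *\<^sub>R v)) differentiable (at 0)))"

definition schwartz :: "('a::euclidean_space \<Rightarrow> 'b::real_normed_vector) \<Rightarrow> bool" where
  "schwartz f \<longleftrightarrow> smooth f \<and>
     (\<forall>vs (N::nat). set vs \<subseteq> Basis \<longrightarrow> (\<exists>C. \<forall>x. (1 + norm x) ^ N * norm (diffs vs f x) \<le> C))"

definition fourier :: "(real^'n \<Rightarrow> complex) \<Rightarrow> real^'n \<Rightarrow> complex" where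
  "fourier f \<xi> = (LINT x|lborel. exp (- \<i> * complex_of_real (\<xi> \<bullet> x)) * f x)"

definition inv_fourier :: "(real^'n \<Rightarrow> complex) \<Rightarrow> real^'n \<Rightarrow> complex" where
  "inv_fourier f x = complex_of_real ((2 * pi) powr (- real CARD('n))) *
     (LINT \<xi>|lborel. exp (\<i> * complex_of_real (x \<bullet> \<xi>)) * f \<xi>)"

definition xdir :: "'n::finite \<Rightarrow> (real^'n) \<times> (real^'n)" where
  "xdir i = (axis i 1, 0)"

definition xidir :: "'n::finite \<Rightarrow> (real^'n) \<times> (real^'n)" where
  "xidir i = (0, axis i 1)"

text \<open>S^m_{rho,delta}; the derivative  d_xi^alpha d_x^beta  is encoded by the index lists alpha, beta
  (order |alpha| = length alpha).\<close>
definition symbol_class :: "real \<Rightarrow> real \<Rightarrow> real \<Rightarrow> (real^'n \<Rightarrow> real^'n \<Rightarrow> complex) set" where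
  "symbol_class m \<rho> \<delta> = {\<sigma>. smooth (\<lambda>(x, \<xi>). \<sigma> x \<xi>) \<and>
     (\<forall>(\<alpha>::'n list) (\<beta>::'n list). \<exists>C. \<forall>x \<xi>.
        norm (diffs (map xidir \<alpha> @ map xdir \<beta>) (\<lambda>(x, \<xi>). \<sigma> x \<xi>) (x, \<xi>))
          \<le> C * (1 + norm \<xi>) powr (m - \<rho> * real (length \<alpha>) + \<delta> * real (length \<beta>)))}"

definition psido :: "(real^'n \<Rightarrow> real^'n \<Rightarrow> complex) \<Rightarrow> (real^'n \<Rightarrow> complex) \<Rightarrow> real^'n \<Rightarrow> complex" where
  "psido \<sigma> f x = complex_of_real ((2 * pi) powr (- real CARD('n))) *
     (LINT \<xi>|lborel. exp (\<i> * complex_of_real (x \<bullet> \<xi>)) * \<sigma> x \<xi> * fourier f \<xi>)"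

text \<open>Cut-off used in the oscillatory integral (any Schwartz chi with chi(0,0)=1 gives the same limit).\<close>
definition osc_cutoff :: "(real^'n) \<times> (real^'n) \<Rightarrow> complex" where
  "osc_cutoff = (\<lambda>(y, \<zeta>). complex_of_real (exp (- (norm y ^ 2 + norm \<zeta> ^ 2))))"

definition is_adjoint_symbol :: "(real^'n \<Rightarrow> real^'n \<Rightarrow> complex) \<Rightarrow> (real^'n \<Rightarrow> real^'n \<Rightarrow> complex) \<Rightarrow> bool" where
  "is_adjoint_symbol \<sigma> \<tau> \<longleftrightarrow> (\<forall>x \<xi>.
     ((\<lambda>\<epsilon>::real. complex_of_real ((2 * pi) powr (- real CARD('n))) *
        (LINT z|lborel. (case z of (y, \<zeta>) \<Rightarrow>
           exp (- \<i> * complex_of_real (y \<bullet> \<zeta>)) * osc_cutoff (\<epsilon> *\<^sub>R y, \<epsilon> *\<^sub>R \<zeta>)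
             * cnj (\<sigma> (x + y) (\<xi> + \<zeta>)))))
      \<longlongrightarrow> \<tau> x \<xi>) (at_right 0))"

definition stft :: "(real^'n \<Rightarrow> complex) \<Rightarrow> (real^'n \<Rightarrow> complex) \<Rightarrow> real^'n \<Rightarrow> real^'n \<Rightarrow> complex" where
  "stft \<gamma> f x \<xi> = (LINT t|lborel. f t * cnj (exp (\<i> * complex_of_real (\<xi> \<bullet> t)) * \<gamma> (t - x)))"

text \<open>a ^ r for a in [0,\<infinity>], r > 0.\<close>
definition ennpow :: "ennreal \<Rightarrow> real \<Rightarrow> ennreal" where
  "ennpow a r = (if a = \<infinity> then \<infinity> else ennreal (enn2real a powr r))"

definition mod_norm :: "(real^'n \<Rightarrow> complex) \<Rightarrow> real \<Rightarrow> real \<Rightarrow> (real^'n \<Rightarrow> complex) \<Rightarrow> ennreal" where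
  "mod_norm \<gamma> p q f =
     ennpow (\<integral>\<^sup>+ \<xi>. ennpow (\<integral>\<^sup>+ x. ennreal (norm (stft \<gamma> f x \<xi>) powr p) \<partial>lborel) (q / p) \<partial>lborel) (1 / q)"

definition bounded_on_mod :: "(real^'n \<Rightarrow> complex) \<Rightarrow> real \<Rightarrow> real \<Rightarrow> (real^'n \<Rightarrow> real^'n \<Rightarrow> complex) \<Rightarrow> bool" where
  "bounded_on_mod \<gamma> p q \<sigma> \<longleftrightarrow>
     (\<exists>C::real. \<forall>f. schwartz f \<longrightarrow> mod_norm \<gamma> p q (psido \<sigma> f) \<le> ennreal C * mod_norm \<gamma> p q f)"

definition sigma_delta :: "(real^'n \<Rightarrow> real) \<Rightarrow> (real^'n \<Rightarrow> real) \<Rightarrow> real \<Rightarrow> real \<Rightarrow> nat \<Rightarrow> real^'n \<Rightarrow> real^'n \<Rightarrow> complex" where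
  "sigma_delta \<phi> \<eta> m \<delta> j0 x \<xi> =
     (\<Sum>j. if j0 \<le> j then
        complex_of_real (2 powr (real j * m)) *
        (\<Sum>k\<in>{k::real^'n. (\<forall>i. k $ i \<in> \<int>) \<and> 0 < norm k \<and> norm k \<le> 2 powr (real j * \<delta> / 2)}.
            exp (- \<i> * complex_of_real (k \<bullet> (2 powr (real j * \<delta> / 2) *\<^sub>R x - k)))
            * inv_fourier (\<lambda>\<zeta>. complex_of_real (\<phi> \<zeta>)) (2 powr (real j * \<delta> / 2) *\<^sub>R x - k))
        * complex_of_real (\<eta> (2 powr (- real j) *\<^sub>R \<xi>))
      else 0)"

end

theory Submission
  imports Defs "HOL-Probability.Probability"
begin

text \<open>
  With \<open>L j = 2 powr (j \<delta> / 2)\<close>, the conjugate of the symbol is the member \<open>s = 0\<close>, and the adjoint symbol the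
  member \<open>s = 1\<close>, of the family
  \<open>T s (x, \<xi>) = \<Sum>j. 2 powr (j m) \<Sum>k. (2\<pi>)^-n \<integral> exp (i (L j x - k) \<bullet> \<omega>) \<phi> (\<omega> - k) \<eta> (2^-j (\<xi> + s L j \<omega>)) d\<omega>\<close>.
  Derivatives only insert factors \<open>i L j \<omega>\<close> and differentiate \<open>\<eta>\<close>; integration by parts in \<open>\<omega>\<close> makes the sum over
  the lattice converge uniformly, and for every \<open>\<xi>\<close> at most three \<open>j\<close> contribute, which gives the symbol estimates.
  In the oscillatory integral the Gaussian cut-off turns the integration over \<open>(y, \<zeta>)\<close> into an approximate identity
  at \<open>\<zeta> = L j \<omega>\<close>, and Tannery's theorem passes to the limit under the sum over \<open>j\<close>.

  Let \<open>a j x\<close> be the factor of \<open>2 powr (j m) \<eta> (2^-j \<xi>)\<close> in the symbol, and let \<open>f J\<close> and \<open>g J\<close> be \<open>cnj (a J)\<close> and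
  \<open>\<Phi>^2\<close> modulated to frequency \<open>2^J\<close>. On them the operators act as multiplications,
  \<open>\<sigma> f = 2 powr (J m) a f\<close> and \<open>\<sigma>* g = 2 powr (J m) cnj a g\<close>, so both pairings \<open>(\<sigma> f, g)\<close> and \<open>(\<sigma>* g, f)\<close>
  equal \<open>2 powr (J m) \<integral> |a J|^2 \<Phi>^2\<close>. The wave packets that make up \<open>a J\<close> have disjoint spectra even after
  multiplication by \<open>\<Phi>\<close>, so this integral is bounded below. Since \<open>\<parallel>f J\<parallel>\<close> in the modulation space with second
  exponent \<open>r\<close> is at most \<open>C (L J) powr (2n/r - n)\<close> and \<open>\<parallel>g J\<parallel>\<close> is bounded, duality of modulation norms
  contradicts boundedness, with \<open>r = q\<close> for \<open>\<sigma>\<close> and \<open>r = q'\<close> for \<open>\<sigma>*\<close>.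
\<close>

section \<open>Smooth functions and iterated directional derivatives\<close>


text \<open>The critical exponent comes from counting. A packet sits at position
  \<open>k / L j\<close>, inside the unit ball, so all packets share one weight in x; its frequency
  is \<open>L j k\<close>. Its short-time transform is bounded by a multiple of
  \<open>L powr -n\<close> and concentrates on a frequency ball of radius about \<open>L\<close>.
  About \<open>L powr n\<close> such packets have a q-norm of order at most
  \<open>L powr -n * (L powr n * L powr n) powr (1/q)\<close>, which is
  \<open>2 powr (j \<delta> n (1/q - 1/2))\<close>. The pairing consists of about
  \<open>L powr n\<close> terms of size \<open>L powr -n\<close>, so its growth is
  \<open>2 powr (j m)\<close>; comparing the two gives the threshold on \<open>m\<close>. Taking the
  conjugate of the multiplier as a test function turns the paired product into a square. The
  obstacle on the adjoint side is that the cut-off \<eta> is moved by \<open>L \<omega>\<close>,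
  where \<omega> itself has norm up to about \<open>L\<close>. The shift is of order
  \<open>L^2 = 2 powr (j \<delta>)\<close>, and the condition on \<open>j0\<close> keeps it below a
  fixed fraction of \<open>2^j\<close>. The same product \<open>L * L\<close> is what one
  x-derivative costs, hence the second index \<delta> of the symbol class.\<close>

lemma dirderivI:
  assumes "((\<lambda>t::real. f (x + t *\<^sub>R v)) has_vector_derivative d) (at 0)"
  shows "dirderiv v f x = d"
  unfolding dirderiv_def using assms by (rule vector_derivative_at)

lemma diffs_append: "diffs (us @ vs) f = diffs us (diffs vs f)"
  by (induction us) auto

lemma smooth_diffs:
  assumes "smooth f" "set vs \<subseteq> Basis" shows "smooth (diffs vs f)"
  using assms unfolding smooth_def diffs_append[symmetric] by (metis set_append Un_least)

lemma smooth_dirderiv: "smooth f \<Longrightarrow> v \<in> Basis \<Longrightarrow> smooth (dirderiv v f)"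
  using smooth_diffs[of f "[v]"] by simp

lemma smooth_continuous: "smooth f \<Longrightarrow> continuous_on UNIV f"
  unfolding smooth_def by (metis diffs.simps(1) empty_set empty_subsetI)

text \<open>The definition of \<open>smooth\<close> differentiates only at parameter 0; moving the
  base point along the line gives the derivative at every \<open>t\<close>, as needed for mean value
  bounds and differentiation under the integral.\<close>

lemma smooth_has_dirderiv:
  assumes "smooth f" "v \<in> Basis"
  shows "((\<lambda>t::real. f (x + t *\<^sub>R v)) has_vector_derivative dirderiv v f (x + t *\<^sub>R v)) (at t)"
proof -
  have "(\<lambda>s::real. f ((x + t *\<^sub>R v) + s *\<^sub>R v)) differentiable (at 0)"
    using assms unfolding smooth_def by (metis diffs.simps(1) empty_set empty_subsetI)
  hence "((\<lambda>s::real. f ((x + t *\<^sub>R v) + s *\<^sub>R v)) has_vector_derivative dirderiv v f (x + t *\<^sub>R v)) (at (t - t))"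
    unfolding dirderiv_def by (simp add: vector_derivative_works)
  moreover have "((\<lambda>s. s - t) has_vector_derivative 1) (at t)" by (auto intro!: derivative_eq_intros)
  ultimately have "((\<lambda>s. f ((x + t *\<^sub>R v) + (s - t) *\<^sub>R v)) has_vector_derivative dirderiv v f (x + t *\<^sub>R v)) (at t)"
    using vector_diff_chain_at[of "\<lambda>s. s - t" 1 t "\<lambda>s. f ((x + t *\<^sub>R v) + s *\<^sub>R v)"] by (simp add: o_def)
  thus ?thesis by (simp add: algebra_simps)
qed

lemmas smooth_has_dirderiv0 = smooth_has_dirderiv[where t=0, simplified]

text \<open>A class of continuous functions that have directional derivatives and is closed under
  \<open>dirderiv\<close> contains all iterated derivatives of its members. Smoothness proofs thus
  reduce to finding an explicit family that is stable under differentiation.\<close>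

lemma smooth_coinduct:
  fixes f :: "'a::euclidean_space \<Rightarrow> 'b::real_normed_vector"
  assumes "P f"
    and step: "\<And>f. P f \<Longrightarrow> continuous_on UNIV f"
      "\<And>f v x. P f \<Longrightarrow> v \<in> Basis \<Longrightarrow> \<exists>d. ((\<lambda>t::real. f (x + t *\<^sub>R v)) has_vector_derivative d) (at 0)"
      "\<And>f v. P f \<Longrightarrow> v \<in> Basis \<Longrightarrow> P (dirderiv v f)"
  shows "smooth f"
proof -
  have "P (diffs vs f)" if "set vs \<subseteq> Basis" for vs
    using that by (induction vs) (use assms(1) step(3) in auto)
  note * = this
  show ?thesis unfolding smooth_def
  proof (intro allI impI conjI ballI)
    fix vs :: "'a list" and v x :: 'a assume vs: "set vs \<subseteq> Basis"
    show "continuous_on UNIV (diffs vs f)" by (rule step(1)[OF *[OF vs]])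
    assume "v \<in> Basis"
    from step(2)[OF *[OF vs] this, of x]
    show "(\<lambda>t::real. diffs vs f (x + t *\<^sub>R v)) differentiable at 0"
      using differentiableI_vector by blast
  qed
qed

section \<open>Closure of smooth functions under algebraic operations and affine
  substitutions\<close>

lemma dirderiv_add:
  assumes "smooth f" "smooth g" "v \<in> Basis"
  shows "dirderiv v (\<lambda>x. f x + g x) = (\<lambda>x. dirderiv v f x + dirderiv v g x)"
  by (intro ext dirderivI has_vector_derivative_add smooth_has_dirderiv0 assms)

lemma smooth_add:
  fixes f g :: "'a::euclidean_space \<Rightarrow> 'b::real_normed_vector"
  assumes "smooth f" "smooth g" shows "smooth (\<lambda>x. f x + g x)"
proof (rule smooth_coinduct[where P="\<lambda>h. \<exists>f g. smooth f \<and> smooth g \<and> h = (\<lambda>x. f x + g x)"])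
  fix h :: "'a \<Rightarrow> 'b" and v x :: 'a assume "\<exists>f g. smooth f \<and> smooth g \<and> h = (\<lambda>x. f x + g x)" and v: "v \<in> Basis"
  then obtain f g where "smooth f" "smooth g" "h = (\<lambda>x. f x + g x)" by blast
  note fg = this
  show "\<exists>d. ((\<lambda>t::real. h (x + t *\<^sub>R v)) has_vector_derivative d) (at 0)"
    unfolding fg(3) by (rule exI, rule has_vector_derivative_add[OF smooth_has_dirderiv0[OF fg(1) v] smooth_has_dirderiv0[OF fg(2) v]])
  show "\<exists>f g. smooth f \<and> smooth g \<and> dirderiv v h = (\<lambda>x. f x + g x)"
    unfolding fg(3) using dirderiv_add[OF fg(1,2) v] smooth_dirderiv[OF fg(1) v] smooth_dirderiv[OF fg(2) v] by (intro exI conjI)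
qed (use assms in \<open>auto dest: smooth_continuous intro: continuous_on_add\<close>)

lemma diffs_add:
  assumes "smooth f" "smooth g" "set vs \<subseteq> Basis"
  shows "diffs vs (\<lambda>x. f x + g x) = (\<lambda>x. diffs vs f x + diffs vs g x)"
  using assms(3) by (induction vs) (auto simp: dirderiv_add smooth_diffs assms)

lemma dirderiv_linear:
  assumes "bounded_linear L" "smooth f" "v \<in> Basis"
  shows "dirderiv v (\<lambda>x. L (f x)) = (\<lambda>x. L (dirderiv v f x))"
  by (intro ext dirderivI bounded_linear.has_vector_derivative[OF assms(1)] smooth_has_dirderiv0 assms)

lemma smooth_linear:
  fixes f :: "'a::euclidean_space \<Rightarrow> 'b::real_normed_vector" and L :: "'b \<Rightarrow> 'c::real_normed_vector"
  assumes L: "bounded_linear L" and "smooth f" shows "smooth (\<lambda>x. L (f x))"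
proof (rule smooth_coinduct[where P="\<lambda>h. \<exists>f. smooth f \<and> h = (\<lambda>x. L (f x))"])
  fix h :: "'a \<Rightarrow> 'c" and v x :: 'a assume "\<exists>f. smooth f \<and> h = (\<lambda>x. L (f x))" and v: "v \<in> Basis"
  then obtain f where "smooth f" "h = (\<lambda>x. L (f x))" by blast
  note f = this
  show "\<exists>d. ((\<lambda>t::real. h (x + t *\<^sub>R v)) has_vector_derivative d) (at 0)"
    unfolding f(2) by (rule exI, rule bounded_linear.has_vector_derivative[OF L smooth_has_dirderiv0[OF f(1) v]])
  show "\<exists>f. smooth f \<and> dirderiv v h = (\<lambda>x. L (f x))"
    unfolding f(2) using dirderiv_linear[OF L f(1) v] smooth_dirderiv[OF f(1) v] by (intro exI conjI)
qed (use assms in \<open>auto dest: smooth_continuous intro: bounded_linear.continuous_on[OF L]\<close>)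

lemma diffs_linear:
  assumes "bounded_linear L" "smooth f" "set vs \<subseteq> Basis"
  shows "diffs vs (\<lambda>x. L (f x)) = (\<lambda>x. L (diffs vs f x))"
  using assms(3) by (induction vs) (auto simp: dirderiv_linear smooth_diffs assms)

lemma dirderiv_const: "dirderiv v (\<lambda>x. c) = (\<lambda>x. 0)"
  by (intro ext dirderivI) simp

lemma diffs_const: "diffs vs (\<lambda>x. c) = (\<lambda>x. if vs = [] then c else 0)"
  by (induction vs) (auto simp: dirderiv_const)

lemma smooth_const: "smooth (\<lambda>x. c)"
  by (rule smooth_coinduct[where P="\<lambda>h. \<exists>c. h = (\<lambda>x. c)"]) (auto simp: dirderiv_const intro: exI[of _ 0])

lemma smooth_sum:
  assumes "\<And>i. i \<in> I \<Longrightarrow> smooth (f i)" shows "smooth (\<lambda>x. \<Sum>i\<in>I. f i x)"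
  using assms by (induction I rule: infinite_finite_induct) (auto intro: smooth_const smooth_add)

lemma diffs_sum:
  assumes "\<And>i. i \<in> I \<Longrightarrow> smooth (f i)" "set vs \<subseteq> Basis"
  shows "diffs vs (\<lambda>x. \<Sum>i\<in>I. f i x) = (\<lambda>x. \<Sum>i\<in>I. diffs vs (f i) x)"
  using assms
proof (induction I rule: infinite_finite_induct)
  case (insert i I)
  thus ?case by (simp add: diffs_add smooth_sum)
qed (auto simp: diffs_const)

lemma dirderiv_mult:
  fixes f g :: "'a::euclidean_space \<Rightarrow> 'b::real_normed_algebra"
  assumes "smooth f" "smooth g" "v \<in> Basis"
  shows "dirderiv v (\<lambda>x. f x * g x) = (\<lambda>x. f x * dirderiv v g x + dirderiv v f x * g x)"
proof (intro ext dirderivI)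
  fix x
  show "((\<lambda>t. f (x + t *\<^sub>R v) * g (x + t *\<^sub>R v)) has_vector_derivative f x * dirderiv v g x + dirderiv v f x * g x) (at 0)"
    using has_vector_derivative_mult[OF smooth_has_dirderiv0[OF assms(1,3)] smooth_has_dirderiv0[OF assms(2,3)], of x x]
    by simp
qed

text \<open>By the Leibniz rule the derivative of a product is a sum of two products, so products
  alone are not stable under differentiation; this additive closure is the invariant for the
  coinduction in \<open>smooth_mult\<close>.\<close>

inductive prodspan :: "('a::euclidean_space \<Rightarrow> 'b::real_normed_algebra) \<Rightarrow> bool" where
  "smooth f \<Longrightarrow> smooth g \<Longrightarrow> prodspan (\<lambda>x. f x * g x)"
| "prodspan f \<Longrightarrow> prodspan g \<Longrightarrow> prodspan (\<lambda>x. f x + g x)"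

lemma prodspan_step:
  assumes "prodspan f"
  shows "continuous_on UNIV f \<and> (\<forall>v\<in>Basis. (\<forall>x. ((\<lambda>t::real. f (x + t *\<^sub>R v)) has_vector_derivative dirderiv v f x) (at 0)) \<and> prodspan (dirderiv v f))"
  using assms
proof induction
  case (1 f g)
  show ?case
  proof (intro conjI ballI allI)
    show "continuous_on UNIV (\<lambda>x. f x * g x)" by (intro continuous_intros smooth_continuous 1)
    fix v :: 'a assume v: "v \<in> Basis"
    show "((\<lambda>t. f (x + t *\<^sub>R v) * g (x + t *\<^sub>R v)) has_vector_derivative dirderiv v (\<lambda>x. f x * g x) x) (at 0)" for x
      using has_vector_derivative_mult[OF smooth_has_dirderiv0[OF 1(1) v] smooth_has_dirderiv0[OF 1(2) v], of x x]
      by (simp add: dirderiv_mult 1 v)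
    show "prodspan (dirderiv v (\<lambda>x. f x * g x))"
      unfolding dirderiv_mult[OF 1 v] by (intro prodspan.intros 1 smooth_dirderiv v)
  qed
next
  case (2 f g)
  show ?case
  proof (intro conjI ballI allI)
    show "continuous_on UNIV (\<lambda>x. f x + g x)" using 2 by (intro continuous_intros) auto
    fix v :: 'a assume v: "v \<in> Basis"
    have *: "((\<lambda>t. f (x + t *\<^sub>R v) + g (x + t *\<^sub>R v)) has_vector_derivative dirderiv v f x + dirderiv v g x) (at 0)" for x
      using 2 v by (intro has_vector_derivative_add) auto
    hence e: "dirderiv v (\<lambda>x. f x + g x) = (\<lambda>x. dirderiv v f x + dirderiv v g x)"
      by (intro ext dirderivI)
    show "((\<lambda>t. f (x + t *\<^sub>R v) + g (x + t *\<^sub>R v)) has_vector_derivative dirderiv v (\<lambda>x. f x + g x) x) (at 0)" for x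
      using * e by simp
    show "prodspan (dirderiv v (\<lambda>x. f x + g x))" unfolding e using 2 v by (intro prodspan.intros) auto
  qed
qed

lemma smooth_mult:
  fixes f g :: "'a::euclidean_space \<Rightarrow> 'b::real_normed_algebra"
  assumes "smooth f" "smooth g" shows "smooth (\<lambda>x. f x * g x)"
proof (rule smooth_coinduct[where P=prodspan])
  show "prodspan (\<lambda>x. f x * g x)" by (rule prodspan.intros(1)[OF assms])
next
  fix f :: "'a \<Rightarrow> 'b" and v x :: 'a assume "prodspan f" "v \<in> Basis"
  thus "\<exists>d. ((\<lambda>t::real. f (x + t *\<^sub>R v)) has_vector_derivative d) (at 0)" "prodspan (dirderiv v f)"
    using prodspan_step[of f] by auto
next
  fix f :: "'a \<Rightarrow> 'b" assume "prodspan f" thus "continuous_on UNIV f" using prodspan_step[of f] by auto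
qed

lemma dirderiv_affine:
  assumes "smooth f" "v \<in> Basis"
  shows "dirderiv v (\<lambda>x. f (c *\<^sub>R x + b)) = (\<lambda>x. c *\<^sub>R dirderiv v f (c *\<^sub>R x + b))"
    "((\<lambda>t. f (c *\<^sub>R (x + t *\<^sub>R v) + b)) has_vector_derivative c *\<^sub>R dirderiv v f (c *\<^sub>R x + b)) (at 0)"
proof -
  show *: "((\<lambda>t. f (c *\<^sub>R (x + t *\<^sub>R v) + b)) has_vector_derivative c *\<^sub>R dirderiv v f (c *\<^sub>R x + b)) (at 0)" for x
  proof -
    have "((\<lambda>t. c * t) has_vector_derivative c) (at 0)" by (auto intro!: derivative_eq_intros)
    from vector_diff_chain_at[OF this smooth_has_dirderiv[OF assms, of "c *\<^sub>R x + b" "c * 0"]]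
    show ?thesis by (simp add: o_def algebra_simps)
  qed
  thus "dirderiv v (\<lambda>x. f (c *\<^sub>R x + b)) = (\<lambda>x. c *\<^sub>R dirderiv v f (c *\<^sub>R x + b))"
    by (intro ext dirderivI)
qed

lemma dirderiv_scaleR:
  assumes "smooth f" "v \<in> Basis"
  shows "dirderiv v (\<lambda>x. c *\<^sub>R f x) = (\<lambda>x. c *\<^sub>R dirderiv v f x)"
  by (rule dirderiv_linear[OF bounded_linear_scaleR_right assms])

lemma smooth_affine:
  fixes f :: "'a::euclidean_space \<Rightarrow> 'b::real_normed_vector"
  assumes "smooth f" shows "smooth (\<lambda>x. f (c *\<^sub>R x + b))"
\<comment> \<open>The scalar \<open>a\<close> in the invariant absorbs the chain rule factor
  \<open>c\<close> that each derivative produces.\<close>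
proof (rule smooth_coinduct[where P="\<lambda>h. \<exists>f a. smooth f \<and> h = (\<lambda>x. a *\<^sub>R f (c *\<^sub>R x + b))"])
  fix h :: "'a \<Rightarrow> 'b" and v x :: 'a assume "\<exists>f a. smooth f \<and> h = (\<lambda>x. a *\<^sub>R f (c *\<^sub>R x + b))" and v: "v \<in> Basis"
  then obtain f a where f: "smooth f" "h = (\<lambda>x. (a *\<^sub>R f (c *\<^sub>R x + b)))" by blast
  have *: "((\<lambda>t::real. h (x + t *\<^sub>R v)) has_vector_derivative (a *\<^sub>R (c *\<^sub>R dirderiv v f (c *\<^sub>R x + b)))) (at 0)" for x
    unfolding f(2) by (rule bounded_linear.has_vector_derivative[OF bounded_linear_scaleR_right dirderiv_affine(2)[OF f(1) v]])
  hence "dirderiv v h = (\<lambda>x. ((a * c) *\<^sub>R dirderiv v f (c *\<^sub>R x + b)))"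
    by (intro ext dirderivI) (simp add: mult.commute)
  thus "\<exists>f a. smooth f \<and> dirderiv v h = (\<lambda>x. a *\<^sub>R f (c *\<^sub>R x + b))"
    using smooth_dirderiv[OF f(1) v] by (intro exI conjI)
  show "\<exists>d. ((\<lambda>t::real. h (x + t *\<^sub>R v)) has_vector_derivative d) (at 0)"
    using * by (rule exI)
next
  fix h :: "'a \<Rightarrow> 'b" assume "\<exists>f a. smooth f \<and> h = (\<lambda>x. a *\<^sub>R f (c *\<^sub>R x + b))"
  then obtain f a where f: "smooth f" and h: "h = (\<lambda>x. (a *\<^sub>R f (c *\<^sub>R x + b)))" by blast
  show "continuous_on UNIV h"
    unfolding h by (intro continuous_intros continuous_on_compose2[OF smooth_continuous[OF f]]) auto
next
  show "\<exists>g a. smooth g \<and> (\<lambda>x. f (c *\<^sub>R x + b)) = (\<lambda>x. a *\<^sub>R g (c *\<^sub>R x + b))"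
    using assms by (intro exI[of _ f] exI[of _ 1]) auto
qed

lemma diffs_affine:
  assumes "smooth f" "set vs \<subseteq> Basis"
  shows "diffs vs (\<lambda>x. f (c *\<^sub>R x + b)) = (\<lambda>x. c ^ length vs *\<^sub>R diffs vs f (c *\<^sub>R x + b))"
  using assms(2)
proof (induction vs)
  case (Cons v vs)
  hence s: "smooth (diffs vs f)" and v: "v \<in> Basis" using assms smooth_diffs by auto
  show ?case using Cons s v
    by (simp add: dirderiv_scaleR[OF smooth_affine[OF s] v] dirderiv_affine(1)[OF s v] mult.commute)
qed auto

lemma dirderiv_inner_right: "dirderiv v (\<lambda>x. x \<bullet> b) = (\<lambda>x. v \<bullet> b)"
  by (intro ext dirderivI) (auto simp: inner_add_left intro!: derivative_eq_intros)

lemma smooth_inner: "smooth (\<lambda>x::'a::euclidean_space. x \<bullet> b)"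
proof (rule smooth_coinduct[where P="\<lambda>h. h = (\<lambda>x. x \<bullet> b) \<or> (\<exists>c. h = (\<lambda>x. c))"])
  fix h :: "'a \<Rightarrow> real" and v x :: 'a assume "h = (\<lambda>x. x \<bullet> b) \<or> (\<exists>c. h = (\<lambda>x. c))"
  thus "\<exists>d. ((\<lambda>t::real. h (x + t *\<^sub>R v)) has_vector_derivative d) (at 0)"
  proof
    assume h: "h = (\<lambda>x. x \<bullet> b)"
    show ?thesis unfolding h by (rule exI[of _ "v \<bullet> b"]) (auto simp: inner_add_left intro!: derivative_eq_intros)
  qed (auto intro: exI[of _ 0])
qed (auto simp: dirderiv_inner_right dirderiv_const intro!: continuous_intros)

lemma cexp_has_vector_derivative:
  "((\<lambda>t. exp (\<i> * complex_of_real (b \<bullet> (x + t *\<^sub>R v)))) has_vector_derivative (\<i> * complex_of_real (b \<bullet> v) * (exp (\<i> * complex_of_real (b \<bullet> (x + t *\<^sub>R v)))))) (at t)"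
proof -
  have 1: "((\<lambda>t. \<i> * complex_of_real (b \<bullet> (x + t *\<^sub>R v))) has_vector_derivative \<i> * complex_of_real (b \<bullet> v)) (at t)"
    by (auto simp: inner_add_right algebra_simps intro!: derivative_eq_intros)
  from field_vector_diff_chain_at[OF 1 DERIV_exp] show ?thesis by (simp add: o_def)
qed


section \<open>Derivative bounds, Schwartz functions and oscillatory integrals\<close>


text \<open>The bound is a function of the point, so that decay is carried through products and
  substitutions, and one bound serves all derivatives up to order \<open>N\<close>, which is what
  \<open>N\<close> integrations by parts consume.\<close>

definition dbd :: "nat \<Rightarrow> ('a::euclidean_space \<Rightarrow> real) \<Rightarrow> ('a \<Rightarrow> 'b::real_normed_vector) \<Rightarrow> bool" where
  "dbd N B f \<longleftrightarrow> smooth f \<and> (\<forall>vs x. set vs \<subseteq> Basis \<and> length vs \<le> N \<longrightarrow> norm (diffs vs f x) \<le> B x)"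

lemma dbdD: "dbd N B f \<Longrightarrow> set vs \<subseteq> Basis \<Longrightarrow> length vs \<le> N \<Longrightarrow> norm (diffs vs f x) \<le> B x"
  unfolding dbd_def by blast

lemma dbd_smooth: "dbd N B f \<Longrightarrow> smooth f"
  unfolding dbd_def by blast

lemma dbd_bound: "dbd N B f \<Longrightarrow> norm (f x) \<le> B x"
  using dbdD[of N B f "[]"] by simp

lemma dbd_nonneg: "dbd N B f \<Longrightarrow> 0 \<le> B x"
  using dbd_bound norm_ge_zero order_trans by blast

lemma dbd_mono: "dbd N B f \<Longrightarrow> (\<And>x. B x \<le> B' x) \<Longrightarrow> dbd N B' f"
  unfolding dbd_def by (meson order_trans)

text \<open>Each derivative doubles the number of Leibniz terms, hence the power of 2. The induction
  peels off the innermost derivative, at the end of the list, because that one acts on the product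
  itself; \<open>b1\<close> and \<open>b2\<close> bound derivatives at the single point
  \<open>x\<close>.\<close>

lemma norm_diffs_mult_le:
  fixes f g :: "'a::euclidean_space \<Rightarrow> 'b::real_normed_algebra"
  assumes "set vs \<subseteq> Basis" "smooth f" "smooth g"
    and "\<And>us. set us \<subseteq> Basis \<Longrightarrow> length us \<le> length vs \<Longrightarrow> norm (diffs us f x) \<le> b1"
    and "\<And>us. set us \<subseteq> Basis \<Longrightarrow> length us \<le> length vs \<Longrightarrow> norm (diffs us g x) \<le> b2"
  shows "norm (diffs vs (\<lambda>x. f x * g x) x) \<le> 2 ^ length vs * (b1 * b2)"
  using assms
proof (induction vs arbitrary: f g rule: rev_induct)
  case Nil
  show ?case
    using Nil(4)[of "[]"] Nil(5)[of "[]"] order_trans[OF norm_ge_zero, of "f x" b1]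
    by (auto intro!: order_trans[OF norm_mult_ineq] mult_mono)
next
  case (snoc v vs)
  have v: "v \<in> Basis" and vs: "set vs \<subseteq> Basis" using snoc.prems(1) by auto
  note s = snoc.prems(2,3)
  note ds = smooth_dirderiv[OF s(1) v] smooth_dirderiv[OF s(2) v]
  have d: "diffs us (dirderiv v h) = diffs (us @ [v]) h" for us and h :: "'a \<Rightarrow> 'b"
    by (simp add: diffs_append)
  have "diffs (vs @ [v]) (\<lambda>x. f x * g x)
      = (\<lambda>x. diffs vs (\<lambda>x. f x * dirderiv v g x) x + diffs vs (\<lambda>x. dirderiv v f x * g x) x)"
    by (simp add: diffs_append dirderiv_mult s v diffs_add smooth_mult ds vs)
  hence "norm (diffs (vs @ [v]) (\<lambda>x. f x * g x) x)
      \<le> norm (diffs vs (\<lambda>x. f x * dirderiv v g x) x) + norm (diffs vs (\<lambda>x. dirderiv v f x * g x) x)"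
    by (simp add: norm_triangle_ineq)
  also have "\<dots> \<le> 2 ^ length vs * (b1 * b2) + 2 ^ length vs * (b1 * b2)"
  proof (rule add_mono)
    have e: "set (us @ [v]) \<subseteq> Basis" "length (us @ [v]) \<le> length (vs @ [v])"
      if "set us \<subseteq> Basis" "length us \<le> length vs" for us using that v by auto
    have l: "length us \<le> length (vs @ [v])" if "length us \<le> length vs" for us :: "'a list" using that by simp
    show "norm (diffs vs (\<lambda>x. f x * dirderiv v g x) x) \<le> 2 ^ length vs * (b1 * b2)"
      by (intro snoc.IH vs s ds) (simp_all only: d snoc.prems(4)[OF _ l] snoc.prems(5)[OF e])
    show "norm (diffs vs (\<lambda>x. dirderiv v f x * g x) x) \<le> 2 ^ length vs * (b1 * b2)"
      by (intro snoc.IH vs s ds) (simp_all only: d snoc.prems(4)[OF e] snoc.prems(5)[OF _ l])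
  qed
  also have "\<dots> = 2 ^ length (vs @ [v]) * (b1 * b2)" by simp
  finally show ?case .
qed

lemma dbd_mult:
  fixes f g :: "'a::euclidean_space \<Rightarrow> 'b::real_normed_algebra"
  assumes f: "dbd N B1 f" and g: "dbd N B2 g"
  shows "dbd N (\<lambda>x. 2 ^ N * (B1 x * B2 x)) (\<lambda>x. f x * g x)"
  unfolding dbd_def
proof (intro conjI allI impI)
  show "smooth (\<lambda>x. f x * g x)" using f g by (intro smooth_mult dbd_smooth)
  fix vs :: "'a list" and x assume vs: "set vs \<subseteq> Basis \<and> length vs \<le> N"
  have "norm (diffs vs (\<lambda>x. f x * g x) x) \<le> 2 ^ length vs * (B1 x * B2 x)"
    using vs f g by (intro norm_diffs_mult_le) (auto intro: dbd_smooth dbdD)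
  also have "\<dots> \<le> 2 ^ N * (B1 x * B2 x)"
    using vs f g by (intro mult_right_mono power_increasing mult_nonneg_nonneg) (auto intro: dbd_nonneg)
  finally show "norm (diffs vs (\<lambda>x. f x * g x) x) \<le> 2 ^ N * (B1 x * B2 x)" .
qed

text \<open>Contractions produce chain rule factors of modulus at most 1, so the bound survives
  unchanged. For this reason the later substitutions are arranged to have coefficients such as
  \<open>1 / L\<close> or \<open>dil j * (s * lam j)\<close>.\<close>

lemma dbd_affine:
  assumes "dbd N B f" "\<bar>c\<bar> \<le> 1"
  shows "dbd N (\<lambda>x. B (c *\<^sub>R x + b)) (\<lambda>x. f (c *\<^sub>R x + b))"
  unfolding dbd_def
proof (intro conjI allI impI)
  show "smooth (\<lambda>x. f (c *\<^sub>R x + b))" using assms by (intro smooth_affine dbd_smooth)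
  fix vs :: "'a list" and x assume vs: "set vs \<subseteq> Basis \<and> length vs \<le> N"
  have "norm (diffs vs (\<lambda>x. f (c *\<^sub>R x + b)) x) = \<bar>c\<bar> ^ length vs * norm (diffs vs f (c *\<^sub>R x + b))"
    using vs assms dbd_smooth by (subst diffs_affine) (auto simp: power_abs)
  also have "\<dots> \<le> 1 * B (c *\<^sub>R x + b)"
    using vs assms by (intro mult_mono dbdD power_le_one) auto
  finally show "norm (diffs vs (\<lambda>x. f (c *\<^sub>R x + b)) x) \<le> B (c *\<^sub>R x + b)" by simp
qed

lemma dbd_linear_isometry:
  assumes "dbd N B f" "bounded_linear L" "\<And>y. norm (L y) = norm y"
  shows "dbd N B (\<lambda>x. L (f x))"
  using assms unfolding dbd_def by (auto simp: smooth_linear diffs_linear)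

lemma dbd_const: "norm c \<le> b \<Longrightarrow> dbd N (\<lambda>x. b) (\<lambda>x. c)"
  unfolding dbd_def by (auto simp: diffs_const smooth_const intro: order_trans[OF norm_ge_zero])

lemma diffs_inner_right: "diffs vs (\<lambda>x. x \<bullet> b + c) = (case vs of [] \<Rightarrow> (\<lambda>x. x \<bullet> b + c) | [v] \<Rightarrow> (\<lambda>x. v \<bullet> b) | _ \<Rightarrow> (\<lambda>x. 0))"
  by (induction vs) (auto split: list.splits simp: dirderiv_const dirderiv_inner_right dirderiv_add smooth_inner smooth_const
     intro!: ext dirderivI derivative_eq_intros simp: inner_add_left)

text \<open>The summand 1 covers the first derivative, which is \<open>v \<bullet> b\<close> and
  equals 0 or 1 on basis vectors; all higher derivatives vanish.\<close>

lemma dbd_inner: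
  assumes "b \<in> Basis" shows "dbd N (\<lambda>x. \<bar>x \<bullet> b + c\<bar> + 1) (\<lambda>x. x \<bullet> b + c)"
proof -
  have "smooth (\<lambda>x. x \<bullet> b + c)" by (intro smooth_add smooth_inner smooth_const)
  moreover have "\<bar>v \<bullet> b\<bar> \<le> \<bar>x \<bullet> b + c\<bar> + 1" if "v \<in> Basis" for v x
    using that assms by (auto simp: inner_Basis)
  ultimately show ?thesis unfolding dbd_def by (auto simp: diffs_inner_right split: list.splits)
qed

section \<open>Schwartz functions through uniform derivative bounds\<close>

lemma schwartz_smooth: "schwartz f \<Longrightarrow> smooth f"
  unfolding schwartz_def by blast

text \<open>\<open>schwartz\<close> gives every derivative list its own constant; there are finitely
  many lists of length at most \<open>N\<close>, and the sum of their constants works for all of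
  them.\<close>

lemma schwartz_dbd:
  fixes f :: "'a::euclidean_space \<Rightarrow> 'b::real_normed_vector"
  assumes "schwartz f"
  obtains C where "C \<ge> 0" "dbd N (\<lambda>x. C / (1 + norm x) ^ M) f"
proof -
  let ?L = "{vs. set vs \<subseteq> (Basis::'a set) \<and> length vs \<le> N}"
  have fin: "finite ?L" by (rule finite_lists_length_le) simp
  have "\<forall>vs\<in>?L. \<exists>C. \<forall>x. (1 + norm x) ^ M * norm (diffs vs f x) \<le> C"
    using assms unfolding schwartz_def by blast
  then obtain C where C: "\<And>vs x. vs \<in> ?L \<Longrightarrow> (1 + norm x) ^ M * norm (diffs vs f x) \<le> C vs"
    by metis
  have C0: "0 \<le> C vs" if "vs \<in> ?L" for vs
    using C[OF that, of 0] by (auto intro: order_trans[OF norm_ge_zero])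
  have "norm (diffs vs f x) \<le> (\<Sum>vs\<in>?L. C vs) / (1 + norm x) ^ M" if "vs \<in> ?L" for vs x
  proof -
    have "(1 + norm x) ^ M * norm (diffs vs f x) \<le> C vs" by (rule C[OF that])
    also have "\<dots> \<le> (\<Sum>vs\<in>?L. C vs)" by (rule member_le_sum[OF that _ fin]) (use C0 in auto)
    finally show ?thesis
      by (subst pos_le_divide_eq) (auto simp: mult.commute add_pos_nonneg)
  qed
  hence "dbd N (\<lambda>x. (\<Sum>vs\<in>?L. C vs) / (1 + norm x) ^ M) f"
    unfolding dbd_def using assms schwartz_smooth by auto
  moreover have "0 \<le> (\<Sum>vs\<in>?L. C vs)" using C0 by (intro sum_nonneg) auto
  ultimately show ?thesis using that by blast
qed

lemma schwartzI:
  assumes "\<And>N M. \<exists>C. dbd N (\<lambda>x. C / (1 + norm x) ^ M) f"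
  shows "schwartz f"
  unfolding schwartz_def
proof (intro conjI allI impI)
  show "smooth f" using assms dbd_smooth by blast
  fix vs :: "'a list" and M :: nat assume vs: "set vs \<subseteq> Basis"
  from assms[of "length vs" M] obtain C where C: "dbd (length vs) (\<lambda>x. C / (1 + norm x) ^ M) f" by blast
  have "(1 + norm x) ^ M * norm (diffs vs f x) \<le> C" for x
    using dbdD[OF C vs order_refl, of x] by (subst (asm) pos_le_divide_eq) (auto simp: mult.commute add_pos_nonneg)
  thus "\<exists>C. \<forall>x. (1 + norm x) ^ M * norm (diffs vs f x) \<le> C" by blast
qed

lemma schwartz_bounded:
  assumes "schwartz f" obtains C where "C \<ge> 0" "dbd N (\<lambda>x. C) f"
  using schwartz_dbd[OF assms, of N 0] by auto

text \<open>The second factor needs bounded derivatives but no decay, so the lemma covers waves,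
  translated windows and dilated cut-offs.\<close>

lemma schwartz_mult_dbd:
  fixes f g :: "'a::euclidean_space \<Rightarrow> 'b::real_normed_algebra"
  assumes f: "schwartz f" and g: "\<And>N. \<exists>C. dbd N (\<lambda>x. C) g"
  shows "schwartz (\<lambda>x. f x * g x)"
proof (rule schwartzI)
  fix N M
  obtain C where "dbd N (\<lambda>x. C / (1 + norm x) ^ M) f" using schwartz_dbd[OF f] by blast
  moreover obtain C' where "dbd N (\<lambda>x. C') g" using g by blast
  ultimately have "dbd N (\<lambda>x. 2 ^ N * (C / (1 + norm x) ^ M * C')) (\<lambda>x. f x * g x)" by (rule dbd_mult)
  thus "\<exists>C. dbd N (\<lambda>x. C / (1 + norm x) ^ M) (\<lambda>x. f x * g x)"
    by (intro exI[of _ "2 ^ N * C * C'"]) (simp add: field_simps)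
qed

lemma schwartz_mult:
  fixes f g :: "'a::euclidean_space \<Rightarrow> 'b::real_normed_algebra"
  assumes "schwartz f" "schwartz g" shows "schwartz (\<lambda>x. f x * g x)"
  using assms by (intro schwartz_mult_dbd) (blast elim: schwartz_bounded)+

lemma schwartz_linear_isometry:
  assumes "schwartz f" "bounded_linear L" "\<And>y. norm (L y) = norm y"
  shows "schwartz (\<lambda>x. L (f x))"
  using assms(1) by (intro schwartzI) (blast intro: dbd_linear_isometry[OF _ assms(2,3)] elim: schwartz_dbd)

lemma schwartz_cnj: "schwartz f \<Longrightarrow> schwartz (\<lambda>x. cnj (f x))"
  by (rule schwartz_linear_isometry[OF _ bounded_linear_cnj]) auto

lemma schwartz_of_real: "schwartz f \<Longrightarrow> schwartz (\<lambda>x. complex_of_real (f x))"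
  by (rule schwartz_linear_isometry[OF _ bounded_linear_of_real]) auto

lemma schwartz_continuous: "schwartz f \<Longrightarrow> continuous_on UNIV f"
  by (intro smooth_continuous schwartz_smooth)

lemma schwartz_diffs:
  assumes "schwartz f" "set vs \<subseteq> Basis" shows "schwartz (diffs vs f)"
  unfolding schwartz_def
proof (intro conjI allI impI)
  show "smooth (diffs vs f)" using assms schwartz_smooth smooth_diffs by blast
  fix us :: "'a list" and M :: nat assume us: "set us \<subseteq> Basis"
  have "\<exists>C. \<forall>x. (1 + norm x) ^ M * norm (diffs (us @ vs) f x) \<le> C"
    using assms us unfolding schwartz_def by (metis set_append Un_least)
  thus "\<exists>C. \<forall>x. (1 + norm x) ^ M * norm (diffs us (diffs vs f) x) \<le> C" by (simp add: diffs_append)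
qed

lemma schwartz_dirderiv: "schwartz f \<Longrightarrow> v \<in> Basis \<Longrightarrow> schwartz (dirderiv v f)"
  using schwartz_diffs[of f "[v]"] by simp

section \<open>Polynomial weights and integrability\<close>

lemma one_plus_norm_shift: "1 + norm x \<le> (1 + norm (x + b)) * (1 + norm (b::'a::real_normed_vector))"
proof -
  have "norm x \<le> norm (x + b) + norm b" using norm_triangle_ineq4[of "x + b" b] by simp
  moreover have "0 \<le> norm b * norm (x + b)" by simp
  moreover have "(1 + norm (x + b)) * (1 + norm b) = 1 + norm (x + b) + norm b + norm b * norm (x + b)" by (simp add: algebra_simps)
  ultimately show ?thesis by linarith
qed

lemma integrable_one_over_1_plus_sq: "integrable lborel (\<lambda>t::real. inverse (1 + t\<^sup>2))"
  using integrable_inverse_1_plus_square by (simp add: set_integrable_def)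

text \<open>The exponent is twice the dimension so that \<open>wt\<close> lies below the product of
  the one-dimensional weights \<open>1 / (1 + t^2)\<close> over the coordinates. This makes it
  integrable and also summable over the integer lattice.\<close>

definition wt :: "'a::euclidean_space \<Rightarrow> real" where "wt x = 1 / (1 + norm x) ^ (2 * DIM('a))"

lemma wt_nonneg: "0 \<le> wt x" and wt_pos: "0 < wt x" and wt_le_1: "wt x \<le> 1"
  by (auto simp: wt_def add_pos_nonneg add_nonneg_pos divide_le_eq_1)

lemma wt_le_prod: "wt x \<le> (\<Prod>b\<in>Basis. inverse (1 + (x \<bullet> b)\<^sup>2))"
proof -
  have "(\<Prod>b\<in>Basis. 1 + (x \<bullet> b)\<^sup>2) \<le> (\<Prod>b\<in>(Basis::'a set). (1 + norm x)\<^sup>2)"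
  proof (rule prod_mono, safe)
    fix b :: 'a assume b: "b \<in> Basis"
    have "(x \<bullet> b)\<^sup>2 \<le> (norm x)\<^sup>2" using Basis_le_norm[OF b] by (simp add: abs_le_square_iff[symmetric])
    thus "1 + (x \<bullet> b)\<^sup>2 \<le> (1 + norm x)\<^sup>2" using norm_ge_zero[of x] by (simp add: power2_eq_square algebra_simps del: norm_ge_zero)
  qed auto
  also have "\<dots> = (1 + norm x) ^ (2 * DIM('a))" by (simp add: power_mult)
  finally have "(\<Prod>b\<in>Basis. 1 + (x \<bullet> b)\<^sup>2) \<le> (1 + norm x) ^ (2 * DIM('a))" .
  moreover have "0 < (\<Prod>b\<in>Basis. 1 + (x \<bullet> b)\<^sup>2)" by (intro prod_pos) (auto simp: add_pos_nonneg)
  ultimately show ?thesis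
    unfolding wt_def by (simp add: prod_inversef[symmetric, unfolded o_def] inverse_eq_divide prod_dividef frac_le)
qed

lemma continuous_wt[continuous_intros]: "continuous_on A g \<Longrightarrow> continuous_on A (\<lambda>x. wt (g x))"
  unfolding wt_def by (intro continuous_intros) (auto simp: add_pos_nonneg pos_add_strict add_nonneg_eq_0_iff)

lemma measurable_wt[measurable]: "wt \<in> borel_measurable borel"
  by (intro borel_measurable_continuous_onI continuous_intros)

lemma integrable_wt: "integrable lborel (wt :: 'a::euclidean_space \<Rightarrow> real)"
proof (rule Bochner_Integration.integrable_bound)
  show "integrable lborel (\<lambda>x::'a. \<Prod>b\<in>Basis. inverse (1 + (x \<bullet> b)\<^sup>2))"
  proof (rule integrableI_nonneg)
    have "(\<integral>\<^sup>+x. ennreal (\<Prod>b\<in>(Basis::'a set). inverse (1 + (x \<bullet> b)\<^sup>2)) \<partial>lborel)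
       = (\<integral>\<^sup>+x. (\<Prod>b\<in>(Basis::'a set). ennreal (inverse (1 + (x \<bullet> b)\<^sup>2))) \<partial>lborel)"
      by (simp add: prod_ennreal)
    also have "\<dots> = (\<Prod>b\<in>(Basis::'a set). \<integral>\<^sup>+t. ennreal (inverse (1 + t\<^sup>2)) \<partial>lborel)"
      by (subst nn_integral_lborel_prod[where f="\<lambda>b t. ennreal (inverse (1 + t\<^sup>2))"]) auto
    also have "\<dots> < \<infinity>"
      using integrable_one_over_1_plus_sq unfolding integrable_iff_bounded
      by (simp add: power_less_top_ennreal)
    finally show "(\<integral>\<^sup>+x. ennreal (\<Prod>b\<in>(Basis::'a set). inverse (1 + (x \<bullet> b)\<^sup>2)) \<partial>lborel) < \<infinity>" .
  qed (auto intro!: prod_nonneg)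
  show "AE x in lborel. norm (wt x) \<le> norm (\<Prod>b\<in>(Basis::'a set). inverse (1 + (x \<bullet> b)\<^sup>2))"
    using order_trans[OF wt_le_prod abs_ge_self] by (intro AE_I2) (simp add: wt_nonneg)
qed auto

lemma schwartz_integrable:
  fixes f :: "'a::euclidean_space \<Rightarrow> 'b::{banach,second_countable_topology}"
  assumes "schwartz f" shows "integrable lborel f"
proof -
  obtain C where "dbd 0 (\<lambda>x. C / (1 + norm x) ^ (2 * DIM('a))) f" using schwartz_dbd[OF assms] by blast
  hence *: "norm (f x) \<le> C * wt x" for x using dbd_bound unfolding wt_def by fastforce
  show ?thesis
    by (rule Bochner_Integration.integrable_bound[OF integrable_mult_right[OF integrable_wt, of C]])
       (use * schwartz_continuous[OF assms] in \<open>auto intro!: borel_measurable_continuous_onI intro: order_trans[OF _ abs_ge_self]\<close>)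
qed

section \<open>Affine changes of variables\<close>

lemma nn_integral_affine:
  fixes t :: "'a::euclidean_space"
  assumes [measurable]: "f \<in> borel_measurable borel" and c: "c \<noteq> 0"
  shows "(\<integral>\<^sup>+x. f x \<partial>lborel) = ennreal (\<bar>c\<bar> ^ DIM('a)) * (\<integral>\<^sup>+x. f (c *\<^sub>R x + t) \<partial>lborel)"
  by (subst lborel_affine[OF c, of t])
     (simp add: nn_integral_density nn_integral_distr nn_integral_cmult add.commute)

lemma integrable_affine:
  fixes f :: "'a::euclidean_space \<Rightarrow> 'b :: {banach, second_countable_topology}"
  assumes f: "integrable lborel f"
  shows "c \<noteq> 0 \<Longrightarrow> integrable lborel (\<lambda>x. f (c *\<^sub>R x + t))"
  using f f[THEN borel_measurable_integrable] unfolding integrable_iff_bounded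
  by (subst (asm) nn_integral_affine[where c=c and t=t]) (auto simp: ennreal_mult_less_top)

lemma integrable_affine_iff:
  fixes f :: "'a::euclidean_space \<Rightarrow> 'b :: {banach, second_countable_topology}"
  shows "c \<noteq> 0 \<Longrightarrow> integrable lborel (\<lambda>x. f (c *\<^sub>R x + t)) \<longleftrightarrow> integrable lborel f"
  using
    integrable_affine[of f c t]
    integrable_affine[of "\<lambda>x. f (c *\<^sub>R x + t)" "1/c" "- (1/c) *\<^sub>R t"]
  by (auto simp add: algebra_simps)

lemma integral_affine:
  fixes f :: "'a::euclidean_space \<Rightarrow> 'b :: {banach, second_countable_topology}"
  assumes c: "c \<noteq> 0" shows "(\<integral>x. f x \<partial> lborel) = \<bar>c\<bar> ^ DIM('a) *\<^sub>R (\<integral>x. f (c *\<^sub>R x + t) \<partial>lborel)"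
proof cases
  assume f[measurable]: "integrable lborel f" then show ?thesis
    using c f f[THEN borel_measurable_integrable] f[THEN integrable_affine, of c t]
    by (subst lborel_affine[OF c, of t])
       (simp add: integral_density integral_distr add.commute)
next
  assume "\<not> integrable lborel f" with c show ?thesis
    by (simp add: integrable_affine_iff not_integrable_integral_eq)
qed

lemma integral_translate:
  fixes f :: "'a::euclidean_space \<Rightarrow> 'b :: {banach, second_countable_topology}"
  shows "(\<integral>x. f (x + t) \<partial>lborel) = (\<integral>x. f x \<partial> lborel)"
  using integral_affine[of 1 f t] by simp

lemma integral_reflect:
  fixes f :: "'a::euclidean_space \<Rightarrow> 'b :: {banach, second_countable_topology}"
  shows "(\<integral>x. f (- x) \<partial>lborel) = (\<integral>x. f x \<partial> lborel)"
  using integral_affine[of "-1" f 0] by simp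

section \<open>Differentiation under the integral sign\<close>

lemma has_vector_derivative_iff_tendsto:
  "(f has_vector_derivative d) (at x) \<longleftrightarrow> ((\<lambda>y. (f y - f x) /\<^sub>R (y - x)) \<longlongrightarrow> d) (at x)"
proof -
  have "norm (f y - f x - (y - x) *\<^sub>R d) / norm (y - x) = norm ((f y - f x) /\<^sub>R (y - x) - d)" if "y \<noteq> x" for y
  proof -
    have "(f y - f x) /\<^sub>R (y - x) - d = (f y - f x - (y - x) *\<^sub>R d) /\<^sub>R (y - x)"
      using that by (simp add: scaleR_diff_right)
    thus ?thesis by (simp add: divide_inverse mult.commute)
  qed
  hence "((\<lambda>y. norm (f y - f x - (y - x) *\<^sub>R d) / norm (y - x)) \<longlongrightarrow> 0) (at x)
     \<longleftrightarrow> ((\<lambda>y. norm ((f y - f x) /\<^sub>R (y - x) - d)) \<longlongrightarrow> 0) (at x)"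
    by (intro filterlim_cong refl) (auto simp: eventually_at_filter)
  thus ?thesis
    unfolding has_vector_derivative_def has_derivative_iff_norm
    by (simp add: bounded_linear_scaleR_left tendsto_norm_zero_iff LIM_zero_iff)
qed

text \<open>The mean value inequality bounds every difference quotient by \<open>B x\<close>, so
  dominated convergence applies along each null sequence. Integrability of \<open>G' 0\<close> comes
  out of the same convergence theorem.\<close>

lemma has_vector_derivative_integral:
  fixes G :: "real \<Rightarrow> 'a \<Rightarrow> 'b::{banach,second_countable_topology}"
  assumes D: "\<And>t x. \<bar>t\<bar> < 1 \<Longrightarrow> ((\<lambda>t. G t x) has_vector_derivative G' t x) (at t)"
    and B: "\<And>t x. \<bar>t\<bar> < 1 \<Longrightarrow> norm (G' t x) \<le> B x" and iB: "integrable M B"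
    and iG: "\<And>t. \<bar>t\<bar> < 1 \<Longrightarrow> integrable M (G t)"
  shows "((\<lambda>t. \<integral>x. G t x \<partial>M) has_vector_derivative (\<integral>x. G' 0 x \<partial>M)) (at 0)"
    "integrable M (G' 0)"
proof -
  have bd: "norm ((G t x - G 0 x) /\<^sub>R t) \<le> B x" if "\<bar>t\<bar> < 1" "t \<noteq> 0" for t x
  proof -
    have "norm (G t x - G 0 x) \<le> B x * norm (t - 0)"
    proof (rule differentiable_bound[where S="{-1<..<1}" and f'="\<lambda>t s. s *\<^sub>R G' t x"])
      show "((\<lambda>t. G t x) has_derivative (\<lambda>s. s *\<^sub>R G' y x)) (at y within {- 1<..<1})" if "y \<in> {-1<..<1}" for y
        using D[of y x] that unfolding has_vector_derivative_def by (auto intro: has_derivative_at_withinI)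
      show "onorm (\<lambda>s. s *\<^sub>R G' y x) \<le> B x" if "y \<in> {-1<..<1}" for y
        using mult_left_mono[OF B[of y x] abs_ge_zero] that by (intro onorm_le) (auto simp: mult.commute)
    qed (use that in auto)
    hence "norm (G t x - G 0 x) * inverse \<bar>t\<bar> \<le> B x" using that by (simp add: field_simps)
    thus ?thesis by (simp add: mult.commute)
  qed
  have key: "(\<lambda>n. (\<integral>x. (G (X n) x - G 0 x) /\<^sub>R X n \<partial>M)) \<longlonglongrightarrow> (\<integral>x. G' 0 x \<partial>M) \<and> integrable M (G' 0)"
    if X: "\<And>n. X n \<noteq> 0" "\<And>n. \<bar>X n\<bar> < 1" "X \<longlonglongrightarrow> 0" for X :: "nat \<Rightarrow> real"
  proof -
    have lim: "(\<lambda>n. (G (X n) x - G 0 x) /\<^sub>R X n) \<longlonglongrightarrow> G' 0 x" for x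
      using D[of 0 x] X unfolding has_vector_derivative_iff_tendsto
      by (auto simp: tendsto_at_iff_sequentially o_def)
    have m: "(\<lambda>x. (G (X n) x - G 0 x) /\<^sub>R X n) \<in> borel_measurable M" for n
      using iG[of "X n"] iG[of 0] X(2)[of n] by auto
    have m': "G' 0 \<in> borel_measurable M" by (rule borel_measurable_LIMSEQ_metric[OF m lim])
    have b: "AE x in M. norm ((G (X n) x - G 0 x) /\<^sub>R X n) \<le> B x" for n by (intro AE_I2 bd X)
    show ?thesis
      by (intro conjI integral_dominated_convergence[OF m' m iB AE_I2[OF lim] b] integrable_dominated_convergence[OF m' m iB AE_I2[OF lim] b])
  qed
  \<comment> \<open>A concrete null sequence extracts the integrability of \<open>G' 0\<close> from
    \<open>key\<close>. It starts at 1/2 so that all its terms lie strictly below 1.\<close>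
  have "(\<lambda>n. inverse (real (Suc (Suc n)))) \<longlonglongrightarrow> 0"
    using LIMSEQ_inverse_real_of_nat by (rule LIMSEQ_Suc)
  from key[OF _ _ this] show "integrable M (G' 0)" by (auto simp: inverse_less_1_iff)
  show "((\<lambda>t. \<integral>x. G t x \<partial>M) has_vector_derivative (\<integral>x. G' 0 x \<partial>M)) (at 0)"
    unfolding has_vector_derivative_iff_tendsto tendsto_at_iff_sequentially
  proof (intro allI impI)
    fix X :: "nat \<Rightarrow> real" assume X: "\<forall>i. X i \<in> UNIV - {0}" "X \<longlonglongrightarrow> 0"
    have "eventually (\<lambda>n. \<bar>X n\<bar> < 1) sequentially"
      using X(2) unfolding tendsto_iff by (auto dest: spec[of _ 1])
    then obtain n0 where n0: "\<And>n. n \<ge> n0 \<Longrightarrow> \<bar>X n\<bar> < 1" unfolding eventually_sequentially by blast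
    have "(\<lambda>n. (\<integral>x. (G (X (n + n0)) x - G 0 x) /\<^sub>R X (n + n0) \<partial>M)) \<longlonglongrightarrow> (\<integral>x. G' 0 x \<partial>M)"
      using key[of "\<lambda>n. X (n + n0)"] n0 X by (auto intro: LIMSEQ_ignore_initial_segment)
    also have "(\<lambda>n. (\<integral>x. (G (X (n + n0)) x - G 0 x) /\<^sub>R X (n + n0) \<partial>M))
      = (\<lambda>n. ((\<integral>x. G (X (n + n0)) x \<partial>M) - (\<integral>x. G 0 x \<partial>M)) /\<^sub>R (X (n + n0) - 0))"
      using iG n0 by (intro ext) (simp add: Bochner_Integration.integral_diff)
    finally show "((\<lambda>t. ((\<integral>x. G t x \<partial>M) - (\<integral>x. G 0 x \<partial>M)) /\<^sub>R (t - 0)) \<circ> X) \<longlonglongrightarrow> (\<integral>x. G' 0 x \<partial>M)"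
      unfolding o_def by (rule LIMSEQ_offset)
  qed
qed

section \<open>Integration by parts and decay of oscillatory integrals\<close>

abbreviation wave :: "'a::euclidean_space \<Rightarrow> 'a \<Rightarrow> complex" where
  "wave w x \<equiv> exp (\<i> * complex_of_real (w \<bullet> x))"

lemma measurable_wave: "wave w \<in> borel_measurable borel"
  by (intro borel_measurable_continuous_onI continuous_intros)

lemma integrable_wave:
  assumes "integrable lborel h" shows "integrable lborel (\<lambda>x. wave w x * h x)"
  by (rule Bochner_Integration.integrable_bound[OF assms])
     (use borel_measurable_integrable[OF assms] measurable_wave[of w] in \<open>auto simp: norm_mult\<close>)

text \<open>Translation invariance replaces boundary terms: the integral of \<open>G t\<close> does
  not depend on \<open>t\<close>, so its derivative at 0 vanishes, and differentiating under the
  integral splits this zero into the two terms of the product rule.\<close>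

lemma osc_ibp:
  fixes h :: "'a::euclidean_space \<Rightarrow> complex"
  assumes h: "schwartz h" and v: "v \<in> Basis"
  shows "(\<integral>x. wave w x * dirderiv v h x \<partial>lborel) = (- \<i> * complex_of_real (w \<bullet> v)) * (\<integral>x. wave w x * h x \<partial>lborel)"
proof -
  define G where "G t x = wave w (x + t *\<^sub>R v) * h (x + t *\<^sub>R v)" for t x
  define G' where "G' t x = wave w (x + t *\<^sub>R v) * dirderiv v h (x + t *\<^sub>R v)
     + (\<i> * complex_of_real (w \<bullet> v) * wave w (x + t *\<^sub>R v)) * h (x + t *\<^sub>R v)" for t x
  obtain C where C: "C \<ge> 0" "dbd 1 (\<lambda>x. C / (1 + norm x) ^ (2 * DIM('a))) h" using schwartz_dbd[OF h] by blast
  have b0: "norm (h x) \<le> C * wt x" for x using dbd_bound[OF C(2), of x] by (simp add: wt_def)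
  have b1: "norm (dirderiv v h x) \<le> C * wt x" for x using dbdD[OF C(2), of "[v]" x] v by (simp add: wt_def)
  have sh: "wt (x + t *\<^sub>R v) \<le> 2 ^ (2 * DIM('a)) * wt x" if "\<bar>t\<bar> < 1" for x t
  proof -
    have "1 + norm x \<le> (1 + norm (x + t *\<^sub>R v)) * (1 + norm (t *\<^sub>R v))" by (rule one_plus_norm_shift)
    also have "\<dots> \<le> (1 + norm (x + t *\<^sub>R v)) * 2" using that v by (intro mult_left_mono) auto
    finally have "(1 + norm x) ^ (2 * DIM('a)) \<le> ((1 + norm (x + t *\<^sub>R v)) * 2) ^ (2 * DIM('a))"
      by (intro power_mono) auto
    hence "(1 + norm x) ^ (2 * DIM('a)) \<le> (1 + norm (x + t *\<^sub>R v)) ^ (2 * DIM('a)) * 2 ^ (2 * DIM('a))"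
      by (simp only: power_mult_distrib)
    thus ?thesis unfolding wt_def by (simp add: field_simps add_pos_nonneg)
  qed
  have iG: "integrable lborel (G t)" for t
    using integrable_affine[OF integrable_wave[OF schwartz_integrable[OF h], of w], of 1 "t *\<^sub>R v"] unfolding G_def by simp
  note * = has_vector_derivative_integral[of G G' "\<lambda>x. (C + \<bar>w \<bullet> v\<bar> * C) * (2 ^ (2 * DIM('a)) * wt x)" lborel]
  have "((\<lambda>t. \<integral>x. G t x \<partial>lborel) has_vector_derivative (\<integral>x. G' 0 x \<partial>lborel)) (at 0)"
  proof (rule *)
    fix t :: real and x :: 'a assume t: "\<bar>t\<bar> < 1"
    show "((\<lambda>t. G t x) has_vector_derivative G' t x) (at t)"
      unfolding G_def G'_def
      by (rule has_vector_derivative_mult[OF cexp_has_vector_derivative smooth_has_dirderiv[OF schwartz_smooth[OF h] v]])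
    have "norm (G' t x) \<le> C * wt (x + t *\<^sub>R v) + \<bar>w \<bullet> v\<bar> * (C * wt (x + t *\<^sub>R v))"
      unfolding G'_def
      by (intro order_trans[OF norm_triangle_ineq] add_mono) (auto simp: norm_mult b0 b1 intro!: mult_left_mono)
    also have "\<dots> = (C + \<bar>w \<bullet> v\<bar> * C) * wt (x + t *\<^sub>R v)" by (simp add: algebra_simps)
    also have "\<dots> \<le> (C + \<bar>w \<bullet> v\<bar> * C) * (2 ^ (2 * DIM('a)) * wt x)"
      using sh[OF t] C(1) by (intro mult_left_mono) auto
    finally show "norm (G' t x) \<le> (C + \<bar>w \<bullet> v\<bar> * C) * (2 ^ (2 * DIM('a)) * wt x)" .
  qed (use iG integrable_wt in auto)
  moreover have "(\<lambda>t. \<integral>x. G t x \<partial>lborel) = (\<lambda>t. \<integral>x. wave w x * h x \<partial>lborel)"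
    unfolding G_def by (intro ext integral_translate)
  ultimately have "(\<integral>x. G' 0 x \<partial>lborel) = 0"
    using vector_derivative_unique_at[OF _ has_vector_derivative_const] by fastforce
  moreover have "(\<integral>x. G' 0 x \<partial>lborel) = (\<integral>x. wave w x * dirderiv v h x \<partial>lborel)
     + (\<i> * complex_of_real (w \<bullet> v)) * (\<integral>x. wave w x * h x \<partial>lborel)"
    unfolding G'_def using integrable_wave[OF schwartz_integrable[OF h], of w] integrable_wave[OF schwartz_integrable[OF schwartz_dirderiv[OF h v]], of w]
    by (simp add: mult.assoc)
  ultimately show ?thesis by (simp add: add_eq_0_iff2)
qed

lemma osc_ibp_pow:
  fixes h :: "'a::euclidean_space \<Rightarrow> complex"
  assumes h: "schwartz h" and v: "v \<in> Basis"
  shows "(\<integral>x. wave w x * diffs (replicate N v) h x \<partial>lborel) = (- \<i> * complex_of_real (w \<bullet> v)) ^ N * (\<integral>x. wave w x * h x \<partial>lborel)"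
proof (induction N)
  case (Suc N)
  have "schwartz (diffs (replicate N v) h)" using v by (intro schwartz_diffs h) auto
  from osc_ibp[OF this v, of w] Suc show ?case by simp
qed auto

text \<open>If all coordinates of \<open>w\<close> have modulus at most 1, the trivial bound by the
  integral of \<open>B\<close> suffices. Otherwise \<open>N\<close> integrations by parts gain the
  \<open>N\<close>-th power of the largest coordinate. The factor \<open>(1 + DIM)^N\<close> pays
  for comparing that coordinate with the norm.\<close>

lemma osc_decay:
  fixes h :: "'a::euclidean_space \<Rightarrow> complex"
  assumes h: "schwartz h" and B: "dbd N B h" and iB: "integrable lborel B"
  shows "norm (\<integral>x. wave w x * h x \<partial>lborel) \<le> (1 + real DIM('a)) ^ N * (\<integral>x. B x \<partial>lborel) / (1 + norm w) ^ N"
proof -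
  let ?I = "\<integral>x. wave w x * h x \<partial>lborel" and ?D = "real DIM('a)"
  have le: "norm (\<integral>x. wave w x * diffs vs h x \<partial>lborel) \<le> (\<integral>x. B x \<partial>lborel)"
    if "set vs \<subseteq> Basis" "length vs \<le> N" for vs
    using dbdD[OF B that] iB integrable_wave[OF schwartz_integrable[OF schwartz_diffs[OF h that(1)]]]
    by (intro Bochner_Integration.integral_norm_bound_integral) (auto simp: norm_mult)
  \<comment> \<open>The coordinate in which \<open>w\<close> is largest controls
    \<open>norm w\<close> up to the dimension, so integrating by parts in this one direction is
    enough.\<close>
  obtain v where v: "v \<in> Basis" "\<And>b. b \<in> Basis \<Longrightarrow> \<bar>w \<bullet> b\<bar> \<le> \<bar>w \<bullet> v\<bar>"
  proof -
    have "Max ((\<lambda>b. \<bar>w \<bullet> b\<bar>) ` Basis) \<in> (\<lambda>b. \<bar>w \<bullet> b\<bar>) ` Basis" by (rule Max_in) auto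
    then obtain v where "v \<in> Basis" "Max ((\<lambda>b. \<bar>w \<bullet> b\<bar>) ` Basis) = \<bar>w \<bullet> v\<bar>" by (rule imageE)
    moreover have "\<bar>w \<bullet> b\<bar> \<le> Max ((\<lambda>b. \<bar>w \<bullet> b\<bar>) ` Basis)" if "b \<in> Basis" for b using that by (intro Max_ge) auto
    ultimately show ?thesis using that by auto
  qed
  have "norm w \<le> (\<Sum>b\<in>Basis. \<bar>w \<bullet> b\<bar>)" by (rule norm_le_l1)
  also have "\<dots> \<le> (\<Sum>b\<in>(Basis::'a set). \<bar>w \<bullet> v\<bar>)" by (rule sum_mono) (rule v(2))
  finally have nw: "norm w \<le> ?D * \<bar>w \<bullet> v\<bar>" by simp
  have "(1 + norm w) ^ N * norm ?I \<le> (1 + ?D) ^ N * (\<integral>x. B x \<partial>lborel)"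
  proof (cases "\<bar>w \<bullet> v\<bar> \<le> 1")
    case True
    have "norm w \<le> ?D * 1" using nw True by (meson mult_left_mono of_nat_0_le_iff order_trans)
    thus ?thesis using le[of "[]"] by (intro mult_mono power_mono) auto
  next
    case False
    have "1 + norm w \<le> (1 + ?D) * \<bar>w \<bullet> v\<bar>" using nw False by (simp add: algebra_simps)
    hence "(1 + norm w) ^ N * norm ?I \<le> ((1 + ?D) * \<bar>w \<bullet> v\<bar>) ^ N * norm ?I"
      by (intro mult_right_mono power_mono) auto
    also have "\<dots> = (1 + ?D) ^ N * norm (\<integral>x. wave w x * diffs (replicate N v) h x \<partial>lborel)"
      unfolding osc_ibp_pow[OF h v(1)] by (simp add: power_mult_distrib norm_mult norm_power)
    also have "\<dots> \<le> (1 + ?D) ^ N * (\<integral>x. B x \<partial>lborel)"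
      using v by (intro mult_left_mono le) (auto simp: set_replicate_conv_if)
    finally show ?thesis .
  qed
  thus ?thesis by (subst pos_le_divide_eq) (auto simp: add_pos_nonneg mult.commute)
qed


section \<open>Gaussians and Fourier inversion\<close>


lemma integral_lborel_prod:
  fixes f :: "'a::euclidean_space \<Rightarrow> real \<Rightarrow> 'b::{real_normed_field,banach,second_countable_topology}"
  assumes "\<And>b. b \<in> Basis \<Longrightarrow> integrable lborel (f b)"
  shows "(\<integral>x. (\<Prod>b\<in>Basis. f b (x \<bullet> b)) \<partial>lborel) = (\<Prod>b\<in>Basis. (\<integral>t. f b t \<partial>lborel))"
proof -
  interpret product_sigma_finite "\<lambda>b::'a. lborel :: real measure" by standard
  have [measurable]: "b \<in> Basis \<Longrightarrow> f b \<in> borel_measurable borel" for b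
    using borel_measurable_integrable[OF assms] by simp
  have m: "(\<lambda>f. \<Sum>b\<in>(Basis::'a set). f b *\<^sub>R b) \<in> (\<Pi>\<^sub>M b\<in>Basis. lborel) \<rightarrow>\<^sub>M borel" by measurable
  have m2: "(\<lambda>x::'a. (\<Prod>b\<in>Basis. f b (x \<bullet> b))) \<in> borel_measurable borel" by measurable
  have "(\<integral>x. (\<Prod>b\<in>Basis. f b (x \<bullet> b)) \<partial>lborel)
      = (\<integral>x. (\<Prod>b\<in>Basis. f b ((\<Sum>b\<in>Basis. x b *\<^sub>R b) \<bullet> b)) \<partial>(\<Pi>\<^sub>M b\<in>(Basis::'a set). lborel))"
    by (subst lborel_eq) (rule integral_distr[OF m m2])
  also have "\<dots> = (\<integral>x. (\<Prod>b\<in>Basis. f b (x b)) \<partial>(\<Pi>\<^sub>M b\<in>(Basis::'a set). lborel))"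
    by (intro Bochner_Integration.integral_cong prod.cong refl) (simp add: inner_sum_left_Basis)
  also have "\<dots> = (\<Prod>b\<in>Basis. (\<integral>t. f b t \<partial>lborel))"
    by (rule product_integral_prod) (use assms in auto)
  finally show ?thesis .
qed

text \<open>This is the characteristic function of the standard normal distribution after rescaling
  by \<open>sqrt 2\<close>, which turns the density exponent \<open>x^2 / 2\<close> into
  \<open>t^2\<close>.\<close>

lemma gauss_fourier_1d:
  "integrable lborel (\<lambda>t::real. exp (\<i> * complex_of_real (w * t)) * complex_of_real (exp (- t\<^sup>2)))"
  "(\<integral>t. exp (\<i> * complex_of_real (w * t)) * complex_of_real (exp (- t\<^sup>2)) \<partial>lborel)
     = complex_of_real (sqrt pi * exp (- w\<^sup>2 / 4))"
proof -
  let ?g = "\<lambda>x. std_normal_density x *\<^sub>R exp (\<i> * complex_of_real ((w / sqrt 2) * x))"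
  have "integrable lborel (std_normal_density)" by (rule integrable_normal_density) simp
  hence i: "integrable lborel ?g"
    by (rule Bochner_Integration.integrable_bound) (auto simp: normal_density_nonneg)
  have e: "?g (0 + sqrt 2 * t) = complex_of_real (1 / sqrt (2 * pi)) * (exp (\<i> * complex_of_real (w * t)) * complex_of_real (exp (- t\<^sup>2)))" for t
  proof -
    have "std_normal_density (0 + sqrt 2 * t) = 1 / sqrt (2 * pi) * exp (- t\<^sup>2)"
      by (simp add: normal_density_def power_mult_distrib)
    moreover have "(w / sqrt 2) * (0 + sqrt 2 * t) = w * t" by simp
    ultimately show ?thesis unfolding scaleR_conv_of_real by (simp only: of_real_mult mult_ac)
  qed
  have "char std_normal_distribution (w / sqrt 2) = (\<integral>x. ?g x \<partial>lborel)"
    unfolding char_def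
    by (rule integral_density) (auto simp: normal_density_nonneg intro!: borel_measurable_continuous_onI continuous_intros)
  hence "(\<integral>x. ?g x \<partial>lborel) = complex_of_real (exp (- w\<^sup>2 / 4))"
    unfolding char_std_normal_distribution by (simp add: power_divide)
  also have "(\<integral>x. ?g x \<partial>lborel) = \<bar>sqrt 2\<bar> *\<^sub>R (\<integral>t. ?g (0 + sqrt 2 * t) \<partial>lborel)"
    by (rule lborel_integral_real_affine) simp
  finally have "complex_of_real (sqrt 2 / sqrt (2 * pi)) * (\<integral>t. exp (\<i> * complex_of_real (w * t)) * complex_of_real (exp (- t\<^sup>2)) \<partial>lborel) = complex_of_real (exp (- w\<^sup>2 / 4))"
    unfolding e by (simp add: scaleR_conv_of_real)
  moreover have "sqrt 2 / sqrt (2 * pi) = 1 / sqrt pi" by (simp add: real_sqrt_mult)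
  ultimately show "(\<integral>t. exp (\<i> * complex_of_real (w * t)) * complex_of_real (exp (- t\<^sup>2)) \<partial>lborel)
     = complex_of_real (sqrt pi * exp (- w\<^sup>2 / 4))"
    using pi_gt_zero by (simp add: divide_eq_eq mult.commute)
  have "integrable lborel (\<lambda>t. ?g (0 + sqrt 2 * t))"
    by (rule lborel_integrable_real_affine[OF i]) simp
  hence "integrable lborel (\<lambda>t. complex_of_real (sqrt (2 * pi)) * (complex_of_real (1 / sqrt (2 * pi)) * (exp (\<i> * complex_of_real (w * t)) * complex_of_real (exp (- t\<^sup>2)))))"
    unfolding e by (rule integrable_mult_right)
  moreover have "complex_of_real (sqrt (2 * pi)) * (complex_of_real (1 / sqrt (2 * pi)) * z) = z" for z
    by simp
  ultimately show "integrable lborel (\<lambda>t::real. exp (\<i> * complex_of_real (w * t)) * complex_of_real (exp (- t\<^sup>2)))"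
    by (simp only:)
qed

lemma norm_sq_Basis: "(norm (x::'a::euclidean_space))\<^sup>2 = (\<Sum>b\<in>Basis. (x \<bullet> b)\<^sup>2)"
  unfolding power2_norm_eq_inner by (subst euclidean_inner) (simp add: power2_eq_square)

lemma gauss_fourier:
  fixes w :: "'a::euclidean_space"
  shows "(\<integral>x. wave w x * complex_of_real (exp (- (norm x)\<^sup>2)) \<partial>lborel)
     = complex_of_real (sqrt pi ^ DIM('a) * exp (- (norm w)\<^sup>2 / 4))"
proof -
  have "wave w x * complex_of_real (exp (- (norm x)\<^sup>2))
     = (\<Prod>b\<in>Basis. exp (\<i> * complex_of_real ((w \<bullet> b) * (x \<bullet> b))) * complex_of_real (exp (- (x \<bullet> b)\<^sup>2)))" for x :: 'a
  proof -
    have e: "exp (\<i> * complex_of_real c) * complex_of_real (exp d) = exp (\<i> * complex_of_real c + complex_of_real d)" for c d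
      by (simp add: exp_add exp_of_real)
    have "\<i> * complex_of_real (w \<bullet> x) + complex_of_real (- (norm x)\<^sup>2)
      = (\<Sum>b\<in>Basis. \<i> * complex_of_real ((w \<bullet> b) * (x \<bullet> b)) + complex_of_real (- (x \<bullet> b)\<^sup>2))"
      unfolding norm_sq_Basis euclidean_inner[of w x] by (simp add: sum_subtractf sum_distrib_left)
    thus ?thesis unfolding e by (simp add: exp_sum)
  qed
  hence "(\<integral>x. wave w x * complex_of_real (exp (- (norm x)\<^sup>2)) \<partial>lborel)
     = (\<Prod>b\<in>Basis. complex_of_real (sqrt pi * exp (- (w \<bullet> b)\<^sup>2 / 4)))"
    by (simp only: integral_lborel_prod[where f="\<lambda>b t. exp (\<i> * complex_of_real ((w \<bullet> b) * t)) * complex_of_real (exp (- t\<^sup>2))"]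
       gauss_fourier_1d)
  also have "\<dots> = complex_of_real (sqrt pi ^ DIM('a) * exp (- (norm w)\<^sup>2 / 4))"
  proof -
    have "(\<Prod>b\<in>Basis. sqrt pi * exp (- (w \<bullet> b)\<^sup>2 / 4)) = sqrt pi ^ DIM('a) * exp (\<Sum>b\<in>Basis. - (w \<bullet> b)\<^sup>2 / 4)"
      by (simp add: prod.distrib exp_sum)
    also have "(\<Sum>b\<in>Basis. - (w \<bullet> b)\<^sup>2 / 4) = - (norm w)\<^sup>2 / 4"
      unfolding norm_sq_Basis by (simp add: sum_negf sum_divide_distrib)
    finally show ?thesis by (metis of_real_prod)
  qed
  finally show ?thesis .
qed

lemma gauss_has_integral:
  "integrable lborel (\<lambda>x::'a::euclidean_space. exp (- (norm x)\<^sup>2))"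
  "(\<integral>x. exp (- (norm (x::'a::euclidean_space))\<^sup>2) \<partial>lborel) = sqrt pi ^ DIM('a)"
proof -
  have *: "(\<integral>x. complex_of_real (exp (- (norm (x::'a))\<^sup>2)) \<partial>lborel) = complex_of_real (sqrt pi ^ DIM('a))"
    using gauss_fourier[of "0::'a"] by simp
  thus "(\<integral>x. exp (- (norm (x::'a))\<^sup>2) \<partial>lborel) = sqrt pi ^ DIM('a)"
    by (metis integral_complex_of_real of_real_eq_iff)
  show "integrable lborel (\<lambda>x::'a. exp (- (norm x)\<^sup>2))"
    \<comment> \<open>The integral of a non-integrable function is 0 by convention, whereas this one
      has just been computed to be positive.\<close>
    by (rule ccontr) (use * in \<open>auto simp: not_integrable_integral_eq\<close>)
qed

lemma integrable_gauss_scaled: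
  assumes "e > 0"
  shows "integrable lborel (\<lambda>x::'a::euclidean_space. exp (- (e\<^sup>2 * (norm x)\<^sup>2)))"
  using integrable_affine[OF gauss_has_integral(1), of e 0] assms by (simp add: power_mult_distrib)

lemma gauss_fourier_scaled:
  fixes w :: "'a::euclidean_space"
  assumes "e > 0"
  shows "(\<integral>x. wave w x * complex_of_real (exp (- (e\<^sup>2 * (norm x)\<^sup>2))) \<partial>lborel)
     = complex_of_real ((sqrt pi / e) ^ DIM('a) * exp (- (norm ((1 / (2 * e)) *\<^sub>R w))\<^sup>2))"
proof -
  have "(\<integral>x. wave w x * complex_of_real (exp (- (e\<^sup>2 * (norm x)\<^sup>2))) \<partial>lborel)
     = \<bar>1 / e\<bar> ^ DIM('a) *\<^sub>R (\<integral>x. wave w ((1 / e) *\<^sub>R x + 0) * complex_of_real (exp (- (e\<^sup>2 * (norm ((1 / e) *\<^sub>R x + 0))\<^sup>2))) \<partial>lborel)"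
    using assms by (intro integral_affine) auto
  also have "(\<lambda>x. wave w ((1 / e) *\<^sub>R x + 0) * complex_of_real (exp (- (e\<^sup>2 * (norm ((1 / e) *\<^sub>R x + 0))\<^sup>2))))
     = (\<lambda>x. wave ((1 / e) *\<^sub>R w) x * complex_of_real (exp (- (norm x)\<^sup>2)))"
    using assms by (intro ext) (simp add: power_divide)
  finally show ?thesis
    unfolding gauss_fourier using assms
    by (simp add: scaleR_conv_of_real power_divide power_mult_distrib)
qed

text \<open>A majorant that separates the two variables reduces joint integrability to Tonelli's
  theorem; the double integrals below are arranged to have majorants of this form.\<close>

lemma integrable_pair_bound:
  fixes H :: "'a::euclidean_space \<times> 'b::euclidean_space \<Rightarrow> 'c::{banach,second_countable_topology}"
  assumes [measurable]: "H \<in> borel_measurable (lborel \<Otimes>\<^sub>M lborel)"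
    and f: "integrable lborel f" and g: "integrable lborel g"
    and le: "\<And>x y. norm (H (x, y)) \<le> f x * g y"
  shows "integrable (lborel \<Otimes>\<^sub>M lborel) H"
proof (rule integrableI_bounded)
  have [measurable]: "f \<in> borel_measurable borel" "g \<in> borel_measurable borel"
    using borel_measurable_integrable[OF f] borel_measurable_integrable[OF g] by auto
  have "(\<integral>\<^sup>+z. ennreal (norm (H z)) \<partial>(lborel \<Otimes>\<^sub>M lborel)) = (\<integral>\<^sup>+x. \<integral>\<^sup>+y. ennreal (norm (H (x, y))) \<partial>lborel \<partial>lborel)"
    by (rule lborel.nn_integral_fst[symmetric]) measurable
  also have "\<dots> \<le> (\<integral>\<^sup>+x. \<integral>\<^sup>+y. ennreal (norm (f x)) * ennreal (norm (g y)) \<partial>lborel \<partial>lborel)"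
  proof (intro nn_integral_mono)
    fix x y
    have "norm (H (x, y)) \<le> norm (f x) * norm (g y)"
      using le[of x y] by (metis abs_ge_self abs_mult order_trans real_norm_def)
    thus "ennreal (norm (H (x, y))) \<le> ennreal (norm (f x)) * ennreal (norm (g y))"
      by (simp add: ennreal_mult[symmetric] ennreal_leI del: real_norm_def)
  qed
  also have "\<dots> = (\<integral>\<^sup>+x. ennreal (norm (f x)) \<partial>lborel) * (\<integral>\<^sup>+y. ennreal (norm (g y)) \<partial>lborel)"
    by (simp add: nn_integral_cmult nn_integral_multc)
  also have "\<dots> < \<infinity>"
    using f g unfolding integrable_iff_bounded by (simp add: ennreal_mult_less_top)
  finally show "(\<integral>\<^sup>+z. ennreal (norm (H z)) \<partial>(lborel \<Otimes>\<^sub>M lborel)) < \<infinity>" .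
qed measurable

lemma Fubini_bound:
  fixes H :: "'a::euclidean_space \<Rightarrow> 'b::euclidean_space \<Rightarrow> 'c::{banach,second_countable_topology}"
  assumes "(\<lambda>(x, y). H x y) \<in> borel_measurable (lborel \<Otimes>\<^sub>M lborel)"
    and "integrable lborel f" "integrable lborel g" "\<And>x y. norm (H x y) \<le> f x * g y"
  shows "(\<integral>x. \<integral>y. H x y \<partial>lborel \<partial>lborel) = (\<integral>y. \<integral>x. H x y \<partial>lborel \<partial>lborel)"
  by (rule lborel_pair.Fubini_integral[symmetric], rule integrable_pair_bound[OF _ assms(2,3)]) (use assms in auto)

lemma measurable_wave2[measurable]:
  assumes [measurable]: "f \<in> borel_measurable M" "g \<in> borel_measurable M"
  shows "(\<lambda>x. wave (f x) (g x)) \<in> borel_measurable M"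
  by measurable

lemma measurable_cnj[measurable]: "f \<in> borel_measurable M \<Longrightarrow> (\<lambda>x. cnj (f x)) \<in> borel_measurable M"
  by (rule borel_measurable_continuous_on[where f=cnj]) (auto intro: continuous_intros)

lemma cnj_wave: "cnj (wave w x) = wave (- w) x"
  by (simp add: exp_cnj)

lemma wave_commute: "wave w x = wave x w"
  by (simp add: inner_commute)

lemma wave_add_left: "wave (v + w) x = wave v x * wave w x"
  by (simp add: inner_add_left exp_add[symmetric] algebra_simps)

lemma wave_add_right: "wave w (x + y) = wave w x * wave w y"
  by (simp add: inner_add_right exp_add[symmetric] algebra_simps)

lemma wave_diff_left: "wave (x - y) \<xi> = wave x \<xi> * wave (- \<xi>) y"
  by (simp add: inner_diff_left inner_commute exp_add[symmetric] algebra_simps)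

lemma wave_diff_left': "wave (x - y) \<xi> = wave (- y) \<xi> * wave \<xi> x"
  by (simp add: inner_diff_left inner_commute exp_add[symmetric] algebra_simps)

section \<open>The Fourier transform: inversion, Parseval's identity and convolution\<close>

definition cpi :: "'n::finite itself \<Rightarrow> real" where "cpi _ = (2 * pi) ^ CARD('n)"

lemma cpi_pos: "cpi t > 0"
  by (simp add: cpi_def)

lemma cpi_powr: "(2 * pi) powr (- real CARD('n::finite)) = 1 / cpi TYPE('n)"
  by (simp add: cpi_def powr_minus powr_realpow inverse_eq_divide)

lemma fourier_wave: "fourier f \<xi> = (\<integral>x. wave (- \<xi>) x * f x \<partial>lborel)"
  unfolding fourier_def by (simp add: inner_minus_left)

lemma inv_fourier_wave:
  fixes f :: "real^'n \<Rightarrow> complex"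
  shows "inv_fourier f x = (\<integral>\<xi>. wave x \<xi> * f \<xi> \<partial>lborel) / complex_of_real (cpi TYPE('n))"
  unfolding inv_fourier_def cpi_powr by simp

lemma inv_fourier_eq_fourier:
  fixes f :: "real^'n \<Rightarrow> complex"
  shows "inv_fourier f x = fourier f (- x) / complex_of_real (cpi TYPE('n))"
  unfolding inv_fourier_wave fourier_wave by simp

lemma measurable_fourier[measurable]:
  assumes [measurable]: "f \<in> borel_measurable borel"
  shows "fourier f \<in> borel_measurable borel"
proof -
  have "(\<lambda>\<xi>. \<integral>x. wave (- \<xi>) x * f x \<partial>lborel) \<in> borel_measurable borel"
    by (rule lborel.borel_measurable_lebesgue_integral) measurable
  thus ?thesis by (simp add: fourier_wave[abs_def])
qed

lemma norm_fourier_le: "norm (fourier f \<xi>) \<le> (\<integral>x. norm (f x) \<partial>lborel)"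
  unfolding fourier_wave by (rule order_trans[OF integral_norm_bound]) (simp add: norm_mult)

lemma continuous_integral_wave:
  fixes f :: "'a::euclidean_space \<Rightarrow> complex"
  assumes "integrable lborel f"
  shows "continuous_on UNIV (\<lambda>w. \<integral>x. wave w x * f x \<partial>lborel)"
  unfolding continuous_on_eq_continuous_at[OF open_UNIV] continuous_at_sequentially
proof (intro ballI allI impI)
  fix w and X :: "nat \<Rightarrow> 'a" assume X: "X \<longlonglongrightarrow> w"
  show "((\<lambda>w. \<integral>x. wave w x * f x \<partial>lborel) \<circ> X) \<longlonglongrightarrow> (\<integral>x. wave w x * f x \<partial>lborel)"
    unfolding o_def
    by (rule integral_dominated_convergence[where w="\<lambda>x. norm (f x)"])
       (use X borel_measurable_integrable[OF assms] assms in \<open>auto simp: norm_mult intro!: tendsto_intros\<close>)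
qed

text \<open>Dominated convergence with a multiple of the Gaussian as majorant; the factor
  \<open>sqrt pi ^ DIM\<close> is the mass of the Gaussian.\<close>

lemma approx_identity:
  fixes f :: "'a::euclidean_space \<Rightarrow> complex"
  assumes c: "continuous_on UNIV f" and b: "\<And>x. norm (f x) \<le> C" and e: "e \<longlonglongrightarrow> 0"
  shows "(\<lambda>m. \<integral>u. complex_of_real (exp (- (norm u)\<^sup>2)) * f (x + e m *\<^sub>R u) \<partial>lborel) \<longlonglongrightarrow> complex_of_real (sqrt pi ^ DIM('a)) * f x"
proof -
  have [measurable]: "f \<in> borel_measurable borel" using c by (rule borel_measurable_continuous_onI)
  have "(\<lambda>m. \<integral>u. complex_of_real (exp (- (norm u)\<^sup>2)) * f (x + e m *\<^sub>R u) \<partial>lborel)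
      \<longlonglongrightarrow> (\<integral>u. complex_of_real (exp (- (norm (u::'a))\<^sup>2)) * f x \<partial>lborel)"
  proof (rule integral_dominated_convergence[where w="\<lambda>u. exp (- (norm u)\<^sup>2) * C"])
    show "AE u in lborel. (\<lambda>m. complex_of_real (exp (- (norm u)\<^sup>2)) * f (x + e m *\<^sub>R u)) \<longlonglongrightarrow> complex_of_real (exp (- (norm u)\<^sup>2)) * f x"
    proof (intro AE_I2 tendsto_intros)
      fix u
      have "(\<lambda>m. x + e m *\<^sub>R u) \<longlonglongrightarrow> x + 0 *\<^sub>R u" by (intro tendsto_intros e)
      thus "(\<lambda>m. f (x + e m *\<^sub>R u)) \<longlonglongrightarrow> f x"
        using c by (auto simp: continuous_on_eq_continuous_at continuous_at_sequentially o_def)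
    qed
  qed (use gauss_has_integral(1)[where 'a='a] b in \<open>auto simp: norm_mult intro!: mult_left_mono\<close>)
  also have "(\<integral>u. complex_of_real (exp (- (norm (u::'a))\<^sup>2)) * f x \<partial>lborel) = complex_of_real (sqrt pi ^ DIM('a)) * f x"
    by (simp only: integral_mult_left_zero integral_complex_of_real gauss_has_integral(2))
  finally show ?thesis .
qed

text \<open>Gauss summation: damping the inversion integral by a Gaussian of parameter
  \<open>e m\<close> makes Fubini applicable. As \<open>e m\<close> tends to 0, one expression tends
  to the inversion integral and the other to a multiple of \<open>f x\<close>.\<close>

theorem fourier_inversion:
  fixes f :: "real^'n \<Rightarrow> complex"
  assumes f: "integrable lborel f" and c: "continuous_on UNIV f" and b: "\<And>x. norm (f x) \<le> C"
    and F: "integrable lborel (fourier f)"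
  shows "inv_fourier (fourier f) x = f x"
proof -
  define e where "e m = inverse (real (Suc m))" for m
  have e: "e \<longlonglongrightarrow> 0" "\<And>m. e m > 0" unfolding e_def using LIMSEQ_inverse_real_of_nat by auto
  have [measurable]: "f \<in> borel_measurable borel" using c by (rule borel_measurable_continuous_onI)
  let ?g = "\<lambda>m (\<xi>::real^'n). complex_of_real (exp (- ((e m)\<^sup>2 * (norm \<xi>)\<^sup>2)))"
  have 1: "(\<lambda>m. \<integral>\<xi>. wave x \<xi> * (?g m \<xi> * fourier f \<xi>) \<partial>lborel) \<longlonglongrightarrow> (\<integral>\<xi>. wave x \<xi> * fourier f \<xi> \<partial>lborel)"
  proof (rule integral_dominated_convergence[where w="\<lambda>\<xi>. norm (fourier f \<xi>)"])
    show "AE \<xi> in lborel. (\<lambda>m. wave x \<xi> * (?g m \<xi> * fourier f \<xi>)) \<longlonglongrightarrow> wave x \<xi> * fourier f \<xi>"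
    proof (rule AE_I2)
      fix \<xi>
      have "(\<lambda>m. wave x \<xi> * (?g m \<xi> * fourier f \<xi>)) \<longlonglongrightarrow> wave x \<xi> * (complex_of_real (exp (- (0\<^sup>2 * (norm \<xi>)\<^sup>2))) * fourier f \<xi>)"
        by (intro tendsto_intros e)
      thus "(\<lambda>m. wave x \<xi> * (?g m \<xi> * fourier f \<xi>)) \<longlonglongrightarrow> wave x \<xi> * fourier f \<xi>" by simp
    qed
  qed (use F in \<open>auto simp: norm_mult intro!: mult_left_le_one_le\<close>)
  \<comment> \<open>Integrating the damped wave over \<xi> leaves a Gaussian in
    \<open>x - y\<close>. The substitution \<open>y = 2 * e m * u + x\<close> cancels all powers of
    \<open>e m\<close> and leaves the constant \<open>(2 * sqrt pi)^n\<close>.\<close>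
  have 2: "(\<integral>\<xi>. wave x \<xi> * (?g m \<xi> * fourier f \<xi>) \<partial>lborel)
     = complex_of_real ((2 * sqrt pi) ^ CARD('n)) * (\<integral>u. complex_of_real (exp (- (norm u)\<^sup>2)) * f (x + (2 * e m) *\<^sub>R u) \<partial>lborel)" for m
  proof -
    have "(\<integral>\<xi>. wave x \<xi> * (?g m \<xi> * fourier f \<xi>) \<partial>lborel)
      = (\<integral>\<xi>. \<integral>y. f y * (wave (x - y) \<xi> * ?g m \<xi>) \<partial>lborel \<partial>lborel)"
    proof (intro Bochner_Integration.integral_cong refl)
      fix \<xi> :: "real^'n"
      have "(\<lambda>y. f y * (wave (x - y) \<xi> * ?g m \<xi>)) = (\<lambda>y. (wave x \<xi> * ?g m \<xi>) * (wave (- \<xi>) y * f y))"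
        by (intro ext) (simp only: wave_diff_left mult_ac)
      thus "wave x \<xi> * (?g m \<xi> * fourier f \<xi>) = (\<integral>y. f y * (wave (x - y) \<xi> * ?g m \<xi>) \<partial>lborel)"
        unfolding fourier_wave by (simp only: integral_mult_right_zero mult.assoc)
    qed
    also have "\<dots> = (\<integral>y. \<integral>\<xi>. f y * (wave (x - y) \<xi> * ?g m \<xi>) \<partial>lborel \<partial>lborel)"
      by (rule Fubini_bound[where f="\<lambda>\<xi>. exp (- ((e m)\<^sup>2 * (norm \<xi>)\<^sup>2))" and g="\<lambda>y. norm (f y)"], measurable)
         (use f integrable_gauss_scaled[OF e(2)] in \<open>auto simp: norm_mult\<close>)
    also have "\<dots> = (\<integral>y. f y * complex_of_real ((sqrt pi / e m) ^ CARD('n) * exp (- (norm ((1 / (2 * e m)) *\<^sub>R (x - y)))\<^sup>2)) \<partial>lborel)"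
      unfolding integral_mult_right_zero gauss_fourier_scaled[OF e(2)] by simp
    also have "\<dots> = \<bar>2 * e m\<bar> ^ CARD('n) *\<^sub>R (\<integral>u. f ((2 * e m) *\<^sub>R u + x) * complex_of_real ((sqrt pi / e m) ^ CARD('n)
         * exp (- (norm ((1 / (2 * e m)) *\<^sub>R (x - ((2 * e m) *\<^sub>R u + x))))\<^sup>2)) \<partial>lborel)"
      using e(2)[of m] by (subst integral_affine[where c="2 * e m" and t=x]) auto
    also have "\<dots> = \<bar>2 * e m\<bar> ^ CARD('n) *\<^sub>R (\<integral>u. complex_of_real ((sqrt pi / e m) ^ CARD('n)) * (complex_of_real (exp (- (norm u)\<^sup>2)) * f (x + (2 * e m) *\<^sub>R u)) \<partial>lborel)"
    proof -
      have "(1 / (2 * e m)) *\<^sub>R (x - ((2 * e m) *\<^sub>R u + x)) = - u" for u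
        using e(2)[of m] by simp
      thus ?thesis by (simp only: norm_minus_cancel of_real_mult mult_ac add.commute)
    qed
    also have "\<dots> = complex_of_real (\<bar>2 * e m\<bar> ^ CARD('n) * (sqrt pi / e m) ^ CARD('n)) * (\<integral>u. complex_of_real (exp (- (norm u)\<^sup>2)) * f (x + (2 * e m) *\<^sub>R u) \<partial>lborel)"
      unfolding integral_mult_right_zero scaleR_conv_of_real by simp
    also have "\<bar>2 * e m\<bar> ^ CARD('n) * (sqrt pi / e m) ^ CARD('n) = (2 * sqrt pi) ^ CARD('n)"
      using e(2)[of m] unfolding power_mult_distrib[symmetric] by simp
    finally show ?thesis .
  qed
  have "(\<lambda>m. 2 * e m) \<longlonglongrightarrow> 2 * 0" by (intro tendsto_intros e)
  hence "(\<lambda>m. \<integral>\<xi>. wave x \<xi> * (?g m \<xi> * fourier f \<xi>) \<partial>lborel) \<longlonglongrightarrow> complex_of_real ((2 * sqrt pi) ^ CARD('n)) * (complex_of_real (sqrt pi ^ CARD('n)) * f x)"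
    unfolding 2 using approx_identity[OF c b, of "\<lambda>m. 2 * e m" x] by (intro tendsto_intros) simp
  from LIMSEQ_unique[OF 1 this]
  have "(\<integral>\<xi>. wave x \<xi> * fourier f \<xi> \<partial>lborel) = complex_of_real ((2 * sqrt pi * sqrt pi) ^ CARD('n)) * f x"
    by (simp add: power_mult_distrib)
  also have "(2 * sqrt pi * sqrt pi) ^ CARD('n) = cpi TYPE('n)" unfolding cpi_def by (simp only: mult.assoc real_sqrt_mult_self abs_of_pos pi_gt_zero)
  finally show ?thesis unfolding inv_fourier_wave using cpi_pos[of "TYPE('n)"] by simp
qed

lemma continuous_inv_fourier:
  fixes f :: "real^'n \<Rightarrow> complex"
  assumes "integrable lborel f" shows "continuous_on UNIV (inv_fourier f)"
  unfolding inv_fourier_wave[abs_def] using cpi_pos[of "TYPE('n)"] by (intro continuous_intros continuous_integral_wave assms) auto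

text \<open>Up to the constant \<open>cpi\<close> the two transforms differ by the reflection of the
  argument, so this order of composition follows from \<open>fourier_inversion\<close>.\<close>

lemma fourier_inv_fourier:
  fixes f :: "real^'n \<Rightarrow> complex"
  assumes f: "integrable lborel f" and c: "continuous_on UNIV f" and b: "\<And>x. norm (f x) \<le> C"
    and F: "integrable lborel (inv_fourier f)"
  shows "fourier (inv_fourier f) \<xi> = f \<xi>"
proof -
  have e: "fourier f x = complex_of_real (cpi TYPE('n)) * inv_fourier f (- x)" for x
    unfolding inv_fourier_eq_fourier using cpi_pos[of "TYPE('n)"] by simp
  have "integrable lborel (fourier f)"
    unfolding e[abs_def] using integrable_affine[OF F, of "-1" 0] by (intro integrable_mult_right) auto
  from fourier_inversion[OF f c b this]
  have "f \<xi> = inv_fourier (fourier f) \<xi>" by simp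
  also have "\<dots> = (\<integral>x. wave \<xi> x * inv_fourier f (- x) \<partial>lborel)"
    unfolding inv_fourier_wave[of "fourier f"] e using cpi_pos[of "TYPE('n)"]
    by (simp add: mult.left_commute)
  also have "\<dots> = fourier (inv_fourier f) \<xi>"
    unfolding fourier_wave by (subst integral_reflect[symmetric]) simp
  finally show ?thesis by simp
qed

text \<open>Fubini moves the transform off \<open>f\<close> and onto \<open>fourier g\<close>, where
  inversion gives back \<open>g\<close>; this requires \<open>fourier g\<close> to be integrable
  while \<open>f\<close> is merely integrable.\<close>

lemma parseval:
  fixes f g :: "real^'n \<Rightarrow> complex"
  assumes f: "integrable lborel f" and g: "integrable lborel g" "continuous_on UNIV g" "\<And>x. norm (g x) \<le> C"
    and G: "integrable lborel (fourier g)"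
  shows "(\<integral>\<xi>. fourier f \<xi> * cnj (fourier g \<xi>) \<partial>lborel) = complex_of_real (cpi TYPE('n)) * (\<integral>x. f x * cnj (g x) \<partial>lborel)"
proof -
  have [measurable]: "f \<in> borel_measurable borel" "fourier g \<in> borel_measurable borel"
    using borel_measurable_integrable f G by auto
  have "(\<integral>\<xi>. fourier f \<xi> * cnj (fourier g \<xi>) \<partial>lborel) = (\<integral>\<xi>. \<integral>x. f x * (wave (- \<xi>) x * cnj (fourier g \<xi>)) \<partial>lborel \<partial>lborel)"
  proof (intro Bochner_Integration.integral_cong refl)
    fix \<xi> :: "real^'n"
    have "(\<lambda>x. f x * (wave (- \<xi>) x * cnj (fourier g \<xi>))) = (\<lambda>x. (wave (- \<xi>) x * f x) * cnj (fourier g \<xi>))"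
      by (intro ext) (simp only: mult_ac)
    thus "fourier f \<xi> * cnj (fourier g \<xi>) = (\<integral>x. f x * (wave (- \<xi>) x * cnj (fourier g \<xi>)) \<partial>lborel)"
      unfolding fourier_wave[of f] by (simp only: integral_mult_left_zero)
  qed
  also have "\<dots> = (\<integral>x. \<integral>\<xi>. f x * (wave (- \<xi>) x * cnj (fourier g \<xi>)) \<partial>lborel \<partial>lborel)"
    by (rule Fubini_bound[where f="\<lambda>\<xi>. norm (fourier g \<xi>)" and g="\<lambda>y. norm (f y)"], measurable)
         (use f G in \<open>auto simp: norm_mult\<close>)
  also have "\<dots> = (\<integral>x. f x * (complex_of_real (cpi TYPE('n)) * cnj (inv_fourier (fourier g) x)) \<partial>lborel)"
  proof (intro Bochner_Integration.integral_cong refl)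
    fix x
    have "cnj (\<integral>\<xi>. wave x \<xi> * fourier g \<xi> \<partial>lborel) = (\<integral>\<xi>. cnj (wave x \<xi> * fourier g \<xi>) \<partial>lborel)"
      by (rule Bochner_Integration.integral_cnj[symmetric])
    also have "\<dots> = (\<integral>\<xi>. wave (- \<xi>) x * cnj (fourier g \<xi>) \<partial>lborel)"
      by (simp add: exp_cnj inner_commute)
    finally show "(\<integral>\<xi>. f x * (wave (- \<xi>) x * cnj (fourier g \<xi>)) \<partial>lborel) = f x * (complex_of_real (cpi TYPE('n)) * cnj (inv_fourier (fourier g) x))"
      unfolding inv_fourier_wave using cpi_pos[of "TYPE('n)"] by simp
  qed
  also have "\<dots> = complex_of_real (cpi TYPE('n)) * (\<integral>x. f x * cnj (g x) \<partial>lborel)"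
    unfolding fourier_inversion[OF g G] integral_mult_right_zero[symmetric] by (simp only: mult.left_commute)
  finally show ?thesis .
qed

lemma fourier_mult_inv_fourier:
  fixes F g :: "real^'n \<Rightarrow> complex"
  assumes F: "integrable lborel F" and g: "integrable lborel g"
  shows "fourier (\<lambda>x. inv_fourier F x * g x) \<xi> = (\<integral>\<omega>. F \<omega> * fourier g (\<xi> - \<omega>) \<partial>lborel) / complex_of_real (cpi TYPE('n))"
proof -
  have [measurable]: "F \<in> borel_measurable borel" "g \<in> borel_measurable borel"
    using borel_measurable_integrable F g by auto
  have "fourier (\<lambda>x. inv_fourier F x * g x) \<xi> = (\<integral>x. (\<integral>\<omega>. F \<omega> * (wave (\<omega> - \<xi>) x * g x) \<partial>lborel) / complex_of_real (cpi TYPE('n)) \<partial>lborel)"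
    unfolding fourier_wave
  proof (intro Bochner_Integration.integral_cong refl)
    fix x :: "real^'n"
    have "(\<lambda>\<omega>. F \<omega> * (wave (\<omega> - \<xi>) x * g x)) = (\<lambda>\<omega>. (wave (- \<xi>) x * g x) * (wave x \<omega> * F \<omega>))"
      by (intro ext) (simp only: wave_diff_left' mult_ac)
    hence e: "(\<integral>\<omega>. F \<omega> * (wave (\<omega> - \<xi>) x * g x) \<partial>lborel) = (wave (- \<xi>) x * g x) * (\<integral>\<omega>. wave x \<omega> * F \<omega> \<partial>lborel)"
      by (simp only: integral_mult_right_zero)
    show "wave (- \<xi>) x * (inv_fourier F x * g x) = (\<integral>\<omega>. F \<omega> * (wave (\<omega> - \<xi>) x * g x) \<partial>lborel) / complex_of_real (cpi TYPE('n))"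
      unfolding inv_fourier_wave e by simp
  qed
  also have "\<dots> = (\<integral>x. (\<integral>\<omega>. F \<omega> * (wave (\<omega> - \<xi>) x * g x) \<partial>lborel) \<partial>lborel) / complex_of_real (cpi TYPE('n))"
    by simp
  also have "(\<integral>x. \<integral>\<omega>. F \<omega> * (wave (\<omega> - \<xi>) x * g x) \<partial>lborel \<partial>lborel) = (\<integral>\<omega>. \<integral>x. F \<omega> * (wave (\<omega> - \<xi>) x * g x) \<partial>lborel \<partial>lborel)"
    by (rule Fubini_bound[where f="\<lambda>\<xi>. norm (g \<xi>)" and g="\<lambda>y. norm (F y)"], measurable)
         (use F g in \<open>auto simp: norm_mult\<close>)
  also have "\<dots> = (\<integral>\<omega>. F \<omega> * fourier g (\<xi> - \<omega>) \<partial>lborel)"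
    unfolding fourier_wave by simp
  finally show ?thesis .
qed

text \<open>The transform of the product is a convolution, and at a point farther than
  \<open>r + s\<close> from \<open>a + b\<close> one of the two factors of its integrand always
  vanishes.\<close>

lemma fourier_mult_support:
  fixes F g :: "real^'n \<Rightarrow> complex"
  assumes "integrable lborel F" "integrable lborel g"
    and F: "\<And>\<omega>. norm (\<omega> - a) > r \<Longrightarrow> F \<omega> = 0" and g: "\<And>\<omega>. norm (\<omega> - b) > s \<Longrightarrow> fourier g \<omega> = 0"
    and "norm (\<xi> - (a + b)) > r + s"
  shows "fourier (\<lambda>x. inv_fourier F x * g x) \<xi> = 0"
proof -
  have "F \<omega> * fourier g (\<xi> - \<omega>) = 0" for \<omega>
  proof (cases "norm (\<omega> - a) > r")
    case False
    have "\<xi> - (a + b) = (\<xi> - \<omega> - b) + (\<omega> - a)" by simp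
    hence "norm (\<xi> - (a + b)) \<le> norm (\<xi> - \<omega> - b) + norm (\<omega> - a)"
      by (metis norm_triangle_ineq)
    hence "norm (\<xi> - \<omega> - b) > s" using False assms(5) by linarith
    from g[OF this] show ?thesis by simp
  qed (use F in auto)
  thus ?thesis unfolding fourier_mult_inv_fourier[OF assms(1,2)] by (simp only: Bochner_Integration.integral_zero div_0)
qed

section \<open>Fourier transforms of Schwartz functions\<close>

lemma schwartz_mult_inner:
  fixes F :: "'a::euclidean_space \<Rightarrow> complex"
  assumes F: "schwartz F" and v: "v \<in> Basis"
  shows "schwartz (\<lambda>\<omega>. complex_of_real (\<omega> \<bullet> v) * F \<omega>)"
proof (rule schwartzI)
  fix N M
  \<comment> \<open>One extra power of decay pays for the linear growth of the factor
    \<open>\<omega> \<bullet> v\<close>.\<close>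
  obtain C where C: "dbd N (\<lambda>x. C / (1 + norm x) ^ Suc M) F" "C \<ge> 0" using schwartz_dbd[OF F] by blast
  have "dbd N (\<lambda>x. \<bar>x \<bullet> v\<bar> + 1) (\<lambda>x. complex_of_real (x \<bullet> v))"
    by (rule dbd_linear_isometry[OF dbd_inner[OF v, of N 0, unfolded add_0_right] bounded_linear_of_real norm_of_real[unfolded real_norm_def[symmetric]]])
  from dbd_mult[OF this C(1)]
  have "dbd N (\<lambda>x. 2 ^ N * C / (1 + norm x) ^ M) (\<lambda>\<omega>. complex_of_real (\<omega> \<bullet> v) * F \<omega>)"
  proof (rule dbd_mono)
    fix x
    have "(\<bar>x \<bullet> v\<bar> + 1) * (C / (1 + norm x) ^ Suc M) \<le> (1 + norm x) * (C / (1 + norm x) ^ Suc M)"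
      using Basis_le_norm[OF v, of x] C(2) by (intro mult_right_mono) auto
    also have "\<dots> = C / (1 + norm x) ^ M"
    proof -
      have "1 + norm x \<noteq> 0" using norm_ge_zero[of x] by linarith
      thus ?thesis by simp
    qed
    finally have "(\<bar>x \<bullet> v\<bar> + 1) * (C / (1 + norm x) ^ Suc M) \<le> C / (1 + norm x) ^ M" .
    from mult_left_mono[OF this, of "2 ^ N"]
    show "2 ^ N * ((\<bar>x \<bullet> v\<bar> + 1) * (C / (1 + norm x) ^ Suc M)) \<le> 2 ^ N * C / (1 + norm x) ^ M" by simp
  qed
  thus "\<exists>C. dbd N (\<lambda>x. C / (1 + norm x) ^ M) (\<lambda>\<omega>. complex_of_real (\<omega> \<bullet> v) * F \<omega>)" by blast
qed

lemma schwartz_cmult: "schwartz f \<Longrightarrow> schwartz (\<lambda>x. (c::complex) * f x)"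
  using schwartz_mult_dbd[of f "\<lambda>x. c"] dbd_const[OF order_refl[of "norm c"]] by (auto simp: mult.commute)

lemma inv_fourier_has_dirderiv:
  fixes F :: "real^'n \<Rightarrow> complex"
  assumes F: "schwartz F" and v: "v \<in> Basis"
  shows "((\<lambda>t. inv_fourier F (x + t *\<^sub>R v)) has_vector_derivative inv_fourier (\<lambda>\<omega>. \<i> * (complex_of_real (\<omega> \<bullet> v) * F \<omega>)) x) (at 0)"
proof -
  let ?F = "\<lambda>\<omega>. \<i> * (complex_of_real (\<omega> \<bullet> v) * F \<omega>)"
  have s: "schwartz ?F" by (intro schwartz_cmult schwartz_mult_inner F v)
  have *: "((\<lambda>t. \<integral>\<omega>. wave (x + t *\<^sub>R v) \<omega> * F \<omega> \<partial>lborel) has_vector_derivative (\<integral>\<omega>. wave (x + 0 *\<^sub>R v) \<omega> * ?F \<omega> \<partial>lborel)) (at 0)"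
  proof (rule has_vector_derivative_integral(1)[where B="\<lambda>\<omega>. norm (?F \<omega>)"])
    fix t :: real and \<omega>
    have "((\<lambda>t. wave \<omega> (x + t *\<^sub>R v) * F \<omega>) has_vector_derivative \<i> * complex_of_real (\<omega> \<bullet> v) * wave \<omega> (x + t *\<^sub>R v) * F \<omega>) (at t)"
      by (rule has_vector_derivative_mult_left[OF cexp_has_vector_derivative])
    thus "((\<lambda>t. wave (x + t *\<^sub>R v) \<omega> * F \<omega>) has_vector_derivative wave (x + t *\<^sub>R v) \<omega> * ?F \<omega>) (at t)"
      by (simp add: inner_commute mult_ac)
    show "integrable lborel (\<lambda>\<omega>. norm (?F \<omega>))" by (rule integrable_norm[OF schwartz_integrable[OF s]])
    show "integrable lborel (\<lambda>\<omega>. wave (x + t *\<^sub>R v) \<omega> * F \<omega>)" by (rule integrable_wave[OF schwartz_integrable[OF F]])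
  qed (simp add: norm_mult)
  show ?thesis unfolding inv_fourier_wave divide_inverse
    using has_vector_derivative_mult_left[OF *] by simp
qed

lemma dirderiv_inv_fourier:
  fixes F :: "real^'n \<Rightarrow> complex"
  assumes F: "schwartz F" and v: "v \<in> Basis"
  shows "dirderiv v (inv_fourier F) = inv_fourier (\<lambda>\<omega>. \<i> * (complex_of_real (\<omega> \<bullet> v) * F \<omega>))"
  by (intro ext dirderivI inv_fourier_has_dirderiv F v)

lemma schwartz_osc_decay:
  fixes F :: "'a::euclidean_space \<Rightarrow> complex"
  assumes "schwartz F"
  obtains C where "C \<ge> 0" "\<And>w. norm (\<integral>x. wave w x * F x \<partial>lborel) \<le> C / (1 + norm w) ^ N"
proof -
  obtain C where C: "C \<ge> 0" "dbd N (\<lambda>x. C * wt x) F" using schwartz_dbd[OF assms] unfolding wt_def by auto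
  have "integrable lborel (\<lambda>x::'a. C * wt x)" by (intro integrable_mult_right integrable_wt)
  from osc_decay[OF assms C(2) this] show ?thesis
    by (intro that[of "(1 + real DIM('a)) ^ N * (\<integral>x. C * wt (x::'a) \<partial>lborel)"]) (use C wt_nonneg in \<open>auto intro!: mult_nonneg_nonneg Bochner_Integration.integral_nonneg\<close>)
qed

text \<open>Differentiating \<open>inv_fourier F\<close> multiplies \<open>F\<close> by a linear
  factor and so stays among inverse transforms of Schwartz functions. Coinduction then gives
  smoothness, and \<open>osc_decay\<close> applied to each of these functions gives the
  decay.\<close>

theorem schwartz_inv_fourier:
  fixes F :: "real^'n \<Rightarrow> complex"
  assumes F: "schwartz F" shows "schwartz (inv_fourier F)"
proof -
  have step: "schwartz (\<lambda>\<omega>. \<i> * (complex_of_real (\<omega> \<bullet> v) * F \<omega>))" if "schwartz F" "v \<in> Basis" for v and F :: "real^'n \<Rightarrow> complex"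
    using that by (intro schwartz_cmult schwartz_mult_inner)
  have sm: "smooth (inv_fourier F)"
  proof (rule smooth_coinduct[where P="\<lambda>f. \<exists>F. schwartz F \<and> f = inv_fourier F"])
    fix f :: "real^'n \<Rightarrow> complex" assume "\<exists>F. schwartz F \<and> f = inv_fourier F"
    thus "continuous_on UNIV f" by (auto intro: continuous_inv_fourier schwartz_integrable)
  next
    fix f :: "real^'n \<Rightarrow> complex" and v x :: "real^'n"
    assume "\<exists>F. schwartz F \<and> f = inv_fourier F" and v: "v \<in> Basis"
    then obtain F where F: "schwartz F" "f = inv_fourier F" by blast
    show "\<exists>d. ((\<lambda>t. f (x + t *\<^sub>R v)) has_vector_derivative d) (at 0)"
      unfolding F(2) by (rule exI, rule inv_fourier_has_dirderiv[OF F(1) v])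
    show "\<exists>F. schwartz F \<and> dirderiv v f = inv_fourier F"
      unfolding F(2) dirderiv_inv_fourier[OF F(1) v] using step[OF F(1) v] by blast
  qed (use F in blast)
  have d: "\<exists>G. schwartz G \<and> diffs vs (inv_fourier F) = inv_fourier G" if "set vs \<subseteq> Basis" for vs
    using that
  proof (induction vs)
    case (Cons v vs)
    then obtain G where "schwartz G" "diffs vs (inv_fourier F) = inv_fourier G" "v \<in> Basis" by auto
    thus ?case using dirderiv_inv_fourier[of G v] step[of G v] by auto
  qed (use F in auto)
  show ?thesis unfolding schwartz_def
  proof (intro conjI allI impI sm)
    fix vs :: "(real^'n) list" and N :: nat assume "set vs \<subseteq> Basis"
    from d[OF this] obtain G where G: "schwartz G" "diffs vs (inv_fourier F) = inv_fourier G" by blast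
    obtain C where C: "\<And>w. norm (\<integral>x. wave w x * G x \<partial>lborel) \<le> C / (1 + norm w) ^ N" using schwartz_osc_decay[OF G(1)] by blast
    have "(1 + norm x) ^ N * norm (inv_fourier G x) \<le> C / cpi TYPE('n)" for x
    proof -
      have "(1 + norm x) ^ N * norm (\<integral>\<xi>. wave x \<xi> * G \<xi> \<partial>lborel) \<le> C"
        using C[of x] by (subst (asm) pos_le_divide_eq) (auto simp: add_pos_nonneg mult.commute)
      thus ?thesis unfolding inv_fourier_wave using cpi_pos[of "TYPE('n)"] by (simp add: norm_divide divide_right_mono)
    qed
    thus "\<exists>C. \<forall>x. (1 + norm x) ^ N * norm (diffs vs (inv_fourier F) x) \<le> C" unfolding G(2) by blast
  qed
qed

lemma schwartz_fourier_decay: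
  assumes "schwartz f" obtains C where "C \<ge> 0" "\<And>\<xi>. norm (fourier f \<xi>) \<le> C * wt \<xi>"
proof -
  obtain C where C: "C \<ge> 0" "\<And>w. norm (\<integral>x. wave w x * f x \<partial>lborel) \<le> C / (1 + norm w) ^ (2 * DIM(real^'a))"
    using schwartz_osc_decay[OF assms] by blast
  show ?thesis using C(2)[of "- _"] by (intro that[OF C(1)]) (simp add: fourier_wave wt_def)
qed

lemma schwartz_integrable_fourier:
  assumes "schwartz f" shows "integrable lborel (fourier f)"
proof -
  obtain C where C: "C \<ge> 0" "\<And>\<xi>. norm (fourier f \<xi>) \<le> C * wt \<xi>" using schwartz_fourier_decay[OF assms] by blast
  have [measurable]: "f \<in> borel_measurable borel" using schwartz_integrable[OF assms] borel_measurable_integrable by auto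
  show ?thesis
    by (rule Bochner_Integration.integrable_bound[OF integrable_mult_right[OF integrable_wt, of C]])
       (use C in \<open>auto simp: wt_nonneg\<close>)
qed

lemma schwartz_fourier_inversion: "schwartz f \<Longrightarrow> inv_fourier (fourier f) = f"
  by (rule ext, rule schwartz_bounded[of f 0], assumption,
      rule fourier_inversion[OF schwartz_integrable schwartz_continuous dbd_bound schwartz_integrable_fourier])

lemma schwartz_fourier_inv_fourier: "schwartz f \<Longrightarrow> fourier (inv_fourier f) = f"
  by (rule ext, rule schwartz_bounded[of f 0], assumption,
      rule fourier_inv_fourier[OF schwartz_integrable schwartz_continuous dbd_bound schwartz_integrable[OF schwartz_inv_fourier]])

lemma schwartz_parseval:
  fixes f g :: "real^'n \<Rightarrow> complex"
  assumes "schwartz f" "schwartz g"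
  shows "(\<integral>\<xi>. fourier f \<xi> * cnj (fourier g \<xi>) \<partial>lborel) = complex_of_real (cpi TYPE('n)) * (\<integral>x. f x * cnj (g x) \<partial>lborel)"
  by (rule schwartz_bounded[OF assms(2), of 0], rule parseval)
     (use assms in \<open>auto intro: schwartz_integrable schwartz_continuous dbd_bound schwartz_integrable_fourier\<close>)


section \<open>Modulation norms\<close>


lemma ennpow_ennreal: "0 \<le> a \<Longrightarrow> ennpow (ennreal a) r = ennreal (a powr r)"
  by (simp add: ennpow_def)

lemma ennpow_top[simp]: "ennpow top r = top"
  by (simp add: ennpow_def)

lemma ennpow_0[simp]: "ennpow 0 r = 0"
  by (simp add: ennpow_def)

lemma ennpow_mono: "a \<le> b \<Longrightarrow> 0 \<le> r \<Longrightarrow> ennpow a r \<le> ennpow b r"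
  by (cases a; cases b) (auto simp: ennpow_ennreal powr_mono2 ennreal_leI top_unique)

lemma ennpow_mult: "0 < r \<Longrightarrow> ennpow (a * b) r = ennpow a r * ennpow b r"
proof (cases a; cases b)
  fix x y assume "0 \<le> x" "a = ennreal x" "0 \<le> y" "b = ennreal y"
  thus ?thesis by (simp add: ennpow_ennreal powr_mult flip: ennreal_mult)
next
  fix x assume "0 \<le> x" "a = ennreal x" "b = top" "0 < r"
  thus ?thesis by (cases "x = 0") (auto simp: ennpow_ennreal ennreal_mult_top)
next
  fix x assume "0 \<le> x" "b = ennreal x" "a = top" "0 < r"
  thus ?thesis by (cases "x = 0") (auto simp: ennpow_ennreal ennreal_top_mult)
qed (simp add: ennreal_mult_top ennreal_top_mult)

lemma ennpow_ennpow: "ennpow (ennpow a r) s = ennpow a (r * s)"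
  by (cases a) (auto simp: ennpow_ennreal powr_powr)

lemma ennpow_1[simp]: "ennpow a 1 = a"
  by (cases a) (auto simp: ennpow_ennreal)

lemma ennpow_eq_0: "ennpow a r = 0 \<longleftrightarrow> a = 0"
  by (cases a) (auto simp: ennpow_ennreal)

lemma ennpow_eq_top: "ennpow a r = top \<longleftrightarrow> a = top"
  by (cases a) (auto simp: ennpow_ennreal)

lemma measurable_ennpow[measurable]:
  assumes [measurable]: "f \<in> borel_measurable M" shows "(\<lambda>x. ennpow (f x) r) \<in> borel_measurable M"
  unfolding ennpow_def by measurable

lemma ennreal_Young:
  assumes "1 < p" "1 < p'" "1 / p + 1 / p' = 1"
  shows "a * b \<le> ennreal (1 / p) * ennpow a p + ennreal (1 / p') * ennpow b p'"
proof (cases "a = top \<or> b = top")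
  case True
  have "ennreal (1 / p) * top = top" "ennreal (1 / p') * top = top"
    using assms by (simp_all add: ennreal_mult_top)
  with True have "ennreal (1 / p) * ennpow a p + ennreal (1 / p') * ennpow b p' = top"
    by (auto simp: ennpow_def)
  thus ?thesis by (simp only: top_greatest)
next
  case False
  then obtain x y where xy: "a = ennreal x" "0 \<le> x" "b = ennreal y" "0 \<le> y" by (cases a; cases b) auto
  have "x * y \<le> 1 / p * x powr p + 1 / p' * y powr p'"
    using Youngs_inequality[of p p' x y] assms xy by (simp add: divide_inverse mult.commute)
  thus ?thesis unfolding xy using assms xy(2,4)
    by (simp add: ennpow_ennreal ennreal_leI flip: ennreal_mult ennreal_plus)
qed

text \<open>Both functions are divided by their norms \<open>a\<close> and \<open>b\<close> and
  Young's inequality is integrated pointwise. If a norm is 0 the product vanishes almost everywhere;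
  if one is infinite and the other nonzero, the bound is infinite.\<close>

lemma ennreal_Holder:
  assumes p: "1 < p" "1 < p'" "1 / p + 1 / p' = 1"
    and [measurable]: "f \<in> borel_measurable M" "g \<in> borel_measurable M"
  shows "(\<integral>\<^sup>+x. f x * g x \<partial>M) \<le> ennpow (\<integral>\<^sup>+x. ennpow (f x) p \<partial>M) (1 / p) * ennpow (\<integral>\<^sup>+x. ennpow (g x) p' \<partial>M) (1 / p')"
    (is "_ \<le> ennpow ?F _ * ennpow ?G _")
proof -
  consider "?F = 0 \<or> ?G = 0" | "?F \<noteq> 0" "?G \<noteq> 0" "?F = top \<or> ?G = top"
    | "?F \<noteq> 0" "?G \<noteq> 0" "?F \<noteq> top" "?G \<noteq> top" by blast
  thus ?thesis
  proof cases
    case 1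
    hence "AE x in M. f x * g x = 0"
      by (subst (asm) (1 2) nn_integral_0_iff_AE) (auto simp: ennpow_eq_0)
    hence "(\<integral>\<^sup>+x. f x * g x \<partial>M) = 0" by (subst nn_integral_0_iff_AE) auto
    thus ?thesis by simp
  next
    case 2
    hence "ennpow ?F (1 / p) * ennpow ?G (1 / p') = top"
      by (auto simp: ennreal_mult_eq_top_iff ennpow_eq_0 ennpow_eq_top)
    thus ?thesis by simp
  next
    case 3
    obtain \<alpha> where \<alpha>: "?F = ennreal \<alpha>" "0 < \<alpha>" using 3(1,3) by (cases ?F) (auto simp: less_le)
    obtain \<beta> where \<beta>: "?G = ennreal \<beta>" "0 < \<beta>" using 3(2,4) by (cases ?G) (auto simp: less_le)
    define a where "a = \<alpha> powr (1 / p)"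
    define b where "b = \<beta> powr (1 / p')"
    have ab: "a > 0" "b > 0" "a powr p = \<alpha>" "b powr p' = \<beta>" using \<alpha> \<beta> p by (auto simp: a_def b_def powr_powr)
    have "(\<integral>\<^sup>+x. f x * g x \<partial>M) = (\<integral>\<^sup>+x. ennreal (a * b) * ((ennreal (1 / a) * f x) * (ennreal (1 / b) * g x)) \<partial>M)"
    proof (intro nn_integral_cong)
      fix x
      have "ennreal (a * b) * (ennreal (1 / a) * ennreal (1 / b)) = 1" using ab by (simp flip: ennreal_mult)
      hence "(ennreal (a * b) * (ennreal (1 / a) * ennreal (1 / b))) * (f x * g x) = f x * g x" by simp
      thus "f x * g x = ennreal (a * b) * ((ennreal (1 / a) * f x) * (ennreal (1 / b) * g x))" by (simp only: mult_ac)
    qed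
    also have "\<dots> \<le> (\<integral>\<^sup>+x. ennreal (a * b) * (ennreal (1 / p) * ennpow (ennreal (1 / a) * f x) p + ennreal (1 / p') * ennpow (ennreal (1 / b) * g x) p') \<partial>M)"
      by (intro nn_integral_mono mult_left_mono ennreal_Young p) auto
    also have "\<dots> = ennreal (a * b) * (ennreal (1 / p) * (ennpow (ennreal (1 / a)) p * ?F) + ennreal (1 / p') * (ennpow (ennreal (1 / b)) p' * ?G))"
      using p by (simp add: nn_integral_cmult nn_integral_add ennpow_mult)
    also have "ennpow (ennreal (1 / a)) p * ?F = 1"
      using ab \<alpha> by (simp add: ennpow_ennreal powr_divide flip: ennreal_mult)
    also have "ennpow (ennreal (1 / b)) p' * ?G = 1"
      using ab \<beta> by (simp add: ennpow_ennreal powr_divide flip: ennreal_mult)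
    also have "ennreal (1 / p) * 1 + ennreal (1 / p') * 1 = 1"
      using p by (simp flip: ennreal_plus)
    also have "ennreal (a * b) * 1 = ennpow ?F (1 / p) * ennpow ?G (1 / p')"
      using \<alpha> \<beta> ab by (simp add: ennpow_ennreal a_def b_def ennreal_mult)
    finally show ?thesis .
  qed
qed

section \<open>Short-time Fourier transforms and duality of modulation norms\<close>

lemma stft_fourier: "stft \<gamma> f x \<xi> = fourier (\<lambda>t. f t * cnj (\<gamma> (t - x))) \<xi>"
  unfolding stft_def fourier_wave
  by (intro Bochner_Integration.integral_cong refl) (simp add: exp_cnj)

lemma measurable_stft[measurable]:
  assumes [measurable]: "\<gamma> \<in> borel_measurable borel" "f \<in> borel_measurable borel"
  shows "(\<lambda>z. stft \<gamma> f (fst z) (snd z)) \<in> borel_measurable (borel \<Otimes>\<^sub>M borel)"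
proof -
  have "(\<lambda>z. \<integral>t. f t * cnj (exp (\<i> * complex_of_real (snd z \<bullet> t)) * \<gamma> (t - fst z)) \<partial>lborel) \<in> borel_measurable (borel \<Otimes>\<^sub>M borel)"
    by (rule lborel.borel_measurable_lebesgue_integral) measurable
  thus ?thesis by (simp add: stft_def)
qed

lemma measurable_stft_swap:
  assumes "\<gamma> \<in> borel_measurable borel" "f \<in> borel_measurable borel"
  shows "(\<lambda>z. stft \<gamma> f (snd z) (fst z)) \<in> borel_measurable (borel \<Otimes>\<^sub>M borel)"
  using measurable_compose[OF measurable_Pair[OF measurable_snd measurable_fst] measurable_stft[OF assms]] by simp

lemma schwartz_measurable: "schwartz (f :: real^'n \<Rightarrow> complex) \<Longrightarrow> f \<in> borel_measurable borel"
  using schwartz_integrable borel_measurable_integrable by fastforce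

lemma dbd_shift: "dbd N (\<lambda>x. C) f \<Longrightarrow> dbd N (\<lambda>x. C) (\<lambda>t. f (t - x))"
  using dbd_affine[of N "\<lambda>x. C" f 1 "- x"] by simp

lemma schwartz_mult_window:
  assumes "schwartz f" "schwartz \<gamma>" shows "schwartz (\<lambda>t. f t * cnj (\<gamma> (t - x)))"
proof (rule schwartz_mult_dbd[OF assms(1)])
  fix N
  obtain C where "dbd N (\<lambda>x. C) (\<lambda>t. cnj (\<gamma> t))" using schwartz_bounded[OF schwartz_cnj[OF assms(2)]] by blast
  from dbd_shift[OF this] show "\<exists>C. dbd N (\<lambda>x. C) (\<lambda>t. cnj (\<gamma> (t - x)))" by blast
qed

text \<open>Decay in \<open>t - x\<close> becomes decay in \<open>x\<close> at the price of a power
  of \<open>1 + norm t\<close>, which the decay of another factor in \<open>t\<close> can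
  absorb.\<close>

lemma wt_shift: "wt (t - x) \<le> (1 + norm t) ^ (2 * DIM('a)) * wt (x::'a::euclidean_space)"
proof -
  have "1 + norm x \<le> (1 + norm (t - x)) * (1 + norm t)"
    using one_plus_norm_shift[of "x" "- t"] by (simp add: norm_minus_commute)
  hence "(1 + norm x) ^ (2 * DIM('a)) \<le> ((1 + norm (t - x)) * (1 + norm t)) ^ (2 * DIM('a))"
    by (intro power_mono) auto
  thus ?thesis unfolding wt_def power_mult_distrib by (simp add: field_simps add_pos_nonneg)
qed

text \<open>The non-integrable case is included, since the integral is then 0; iterated integrals
  can thus be estimated without checking integrability at each stage.\<close>

lemma norm_integral_le_nn: "ennreal (norm (integral\<^sup>L M f)) \<le> (\<integral>\<^sup>+x. ennreal (norm (f x)) \<partial>M)"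
  by (cases "integrable M f") (auto simp: integral_norm_bound_ennreal not_integrable_integral_eq)

text \<open>Parseval in \<xi> for fixed \<open>x\<close>, followed by integration over
  \<open>x\<close>, gives the orthogonality relation of short-time Fourier transforms: the double
  integral equals \<open>(2 pi)^n\<close> times the squared window norm times the pairing. Hoelder's
  inequality then acts first in \<open>x\<close> and afterwards in \<xi>.\<close>

theorem mod_norm_duality:
  fixes f g \<gamma> :: "real^'n \<Rightarrow> complex"
  assumes f: "schwartz f" and g: "schwartz g" and \<gamma>: "schwartz \<gamma>"
    and p: "1 < p" "1 < p'" "1 / p + 1 / p' = 1" and q: "1 < q" "1 < q'" "1 / q + 1 / q' = 1"
  shows "ennreal (cpi TYPE('n) * (\<integral>x. (norm (\<gamma> x))\<^sup>2 \<partial>lborel) * norm (\<integral>x. f x * cnj (g x) \<partial>lborel))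
    \<le> mod_norm \<gamma> p q f * mod_norm \<gamma> p' q' g"
proof -
  note [measurable] = schwartz_measurable[OF f] schwartz_measurable[OF g] schwartz_measurable[OF \<gamma>]
  let ?V = "\<lambda>x \<xi>. stft \<gamma> f x \<xi>" and ?U = "\<lambda>x \<xi>. stft \<gamma> g x \<xi>"
  define H where "H x t = f t * cnj (g t) * complex_of_real ((norm (\<gamma> (t - x)))\<^sup>2)" for x t
  have par: "(\<integral>\<xi>. ?V x \<xi> * cnj (?U x \<xi>) \<partial>lborel) = complex_of_real (cpi TYPE('n)) * (\<integral>t. H x t \<partial>lborel)" for x
  proof -
    have "(f t * cnj (\<gamma> (t - x))) * cnj (g t * cnj (\<gamma> (t - x))) = H x t" for t
      unfolding H_def complex_norm_square by (simp add: mult_ac)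
    thus ?thesis unfolding stft_fourier
      by (subst schwartz_parseval[OF schwartz_mult_window[OF f \<gamma>] schwartz_mult_window[OF g \<gamma>]]) simp
  qed
  have "(\<integral>x. \<integral>t. H x t \<partial>lborel \<partial>lborel) = (\<integral>t. \<integral>x. H x t \<partial>lborel \<partial>lborel)"
  proof -
    let ?D = "2 * DIM(real^'n)"
    \<comment> \<open>The decay of \<open>f\<close> is doubled: one half pays for turning the
      window's decay in \<open>t - x\<close> into decay in \<open>x\<close>, the other half makes
      the majorant integrable in \<open>t\<close>.\<close>
    obtain C1 where C1: "C1 \<ge> 0" "dbd 0 (\<lambda>x. C1 / (1 + norm x) ^ (?D + ?D)) f" using schwartz_dbd[OF f] by blast
    obtain C2 where C2: "C2 \<ge> 0" "dbd 0 (\<lambda>x. C2) g" using schwartz_bounded[OF g] by blast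
    obtain C3 where C3: "C3 \<ge> 0" "dbd 0 (\<lambda>x. C3 / (1 + norm x) ^ ?D) \<gamma>" using schwartz_dbd[OF \<gamma>] by blast
    have le: "norm (H x t) \<le> (C2 * C3 * C3 * wt x) * (C1 * wt t)" for x t
    proof -
      have c3: "norm (\<gamma> (t - x)) \<le> C3 * wt (t - x)" using dbd_bound[OF C3(2)] by (simp add: wt_def)
      have "(norm (\<gamma> (t - x)))\<^sup>2 \<le> (C3 * wt (t - x)) * (C3 * 1)"
        unfolding power2_eq_square using C3(1) wt_nonneg wt_le_1 by (intro mult_mono order_trans[OF c3] mult_left_mono) auto
      also have "\<dots> \<le> C3 * C3 * ((1 + norm t) ^ ?D * wt x)"
        using mult_left_mono[OF wt_shift[of t x], of "C3 * C3"] C3(1) by (simp add: mult_ac)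
      finally have g3: "(norm (\<gamma> (t - x)))\<^sup>2 \<le> C3 * C3 * ((1 + norm t) ^ ?D * wt x)" .
      have "norm (H x t) = norm (f t) * norm (g t) * (norm (\<gamma> (t - x)))\<^sup>2" by (simp add: H_def norm_mult norm_power)
      also have "\<dots> \<le> (C1 / (1 + norm t) ^ (?D + ?D)) * C2 * (C3 * C3 * ((1 + norm t) ^ ?D * wt x))"
        using dbd_bound[OF C1(2)] dbd_bound[OF C2(2)] C1(1) C2(1) by (intro mult_mono g3) auto
      also have "\<dots> = (C2 * C3 * C3 * wt x) * (C1 * ((1 + norm t) ^ ?D / (1 + norm t) ^ (?D + ?D)))"
        by simp
      also have "(1 + norm t) ^ ?D / (1 + norm t) ^ (?D + ?D) = wt t"
      proof -
        have "1 + norm t \<noteq> 0" using norm_ge_zero[of t] by linarith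
        thus ?thesis unfolding wt_def power_add by simp
      qed
      finally show ?thesis .
    qed
    show ?thesis
      by (rule Fubini_bound[OF _ integrable_mult_right[OF integrable_wt] integrable_mult_right[OF integrable_wt] le]) (unfold H_def, measurable)
  qed
  also have "\<dots> = (\<integral>t. f t * cnj (g t) * complex_of_real (\<integral>x. (norm (\<gamma> x))\<^sup>2 \<partial>lborel) \<partial>lborel)"
  proof (intro Bochner_Integration.integral_cong refl)
    fix t
    have "(\<integral>x. (norm (\<gamma> (t - x)))\<^sup>2 \<partial>lborel) = (\<integral>x. (norm (\<gamma> x))\<^sup>2 \<partial>lborel)"
      using integral_affine[of "-1" "\<lambda>x. (norm (\<gamma> x))\<^sup>2" t] by simp
    thus "(\<integral>x. H x t \<partial>lborel) = f t * cnj (g t) * complex_of_real (\<integral>x. (norm (\<gamma> x))\<^sup>2 \<partial>lborel)"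
      unfolding H_def integral_mult_right_zero integral_complex_of_real by simp
  qed
  finally have tot: "(\<integral>x. \<integral>\<xi>. ?V x \<xi> * cnj (?U x \<xi>) \<partial>lborel \<partial>lborel)
      = complex_of_real (cpi TYPE('n)) * ((\<integral>t. f t * cnj (g t) \<partial>lborel) * complex_of_real (\<integral>x. (norm (\<gamma> x))\<^sup>2 \<partial>lborel))"
    unfolding par by simp
  have nn: "0 \<le> (\<integral>x. (norm (\<gamma> x))\<^sup>2 \<partial>lborel)" by simp
  have "ennreal (cpi TYPE('n) * (\<integral>x. (norm (\<gamma> x))\<^sup>2 \<partial>lborel) * norm (\<integral>x. f x * cnj (g x) \<partial>lborel))
     = ennreal (norm (\<integral>x. \<integral>\<xi>. ?V x \<xi> * cnj (?U x \<xi>) \<partial>lborel \<partial>lborel))"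
    unfolding tot using cpi_pos[of "TYPE('n)"] nn by (simp add: norm_mult mult_ac)
  also have "\<dots> \<le> (\<integral>\<^sup>+x. ennreal (norm (\<integral>\<xi>. ?V x \<xi> * cnj (?U x \<xi>) \<partial>lborel)) \<partial>lborel)"
    by (rule norm_integral_le_nn)
  also have "\<dots> \<le> (\<integral>\<^sup>+x. \<integral>\<^sup>+\<xi>. ennreal (norm (?V x \<xi> * cnj (?U x \<xi>))) \<partial>lborel \<partial>lborel)"
    by (intro nn_integral_mono norm_integral_le_nn)
  also have "\<dots> = (\<integral>\<^sup>+x. \<integral>\<^sup>+\<xi>. ennreal (norm (?V x \<xi>)) * ennreal (norm (?U x \<xi>)) \<partial>lborel \<partial>lborel)"
    by (simp add: norm_mult ennreal_mult)
  \<comment> \<open>Parseval needed \<xi> as the inner variable, whereas \<open>mod_norm\<close>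
    integrates over \<open>x\<close> first; the absolute values allow the exchange by
    Tonelli.\<close>
  also have "\<dots> = (\<integral>\<^sup>+\<xi>. \<integral>\<^sup>+x. ennreal (norm (?V x \<xi>)) * ennreal (norm (?U x \<xi>)) \<partial>lborel \<partial>lborel)"
  proof (rule lborel_pair.Fubini')
    note [measurable] = measurable_stft_swap[OF schwartz_measurable[OF \<gamma>] schwartz_measurable[OF f]]
      measurable_stft_swap[OF schwartz_measurable[OF \<gamma>] schwartz_measurable[OF g]]
    have "(\<lambda>z. ennreal (norm (?V (snd z) (fst z))) * ennreal (norm (?U (snd z) (fst z)))) \<in> borel_measurable (borel \<Otimes>\<^sub>M borel)"
      by measurable
    thus "(\<lambda>(\<xi>, x). ennreal (norm (?V x \<xi>)) * ennreal (norm (?U x \<xi>))) \<in> borel_measurable (lborel \<Otimes>\<^sub>M lborel)"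
      by (simp add: case_prod_beta' cong: measurable_cong_sets sets_pair_measure_cong)
  qed
  also have "\<dots> \<le> (\<integral>\<^sup>+\<xi>. ennpow (\<integral>\<^sup>+x. ennreal (norm (?V x \<xi>) powr p) \<partial>lborel) (1 / p)
       * ennpow (\<integral>\<^sup>+x. ennreal (norm (?U x \<xi>) powr p') \<partial>lborel) (1 / p') \<partial>lborel)"
  proof (rule nn_integral_mono)
    fix \<xi> :: "real^'n"
    have "(\<lambda>x. stft \<gamma> h x \<xi>) \<in> borel_measurable borel" if [measurable]: "h \<in> borel_measurable borel" for h
      using measurable_compose[OF measurable_Pair[OF measurable_ident_sets[OF refl] measurable_const] measurable_stft[OF schwartz_measurable[OF \<gamma>] that], of \<xi>]
      by simp
    hence [measurable]: "(\<lambda>x. stft \<gamma> f x \<xi>) \<in> borel_measurable borel" "(\<lambda>x. stft \<gamma> g x \<xi>) \<in> borel_measurable borel" by simp_all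
    from ennreal_Holder[OF p, of "\<lambda>x. ennreal (norm (?V x \<xi>))" lborel "\<lambda>x. ennreal (norm (?U x \<xi>))"]
    show "(\<integral>\<^sup>+x. ennreal (norm (?V x \<xi>)) * ennreal (norm (?U x \<xi>)) \<partial>lborel)
      \<le> ennpow (\<integral>\<^sup>+x. ennreal (norm (?V x \<xi>) powr p) \<partial>lborel) (1 / p) * ennpow (\<integral>\<^sup>+x. ennreal (norm (?U x \<xi>) powr p') \<partial>lborel) (1 / p')"
      by (simp add: ennpow_ennreal)
  qed
  also have "\<dots> \<le> ennpow (\<integral>\<^sup>+\<xi>. ennpow (ennpow (\<integral>\<^sup>+x. ennreal (norm (?V x \<xi>) powr p) \<partial>lborel) (1 / p)) q \<partial>lborel) (1 / q)
     * ennpow (\<integral>\<^sup>+\<xi>. ennpow (ennpow (\<integral>\<^sup>+x. ennreal (norm (?U x \<xi>) powr p') \<partial>lborel) (1 / p')) q' \<partial>lborel) (1 / q')"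
  proof (rule ennreal_Holder[OF q])
    have "(\<lambda>\<xi>. ennpow (\<integral>\<^sup>+x. ennreal (norm (stft \<gamma> h x \<xi>) powr r) \<partial>lborel) s) \<in> borel_measurable lborel"
      if [measurable]: "h \<in> borel_measurable borel" for h r s
    proof -
      note [measurable] = measurable_stft_swap[OF schwartz_measurable[OF \<gamma>] that]
      have "(\<lambda>\<xi>. \<integral>\<^sup>+x. ennreal (norm (stft \<gamma> h x \<xi>) powr r) \<partial>lborel) \<in> borel_measurable borel"
      proof (rule lborel.borel_measurable_nn_integral)
        have "(\<lambda>z. ennreal (norm (stft \<gamma> h (snd z) (fst z)) powr r)) \<in> borel_measurable (borel \<Otimes>\<^sub>M borel)" by measurable
        thus "(\<lambda>(\<xi>, x). ennreal (norm (stft \<gamma> h x \<xi>) powr r)) \<in> borel_measurable (borel \<Otimes>\<^sub>M lborel)"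
          by (simp add: case_prod_beta' cong: measurable_cong_sets sets_pair_measure_cong)
      qed
      thus ?thesis by simp
    qed
    thus "(\<lambda>\<xi>. ennpow (\<integral>\<^sup>+x. ennreal (norm (?V x \<xi>) powr p) \<partial>lborel) (1 / p)) \<in> borel_measurable lborel"
      "(\<lambda>\<xi>. ennpow (\<integral>\<^sup>+x. ennreal (norm (?U x \<xi>) powr p') \<partial>lborel) (1 / p')) \<in> borel_measurable lborel" by simp_all
  qed
  also have "\<dots> = mod_norm \<gamma> p q f * mod_norm \<gamma> p' q' g"
    unfolding mod_norm_def ennpow_ennpow by simp
  finally show ?thesis .
qed

section \<open>Upper bounds for modulation norms\<close>

lemma mod_norm_le:
  assumes le: "\<And>x \<xi>. norm (stft \<gamma> f x \<xi>) \<le> A * W x * S \<xi>"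
    and nn: "0 \<le> A" "\<And>x. 0 \<le> W x" "\<And>x. 0 \<le> S x" "0 \<le> w" "0 \<le> s" and pq: "0 < p" "0 < q"
    and [measurable]: "W \<in> borel_measurable borel" "S \<in> borel_measurable borel"
    and w: "(\<integral>\<^sup>+x. ennreal (W x powr p) \<partial>lborel) \<le> ennreal w" and s: "(\<integral>\<^sup>+x. ennreal (S x powr q) \<partial>lborel) \<le> ennreal s"
  shows "mod_norm \<gamma> p q f \<le> ennreal (A * w powr (1 / p) * s powr (1 / q))"
proof -
  have "mod_norm \<gamma> p q f \<le> ennpow (\<integral>\<^sup>+ \<xi>. ennreal (A powr q * w powr (q / p)) * ennreal (S \<xi> powr q) \<partial>lborel) (1 / q)"
    unfolding mod_norm_def
  proof (intro ennpow_mono nn_integral_mono)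
    fix \<xi>
    have "(\<integral>\<^sup>+ x. ennreal (norm (stft \<gamma> f x \<xi>) powr p) \<partial>lborel) \<le> (\<integral>\<^sup>+ x. ennreal ((A * S \<xi>) powr p) * ennreal (W x powr p) \<partial>lborel)"
    proof (intro nn_integral_mono)
      fix x
      have "norm (stft \<gamma> f x \<xi>) powr p \<le> ((A * S \<xi>) * W x) powr p"
        using le[of x \<xi>] pq nn by (intro powr_mono2) (auto simp: mult_ac)
      also have "\<dots> = (A * S \<xi>) powr p * W x powr p" using nn by (simp add: powr_mult)
      finally show "ennreal (norm (stft \<gamma> f x \<xi>) powr p) \<le> ennreal ((A * S \<xi>) powr p) * ennreal (W x powr p)"
        by (simp add: ennreal_leI flip: ennreal_mult)
    qed
    also have "\<dots> = ennreal ((A * S \<xi>) powr p) * (\<integral>\<^sup>+ x. ennreal (W x powr p) \<partial>lborel)" by (simp add: nn_integral_cmult)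
    also have "\<dots> \<le> ennreal ((A * S \<xi>) powr p * w)" using w nn by (simp add: ennreal_mult mult_left_mono)
    finally have "ennpow (\<integral>\<^sup>+ x. ennreal (norm (stft \<gamma> f x \<xi>) powr p) \<partial>lborel) (q / p) \<le> ennpow (ennreal ((A * S \<xi>) powr p * w)) (q / p)"
      using pq by (intro ennpow_mono) auto
    also have "\<dots> = ennreal (A powr q * w powr (q / p)) * ennreal (S \<xi> powr q)"
      using nn pq by (simp add: ennpow_ennreal powr_mult powr_powr mult_ac flip: ennreal_mult)
    finally show "ennpow (\<integral>\<^sup>+ x. ennreal (norm (stft \<gamma> f x \<xi>) powr p) \<partial>lborel) (q / p) \<le> ennreal (A powr q * w powr (q / p)) * ennreal (S \<xi> powr q)" .
  qed (use pq in auto)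
  also have "(\<integral>\<^sup>+ \<xi>. ennreal (A powr q * w powr (q / p)) * ennreal (S \<xi> powr q) \<partial>lborel) = ennreal (A powr q * w powr (q / p)) * (\<integral>\<^sup>+ \<xi>. ennreal (S \<xi> powr q) \<partial>lborel)"
    by (simp add: nn_integral_cmult)
  also have "ennpow \<dots> (1 / q) \<le> ennpow (ennreal (A powr q * w powr (q / p)) * ennreal s) (1 / q)"
    using pq s by (intro ennpow_mono mult_left_mono) auto
  also have "\<dots> = ennreal (A * w powr (1 / p) * s powr (1 / q))"
    using nn pq by (simp add: ennpow_ennreal powr_mult powr_powr flip: ennreal_mult)
  finally show ?thesis .
qed

text \<open>The substitution \<open>s = L t - k\<close> gives the Jacobian \<open>L powr -n\<close>
  and an oscillatory integral of frequency \<open>k - \<xi> / L\<close>. The window becomes a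
  function of \<open>(s + k) / L - x\<close>: the dilation is a contraction because
  \<open>L \<ge> 1\<close>, and \<open>k / L\<close> stays in the unit ball, so its decay is
  \<open>wt x\<close> uniformly in \<open>k\<close>.\<close>

lemma norm_wave_packet_stft_le:
  fixes \<Phi> \<gamma> :: "real^'n \<Rightarrow> complex"
  assumes \<Phi>: "schwartz \<Phi>" and \<gamma>: "schwartz \<gamma>"
  obtains C where "C \<ge> 0" "\<And>L k x \<xi>. L \<ge> 1 \<Longrightarrow> norm k \<le> L \<Longrightarrow>
    norm (stft \<gamma> (\<lambda>t. wave k (L *\<^sub>R t - k) * \<Phi> (L *\<^sub>R t - k)) x \<xi>) \<le> C * (1 / L) ^ CARD('n) * wt x * wt ((1 / L) *\<^sub>R \<xi> - k)"
proof -
  let ?D = "2 * DIM(real^'n)"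
  \<comment> \<open>Half of this decay pays for replacing the window's argument by \<open>x\<close>,
    the other half leaves the integrable weight \<open>wt s\<close>.\<close>
  obtain C1 where C1: "C1 \<ge> 0" "dbd ?D (\<lambda>x. C1 / (1 + norm x) ^ (?D + ?D)) \<Phi>" using schwartz_dbd[OF \<Phi>] by blast
  obtain C2 where C2: "C2 \<ge> 0" "dbd ?D (\<lambda>x. C2 / (1 + norm x) ^ ?D) (\<lambda>t. cnj (\<gamma> t))" using schwartz_dbd[OF schwartz_cnj[OF \<gamma>]] by blast
  define I where "I = (\<integral>x. wt (x::real^'n) \<partial>lborel)"
  have I: "I \<ge> 0" unfolding I_def by (intro Bochner_Integration.integral_nonneg wt_nonneg)
  define C where "C = (1 + real DIM(real^'n)) ^ ?D * (2 ^ ?D * (C1 * (C2 * 2 ^ ?D)) * I)"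
  show ?thesis
  proof (rule that[of C])
    show "C \<ge> 0" unfolding C_def using C1(1) C2(1) I by (intro mult_nonneg_nonneg) auto
    fix L :: real and k x \<xi> :: "real^'n" assume L: "L \<ge> 1" and k: "norm k \<le> L"
    define h where "h s = \<Phi> s * cnj (\<gamma> ((1 / L) *\<^sub>R s + ((1 / L) *\<^sub>R k - x)))" for s
    have hs: "schwartz h" unfolding h_def
    proof (rule schwartz_mult_dbd[OF \<Phi>])
      fix N
      obtain C where "dbd N (\<lambda>x. C) (\<lambda>t. cnj (\<gamma> t))" using schwartz_bounded[OF schwartz_cnj[OF \<gamma>]] by blast
      from dbd_affine[OF this, of "1 / L"] show "\<exists>C. dbd N (\<lambda>x. C) (\<lambda>s. cnj (\<gamma> ((1 / L) *\<^sub>R s + ((1 / L) *\<^sub>R k - x))))"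
        using L by auto
    qed
    have "dbd ?D (\<lambda>s. 2 ^ ?D * (C1 / (1 + norm s) ^ (?D + ?D) * (C2 / (1 + norm ((1 / L) *\<^sub>R s + ((1 / L) *\<^sub>R k - x))) ^ ?D))) h"
      unfolding h_def using L by (intro dbd_mult[OF C1(2)] dbd_affine[OF C2(2)]) auto
    hence hb: "dbd ?D (\<lambda>s. 2 ^ ?D * (C1 * (C2 * 2 ^ ?D)) * wt x * wt s) h"
    proof (rule dbd_mono)
      fix s
      let ?u = "(1 / L) *\<^sub>R s + ((1 / L) *\<^sub>R k - x)" and ?v = "(1 / L) *\<^sub>R s + (1 / L) *\<^sub>R k"
      have "norm ?v \<le> norm s / L + norm k / L"
        using norm_triangle_ineq[of "(1 / L) *\<^sub>R s" "(1 / L) *\<^sub>R k"] L by simp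
      also have "\<dots> \<le> norm s + 1"
        using L k by (intro add_mono) (auto simp: divide_le_eq mult_left_mono intro: mult_le_cancel_left1[THEN iffD2])
      finally have v0: "norm ?v \<le> norm s + 1" .
      \<comment> \<open>The position \<open>(s + k) / L\<close> exceeds \<open>norm s\<close> by at
        most 1; this is the source of the factor \<open>2 ^ ?D\<close>.\<close>
      have "1 + c \<le> 2 * (1 + d)" if "c \<le> d + 1" "0 \<le> d" for c d :: real using that by (simp add: distrib_left)
      from this[OF v0 norm_ge_zero] have v: "1 + norm ?v \<le> 2 * (1 + norm s)" .
      have "wt ?u \<le> (1 + norm ?v) ^ ?D * wt x" using wt_shift[of ?v x] by (simp add: algebra_simps)
      also have "\<dots> \<le> (2 * (1 + norm s)) ^ ?D * wt x" by (intro mult_right_mono power_mono v wt_nonneg) auto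
      finally have u: "wt ?u \<le> 2 ^ ?D * (1 + norm s) ^ ?D * wt x" by (simp only: power_mult_distrib)
      have n0: "1 + norm s \<noteq> 0" using norm_ge_zero[of s] by linarith
      have "C1 / (1 + norm s) ^ (?D + ?D) * (C2 / (1 + norm ?u) ^ ?D) = C1 / (1 + norm s) ^ (?D + ?D) * (C2 * wt ?u)"
        by (simp add: wt_def)
      also have "\<dots> \<le> C1 / (1 + norm s) ^ (?D + ?D) * (C2 * (2 ^ ?D * (1 + norm s) ^ ?D * wt x))"
        using C1(1) C2(1) u by (intro mult_left_mono) auto
      also have "\<dots> = C1 * (C2 * 2 ^ ?D) * wt x * ((1 + norm s) ^ ?D / (1 + norm s) ^ (?D + ?D))" by simp
      also have "(1 + norm s) ^ ?D / (1 + norm s) ^ (?D + ?D) = wt s" using n0 unfolding wt_def power_add by simp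
      finally have "C1 / (1 + norm s) ^ (?D + ?D) * (C2 / (1 + norm ?u) ^ ?D) \<le> C1 * (C2 * 2 ^ ?D) * wt x * wt s" .
      from mult_left_mono[OF this, of "2 ^ ?D"]
      show "2 ^ ?D * (C1 / (1 + norm s) ^ (?D + ?D) * (C2 / (1 + norm ?u) ^ ?D)) \<le> 2 ^ ?D * (C1 * (C2 * 2 ^ ?D)) * wt x * wt s"
        by (simp only: mult.assoc zero_le_power zero_le_numeral)
    qed
    have "stft \<gamma> (\<lambda>t. wave k (L *\<^sub>R t - k) * \<Phi> (L *\<^sub>R t - k)) x \<xi>
       = \<bar>1 / L\<bar> ^ DIM(real^'n) *\<^sub>R (\<integral>s. wave (- \<xi>) ((1 / L) *\<^sub>R s + (1 / L) *\<^sub>R k) * ((wave k (L *\<^sub>R ((1 / L) *\<^sub>R s + (1 / L) *\<^sub>R k) - k)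
           * \<Phi> (L *\<^sub>R ((1 / L) *\<^sub>R s + (1 / L) *\<^sub>R k) - k)) * cnj (\<gamma> ((1 / L) *\<^sub>R s + (1 / L) *\<^sub>R k - x))) \<partial>lborel)"
      unfolding stft_fourier fourier_wave using L by (intro integral_affine) auto
    also have "(\<lambda>s. wave (- \<xi>) ((1 / L) *\<^sub>R s + (1 / L) *\<^sub>R k) * ((wave k (L *\<^sub>R ((1 / L) *\<^sub>R s + (1 / L) *\<^sub>R k) - k)
           * \<Phi> (L *\<^sub>R ((1 / L) *\<^sub>R s + (1 / L) *\<^sub>R k) - k)) * cnj (\<gamma> ((1 / L) *\<^sub>R s + (1 / L) *\<^sub>R k - x))))
      = (\<lambda>s. wave (- \<xi>) ((1 / L) *\<^sub>R k) * (wave (k - (1 / L) *\<^sub>R \<xi>) s * h s))"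
    proof
      fix s
      have 1: "L *\<^sub>R ((1 / L) *\<^sub>R s + (1 / L) *\<^sub>R k) - k = s" using L by (simp add: algebra_simps)
      have 2: "wave (- \<xi>) ((1 / L) *\<^sub>R s + (1 / L) *\<^sub>R k) * wave k s = wave (- \<xi>) ((1 / L) *\<^sub>R k) * wave (k - (1 / L) *\<^sub>R \<xi>) s"
        by (simp add: inner_add_right inner_diff_left exp_add[symmetric] algebra_simps)
      show "wave (- \<xi>) ((1 / L) *\<^sub>R s + (1 / L) *\<^sub>R k) * ((wave k (L *\<^sub>R ((1 / L) *\<^sub>R s + (1 / L) *\<^sub>R k) - k)
           * \<Phi> (L *\<^sub>R ((1 / L) *\<^sub>R s + (1 / L) *\<^sub>R k) - k)) * cnj (\<gamma> ((1 / L) *\<^sub>R s + (1 / L) *\<^sub>R k - x)))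
         = wave (- \<xi>) ((1 / L) *\<^sub>R k) * (wave (k - (1 / L) *\<^sub>R \<xi>) s * h s)"
        unfolding 1 mult.assoc[symmetric] 2 h_def by (simp only: mult.assoc add_diff_eq)
    qed
    finally have "norm (stft \<gamma> (\<lambda>t. wave k (L *\<^sub>R t - k) * \<Phi> (L *\<^sub>R t - k)) x \<xi>)
       = (1 / L) ^ CARD('n) * norm (\<integral>s. wave (k - (1 / L) *\<^sub>R \<xi>) s * h s \<partial>lborel)"
      using L by (simp only: norm_scaleR integral_mult_right_zero norm_mult norm_exp_i_times mult_1_left) (simp add: power_abs)
    also have "\<dots> \<le> (1 / L) ^ CARD('n) * ((1 + real DIM(real^'n)) ^ ?D * (\<integral>s. 2 ^ ?D * (C1 * (C2 * 2 ^ ?D)) * wt x * wt (s::real^'n) \<partial>lborel) / (1 + norm (k - (1 / L) *\<^sub>R \<xi>)) ^ ?D)"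
      using L by (intro mult_left_mono osc_decay[OF hs hb] integrable_mult_right integrable_wt) auto
    also have "\<dots> = C * (1 / L) ^ CARD('n) * wt x * wt ((1 / L) *\<^sub>R \<xi> - k)"
      unfolding C_def I_def wt_def[of "(1 / L) *\<^sub>R \<xi> - k"] norm_minus_commute[of k] integral_mult_right_zero by simp
    finally show "norm (stft \<gamma> (\<lambda>t. wave k (L *\<^sub>R t - k) * \<Phi> (L *\<^sub>R t - k)) x \<xi>) \<le> C * (1 / L) ^ CARD('n) * wt x * wt ((1 / L) *\<^sub>R \<xi> - k)" .
  qed
qed

lemma stft_wave_mult: "stft \<gamma> (\<lambda>t. wave a t * f t) x \<xi> = stft \<gamma> f x (\<xi> - a)"
proof -
  have "wave (- \<xi>) t * (wave a t * f t * cnj (\<gamma> (t - x))) = wave (- (\<xi> - a)) t * (f t * cnj (\<gamma> (t - x)))" for t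
  proof -
    have "wave (- (\<xi> - a)) t = wave (- \<xi>) t * wave a t" unfolding wave_add_left[symmetric] by simp
    thus ?thesis by (simp only: mult.assoc)
  qed
  thus ?thesis unfolding stft_fourier fourier_wave by (simp only:)
qed

section \<open>Counting and summation over integer lattice points\<close>

definition lat :: "real \<Rightarrow> (real^'n) set" where "lat L = {k. (\<forall>i. k $ i \<in> \<int>) \<and> norm k \<le> L}"

lemma lat_subset: "lat L \<subseteq> (\<lambda>f. \<chi> i. real_of_int (f i)) ` (UNIV \<rightarrow>\<^sub>E {- \<lfloor>L\<rfloor>..\<lfloor>L\<rfloor>})"
proof
  fix k :: "real^'n" assume k: "k \<in> lat L"
  define f where "f i = \<lfloor>k $ i\<rfloor>" for i
  have f: "k $ i = real_of_int (f i)" for i using k unfolding lat_def f_def by (auto simp: of_int_floor)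
  have "f i \<in> {- \<lfloor>L\<rfloor>..\<lfloor>L\<rfloor>}" for i
  proof -
    have "\<bar>real_of_int (f i)\<bar> \<le> L" using component_le_norm_cart[of k i] k unfolding f[symmetric] lat_def by simp
    hence "\<bar>f i\<bar> \<le> \<lfloor>L\<rfloor>" by (simp add: le_floor_iff)
    thus ?thesis by auto
  qed
  thus "k \<in> (\<lambda>f. \<chi> i. real_of_int (f i)) ` (UNIV \<rightarrow>\<^sub>E {- \<lfloor>L\<rfloor>..\<lfloor>L\<rfloor>})"
    by (intro image_eqI[of _ _ f]) (auto simp: f vec_eq_iff)
qed

lemma finite_lat: "finite (lat L :: (real^'n) set)"
  by (rule finite_subset[OF lat_subset]) (intro finite_imageI finite_PiE; simp)

lemma card_lat:
  assumes "1 \<le> L" shows "real (card (lat L :: (real^'n) set)) \<le> (3 * L) ^ CARD('n)"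
proof -
  have "card (lat L :: (real^'n) set) \<le> card ((\<lambda>f. \<chi> i. real_of_int (f i) :: real^'n) ` (UNIV \<rightarrow>\<^sub>E {- \<lfloor>L\<rfloor>..\<lfloor>L\<rfloor>}))"
    by (intro card_mono lat_subset finite_imageI finite_PiE) auto
  also have "\<dots> \<le> card ((UNIV::'n set) \<rightarrow>\<^sub>E {- \<lfloor>L\<rfloor>..\<lfloor>L\<rfloor>})" by (intro card_image_le finite_PiE) auto
  also have "\<dots> = nat (2 * \<lfloor>L\<rfloor> + 1) ^ CARD('n)" by (simp add: card_PiE)
  finally have "real (card (lat L :: (real^'n) set)) \<le> real (nat (2 * \<lfloor>L\<rfloor> + 1)) ^ CARD('n)"
    by (metis of_nat_le_iff of_nat_power)
  also have "\<dots> \<le> (3 * L) ^ CARD('n)"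
  proof (rule power_mono)
    have "real (nat (2 * \<lfloor>L\<rfloor> + 1)) = 2 * real_of_int \<lfloor>L\<rfloor> + 1" using assms by simp
    also have "\<dots> \<le> 3 * L" using assms of_int_floor_le[of L] by linarith
    finally show "real (nat (2 * \<lfloor>L\<rfloor> + 1)) \<le> 3 * L" .
  qed auto
  finally show ?thesis .
qed

text \<open>Shifting the summation index by the floor of \<open>y\<close> makes the bound uniform in
  \<open>y\<close>. The factor 6 is 2 for the two half-lines of integers times 3 for the rounding
  error.\<close>

lemma sum_int_inverse_sq_bounded:
  obtains C where "C > 0" "\<And>y F. finite F \<Longrightarrow> (\<Sum>m\<in>F. inverse (1 + (y - real_of_int m)\<^sup>2)) \<le> C"
proof -
  let ?a = "\<lambda>n::nat. inverse (1 + (real n)\<^sup>2)"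
  have sm: "summable ?a"
  proof (rule summable_comparison_test')
    show "summable (\<lambda>n. inverse (real n ^ 2))" by (rule inverse_power_summable) simp
    show "norm (?a n) \<le> inverse (real n ^ 2)" if "n \<ge> 1" for n
      using that by (simp add: le_imp_inverse_le)
  qed
  define S where "S = suminf ?a"
  have le: "(\<Sum>n\<in>A. ?a n) \<le> S" if "finite A" for A unfolding S_def by (rule sum_le_suminf[OF sm that]) auto
  have S: "S > 0" using le[of "{0}"] by simp
  have 1: "(\<Sum>m\<in>F. inverse (1 + (real_of_int m)\<^sup>2)) \<le> 2 * S" if F: "finite F" for F
  proof -
    have "(\<Sum>m\<in>F. inverse (1 + (real_of_int m)\<^sup>2)) = (\<Sum>m\<in>{m\<in>F. 0 \<le> m}. inverse (1 + (real_of_int m)\<^sup>2)) + (\<Sum>m\<in>{m\<in>F. m < 0}. inverse (1 + (real_of_int m)\<^sup>2))"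
      using F by (subst sum.union_disjoint[symmetric]) (auto intro: sum.cong)
    also have "(\<Sum>m\<in>{m\<in>F. 0 \<le> m}. inverse (1 + (real_of_int m)\<^sup>2)) = (\<Sum>n\<in>nat ` {m\<in>F. 0 \<le> m}. ?a n)"
      by (subst sum.reindex) (auto simp: inj_on_def intro!: sum.cong)
    also have "\<dots> \<le> S" using F by (intro le) auto
    also have "(\<Sum>m\<in>{m\<in>F. m < 0}. inverse (1 + (real_of_int m)\<^sup>2)) = (\<Sum>n\<in>(\<lambda>m. nat (- m)) ` {m\<in>F. m < 0}. ?a n)"
      by (subst sum.reindex) (auto simp: inj_on_def intro!: sum.cong)
    also have "\<dots> \<le> S" using F by (intro le) auto
    finally show ?thesis by simp
  qed
  show ?thesis
  proof (rule that[of "6 * S"])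
    fix y :: real and F :: "int set" assume F: "finite F"
    have "(\<Sum>m\<in>F. inverse (1 + (y - real_of_int m)\<^sup>2)) \<le> (\<Sum>m\<in>F. 3 * inverse (1 + (real_of_int (m - \<lfloor>y\<rfloor>))\<^sup>2))"
    proof (rule sum_mono)
      fix m
      let ?r = "\<bar>y - real_of_int m\<bar>" and ?n = "\<bar>real_of_int (m - \<lfloor>y\<rfloor>)\<bar>"
      \<comment> \<open>Rounding \<open>y\<close> moves the distance by at most 1, and
        \<open>(r + 1)^2 \<le> 2 * r^2 + 2\<close> then compares the two weights with the factor
        3.\<close>
      have "?n \<le> ?r + 1" by linarith
      hence "?n\<^sup>2 \<le> (?r + 1)\<^sup>2" by (intro power_mono) auto
      also have "\<dots> \<le> 2 * ?r\<^sup>2 + 2" using zero_le_power2[of "?r - 1"] by (simp add: power2_eq_square algebra_simps)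
      finally have "?n\<^sup>2 \<le> 2 * ?r\<^sup>2 + 2" .
      hence "1 + ?n\<^sup>2 \<le> 3 * (1 + ?r\<^sup>2)" using zero_le_power2[of ?r] unfolding distrib_left by linarith
      thus "inverse (1 + (y - real_of_int m)\<^sup>2) \<le> 3 * inverse (1 + (real_of_int (m - \<lfloor>y\<rfloor>))\<^sup>2)"
        unfolding power2_abs by (simp add: field_simps add_pos_nonneg)
    qed
    also have "\<dots> = 3 * (\<Sum>m\<in>(\<lambda>m. m - \<lfloor>y\<rfloor>) ` F. inverse (1 + (real_of_int m)\<^sup>2))"
      by (subst sum.reindex) (auto simp: inj_on_def sum_distrib_left)
    also have "\<dots> \<le> 3 * (2 * S)" using F by (intro mult_left_mono 1) auto
    finally show "(\<Sum>m\<in>F. inverse (1 + (y - real_of_int m)\<^sup>2)) \<le> 6 * S" by simp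
  qed (use S in simp)
qed

lemma wt_le_prod_cart: "wt (x::real^'n) \<le> (\<Prod>i\<in>UNIV. inverse (1 + (x $ i)\<^sup>2))"
proof -
  have B: "(Basis :: (real^'n) set) = (\<lambda>i. axis i 1) ` UNIV" by (auto simp: Basis_vec_def)
  have "(\<Prod>b\<in>Basis. inverse (1 + (x \<bullet> b)\<^sup>2)) = (\<Prod>i\<in>UNIV. inverse (1 + (x $ i)\<^sup>2))"
    unfolding B by (subst prod.reindex) (auto simp: inj_on_def axis_eq_axis inner_axis)
  thus ?thesis using wt_le_prod[of x] by simp
qed

text \<open>Enlarging the ball to a cube lets the sum of the product weight factor into
  one-dimensional sums, each bounded uniformly in the centre and in the length of the
  interval.\<close>

lemma sum_lat_wt_bounded:
  obtains C where "C > 0" "\<And>L (y::real^'n) K. K \<subseteq> lat L \<Longrightarrow> (\<Sum>k\<in>K. wt (y - k)) \<le> C"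
proof -
  obtain c where c: "c > 0" "\<And>y F. finite F \<Longrightarrow> (\<Sum>m\<in>F. inverse (1 + (y - real_of_int m)\<^sup>2)) \<le> c"
    using sum_int_inverse_sq_bounded by blast
  show ?thesis
  proof (rule that[of "c ^ CARD('n)"])
    fix L and y :: "real^'n" and K :: "(real^'n) set" assume K: "K \<subseteq> lat L"
    let ?P = "(UNIV::'n set) \<rightarrow>\<^sub>E {- \<lfloor>L\<rfloor>..\<lfloor>L\<rfloor>}" and ?e = "\<lambda>f. (\<chi> i. real_of_int (f i)) :: real^'n"
    have inj: "inj_on ?e ?P" by (auto simp: inj_on_def vec_eq_iff fun_eq_iff)
    have "(\<Sum>k\<in>K. wt (y - k)) \<le> (\<Sum>k\<in>?e ` ?P. wt (y - k))"
      using K lat_subset[of L] by (intro sum_mono2 finite_imageI finite_PiE) (auto simp: wt_nonneg)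
    also have "\<dots> = (\<Sum>f\<in>?P. wt (y - ?e f))" by (subst sum.reindex[OF inj]) simp
    also have "\<dots> \<le> (\<Sum>f\<in>?P. \<Prod>i\<in>UNIV. inverse (1 + (y $ i - real_of_int (f i))\<^sup>2))"
    proof (rule sum_mono)
      show "wt (y - ?e f) \<le> (\<Prod>i\<in>UNIV. inverse (1 + (y $ i - real_of_int (f i))\<^sup>2))" for f
        using wt_le_prod_cart[of "y - ?e f"] by simp
    qed
    also have "\<dots> = (\<Prod>i\<in>UNIV. \<Sum>m\<in>{- \<lfloor>L\<rfloor>..\<lfloor>L\<rfloor>}. inverse (1 + (y $ i - real_of_int m)\<^sup>2))"
      by (subst prod_sum_PiE) auto
    also have "\<dots> \<le> (\<Prod>i\<in>(UNIV::'n set). c)" by (intro prod_mono conjI sum_nonneg c(2)) auto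
    finally show "(\<Sum>k\<in>K. wt (y - k)) \<le> c ^ CARD('n)" by simp
  qed (use c in simp)
qed

lemma integrable_stft_integrand:
  fixes f \<gamma> :: "real^'n \<Rightarrow> complex"
  assumes f: "integrable lborel f" and \<gamma>: "schwartz \<gamma>"
  shows "integrable lborel (\<lambda>t. wave (- \<xi>) t * (f t * cnj (\<gamma> (t - x))))"
proof -
  note [measurable] = schwartz_measurable[OF \<gamma>] borel_measurable_integrable[OF f]
  obtain C where C: "dbd 0 (\<lambda>x. C) \<gamma>" "C \<ge> 0" using schwartz_bounded[OF \<gamma>] by blast
  have "integrable lborel (\<lambda>t. f t * cnj (\<gamma> (t - x)))"
    by (rule Bochner_Integration.integrable_bound[OF integrable_mult_right[OF integrable_norm[OF f], of C]])
       (use mult_left_mono[OF dbd_bound[OF C(1)] norm_ge_zero] C(2) in \<open>auto simp: norm_mult mult.commute\<close>)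
  thus ?thesis by (rule integrable_wave)
qed

text \<open>The frequency profile \<open>S\<close> is bounded by the lattice sum, and its integral
  is at most \<open>(3 L)^n * L^n\<close> times a constant: the number of packets times the volume
  scale of one. The q-norm interpolates between these two facts, and with the prefactor
  \<open>(1 / L)^n\<close> the exponent becomes \<open>2n/q - n\<close>.\<close>

theorem mod_norm_wave_packets_le:
  fixes \<Phi> \<gamma> :: "real^'n \<Rightarrow> complex"
  assumes \<Phi>: "schwartz \<Phi>" and \<gamma>: "schwartz \<gamma>" and p: "1 \<le> p" and q: "1 \<le> q"
  obtains C where "C \<ge> 0" "\<And>L K (a::real^'n). L \<ge> 1 \<Longrightarrow> K \<subseteq> lat L \<Longrightarrow>
    mod_norm \<gamma> p q (\<lambda>t. wave a t * (\<Sum>k\<in>K. wave k (L *\<^sub>R t - k) * \<Phi> (L *\<^sub>R t - k))) \<le> ennreal (C * L powr (2 * CARD('n) / q - CARD('n)))"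
proof -
  let ?D = "CARD('n)"
  obtain C where C: "C \<ge> 0" "\<And>L k x \<xi>. L \<ge> 1 \<Longrightarrow> norm k \<le> L \<Longrightarrow>
    norm (stft \<gamma> (\<lambda>t. wave k (L *\<^sub>R t - k) * \<Phi> (L *\<^sub>R t - k)) x \<xi>) \<le> C * (1 / L) ^ ?D * wt x * wt ((1 / L) *\<^sub>R \<xi> - k)"
    using norm_wave_packet_stft_le[OF \<Phi> \<gamma>] by blast
  obtain c where c: "c > 0" "\<And>L (y::real^'n) K. K \<subseteq> lat L \<Longrightarrow> (\<Sum>k\<in>K. wt (y - k)) \<le> c"
    using sum_lat_wt_bounded by blast
  define I where "I = (\<integral>x. wt (x::real^'n) \<partial>lborel)"
  have I: "(\<integral>\<^sup>+x. ennreal (wt (x::real^'n)) \<partial>lborel) = ennreal I" "0 \<le> I"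
    unfolding I_def using integrable_wt wt_nonneg by (auto intro!: nn_integral_eq_integral Bochner_Integration.integral_nonneg)
  have wtp: "(\<integral>\<^sup>+x. ennreal (wt (x::real^'n) powr p) \<partial>lborel) \<le> ennreal I"
    unfolding I(1)[symmetric]
  proof (intro nn_integral_mono ennreal_leI)
    fix x :: "real^'n"
    have "wt x powr p \<le> wt x powr 1" using p wt_le_1 less_imp_le[OF wt_pos] by (intro powr_mono') auto
    thus "wt x powr p \<le> wt x" using wt_nonneg[of x] by simp
  qed
  define A where "A = C * I powr (1 / p) * (c powr (q - 1) * (3 ^ ?D * I)) powr (1 / q)"
  show ?thesis
  proof (rule that[of A])
    show "A \<ge> 0" unfolding A_def using C(1) by simp
    fix L :: real and K :: "(real^'n) set" and a :: "real^'n" assume L: "L \<ge> 1" and K: "K \<subseteq> lat L"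
    have fK: "finite K" using K finite_lat finite_subset by blast
    let ?f = "\<lambda>k t. wave k (L *\<^sub>R t - k) * \<Phi> (L *\<^sub>R t - k)"
    define S where "S \<xi> = (\<Sum>k\<in>K. wt ((1 / L) *\<^sub>R (\<xi> - a) - k))" for \<xi>
    have S0: "0 \<le> S \<xi>" "S \<xi> \<le> c" for \<xi> unfolding S_def using c(2)[OF K] wt_nonneg by (auto intro!: sum_nonneg)
    have [measurable]: "S \<in> borel_measurable borel"
      unfolding S_def by (intro borel_measurable_continuous_onI continuous_intros)
    have int: "integrable lborel (?f k)" for k
      using integrable_affine[OF integrable_wave[OF schwartz_integrable[OF \<Phi>], of k], of L "- k"] L by simp
    have st: "norm (stft \<gamma> (\<lambda>t. wave a t * (\<Sum>k\<in>K. ?f k t)) x \<xi>) \<le> (C * (1 / L) ^ ?D) * wt x * S \<xi>" for x \<xi>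
    proof -
      \<comment> \<open>Modulation by \<open>a\<close> merely translates the frequency variable, so
        the constant is uniform in \<open>a\<close>.\<close>
      have "stft \<gamma> (\<lambda>t. wave a t * (\<Sum>k\<in>K. ?f k t)) x \<xi> = stft \<gamma> (\<lambda>t. (\<Sum>k\<in>K. ?f k t)) x (\<xi> - a)" by (rule stft_wave_mult)
      also have "\<dots> = (\<Sum>k\<in>K. stft \<gamma> (?f k) x (\<xi> - a))"
        unfolding stft_fourier fourier_wave sum_distrib_right sum_distrib_left
        by (intro Bochner_Integration.integral_sum integrable_stft_integrand int \<gamma>)
      also have "norm \<dots> \<le> (\<Sum>k\<in>K. C * (1 / L) ^ ?D * wt x * wt ((1 / L) *\<^sub>R (\<xi> - a) - k))"
        using K L unfolding lat_def by (intro sum_norm_le C(2)) auto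
      also have "\<dots> = (C * (1 / L) ^ ?D) * wt x * S \<xi>" by (simp add: S_def sum_distrib_left)
      finally show ?thesis .
    qed
    have Sq: "(\<integral>\<^sup>+\<xi>. ennreal (S \<xi> powr q) \<partial>lborel) \<le> ennreal (c powr (q - 1) * ((3 * L) ^ ?D * (L ^ ?D * I)))"
    proof -
      have one: "(\<integral>\<^sup>+\<xi>. ennreal (wt ((1 / L) *\<^sub>R (\<xi> - a) - k)) \<partial>lborel) = ennreal (L ^ ?D * I)" for k
      proof -
        have "(\<integral>\<^sup>+\<xi>. ennreal (wt ((1 / L) *\<^sub>R (\<xi> - a) - k)) \<partial>lborel)
          = ennreal (\<bar>L\<bar> ^ DIM(real^'n)) * (\<integral>\<^sup>+\<xi>. ennreal (wt ((1 / L) *\<^sub>R ((L *\<^sub>R \<xi> + (a + L *\<^sub>R k)) - a) - k)) \<partial>lborel)"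
          using L by (intro nn_integral_affine) auto
        also have "(\<lambda>\<xi>. (1 / L) *\<^sub>R ((L *\<^sub>R \<xi> + (a + L *\<^sub>R k)) - a) - k) = (\<lambda>\<xi>. \<xi>)"
          using L by (simp add: algebra_simps)
        hence "(\<integral>\<^sup>+\<xi>. ennreal (wt ((1 / L) *\<^sub>R ((L *\<^sub>R \<xi> + (a + L *\<^sub>R k)) - a) - k)) \<partial>lborel) = ennreal I"
          unfolding I(1)[symmetric] by metis
        finally show ?thesis using L I(2) by (simp add: ennreal_mult)
      qed
      have "(\<integral>\<^sup>+\<xi>. ennreal (S \<xi> powr q) \<partial>lborel) \<le> (\<integral>\<^sup>+\<xi>. ennreal (c powr (q - 1)) * (\<Sum>k\<in>K. ennreal (wt ((1 / L) *\<^sub>R (\<xi> - a) - k))) \<partial>lborel)"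
      proof (rule nn_integral_mono)
        fix \<xi>
        \<comment> \<open>Interpolation between the supremum bound \<open>c\<close> and the integral
          of \<open>S\<close>.\<close>
        have "S \<xi> powr q \<le> c powr (q - 1) * S \<xi>"
        proof (cases "S \<xi> = 0")
          case False
          hence "S \<xi> powr q = S \<xi> powr (q - 1) * S \<xi>" using S0(1)[of \<xi>] by (simp add: powr_diff)
          also have "\<dots> \<le> c powr (q - 1) * S \<xi>" using S0 q by (intro mult_right_mono powr_mono2) auto
          finally show ?thesis .
        qed simp
        hence "ennreal (S \<xi> powr q) \<le> ennreal (c powr (q - 1)) * ennreal (S \<xi>)"
          using S0 by (simp add: ennreal_leI flip: ennreal_mult)
        thus "ennreal (S \<xi> powr q) \<le> ennreal (c powr (q - 1)) * (\<Sum>k\<in>K. ennreal (wt ((1 / L) *\<^sub>R (\<xi> - a) - k)))"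
          unfolding S_def by (simp add: sum_ennreal wt_nonneg)
      qed
      also have "\<dots> = ennreal (c powr (q - 1)) * (\<Sum>k\<in>K. \<integral>\<^sup>+\<xi>. ennreal (wt ((1 / L) *\<^sub>R (\<xi> - a) - k)) \<partial>lborel)"
        by (simp add: nn_integral_cmult nn_integral_sum)
      also have "\<dots> = ennreal (c powr (q - 1)) * (\<Sum>k\<in>K. ennreal (L ^ ?D * I))" by (simp only: one)
      also have "(\<Sum>k\<in>K. ennreal (L ^ ?D * I)) = ennreal (real (card K) * (L ^ ?D * I))"
        using L I(2) by (simp add: ennreal_mult ennreal_of_nat_eq_real_of_nat)
      also have "ennreal (c powr (q - 1)) * \<dots> \<le> ennreal (c powr (q - 1)) * ennreal ((3 * L) ^ ?D * (L ^ ?D * I))"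
      proof (intro mult_left_mono ennreal_leI mult_right_mono)
        have "real (card K) \<le> real (card (lat L :: (real^'n) set))" using card_mono[OF finite_lat K] by simp
        thus "real (card K) \<le> (3 * L) ^ ?D" using card_lat[OF L, where 'n='n] by linarith
      qed (use L I(2) in auto)
      finally show ?thesis using L I(2) by (simp add: ennreal_mult)
    qed
    have "mod_norm \<gamma> p q (\<lambda>t. wave a t * (\<Sum>k\<in>K. ?f k t)) \<le> ennreal ((C * (1 / L) ^ ?D) * I powr (1 / p) * (c powr (q - 1) * ((3 * L) ^ ?D * (L ^ ?D * I))) powr (1 / q))"
      by (rule mod_norm_le[OF st _ wt_nonneg S0(1) _ _ _ _ _ _ wtp Sq]) (use C(1) L I(2) p q in auto)
    also have "(C * (1 / L) ^ ?D) * I powr (1 / p) * (c powr (q - 1) * ((3 * L) ^ ?D * (L ^ ?D * I))) powr (1 / q) = A * L powr (2 * ?D / q - ?D)"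
    proof -
      have l: "(L ^ ?D * L ^ ?D) = L powr (2 * ?D)" using L by (simp add: powr_realpow[symmetric] flip: powr_add)
      have "(c powr (q - 1) * ((3 * L) ^ ?D * (L ^ ?D * I))) = (c powr (q - 1) * (3 ^ ?D * I)) * (L ^ ?D * L ^ ?D)"
        by (simp add: power_mult_distrib)
      hence "(c powr (q - 1) * ((3 * L) ^ ?D * (L ^ ?D * I))) powr (1 / q) = (c powr (q - 1) * (3 ^ ?D * I)) powr (1 / q) * L powr (2 * ?D / q)"
        unfolding l by (simp only: powr_mult[of "c powr (q - 1) * (3 ^ ?D * I)"] powr_powr) (use I(2) L in simp)
      moreover have "(1 / L) ^ ?D = L powr (- ?D)" using L by (simp add: powr_minus powr_realpow inverse_eq_divide power_one_over)
      ultimately show ?thesis unfolding A_def using L by (simp add: powr_diff powr_minus field_simps)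
    qed
    finally show "mod_norm \<gamma> p q (\<lambda>t. wave a t * (\<Sum>k\<in>K. ?f k t)) \<le> ennreal (A * L powr (2 * ?D / q - ?D))" .
  qed
qed


section \<open>Oscillatory integrals with parameters\<close>


lemma schwartz_shift:
  assumes "schwartz f" shows "schwartz (\<lambda>x. f (x + b))"
proof (rule schwartzI)
  fix N M
  obtain C where C: "C \<ge> 0" "dbd N (\<lambda>x. C / (1 + norm x) ^ M) f" using schwartz_dbd[OF assms] by blast
  have "dbd N (\<lambda>x. C / (1 + norm (x + b)) ^ M) (\<lambda>x. f (x + b))"
    using dbd_affine[OF C(2), of 1 b] by simp
  hence "dbd N (\<lambda>x. (C * (1 + norm b) ^ M) / (1 + norm x) ^ M) (\<lambda>x. f (x + b))"
  proof (rule dbd_mono)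
    fix x
    have "(1 + norm x) ^ M \<le> ((1 + norm (x + b)) * (1 + norm b)) ^ M"
      by (intro power_mono one_plus_norm_shift) auto
    hence "(1 + norm x) ^ M \<le> (1 + norm b) ^ M * (1 + norm (x + b)) ^ M" by (simp add: power_mult_distrib mult.commute)
    hence "C * (1 + norm x) ^ M \<le> C * ((1 + norm b) ^ M * (1 + norm (x + b)) ^ M)" using C(1) by (rule mult_left_mono)
    moreover have "0 < (1 + norm x) ^ M" "0 < (1 + norm (x + b)) ^ M" by (simp_all add: add_pos_nonneg)
    ultimately show "C / (1 + norm (x + b)) ^ M \<le> (C * (1 + norm b) ^ M) / (1 + norm x) ^ M"
      by (simp add: divide_le_eq le_divide_eq mult.assoc)
  qed
  thus "\<exists>C. dbd N (\<lambda>x. C / (1 + norm x) ^ M) (\<lambda>x. f (x + b))" by blast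
qed

text \<open>On an open set the function vanishes on a short segment through each point, so each
  directional derivative vanishes there too and the induction continues on the same set.\<close>

lemma diffs_eq_0_on_open:
  assumes "open U" "\<And>y. y \<in> U \<Longrightarrow> f y = 0" "x \<in> U" shows "diffs vs f x = 0"
  using assms(3)
proof (induction vs arbitrary: x)
  case (Cons v vs)
  have "((\<lambda>t::real. diffs vs f (x + t *\<^sub>R v)) has_vector_derivative 0) (at 0)"
  proof (rule has_vector_derivative_transform_within_open[OF has_vector_derivative_const])
    show "open ((\<lambda>t::real. x + t *\<^sub>R v) -` U)"
      by (rule open_vimage[OF assms(1)]) (intro continuous_intros)
  qed (use Cons in auto)
  thus ?case by (auto intro: dirderivI)
qed (use assms(2) in auto)

text \<open>The amplitude after the x-derivatives listed in \<open>l\<close>: each of them brings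
  down one factor \<open>\<i> L (\<omega> \<bullet> e)\<close> from the phase, with \<open>e\<close>
  the unit vector of its coordinate.\<close>

fun amp :: "(real^'n \<Rightarrow> real) \<Rightarrow> real \<Rightarrow> real^'n \<Rightarrow> 'n list \<Rightarrow> real^'n \<Rightarrow> complex" where
  "amp \<phi> L k [] = (\<lambda>\<omega>. complex_of_real (\<phi> (\<omega> - k)))"
| "amp \<phi> L k (i # l) = (\<lambda>\<omega>. (\<i> * complex_of_real L) * (complex_of_real (\<omega> \<bullet> axis i 1) * amp \<phi> L k l \<omega>))"

lemma axis_in_Basis[simp]: "axis i (1::real) \<in> Basis"
  by (simp add: axis_in_Basis_iff)

lemma schwartz_amp: "schwartz \<phi> \<Longrightarrow> schwartz (amp \<phi> L k l)"
proof (induction l)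
  case Nil
  thus ?case using schwartz_shift[OF schwartz_of_real, of \<phi> "- k"] by simp
next
  case (Cons i l)
  thus ?case unfolding amp.simps by (intro schwartz_cmult schwartz_mult_inner) auto
qed

lemma amp_eq_0: "\<phi> (\<omega> - k) = 0 \<Longrightarrow> amp \<phi> L k l \<omega> = 0"
  by (induction l) auto

text \<open>An x-derivative costs \<open>L\<close> from the phase and another \<open>L\<close> from
  the size of \<omega>, which after centring at \<open>k\<close> is at most
  \<open>norm \<zeta> + L\<close>. Together this is \<open>L^2\<close>, which becomes
  \<open>2 powr (j \<delta>)\<close>. One extra power of decay absorbs the remaining
  \<open>1 + norm \<zeta>\<close>.\<close>

lemma dbd_amp:
  fixes \<phi> :: "real^'n \<Rightarrow> real"
  assumes "schwartz \<phi>"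
  shows "\<exists>C\<ge>0. \<forall>L\<ge>1. \<forall>k. norm k \<le> L \<longrightarrow> dbd N (\<lambda>\<zeta>. C * L ^ (2 * length l) / (1 + norm \<zeta>) ^ M) (\<lambda>\<zeta>. amp \<phi> L k l (\<zeta> + k))"
proof (induction l arbitrary: M)
  case Nil
  obtain C where "C \<ge> 0" "dbd N (\<lambda>x. C / (1 + norm x) ^ M) (\<lambda>x. complex_of_real (\<phi> x))"
    using schwartz_dbd[OF schwartz_of_real[OF assms]] by blast
  thus ?case by auto
next
  case (Cons i l)
  from Cons[of "Suc M"] obtain C where C: "C \<ge> 0" "\<And>L k. L \<ge> 1 \<Longrightarrow> norm k \<le> L \<Longrightarrow>
    dbd N (\<lambda>\<zeta>. C * L ^ (2 * length l) / (1 + norm \<zeta>) ^ Suc M) (\<lambda>\<zeta>. amp \<phi> L k l (\<zeta> + k))" by blast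
  show ?case
  proof (intro exI[of _ "2 ^ N * (2 ^ N * (2 * C))"] conjI allI impI)
    fix L :: real and k :: "real^'n" assume L: "L \<ge> 1" and k: "norm k \<le> L"
    have "dbd N (\<lambda>\<zeta>. \<bar>\<zeta> \<bullet> axis i 1 + k \<bullet> axis i 1\<bar> + 1) (\<lambda>\<zeta>::real^'n. complex_of_real (\<zeta> \<bullet> axis i 1 + k \<bullet> axis i 1))"
      by (rule dbd_linear_isometry[OF dbd_inner[OF axis_in_Basis] bounded_linear_of_real]) simp
    hence "dbd N (\<lambda>\<zeta>. 2 * L * (1 + norm \<zeta>)) (\<lambda>\<zeta>::real^'n. complex_of_real ((\<zeta> + k) \<bullet> axis i 1))"
      unfolding inner_add_left
    proof (rule dbd_mono)
      fix \<zeta> :: "real^'n"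
      have "\<bar>\<zeta> \<bullet> axis i 1\<bar> \<le> norm \<zeta>" "\<bar>k \<bullet> axis i 1\<bar> \<le> norm k" by (rule Basis_le_norm, simp)+
      hence "\<bar>\<zeta> \<bullet> axis i 1 + k \<bullet> axis i 1\<bar> + 1 \<le> norm \<zeta> + (L + 1)" using k by linarith
      also have "\<dots> \<le> norm \<zeta> * (2 * L) + 2 * L" using L mult_left_mono[of 1 "2 * L" "norm \<zeta>"] by (intro add_mono) auto
      finally show "\<bar>\<zeta> \<bullet> axis i 1 + k \<bullet> axis i 1\<bar> + 1 \<le> 2 * L * (1 + norm \<zeta>)" by (simp add: algebra_simps)
    qed
    from dbd_mult[OF dbd_const[OF order_refl] dbd_mult[OF this C(2)[OF L k]], of "\<i> * complex_of_real L"]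
    show "dbd N (\<lambda>\<zeta>. 2 ^ N * (2 ^ N * (2 * C)) * L ^ (2 * length (i # l)) / (1 + norm \<zeta>) ^ M) (\<lambda>\<zeta>. amp \<phi> L k (i # l) (\<zeta> + k))"
      unfolding amp.simps
    proof (rule dbd_mono)
      fix \<zeta> :: "real^'n"
      have n0: "1 + norm \<zeta> \<noteq> 0" using norm_ge_zero[of \<zeta>] by linarith
      have "2 ^ N * (norm (\<i> * complex_of_real L) * (2 ^ N * (2 * L * (1 + norm \<zeta>) * (C * L ^ (2 * length l) / (1 + norm \<zeta>) ^ Suc M))))
        = 2 ^ N * (2 ^ N * (2 * C)) * L ^ (2 * length (i # l)) / (1 + norm \<zeta>) ^ M"
        using n0 L by (simp add: norm_mult power2_eq_square[symmetric] power_add)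
      thus "2 ^ N * (norm (\<i> * complex_of_real L) * (2 ^ N * (2 * L * (1 + norm \<zeta>) * (C * L ^ (2 * length l) / (1 + norm \<zeta>) ^ Suc M))))
        \<le> 2 ^ N * (2 ^ N * (2 * C)) * L ^ (2 * length (i # l)) / (1 + norm \<zeta>) ^ M" by simp
    qed
  qed (use C(1) in simp)
qed

text \<open>One lattice term with all its derivatives: \<open>l\<close> lists the x-derivatives,
  \<open>\<alpha>\<close> the \<xi>-derivatives, \<open>d\<close> is the dyadic dilation, and
  \<open>c\<close> couples \<omega> to the cut-off, being 0 for the conjugate symbol and
  \<open>d * L\<close> for the adjoint. Derivatives in \<open>x\<close> and \<xi> only extend the
  two lists.\<close>

definition osc :: "(real^'n \<Rightarrow> real) \<Rightarrow> (real^'n \<Rightarrow> real) \<Rightarrow> real \<Rightarrow> real \<Rightarrow> real \<Rightarrow> real^'n \<Rightarrow> 'n list \<Rightarrow> (real^'n) list \<Rightarrow> (real^'n) \<times> (real^'n) \<Rightarrow> complex" where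
  "osc \<phi> \<eta> L d c k l \<alpha> z = (\<integral>\<omega>. wave (L *\<^sub>R fst z - k) \<omega> * (amp \<phi> L k l \<omega> * complex_of_real (d ^ length \<alpha> * diffs \<alpha> \<eta> (d *\<^sub>R snd z + c *\<^sub>R \<omega>))) \<partial>lborel)"

lemma schwartz_diffs_bounded:
  assumes "schwartz \<eta>" "set \<alpha> \<subseteq> Basis" obtains C where "C \<ge> 0" "dbd N (\<lambda>x. C) (diffs \<alpha> \<eta>)"
  using schwartz_bounded[OF schwartz_diffs[OF assms]] by blast

context
  fixes \<phi> \<eta> :: "real^'n \<Rightarrow> real"
  assumes \<phi>: "schwartz \<phi>" and \<eta>: "schwartz \<eta>"
begin

text \<open>The majorant does not depend on \<xi>, so the same one serves continuity and
  differentiation in \<xi>.\<close>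

lemma osc_dominated:
  assumes "set \<alpha> \<subseteq> Basis"
  obtains B where "integrable lborel B" "\<And>\<xi> \<omega>. norm (amp \<phi> L k l \<omega> * complex_of_real (d ^ length \<alpha> * diffs \<alpha> \<eta> (d *\<^sub>R \<xi> + c *\<^sub>R \<omega>))) \<le> B \<omega>"
proof -
  obtain C where C: "C \<ge> 0" "dbd 0 (\<lambda>x. C) (diffs \<alpha> \<eta>)" using schwartz_diffs_bounded[OF \<eta> assms] by blast
  let ?B = "\<lambda>\<omega>. norm (amp \<phi> L k l \<omega>) * (\<bar>d\<bar> ^ length \<alpha> * C)"
  have "integrable lborel ?B" by (intro integrable_mult_left integrable_norm schwartz_integrable schwartz_amp \<phi>)
  moreover have "norm (amp \<phi> L k l \<omega> * complex_of_real (d ^ length \<alpha> * diffs \<alpha> \<eta> (d *\<^sub>R \<xi> + c *\<^sub>R \<omega>))) \<le> ?B \<omega>" for \<xi> \<omega>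
    unfolding norm_mult norm_of_real abs_mult power_abs
    using dbd_bound[OF C(2)] by (intro mult_left_mono) auto
  ultimately show ?thesis by (rule that)
qed

lemma osc_integrable:
  assumes "set \<alpha> \<subseteq> Basis"
  shows "integrable lborel (\<lambda>\<omega>. wave w \<omega> * (amp \<phi> L k l \<omega> * complex_of_real (d ^ length \<alpha> * diffs \<alpha> \<eta> (d *\<^sub>R \<xi> + c *\<^sub>R \<omega>))))"
proof -
  obtain B where B: "integrable lborel B" "\<And>\<xi> \<omega>. norm (amp \<phi> L k l \<omega> * complex_of_real (d ^ length \<alpha> * diffs \<alpha> \<eta> (d *\<^sub>R \<xi> + c *\<^sub>R \<omega>))) \<le> B \<omega>"
    using osc_dominated[OF assms, where L=L and k=k and l=l and d=d and c=c] by blast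
  have [measurable]: "amp \<phi> L k l \<in> borel_measurable borel" by (intro schwartz_measurable schwartz_amp \<phi>)
  have [measurable]: "diffs \<alpha> \<eta> \<in> borel_measurable borel"
    by (intro borel_measurable_continuous_onI schwartz_continuous schwartz_diffs \<eta> assms)
  have "integrable lborel (\<lambda>\<omega>. amp \<phi> L k l \<omega> * complex_of_real (d ^ length \<alpha> * diffs \<alpha> \<eta> (d *\<^sub>R \<xi> + c *\<^sub>R \<omega>)))" for \<xi>
  proof (rule Bochner_Integration.integrable_bound[OF B(1)])
    show "AE \<omega> in lborel. norm (amp \<phi> L k l \<omega> * complex_of_real (d ^ length \<alpha> * diffs \<alpha> \<eta> (d *\<^sub>R \<xi> + c *\<^sub>R \<omega>))) \<le> norm (B \<omega>)"
      unfolding real_norm_def by (intro AE_I2 order_trans[OF B(2) abs_ge_self])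
  qed measurable
  thus ?thesis by (rule integrable_wave)
qed

lemma osc_continuous:
  assumes "set \<alpha> \<subseteq> Basis" shows "continuous_on UNIV (osc \<phi> \<eta> L d c k l \<alpha>)"
  unfolding continuous_on_eq_continuous_at[OF open_UNIV] continuous_at_sequentially
proof (intro ballI allI impI)
  fix z and X :: "nat \<Rightarrow> (real^'n) \<times> (real^'n)" assume X: "X \<longlonglongrightarrow> z"
  obtain B where B: "integrable lborel B" "\<And>\<xi> \<omega>. norm (amp \<phi> L k l \<omega> * complex_of_real (d ^ length \<alpha> * diffs \<alpha> \<eta> (d *\<^sub>R \<xi> + c *\<^sub>R \<omega>))) \<le> B \<omega>"
    using osc_dominated[OF assms, where L=L and k=k and l=l and d=d and c=c] by blast
  show "(osc \<phi> \<eta> L d c k l \<alpha> \<circ> X) \<longlonglongrightarrow> osc \<phi> \<eta> L d c k l \<alpha> z"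
    unfolding o_def osc_def
  proof (rule integral_dominated_convergence[OF borel_measurable_integrable[OF osc_integrable[OF assms]] borel_measurable_integrable[OF osc_integrable[OF assms]] B(1)])
    have "isCont (diffs \<alpha> \<eta>) y" for y
      using schwartz_continuous[OF schwartz_diffs[OF \<eta> assms]] by (simp add: continuous_on_eq_continuous_at)
    thus "AE \<omega> in lborel. (\<lambda>n. wave (L *\<^sub>R fst (X n) - k) \<omega> * (amp \<phi> L k l \<omega> * complex_of_real (d ^ length \<alpha> * diffs \<alpha> \<eta> (d *\<^sub>R snd (X n) + c *\<^sub>R \<omega>))))
      \<longlonglongrightarrow> wave (L *\<^sub>R fst z - k) \<omega> * (amp \<phi> L k l \<omega> * complex_of_real (d ^ length \<alpha> * diffs \<alpha> \<eta> (d *\<^sub>R snd z + c *\<^sub>R \<omega>)))"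
      using X by (intro AE_I2 tendsto_intros isCont_tendsto_compose[of _ "diffs \<alpha> \<eta>"]) auto
    show "AE \<omega> in lborel. norm (wave (L *\<^sub>R fst (X n) - k) \<omega> * (amp \<phi> L k l \<omega> * complex_of_real (d ^ length \<alpha> * diffs \<alpha> \<eta> (d *\<^sub>R snd (X n) + c *\<^sub>R \<omega>)))) \<le> B \<omega>" for n
      using B(2) by (intro AE_I2) (simp add: norm_mult)
  qed
qed

lemma osc_dx:
  assumes "set \<alpha> \<subseteq> Basis"
  shows "((\<lambda>t. osc \<phi> \<eta> L d c k l \<alpha> (z + t *\<^sub>R xdir i)) has_vector_derivative osc \<phi> \<eta> L d c k (i # l) \<alpha> z) (at 0)"
proof -
  let ?v = "axis i (1::real)"
  let ?E = "\<lambda>\<omega>. complex_of_real (d ^ length \<alpha> * diffs \<alpha> \<eta> (d *\<^sub>R snd z + c *\<^sub>R \<omega>))"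
  obtain B where B: "integrable lborel B" "\<And>\<xi> \<omega>. norm (amp \<phi> L k (i # l) \<omega> * complex_of_real (d ^ length \<alpha> * diffs \<alpha> \<eta> (d *\<^sub>R \<xi> + c *\<^sub>R \<omega>))) \<le> B \<omega>"
    using osc_dominated[OF assms, where L=L and k=k and l="i # l" and d=d and c=c] by blast
  have "((\<lambda>t. \<integral>\<omega>. wave (L *\<^sub>R (fst z + t *\<^sub>R ?v) - k) \<omega> * (amp \<phi> L k l \<omega> * ?E \<omega>) \<partial>lborel) has_vector_derivative
    (\<integral>\<omega>. wave (L *\<^sub>R (fst z + 0 *\<^sub>R ?v) - k) \<omega> * (amp \<phi> L k (i # l) \<omega> * ?E \<omega>) \<partial>lborel)) (at 0)"
  proof (rule has_vector_derivative_integral(1)[where B=B])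
    fix t :: real and \<omega> :: "real^'n"
    have eq: "L *\<^sub>R fst z - k + t *\<^sub>R (L *\<^sub>R ?v) = L *\<^sub>R (fst z + t *\<^sub>R ?v) - k" for t
      by (simp add: algebra_simps)
    have "((\<lambda>t. wave \<omega> (L *\<^sub>R fst z - k + t *\<^sub>R (L *\<^sub>R ?v)) * (amp \<phi> L k l \<omega> * ?E \<omega>)) has_vector_derivative
        (\<i> * complex_of_real (\<omega> \<bullet> (L *\<^sub>R ?v)) * wave \<omega> (L *\<^sub>R fst z - k + t *\<^sub>R (L *\<^sub>R ?v))) * (amp \<phi> L k l \<omega> * ?E \<omega>)) (at t)"
      by (rule has_vector_derivative_mult_left[OF cexp_has_vector_derivative])
    from this[unfolded eq wave_commute[of \<omega>]]
    show "((\<lambda>t. wave (L *\<^sub>R (fst z + t *\<^sub>R ?v) - k) \<omega> * (amp \<phi> L k l \<omega> * ?E \<omega>)) has_vector_derivative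
        wave (L *\<^sub>R (fst z + t *\<^sub>R ?v) - k) \<omega> * (amp \<phi> L k (i # l) \<omega> * ?E \<omega>)) (at t)"
      by (rule has_vector_derivative_eq_rhs) (simp only: amp.simps inner_scaleR_right of_real_mult mult_ac)
    show "norm (wave (L *\<^sub>R (fst z + t *\<^sub>R ?v) - k) \<omega> * (amp \<phi> L k (i # l) \<omega> * ?E \<omega>)) \<le> B \<omega>"
      using B(2)[of \<omega> "snd z"] by (simp only: norm_mult norm_exp_i_times mult_1_left)
    show "integrable lborel (\<lambda>\<omega>. wave (L *\<^sub>R (fst z + t *\<^sub>R ?v) - k) \<omega> * (amp \<phi> L k l \<omega> * ?E \<omega>))"
      by (rule osc_integrable[OF assms])
  qed (rule B(1))
  thus ?thesis unfolding osc_def xdir_def by simp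
qed

lemma osc_dxi:
  assumes "set \<alpha> \<subseteq> Basis"
  shows "((\<lambda>t. osc \<phi> \<eta> L d c k l \<alpha> (z + t *\<^sub>R xidir i)) has_vector_derivative osc \<phi> \<eta> L d c k l (axis i 1 # \<alpha>) z) (at 0)"
proof -
  let ?v = "axis i (1::real)"
  let ?w = "wave (L *\<^sub>R fst z - k)"
  have s: "smooth (diffs \<alpha> \<eta>)" using assms schwartz_smooth[OF \<eta>] by (rule smooth_diffs[rotated])
  have a: "set (?v # \<alpha>) \<subseteq> Basis" using assms by simp
  obtain B where B: "integrable lborel B" "\<And>\<xi> \<omega>. norm (amp \<phi> L k l \<omega> * complex_of_real (d ^ length (?v # \<alpha>) * diffs (?v # \<alpha>) \<eta> (d *\<^sub>R \<xi> + c *\<^sub>R \<omega>))) \<le> B \<omega>"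
    using osc_dominated[OF a, where L=L and k=k and l=l and d=d and c=c] by blast
  have "((\<lambda>t. \<integral>\<omega>. ?w \<omega> * (amp \<phi> L k l \<omega> * complex_of_real (d ^ length \<alpha> * diffs \<alpha> \<eta> (d *\<^sub>R (snd z + t *\<^sub>R ?v) + c *\<^sub>R \<omega>))) \<partial>lborel) has_vector_derivative
    (\<integral>\<omega>. ?w \<omega> * (amp \<phi> L k l \<omega> * complex_of_real (d ^ length (?v # \<alpha>) * diffs (?v # \<alpha>) \<eta> (d *\<^sub>R (snd z + 0 *\<^sub>R ?v) + c *\<^sub>R \<omega>))) \<partial>lborel)) (at 0)"
  proof (rule has_vector_derivative_integral(1)[where B=B])
    fix t :: real and \<omega> :: "real^'n"
    let ?p = "d *\<^sub>R (snd z) + c *\<^sub>R \<omega>"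
    have "((\<lambda>t. diffs \<alpha> \<eta> (?p + (d * t) *\<^sub>R ?v)) has_vector_derivative d *\<^sub>R dirderiv ?v (diffs \<alpha> \<eta>) (?p + (d * t) *\<^sub>R ?v)) (at t)"
    proof -
      have "((\<lambda>t. d * t) has_vector_derivative d) (at t)" by (auto intro!: derivative_eq_intros)
      from vector_diff_chain_at[OF this smooth_has_dirderiv[OF s axis_in_Basis]] show ?thesis by (simp add: o_def)
    qed
    from bounded_linear.has_vector_derivative[OF bounded_linear_of_real has_vector_derivative_mult_right[OF this, of "d ^ length \<alpha>"]]
    have "((\<lambda>t. complex_of_real (d ^ length \<alpha> * diffs \<alpha> \<eta> (?p + (d * t) *\<^sub>R ?v))) has_vector_derivative
       complex_of_real (d ^ length (?v # \<alpha>) * diffs (?v # \<alpha>) \<eta> (?p + (d * t) *\<^sub>R ?v))) (at t)"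
      by (simp add: mult_ac)
    from has_vector_derivative_mult_right[OF has_vector_derivative_mult_right[OF this]]
    have "((\<lambda>t. ?w \<omega> * (amp \<phi> L k l \<omega> * complex_of_real (d ^ length \<alpha> * diffs \<alpha> \<eta> (?p + (d * t) *\<^sub>R ?v)))) has_vector_derivative
       ?w \<omega> * (amp \<phi> L k l \<omega> * complex_of_real (d ^ length (?v # \<alpha>) * diffs (?v # \<alpha>) \<eta> (?p + (d * t) *\<^sub>R ?v)))) (at t)" .
    moreover have "?p + (d * t) *\<^sub>R ?v = d *\<^sub>R (snd z + t *\<^sub>R ?v) + c *\<^sub>R \<omega>" for t by (simp add: algebra_simps)
    ultimately show "((\<lambda>t. ?w \<omega> * (amp \<phi> L k l \<omega> * complex_of_real (d ^ length \<alpha> * diffs \<alpha> \<eta> (d *\<^sub>R (snd z + t *\<^sub>R ?v) + c *\<^sub>R \<omega>)))) has_vector_derivative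
       ?w \<omega> * (amp \<phi> L k l \<omega> * complex_of_real (d ^ length (?v # \<alpha>) * diffs (?v # \<alpha>) \<eta> (d *\<^sub>R (snd z + t *\<^sub>R ?v) + c *\<^sub>R \<omega>)))) (at t)" by (simp only:)
    show "norm (?w \<omega> * (amp \<phi> L k l \<omega> * complex_of_real (d ^ length (?v # \<alpha>) * diffs (?v # \<alpha>) \<eta> (d *\<^sub>R (snd z + t *\<^sub>R ?v) + c *\<^sub>R \<omega>)))) \<le> B \<omega>"
      using B(2)[of \<omega> "snd z + t *\<^sub>R ?v"] by (simp only: norm_mult norm_exp_i_times mult_1_left)
    show "integrable lborel (\<lambda>\<omega>. ?w \<omega> * (amp \<phi> L k l \<omega> * complex_of_real (d ^ length \<alpha> * diffs \<alpha> \<eta> (d *\<^sub>R (snd z + t *\<^sub>R ?v) + c *\<^sub>R \<omega>))))"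
      by (rule osc_integrable[OF assms])
  qed (rule B(1))
  thus ?thesis unfolding osc_def xidir_def by simp
qed

lemma osc_eq_0:
  assumes "\<And>\<omega>. \<phi> (\<omega> - k) \<noteq> 0 \<Longrightarrow> diffs \<alpha> \<eta> (d *\<^sub>R snd z + c *\<^sub>R \<omega>) = 0"
  shows "osc \<phi> \<eta> L d c k l \<alpha> z = 0"
proof -
  have "amp \<phi> L k l \<omega> * complex_of_real (d ^ length \<alpha> * diffs \<alpha> \<eta> (d *\<^sub>R snd z + c *\<^sub>R \<omega>)) = 0" for \<omega>
    using assms[of \<omega>] amp_eq_0[of \<phi> \<omega> k L l] by (cases "\<phi> (\<omega> - k) = 0") auto
  thus ?thesis unfolding osc_def by (simp only: mult_zero_right Bochner_Integration.integral_zero)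
qed

text \<open>After moving the centre of the amplitude from \<open>k\<close> to 0 this is
  \<open>osc_decay\<close> with phase \<open>L *\<^sub>R x - k\<close>. The assumption on
  \<open>c\<close> keeps the \<omega>-derivatives of the cut-off bounded, and 2n integrations by
  parts yield exactly the weight that is summable over the lattice.\<close>

lemma osc_bound:
  assumes \<alpha>: "set \<alpha> \<subseteq> Basis"
  obtains C where "C \<ge> 0" "\<And>L d c k x \<xi>. L \<ge> 1 \<Longrightarrow> norm k \<le> L \<Longrightarrow> \<bar>c\<bar> \<le> 1 \<Longrightarrow>
    norm (osc \<phi> \<eta> L d c k l \<alpha> (x, \<xi>)) \<le> C * L ^ (2 * length l) * \<bar>d\<bar> ^ length \<alpha> * wt (L *\<^sub>R x - k)"
proof -
  let ?D = "2 * DIM(real^'n)"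
  obtain C1 where C1: "C1 \<ge> 0" "\<And>L k. L \<ge> 1 \<Longrightarrow> norm k \<le> L \<Longrightarrow> dbd ?D (\<lambda>\<zeta>. C1 * L ^ (2 * length l) / (1 + norm \<zeta>) ^ ?D) (\<lambda>\<zeta>. amp \<phi> L k l (\<zeta> + k))"
    using dbd_amp[OF \<phi>, of ?D l ?D] by blast
  obtain C2 where C2: "C2 \<ge> 0" "dbd ?D (\<lambda>x. C2) (diffs \<alpha> \<eta>)" using schwartz_diffs_bounded[OF \<eta> \<alpha>] by blast
  define I where "I = (\<integral>x. wt (x::real^'n) \<partial>lborel)"
  have I: "I \<ge> 0" unfolding I_def by (intro Bochner_Integration.integral_nonneg wt_nonneg)
  define C where "C = (1 + real DIM(real^'n)) ^ ?D * (2 ^ ?D * (2 ^ ?D * (C1 * C2)) * I)"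
  show ?thesis
  proof (rule that[of C])
    show "C \<ge> 0" unfolding C_def using C1(1) C2(1) I by (intro mult_nonneg_nonneg) auto
    fix L d c :: real and k x \<xi> :: "real^'n" assume L: "L \<ge> 1" and k: "norm k \<le> L" and c: "\<bar>c\<bar> \<le> 1"
    define h where "h \<zeta> = amp \<phi> L k l (\<zeta> + k) * (complex_of_real (d ^ length \<alpha>) * complex_of_real (diffs \<alpha> \<eta> (c *\<^sub>R \<zeta> + (d *\<^sub>R \<xi> + c *\<^sub>R k))))" for \<zeta>
    have E: "dbd N (\<lambda>\<zeta>. 2 ^ N * (\<bar>d\<bar> ^ length \<alpha> * b)) (\<lambda>\<zeta>. complex_of_real (d ^ length \<alpha>) * complex_of_real (diffs \<alpha> \<eta> (c *\<^sub>R \<zeta> + (d *\<^sub>R \<xi> + c *\<^sub>R k))))"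
      if "dbd N (\<lambda>x. b) (diffs \<alpha> \<eta>)" for N b
      by (rule dbd_mult[OF dbd_const dbd_linear_isometry[OF dbd_affine[OF that c] bounded_linear_of_real]]) (simp_all add: norm_power power_abs)
    have hs: "schwartz h" unfolding h_def
    proof (rule schwartz_mult_dbd)
      show "schwartz (\<lambda>\<zeta>. amp \<phi> L k l (\<zeta> + k))" by (intro schwartz_shift schwartz_amp \<phi>)
      fix N
      obtain b where "dbd N (\<lambda>x. b) (diffs \<alpha> \<eta>)" using schwartz_diffs_bounded[OF \<eta> \<alpha>] by blast
      from E[OF this] show "\<exists>C. dbd N (\<lambda>x. C) (\<lambda>\<zeta>. complex_of_real (d ^ length \<alpha>) * complex_of_real (diffs \<alpha> \<eta> (c *\<^sub>R \<zeta> + (d *\<^sub>R \<xi> + c *\<^sub>R k))))" by blast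
    qed
    have hb: "dbd ?D (\<lambda>\<zeta>. (2 ^ ?D * (2 ^ ?D * (C1 * C2)) * L ^ (2 * length l) * \<bar>d\<bar> ^ length \<alpha>) * wt \<zeta>) h"
      unfolding h_def
      by (rule dbd_mono[OF dbd_mult[OF C1(2)[OF L k] E[OF C2(2)]]]) (simp add: wt_def mult_ac)
    have "osc \<phi> \<eta> L d c k l \<alpha> (x, \<xi>) = (\<integral>\<zeta>. wave (L *\<^sub>R x - k) (\<zeta> + k) * (amp \<phi> L k l (\<zeta> + k) * complex_of_real (d ^ length \<alpha> * diffs \<alpha> \<eta> (d *\<^sub>R \<xi> + c *\<^sub>R (\<zeta> + k)))) \<partial>lborel)"
      unfolding osc_def fst_conv snd_conv by (rule integral_translate[symmetric])
    also have "(\<lambda>\<zeta>. wave (L *\<^sub>R x - k) (\<zeta> + k) * (amp \<phi> L k l (\<zeta> + k) * complex_of_real (d ^ length \<alpha> * diffs \<alpha> \<eta> (d *\<^sub>R \<xi> + c *\<^sub>R (\<zeta> + k)))))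
       = (\<lambda>\<zeta>. wave (L *\<^sub>R x - k) k * (wave (L *\<^sub>R x - k) \<zeta> * h \<zeta>))"
    proof
      fix \<zeta>
      have "d *\<^sub>R \<xi> + c *\<^sub>R (\<zeta> + k) = c *\<^sub>R \<zeta> + (d *\<^sub>R \<xi> + c *\<^sub>R k)" by (simp add: algebra_simps)
      thus "wave (L *\<^sub>R x - k) (\<zeta> + k) * (amp \<phi> L k l (\<zeta> + k) * complex_of_real (d ^ length \<alpha> * diffs \<alpha> \<eta> (d *\<^sub>R \<xi> + c *\<^sub>R (\<zeta> + k))))
        = wave (L *\<^sub>R x - k) k * (wave (L *\<^sub>R x - k) \<zeta> * h \<zeta>)"
        unfolding h_def wave_add_right by (simp only: of_real_mult mult_ac)
    qed
    finally have "norm (osc \<phi> \<eta> L d c k l \<alpha> (x, \<xi>)) = norm (\<integral>\<zeta>. wave (L *\<^sub>R x - k) \<zeta> * h \<zeta> \<partial>lborel)"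
      by (simp only: integral_mult_right_zero norm_mult norm_exp_i_times mult_1_left)
    also have "\<dots> \<le> (1 + real DIM(real^'n)) ^ ?D * (\<integral>\<zeta>. (2 ^ ?D * (2 ^ ?D * (C1 * C2)) * L ^ (2 * length l) * \<bar>d\<bar> ^ length \<alpha>) * wt (\<zeta>::real^'n) \<partial>lborel) / (1 + norm (L *\<^sub>R x - k)) ^ ?D"
      by (intro osc_decay[OF hs hb] integrable_mult_right integrable_wt)
    also have "\<dots> = C * L ^ (2 * length l) * \<bar>d\<bar> ^ length \<alpha> * wt (L *\<^sub>R x - k)"
      unfolding C_def I_def wt_def[of "L *\<^sub>R x - k"] integral_mult_right_zero by simp
    finally show "norm (osc \<phi> \<eta> L d c k l \<alpha> (x, \<xi>)) \<le> C * L ^ (2 * length l) * \<bar>d\<bar> ^ length \<alpha> * wt (L *\<^sub>R x - k)" .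
  qed
qed

end


section \<open>The symbol and its adjoint as one family\<close>


text \<open>Rational bounds for the edges of the dyadic annuli, so that all comparisons between
  neighbouring scales become linear arithmetic.\<close>

lemma two_powr_bounds: "84 / 100 \<le> 2 powr (- 1 / 4 :: real)" "7 / 10 \<le> 2 powr (- 1 / 2 :: real)" "2 powr (1 / 2 :: real) \<le> 142 / 100"
proof -
  have 1: "(2 powr (- 1 / 4 :: real)) ^ 4 = 1 / 2" "(2 powr (- 1 / 2 :: real)) ^ 2 = 1 / 2" "(2 powr (1 / 2 :: real)) ^ 2 = 2"
    by (subst powr_power, simp, simp add: powr_minus_divide)+
  show "84 / 100 \<le> 2 powr (- 1 / 4 :: real)"
    by (rule power_le_imp_le_base[of _ 3]) (use 1(1) in \<open>simp_all add: power_divide\<close>)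
  show "7 / 10 \<le> 2 powr (- 1 / 2 :: real)"
    by (rule power2_le_imp_le) (use 1(2) in \<open>simp_all add: power_divide\<close>)
  show "2 powr (1 / 2 :: real) \<le> 142 / 100"
    by (rule power2_le_imp_le) (use 1(3) in \<open>simp_all add: power_divide\<close>)
qed

lemma cpi_neq_0[simp]: "cpi t \<noteq> 0"
  using cpi_pos[of t] by simp

locale wave_symbol =
  fixes \<phi> \<eta> :: "real^'n \<Rightarrow> real" and m \<delta> :: real and j0 :: nat
  assumes \<phi>: "schwartz \<phi>" and \<phi>_supp: "\<And>\<zeta>. norm \<zeta> > 1 / 8 \<Longrightarrow> \<phi> \<zeta> = 0" and \<phi>_even: "\<And>\<zeta>. \<phi> (- \<zeta>) = \<phi> \<zeta>"
    and \<eta>: "schwartz \<eta>" and \<eta>_supp: "\<And>\<xi>. \<eta> \<xi> \<noteq> 0 \<Longrightarrow> 2 powr (- 1 / 2) \<le> norm \<xi> \<and> norm \<xi> \<le> 2 powr (1 / 2)"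
    and \<delta>: "0 < \<delta>" "\<delta> < 1"
    and j0: "1 - 2 powr (real j0 * (\<delta> - 1) + 1) \<ge> 2 powr (- 1 / 4)"
begin

definition lam :: "nat \<Rightarrow> real" where "lam j = 2 powr (real j * \<delta> / 2)"

definition dil :: "nat \<Rightarrow> real" where "dil j = 2 powr (- real j)"

definition K :: "nat \<Rightarrow> (real^'n) set" where
  "K j = {k. (\<forall>i. k $ i \<in> \<int>) \<and> 0 < norm k \<and> norm k \<le> lam j}"

lemma lam_ge_1: "1 \<le> lam j"
  using \<delta> by (simp add: lam_def ge_one_powr_ge_zero)

lemma lam_sq: "lam j ^ 2 = 2 powr (real j * \<delta>)"
  by (simp add: lam_def powr_power)

lemma dil: "dil j > 0" "dil j * 2 ^ j = 1" "dil j = 1 / 2 ^ j"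
  by (simp_all add: dil_def powr_minus powr_realpow inverse_eq_divide)

lemma K_subset: "K j \<subseteq> lat (lam j)"
  by (auto simp: K_def lat_def)

lemma finite_K: "finite (K j)"
  using K_subset finite_lat finite_subset by blast

lemma norm_K: "k \<in> K j \<Longrightarrow> norm k \<le> lam j"
  by (simp add: K_def)

text \<open>\<open>2 * lam j ^ 2\<close> is \<open>2 powr (j (\<delta> - 1) + 1)\<close> times
  \<open>2^j\<close>, and the first factor decreases in \<open>j\<close> because
  \<open>\<delta> < 1\<close>. At \<open>j0\<close> it is at most \<open>1 - 2 powr (-1/4)\<close>,
  hence at most 16/100.\<close>

lemma lam_sq_le: "j0 \<le> j \<Longrightarrow> 2 * lam j ^ 2 \<le> 16 / 100 * 2 ^ j"
proof -
  assume j: "j0 \<le> j"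
  have "2 * lam j ^ 2 = 2 powr (real j * \<delta> + 1)" by (simp add: lam_sq powr_add)
  also have "\<dots> = 2 powr (real j * (\<delta> - 1) + 1) * 2 ^ j"
  proof -
    have "2 ^ j = 2 powr real j" by (simp add: powr_realpow)
    thus ?thesis by (simp add: powr_add[symmetric] algebra_simps)
  qed
  also have "\<dots> \<le> 2 powr (real j0 * (\<delta> - 1) + 1) * 2 ^ j"
    using j \<delta> by (intro mult_right_mono powr_mono add_right_mono mult_right_mono_neg) auto
  also have "\<dots> \<le> 16 / 100 * 2 ^ j"
    using j0 two_powr_bounds(1) by (intro mult_right_mono) auto
  finally show ?thesis .
qed

text \<open>The radius 1/8 of the spectrum around \<open>k\<close> is absorbed by
  \<open>lam j \<ge> 1\<close>, giving norm at most \<open>2 * lam j\<close>; the factor 2 matches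
  the \<open>+ 1\<close> in the exponent of the condition on \<open>j0\<close>.\<close>

lemma freq_le:
  assumes "k \<in> K j" "\<phi> (\<omega> - k) \<noteq> 0" shows "lam j * norm \<omega> \<le> 2 * lam j ^ 2"
proof -
  have "norm (\<omega> - k) \<le> 1 / 8" using \<phi>_supp assms(2) not_less by blast
  moreover have "norm \<omega> \<le> norm (\<omega> - k) + norm k" using norm_triangle_ineq[of "\<omega> - k" k] by simp
  ultimately have "norm \<omega> \<le> 2 * lam j" using norm_K[OF assms(1)] lam_ge_1[of j] by linarith
  hence "lam j * norm \<omega> \<le> lam j * (2 * lam j)" using lam_ge_1[of j] by (intro mult_left_mono) auto
  thus ?thesis by (simp add: power2_eq_square)
qed

text \<open>The dilation is multiplied out, so that \<open>\<eta>\<close> is evaluated at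
  \<open>dil j\<close> times \<open>\<xi> + s * lam j * \<omega>\<close>. Terms below
  \<open>j0\<close> are set to 0, so the series can run over all naturals.\<close>

definition F :: "real \<Rightarrow> 'n list \<Rightarrow> (real^'n) list \<Rightarrow> nat \<Rightarrow> (real^'n) \<times> (real^'n) \<Rightarrow> complex" where
  "F s l \<alpha> j z = (if j0 \<le> j then complex_of_real (2 powr (real j * m) / cpi TYPE('n)) *
     (\<Sum>k\<in>K j. osc \<phi> \<eta> (lam j) (dil j) (dil j * (s * lam j)) k l \<alpha> z) else 0)"

definition T :: "real \<Rightarrow> 'n list \<Rightarrow> (real^'n) list \<Rightarrow> (real^'n) \<times> (real^'n) \<Rightarrow> complex" where
  "T s l \<alpha> z = (\<Sum>j. F s l \<alpha> j z)"

lemma F_continuous: "set \<alpha> \<subseteq> Basis \<Longrightarrow> continuous_on UNIV (F s l \<alpha> j)"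
  unfolding F_def[abs_def] by (cases "j0 \<le> j") (auto intro!: continuous_intros osc_continuous[OF \<phi> \<eta>])

lemma F_dx: "set \<alpha> \<subseteq> Basis \<Longrightarrow> ((\<lambda>t. F s l \<alpha> j (z + t *\<^sub>R xdir i)) has_vector_derivative F s (i # l) \<alpha> j z) (at 0)"
proof (cases "j0 \<le> j")
  case True
  assume "set \<alpha> \<subseteq> Basis"
  thus ?thesis unfolding F_def if_P[OF True]
    by (intro has_vector_derivative_mult_right has_vector_derivative_sum osc_dx[OF \<phi> \<eta>])
qed (simp add: F_def)

lemma F_dxi: "set \<alpha> \<subseteq> Basis \<Longrightarrow> ((\<lambda>t. F s l \<alpha> j (z + t *\<^sub>R xidir i)) has_vector_derivative F s l (axis i 1 # \<alpha>) j z) (at 0)"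
proof (cases "j0 \<le> j")
  case True
  assume "set \<alpha> \<subseteq> Basis"
  thus ?thesis unfolding F_def if_P[OF True]
    by (intro has_vector_derivative_mult_right has_vector_derivative_sum osc_dxi[OF \<phi> \<eta>])
qed (simp add: F_def)

lemma diffs_\<eta>_supp: "diffs \<alpha> \<eta> \<xi> \<noteq> 0 \<Longrightarrow> 7 / 10 \<le> norm \<xi> \<and> norm \<xi> \<le> 142 / 100"
proof (rule ccontr)
  assume n: "diffs \<alpha> \<eta> \<xi> \<noteq> 0" and c: "\<not> (7 / 10 \<le> norm \<xi> \<and> norm \<xi> \<le> 142 / 100)"
  let ?U = "{\<xi>::real^'n. norm \<xi> < 7 / 10} \<union> {\<xi>. 142 / 100 < norm \<xi>}"
  have "diffs \<alpha> \<eta> \<xi> = 0"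
  proof (rule diffs_eq_0_on_open[of ?U])
    show "open ?U" by (intro open_Un open_Collect_less continuous_intros)
    show "\<eta> y = 0" if "y \<in> ?U" for y
      using \<eta>_supp[of y] that two_powr_bounds by (cases "\<eta> y = 0") auto
    show "\<xi> \<in> ?U" using c by auto
  qed
  with n show False by simp
qed

lemma shift_coeff_le:
  assumes "0 \<le> s" "s \<le> 1" "j0 \<le> j" shows "\<bar>dil j * (s * lam j)\<bar> \<le> 1"
proof -
  have "s * lam j \<le> 1 * lam j" using assms lam_ge_1[of j] by (intro mult_right_mono) auto
  also have "\<dots> \<le> 2 * lam j ^ 2" using lam_ge_1[of j] by (simp add: power2_eq_square)
  also have "\<dots> \<le> 2 ^ j" using lam_sq_le[OF assms(3)] zero_le_power[of "2::real" j] by linarith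
  finally have "dil j * (s * lam j) \<le> dil j * 2 ^ j" using dil(1)[of j] by (intro mult_left_mono) auto
  moreover have "0 \<le> dil j * (s * lam j)" using assms dil(1)[of j] lam_ge_1[of j] by simp
  ultimately show ?thesis using dil(2)[of j] by simp
qed

lemma scaled_freq_le:
  assumes "0 \<le> s" "s \<le> 1" "j0 \<le> j" "k \<in> K j" "\<phi> (\<omega> - k) \<noteq> 0"
  shows "norm ((s * lam j) *\<^sub>R \<omega>) \<le> 16 / 100 * 2 ^ j"
proof -
  have "norm ((s * lam j) *\<^sub>R \<omega>) = s * (lam j * norm \<omega>)" using assms lam_ge_1[of j] by simp
  also have "\<dots> \<le> 1 * (lam j * norm \<omega>)" using assms lam_ge_1[of j] by (intro mult_right_mono) auto
  also have "\<dots> \<le> 16 / 100 * 2 ^ j" using freq_le[OF assms(4,5)] lam_sq_le[OF assms(3)] by linarith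
  finally show ?thesis .
qed

lemma dil_norm_bounds:
  assumes a: "7 / 10 \<le> norm (dil j *\<^sub>R w)" and b: "norm (dil j *\<^sub>R w) \<le> 142 / 100"
  shows "7 / 10 * 2 ^ j \<le> norm w" "norm w \<le> 142 / 100 * 2 ^ j"
proof -
  have n: "norm (dil j *\<^sub>R w) * 2 ^ j = norm w" using dil[of j] by simp
  show "7 / 10 * 2 ^ j \<le> norm w" unfolding n[symmetric] by (rule mult_right_mono[OF a]) simp
  show "norm w \<le> 142 / 100 * 2 ^ j" unfolding n[symmetric] by (rule mult_right_mono[OF b]) simp
qed

text \<open>The argument of the cut-off has norm between 0.7 and 1.42 times \<open>2^j\<close>, and
  the shift by \<open>s * lam j * \<omega>\<close> is at most 0.16 times \<open>2^j\<close>. Hence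
  \<open>norm \<xi>\<close> lies between 0.54 and 1.58 times \<open>2^j\<close>, within the stated
  bounds.\<close>

lemma F_supp:
  assumes s: "0 \<le> s" "s \<le> 1" and "F s l \<alpha> j (x, \<xi>) \<noteq> 0"
  shows "j0 \<le> j" "2 ^ j \<le> 2 * norm \<xi>" "norm \<xi> \<le> 2 * 2 ^ j"
proof -
  show j: "j0 \<le> j" using assms(3) by (auto simp: F_def split: if_splits)
  obtain k where k: "k \<in> K j" "osc \<phi> \<eta> (lam j) (dil j) (dil j * (s * lam j)) k l \<alpha> (x, \<xi>) \<noteq> 0"
    using assms(3) unfolding F_def by (auto split: if_splits dest: sum.not_neutral_contains_not_neutral)
  then obtain \<omega> where \<omega>: "\<phi> (\<omega> - k) \<noteq> 0" "diffs \<alpha> \<eta> (dil j *\<^sub>R \<xi> + (dil j * (s * lam j)) *\<^sub>R \<omega>) \<noteq> 0"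
    using osc_eq_0[OF \<phi> \<eta>, where k=k and \<alpha>=\<alpha> and d="dil j" and z="(x, \<xi>)" and c="dil j * (s * lam j)" and L="lam j" and l=l] by auto
  let ?w = "\<xi> + (s * lam j) *\<^sub>R \<omega>"
  have "dil j *\<^sub>R \<xi> + (dil j * (s * lam j)) *\<^sub>R \<omega> = dil j *\<^sub>R ?w" by (simp add: scaleR_add_right)
  with diffs_\<eta>_supp[OF \<omega>(2)] have "7 / 10 \<le> norm (dil j *\<^sub>R ?w)" "norm (dil j *\<^sub>R ?w) \<le> 142 / 100"
    by (simp_all only:)
  from dil_norm_bounds[OF this] have "7 / 10 * 2 ^ j \<le> norm ?w" "norm ?w \<le> 142 / 100 * 2 ^ j" .
  moreover note scaled_freq_le[OF s j k(1) \<omega>(1)]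
  moreover have "norm ?w \<le> norm \<xi> + norm ((s * lam j) *\<^sub>R \<omega>)" by (rule norm_triangle_ineq)
  moreover have "norm \<xi> \<le> norm ?w + norm ((s * lam j) *\<^sub>R \<omega>)"
    using norm_triangle_ineq4[of ?w "(s * lam j) *\<^sub>R \<omega>"] by simp
  moreover have "(0::real) \<le> 2 ^ j" by simp
  ultimately show "2 ^ j \<le> 2 * norm \<xi>" "norm \<xi> \<le> 2 * 2 ^ j" by linarith+
qed

text \<open>The weights \<open>wt (lam j *\<^sub>R x - k)\<close> sum to a constant independent of
  \<open>j\<close> and \<open>x\<close>. What remains is
  \<open>lam j ^ (2 * length l) = 2 powr (j \<delta> * length l)\<close> and one factor
  \<open>2 powr -j\<close> for each \<xi>-derivative.\<close>

lemma F_bound: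
  assumes s: "0 \<le> s" "s \<le> 1" and \<alpha>: "set \<alpha> \<subseteq> Basis"
  obtains C where "C \<ge> 0" "\<And>j x \<xi>. norm (F s l \<alpha> j (x, \<xi>)) \<le> C * (2 ^ j) powr (m - real (length \<alpha>) + \<delta> * real (length l))"
proof -
  obtain C1 where C1: "C1 \<ge> 0" "\<And>L d c k x \<xi>. L \<ge> 1 \<Longrightarrow> norm k \<le> L \<Longrightarrow> \<bar>c\<bar> \<le> 1 \<Longrightarrow>
    norm (osc \<phi> \<eta> L d c k l \<alpha> (x, \<xi>)) \<le> C1 * L ^ (2 * length l) * \<bar>d\<bar> ^ length \<alpha> * wt (L *\<^sub>R x - k)"
    using osc_bound[OF \<phi> \<eta> \<alpha>] by blast
  obtain C2 where C2: "C2 > 0" "\<And>L (y::real^'n) K. K \<subseteq> lat L \<Longrightarrow> (\<Sum>k\<in>K. wt (y - k)) \<le> C2"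
    using sum_lat_wt_bounded by blast
  let ?c = "1 / cpi TYPE('n)"
  have cp: "?c > 0" using cpi_pos[of "TYPE('n)"] by simp
  show ?thesis
  proof (rule that[of "?c * (C1 * C2)"])
    show "0 \<le> ?c * (C1 * C2)" using cp C1(1) C2(1) by (intro mult_nonneg_nonneg) auto
    fix j x \<xi>
    show "norm (F s l \<alpha> j (x, \<xi>)) \<le> ?c * (C1 * C2) * (2 ^ j) powr (m - real (length \<alpha>) + \<delta> * real (length l))"
    proof (cases "j0 \<le> j")
      case j: True
      let ?A = "lam j ^ (2 * length l) * dil j ^ length \<alpha>"
      have A: "0 \<le> ?A" using lam_ge_1[of j] dil(1)[of j] by simp
      have "norm (\<Sum>k\<in>K j. osc \<phi> \<eta> (lam j) (dil j) (dil j * (s * lam j)) k l \<alpha> (x, \<xi>))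
          \<le> (\<Sum>k\<in>K j. C1 * lam j ^ (2 * length l) * \<bar>dil j\<bar> ^ length \<alpha> * wt (lam j *\<^sub>R x - k))"
        by (intro sum_norm_le C1(2) lam_ge_1 norm_K shift_coeff_le s j)
      also have "\<dots> = (C1 * ?A) * (\<Sum>k\<in>K j. wt (lam j *\<^sub>R x - k))"
        using dil(1)[of j] by (simp add: sum_distrib_left mult.assoc)
      also have "\<dots> \<le> (C1 * ?A) * C2" using A C1(1) by (intro mult_left_mono C2(2)[OF K_subset]) auto
      finally have 1: "norm (\<Sum>k\<in>K j. osc \<phi> \<eta> (lam j) (dil j) (dil j * (s * lam j)) k l \<alpha> (x, \<xi>)) \<le> (C1 * ?A) * C2" .
      have 2: "2 powr (real j * m) * ?A = (2 ^ j) powr (m - real (length \<alpha>) + \<delta> * real (length l))"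
      proof -
        have "?A = 2 powr (real j * \<delta> * real (length l)) * 2 powr (- real j * real (length \<alpha>))"
          unfolding power_mult lam_sq dil_def by (simp add: powr_power mult_ac)
        hence "2 powr (real j * m) * ?A = 2 powr (real j * m + (real j * \<delta> * real (length l) + - real j * real (length \<alpha>)))"
          by (simp only: powr_add)
        also have "\<dots> = 2 powr (real j * (m - real (length \<alpha>) + \<delta> * real (length l)))" by (simp add: algebra_simps)
        also have "\<dots> = (2 ^ j) powr (m - real (length \<alpha>) + \<delta> * real (length l))"
          by (simp only: powr_powr[symmetric]) (simp add: powr_realpow)
        finally show ?thesis .
      qed
      have "norm (F s l \<alpha> j (x, \<xi>)) = (2 powr (real j * m) * ?c) * norm (\<Sum>k\<in>K j. osc \<phi> \<eta> (lam j) (dil j) (dil j * (s * lam j)) k l \<alpha> (x, \<xi>))"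
        using j cpi_pos[of "TYPE('n)"] by (simp add: F_def norm_mult norm_divide)
      also have "\<dots> \<le> (2 powr (real j * m) * ?c) * ((C1 * ?A) * C2)" using cp by (intro mult_left_mono 1) auto
      also have "\<dots> = ?c * (C1 * C2) * (2 powr (real j * m) * ?A)" by simp
      finally show ?thesis unfolding 2 .
    next
      case False
      hence "F s l \<alpha> j (x, \<xi>) = 0" by (simp add: F_def)
      moreover have "0 \<le> ?c * (C1 * C2) * (2 ^ j) powr (m - real (length \<alpha>) + \<delta> * real (length l))"
        by (rule mult_nonneg_nonneg[OF \<open>0 \<le> ?c * (C1 * C2)\<close>]) simp
      ultimately show ?thesis by simp
    qed
  qed
qed

text \<open>A nonzero term forces \<open>2^j < 2 R\<close>, and \<open>j < 2^j\<close> turns this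
  into a bound on \<open>j\<close>. On each slab of bounded \<xi> the series is therefore one fixed
  finite sum, which can be differentiated termwise.\<close>

lemma T_eq_sum:
  assumes s: "0 \<le> s" "s \<le> 1" and "norm (snd z) < R"
  shows "T s l \<alpha> z = (\<Sum>j<nat \<lceil>2 * R\<rceil>. F s l \<alpha> j z)"
  unfolding T_def
proof (rule suminf_finite)
  fix j assume j: "j \<notin> {..<nat \<lceil>2 * R\<rceil>}"
  show "F s l \<alpha> j z = 0"
  proof (rule ccontr)
    assume "F s l \<alpha> j z \<noteq> 0"
    hence "2 ^ j \<le> 2 * norm (snd z)" using F_supp(2)[OF s, of l \<alpha> j "fst z" "snd z"] by simp
    also have "\<dots> < 2 * R" using assms(3) by simp
    also have "\<dots> \<le> real j" using j by (simp add: nat_le_iff ceiling_le_iff not_less)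
    finally show False using of_nat_less_two_power[of j, where 'a=real] by linarith
  qed
qed simp

lemma open_norm_snd: "open {z :: (real^'n) \<times> (real^'n). norm (snd z) < R}"
  by (intro open_Collect_less continuous_intros)

lemma T_continuous:
  assumes s: "0 \<le> s" "s \<le> 1" and \<alpha>: "set \<alpha> \<subseteq> Basis"
  shows "continuous_on UNIV (T s l \<alpha>)"
proof -
  have "continuous_on (\<Union>R\<in>UNIV. {z. norm (snd z) < R}) (T s l \<alpha>)"
  proof (rule continuous_on_open_UN)
    fix R :: real
    have "continuous_on {z. norm (snd z) < R} (\<lambda>z. \<Sum>j<nat \<lceil>2 * R\<rceil>. F s l \<alpha> j z)"
      by (intro continuous_intros continuous_on_subset[OF F_continuous[OF \<alpha>]]) auto
    thus "continuous_on {z. norm (snd z) < R} (T s l \<alpha>)"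
      by (rule continuous_on_eq) (simp add: T_eq_sum[OF s])
  qed (rule open_norm_snd)
  moreover have "(\<Union>R\<in>UNIV. {z :: (real^'n) \<times> (real^'n). norm (snd z) < R}) = UNIV"
    using gt_ex by auto
  ultimately show ?thesis by simp
qed

lemma T_derivative:
  assumes s: "0 \<le> s" "s \<le> 1"
    and d: "\<And>j. ((\<lambda>t. F s l \<alpha> j (z + t *\<^sub>R v)) has_vector_derivative F s l' \<alpha>' j z) (at 0)"
  shows "((\<lambda>t. T s l \<alpha> (z + t *\<^sub>R v)) has_vector_derivative T s l' \<alpha>' z) (at 0)"
proof -
  let ?R = "norm (snd z) + 1"
  have "((\<lambda>t. \<Sum>j<nat \<lceil>2 * ?R\<rceil>. F s l \<alpha> j (z + t *\<^sub>R v)) has_vector_derivative (\<Sum>j<nat \<lceil>2 * ?R\<rceil>. F s l' \<alpha>' j z)) (at 0)"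
    by (intro has_vector_derivative_sum d)
  moreover have "T s l' \<alpha>' z = (\<Sum>j<nat \<lceil>2 * ?R\<rceil>. F s l' \<alpha>' j z)" by (rule T_eq_sum[OF s]) simp
  ultimately have *: "((\<lambda>t. \<Sum>j<nat \<lceil>2 * ?R\<rceil>. F s l \<alpha> j (z + t *\<^sub>R v)) has_vector_derivative T s l' \<alpha>' z) (at 0)" by simp
  show ?thesis
  proof (rule has_vector_derivative_transform_within_open[OF *])
    show "open ((\<lambda>t::real. z + t *\<^sub>R v) -` {z. norm (snd z) < ?R})"
      by (rule open_vimage[OF open_norm_snd]) (intro continuous_intros)
    show "(\<Sum>j<nat \<lceil>2 * ?R\<rceil>. F s l \<alpha> j (z + t *\<^sub>R v)) = T s l \<alpha> (z + t *\<^sub>R v)"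
      if "t \<in> (\<lambda>t::real. z + t *\<^sub>R v) -` {z. norm (snd z) < ?R}" for t
      using that by (intro T_eq_sum[OF s, symmetric]) simp
  qed simp
qed

lemma Basis_xdir_xidir: "v \<in> (Basis :: ((real^'n) \<times> (real^'n)) set) \<Longrightarrow> \<exists>i. v = xdir i \<or> v = xidir i"
  by (auto simp: Basis_prod_def Basis_vec_def xdir_def xidir_def)

lemma smooth_T:
  assumes s: "0 \<le> s" "s \<le> 1" and \<alpha>: "set \<alpha> \<subseteq> Basis"
  shows "smooth (T s l \<alpha>)"
proof (rule smooth_coinduct[where P="\<lambda>f. \<exists>l \<alpha>. set \<alpha> \<subseteq> Basis \<and> f = T s l \<alpha>"])
  fix f and v x :: "(real^'n) \<times> (real^'n)"
  assume "\<exists>l \<alpha>. set \<alpha> \<subseteq> Basis \<and> f = T s l \<alpha>" and "v \<in> Basis"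
  then obtain l \<alpha> i where \<alpha>: "set \<alpha> \<subseteq> Basis" and f: "f = T s l \<alpha>" and v: "v = xdir i \<or> v = xidir i"
    using Basis_xdir_xidir by blast
  obtain l' \<alpha>' where \<alpha>': "set \<alpha>' \<subseteq> Basis" and d: "\<And>z. ((\<lambda>t. T s l \<alpha> (z + t *\<^sub>R v)) has_vector_derivative T s l' \<alpha>' z) (at 0)"
  proof (cases "v = xdir i")
    case True
    show ?thesis using T_derivative[OF s F_dx[OF \<alpha>]] \<alpha> that[of \<alpha> "i # l"] unfolding True by blast
  next
    case False
    hence v: "v = xidir i" using v by simp
    show ?thesis using T_derivative[OF s F_dxi[OF \<alpha>]] \<alpha> that[of "axis i 1 # \<alpha>" l] unfolding v by simp
  qed
  show "\<exists>d. ((\<lambda>t. f (x + t *\<^sub>R v)) has_vector_derivative d) (at 0)" unfolding f using d by blast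
  have "dirderiv v f = T s l' \<alpha>'" unfolding f by (intro ext dirderivI d)
  thus "\<exists>l \<alpha>. set \<alpha> \<subseteq> Basis \<and> dirderiv v f = T s l \<alpha>" using \<alpha>' by blast
qed (use \<alpha> T_continuous[OF s] in blast)+

lemma diffs_T:
  assumes s: "0 \<le> s" "s \<le> 1"
  shows "diffs (map xidir a @ map xdir b) (T s [] []) = T s b (map (\<lambda>i. axis i 1) a)"
proof (induction a)
  case Nil
  have "diffs (map xdir b) (T s [] []) = T s b []"
    by (induction b) (auto intro!: ext dirderivI T_derivative[OF s] F_dx)
  thus ?case by simp
next
  case (Cons i a)
  have "set (map (\<lambda>i. axis i (1::real)) a) \<subseteq> Basis" by auto
  with Cons show ?case by (auto intro!: ext dirderivI T_derivative[OF s] F_dxi)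
qed

text \<open>If \<open>i\<close> is the least member, then
  \<open>2^j \<le> 2 r \<le> 4 * 2^i\<close>, so only \<open>i\<close>, \<open>i + 1\<close> and
  \<open>i + 2\<close> can occur.\<close>

lemma card_dyadic: "finite {j::nat. r \<le> 2 * 2 ^ j \<and> 2 ^ j \<le> 2 * r}" "card {j::nat. (r::real) \<le> 2 * 2 ^ j \<and> 2 ^ j \<le> 2 * r} \<le> 3"
proof -
  let ?S = "{j::nat. r \<le> 2 * 2 ^ j \<and> 2 ^ j \<le> 2 * r}"
  have "\<exists>i. ?S \<subseteq> {i..i + 2}"
  proof (cases "?S = {}")
    case False
    define i where "i = (LEAST j. j \<in> ?S)"
    have "\<exists>j. j \<in> ?S" using False by blast
    hence i: "i \<in> ?S" unfolding i_def by (rule LeastI_ex)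
    have "j \<in> {i..i + 2}" if j: "j \<in> ?S" for j
    proof -
      have "i \<le> j" unfolding i_def using j by (rule Least_le)
      moreover have "2 ^ j \<le> 2 * r" "r \<le> 2 * 2 ^ i" using i j by simp_all
      hence "(2::real) ^ j \<le> 2 ^ (i + 2)" by (simp add: power_add)
      hence "j \<le> i + 2" by (rule power_le_imp_le_exp[rotated]) simp
      ultimately show ?thesis by simp
    qed
    thus ?thesis by blast
  next
    case True
    show ?thesis unfolding True by simp
  qed
  then obtain i where i: "?S \<subseteq> {i..i + 2}" by blast
  show "finite ?S" by (rule finite_subset[OF i]) simp
  have "card ?S \<le> card {i..i + 2}" by (rule card_mono[OF _ i]) simp
  thus "card ?S \<le> 3" by simp
qed

lemma T_eq_dyadic_sum:
  assumes s: "0 \<le> s" "s \<le> 1"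
  shows "(\<lambda>j. F s l \<alpha> j (x, \<xi>)) sums (\<Sum>j\<in>{j::nat. norm \<xi> \<le> 2 * 2 ^ j \<and> 2 ^ j \<le> 2 * norm \<xi>}. F s l \<alpha> j (x, \<xi>))"
proof (rule sums_finite)
  fix j :: nat assume "j \<notin> {j::nat. norm \<xi> \<le> 2 * 2 ^ j \<and> 2 ^ j \<le> 2 * norm \<xi>}"
  thus "F s l \<alpha> j (x, \<xi>) = 0" using F_supp(2,3)[OF s, of l \<alpha> j x \<xi>] by blast
qed (rule card_dyadic(1))

lemma T_sums:
  assumes "0 \<le> s" "s \<le> 1" shows "(\<lambda>j. F s l \<alpha> j z) sums T s l \<alpha> z"
proof -
  have "summable (\<lambda>j. F s l \<alpha> j (fst z, snd z))" by (rule sums_summable[OF T_eq_dyadic_sum[OF assms]])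
  from summable_sums[OF this] show ?thesis by (simp add: T_def)
qed

text \<open>At most three terms are nonzero, and for these \<open>2^j\<close> and
  \<open>1 + norm \<xi>\<close> agree up to a factor 4, also for bounded \<xi> because
  \<open>2^j \<ge> 1\<close>. The factor \<open>4 powr\<close> of the absolute exponent covers both
  signs of the exponent.\<close>

lemma T_bound:
  assumes s: "0 \<le> s" "s \<le> 1" and \<alpha>: "set \<alpha> \<subseteq> Basis"
  shows "\<exists>C. \<forall>x \<xi>. norm (T s l \<alpha> (x, \<xi>)) \<le> C * (1 + norm \<xi>) powr (m - real (length \<alpha>) + \<delta> * real (length l))"
proof -
  let ?r = "m - real (length \<alpha>) + \<delta> * real (length l)"
  obtain C where C: "C \<ge> 0" "\<And>j x \<xi>. norm (F s l \<alpha> j (x, \<xi>)) \<le> C * (2 ^ j) powr ?r"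
    using F_bound[OF s \<alpha>] by blast
  have "norm (T s l \<alpha> (x, \<xi>)) \<le> 3 * (C * 4 powr \<bar>?r\<bar>) * (1 + norm \<xi>) powr ?r" for x \<xi>
  proof -
    let ?S = "{j::nat. norm \<xi> \<le> 2 * 2 ^ j \<and> 2 ^ j \<le> 2 * norm \<xi>}"
    let ?B = "C * 4 powr \<bar>?r\<bar> * (1 + norm \<xi>) powr ?r"
    have B: "?B \<ge> 0" using C(1) by simp
    have le: "norm (F s l \<alpha> j (x, \<xi>)) \<le> ?B" if j: "j \<in> ?S" for j
    proof -
      let ?\<theta> = "2 ^ j / (1 + norm \<xi>)"
      have n: "1 + norm \<xi> > 0" using norm_ge_zero[of \<xi>] by linarith
      have "(1::real) \<le> 2 ^ j" by simp
      moreover have "norm \<xi> \<le> 2 * 2 ^ j" "2 ^ j \<le> 2 * norm \<xi>" using j by auto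
      ultimately have "1 + norm \<xi> \<le> 4 * 2 ^ j" "2 ^ j \<le> 4 + 4 * norm \<xi>" using norm_ge_zero[of \<xi>] by linarith+
      hence "1 + norm \<xi> \<le> 4 * 2 ^ j" "2 ^ j \<le> 4 * (1 + norm \<xi>)" by simp_all
      hence t: "1 / 4 \<le> ?\<theta>" "?\<theta> \<le> 4" using n by (simp_all add: le_divide_eq divide_le_eq)
      have "?\<theta> powr ?r \<le> 4 powr \<bar>?r\<bar>"
      proof (cases "?r \<ge> 0")
        case True
        thus ?thesis using t by (simp add: powr_mono2)
      next
        case False
        hence "?\<theta> powr ?r \<le> (1 / 4) powr ?r" using t by (intro powr_mono2') auto
        also have "\<dots> = 4 powr - ?r" by (simp only: powr_divide powr_one_eq_one powr_minus_divide)
        also have "\<dots> = 4 powr \<bar>?r\<bar>" using False by (simp only: abs_of_neg not_le)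
        finally show ?thesis .
      qed
      have "(2 ^ j) powr ?r = (?\<theta> * (1 + norm \<xi>)) powr ?r" using n by simp
      also have "\<dots> = ?\<theta> powr ?r * (1 + norm \<xi>) powr ?r" by (rule powr_mult)
      also have "\<dots> \<le> 4 powr \<bar>?r\<bar> * (1 + norm \<xi>) powr ?r" by (intro mult_right_mono \<open>?\<theta> powr ?r \<le> 4 powr \<bar>?r\<bar>\<close>) simp
      finally have "C * (2 ^ j) powr ?r \<le> C * (4 powr \<bar>?r\<bar> * (1 + norm \<xi>) powr ?r)" using C(1) by (rule mult_left_mono)
      hence "C * (2 ^ j) powr ?r \<le> ?B" by (simp only: mult.assoc)
      with C(2)[of j x \<xi>] show ?thesis by (rule order_trans)
    qed
    have e: "T s l \<alpha> (x, \<xi>) = (\<Sum>j\<in>?S. F s l \<alpha> j (x, \<xi>))"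
      unfolding T_def by (rule sums_unique[OF T_eq_dyadic_sum[OF s], symmetric])
    have "norm (T s l \<alpha> (x, \<xi>)) \<le> (\<Sum>j\<in>?S. ?B)" unfolding e by (rule sum_norm_le) (rule le)
    also have "\<dots> = real (card ?S) * ?B" by (rule sum_constant)
    also have "\<dots> \<le> 3 * ?B" using B card_dyadic(2)[of "norm \<xi>"] by (intro mult_right_mono) auto
    finally show ?thesis by (simp only: mult.assoc)
  qed
  thus ?thesis by blast
qed

theorem T_symbol_class:
  assumes s: "0 \<le> s" "s \<le> 1" shows "(\<lambda>x \<xi>. T s [] [] (x, \<xi>)) \<in> symbol_class m 1 \<delta>"
proof -
  have e: "(\<lambda>(x, \<xi>). T s [] [] (x, \<xi>)) = T s [] []" by auto
  have "\<exists>C. \<forall>x \<xi>. norm (diffs (map xidir \<alpha> @ map xdir \<beta>) (T s [] []) (x, \<xi>))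
          \<le> C * (1 + norm \<xi>) powr (m - 1 * real (length \<alpha>) + \<delta> * real (length \<beta>))" for \<alpha> \<beta>
  proof -
    have "set (map (\<lambda>i. axis i (1::real)) \<alpha>) \<subseteq> Basis" by auto
    from T_bound[OF s this, of \<beta>] show ?thesis unfolding diffs_T[OF s] by simp
  qed
  thus ?thesis unfolding symbol_class_def mem_Collect_eq e using smooth_T[OF s, of "[]" "[]"] by simp
qed

section \<open>Identification of the family at \<open>s = 0\<close> with the conjugate
  symbol\<close>

definition \<Phi> :: "real^'n \<Rightarrow> complex" where "\<Phi> = inv_fourier (\<lambda>\<zeta>. complex_of_real (\<phi> \<zeta>))"

lemma schwartz_\<Phi>: "schwartz \<Phi>"
  unfolding \<Phi>_def by (intro schwartz_inv_fourier schwartz_of_real \<phi>)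

text \<open>Since \<open>\<phi>\<close> is real and even, \<open>\<Phi>\<close> is real-valued;
  conjugating the symbol therefore changes only the sign in the exponentials.\<close>

lemma cnj_\<Phi>: "cnj (\<Phi> u) = \<Phi> u"
proof -
  have "cnj (\<integral>\<xi>. wave u \<xi> * complex_of_real (\<phi> \<xi>) \<partial>lborel) = (\<integral>\<xi>. cnj (wave u \<xi> * complex_of_real (\<phi> \<xi>)) \<partial>lborel)"
    by (rule Bochner_Integration.integral_cnj[symmetric])
  also have "\<dots> = (\<integral>\<xi>. wave (- u) \<xi> * complex_of_real (\<phi> \<xi>) \<partial>lborel)" by (simp add: exp_cnj)
  also have "\<dots> = (\<integral>\<xi>. wave (- u) (- \<xi>) * complex_of_real (\<phi> (- \<xi>)) \<partial>lborel)" by (rule integral_reflect[symmetric])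
  also have "\<dots> = (\<integral>\<xi>. wave u \<xi> * complex_of_real (\<phi> \<xi>) \<partial>lborel)" by (simp add: \<phi>_even)
  finally show ?thesis unfolding \<Phi>_def inv_fourier_wave complex_cnj_divide by simp
qed

text \<open>The conjugate of the sum over \<open>k\<close> in the \<open>j\<close>-th term of the symbol.\<close>
definition packet :: "nat \<Rightarrow> real^'n \<Rightarrow> complex" where
  "packet j x = (\<Sum>k\<in>K j. wave k (lam j *\<^sub>R x - k) * \<Phi> (lam j *\<^sub>R x - k))"

text \<open>Translating the spectrum by \<open>k\<close> modulates \<open>\<Phi>\<close> by the wave
  of frequency \<open>k\<close>; this rewrites a packet as a superposition of plane waves.\<close>

lemma integral_wave_shifted_\<phi>:
  "(\<integral>\<omega>. wave u \<omega> * complex_of_real (\<phi> (\<omega> - k)) \<partial>lborel) = complex_of_real (cpi TYPE('n)) * (wave k u * \<Phi> u)"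
proof -
  have "(\<integral>\<omega>. wave u \<omega> * complex_of_real (\<phi> (\<omega> - k)) \<partial>lborel) = (\<integral>\<omega>. wave u (\<omega> + k) * complex_of_real (\<phi> (\<omega> + k - k)) \<partial>lborel)"
    by (rule integral_translate[symmetric])
  also have "\<dots> = (\<integral>\<omega>. wave u k * (wave u \<omega> * complex_of_real (\<phi> \<omega>)) \<partial>lborel)"
    unfolding wave_add_right by (simp add: mult_ac)
  also have "\<dots> = complex_of_real (cpi TYPE('n)) * (wave k u * \<Phi> u)"
    unfolding integral_mult_right_zero \<Phi>_def inv_fourier_wave using cpi_pos[of "TYPE('n)"] by (simp add: wave_commute[of k])
  finally show ?thesis .
qed

lemma F_0_eq: "F 0 [] [] j (x, \<xi>) = (if j0 \<le> j then complex_of_real (2 powr (real j * m)) * packet j x * complex_of_real (\<eta> (dil j *\<^sub>R \<xi>)) else 0)"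
proof -
  have "osc \<phi> \<eta> (lam j) (dil j) (dil j * (0 * lam j)) k [] [] (x, \<xi>)
     = complex_of_real (cpi TYPE('n)) * (wave k (lam j *\<^sub>R x - k) * \<Phi> (lam j *\<^sub>R x - k)) * complex_of_real (\<eta> (dil j *\<^sub>R \<xi>))" for k
    unfolding integral_wave_shifted_\<phi>[symmetric] integral_mult_left_zero[symmetric] osc_def by (simp add: mult.assoc)
  thus ?thesis unfolding F_def packet_def using cpi_pos[of "TYPE('n)"]
    by (simp add: sum_distrib_left sum_distrib_right mult_ac)
qed

lemma sigma_delta_eq: "sigma_delta \<phi> \<eta> m \<delta> j0 x \<xi> = cnj (T 0 [] [] (x, \<xi>))"
proof -
  have 1: "cnj (F 0 [] [] j (x, \<xi>)) = (if j0 \<le> j then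
        complex_of_real (2 powr (real j * m)) *
        (\<Sum>k\<in>{k::real^'n. (\<forall>i. k $ i \<in> \<int>) \<and> 0 < norm k \<and> norm k \<le> 2 powr (real j * \<delta> / 2)}.
            exp (- \<i> * complex_of_real (k \<bullet> (2 powr (real j * \<delta> / 2) *\<^sub>R x - k)))
            * inv_fourier (\<lambda>\<zeta>. complex_of_real (\<phi> \<zeta>)) (2 powr (real j * \<delta> / 2) *\<^sub>R x - k))
        * complex_of_real (\<eta> (2 powr (- real j) *\<^sub>R \<xi>)) else 0)" for j
    unfolding F_0_eq packet_def K_def[symmetric, unfolded lam_def] lam_def[symmetric] dil_def[symmetric] \<Phi>_def[symmetric]
    by (simp add: exp_cnj cnj_\<Phi> K_def)
  have "(\<lambda>j. cnj (F 0 [] [] j (x, \<xi>))) sums cnj (T 0 [] [] (x, \<xi>))"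
    unfolding sums_cnj by (rule T_sums) auto
  hence "cnj (T 0 [] [] (x, \<xi>)) = (\<Sum>j. cnj (F 0 [] [] j (x, \<xi>)))" by (rule sums_unique)
  thus ?thesis unfolding 1 sigma_delta_def by simp
qed

theorem sigma_delta_symbol_class: "sigma_delta \<phi> \<eta> m \<delta> j0 \<in> symbol_class m 1 \<delta>"
proof -
  have e: "(\<lambda>(x, \<xi>). sigma_delta \<phi> \<eta> m \<delta> j0 x \<xi>) = (\<lambda>z. cnj (T 0 [] [] z))"
    by (auto simp: sigma_delta_eq)
  have s: "smooth (T 0 [] [])" by (rule smooth_T) auto
  have "set (map xidir \<alpha> @ map xdir \<beta>) \<subseteq> (Basis :: ((real^'n) \<times> (real^'n)) set)" for \<alpha> \<beta>
    by (auto simp: xidir_def xdir_def Basis_prod_def)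
  hence d: "diffs (map xidir \<alpha> @ map xdir \<beta>) (\<lambda>z. cnj (T 0 [] [] z)) z = cnj (diffs (map xidir \<alpha> @ map xdir \<beta>) (T 0 [] []) z)" for \<alpha> \<beta> z
    by (subst diffs_linear[OF bounded_linear_cnj s]) auto
  have e': "(\<lambda>(x, \<xi>). T 0 [] [] (x, \<xi>)) = T 0 [] []" by auto
  show ?thesis
    using T_symbol_class[of 0] smooth_linear[OF bounded_linear_cnj s] unfolding symbol_class_def mem_Collect_eq e e' by (simp add: d)
qed

end


section \<open>The oscillatory integral defining the adjoint symbol\<close>


text \<open>\<open>(1 + t)^N\<close> is at most \<open>exp (N t)\<close>, and completing the square
  absorbs this exponential into half of the Gaussian exponent.\<close>

lemma one_plus_power_gauss_le:
  fixes t c :: real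
  assumes "0 \<le> t" "0 < c"
  shows "(1 + t) ^ N * exp (- (2 * c * t\<^sup>2)) \<le> exp ((real N)\<^sup>2 / (4 * c)) * exp (- (c * t\<^sup>2))"
proof -
  have le: "real N * t - 2 * c * t\<^sup>2 \<le> (real N)\<^sup>2 / (4 * c) - c * t\<^sup>2"
  proof -
    have "0 \<le> (2 * c * t - real N)\<^sup>2 / (4 * c)" using assms by simp
    also have "\<dots> = c * t\<^sup>2 - real N * t + (real N)\<^sup>2 / (4 * c)"
      using assms by (simp add: power2_eq_square field_simps)
    finally show ?thesis by linarith
  qed
  have "(1 + t) ^ N \<le> exp t ^ N" using assms exp_ge_add_one_self[of t] by (intro power_mono) auto
  also have "\<dots> = exp (real N * t)" by (simp add: exp_of_nat_mult)
  finally have "(1 + t) ^ N * exp (- (2 * c * t\<^sup>2)) \<le> exp (real N * t) * exp (- (2 * c * t\<^sup>2))"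
    by (rule mult_right_mono) simp
  also have "\<dots> = exp (real N * t - 2 * c * t\<^sup>2)" by (simp only: diff_conv_add_uminus exp_add)
  also have "\<dots> \<le> exp ((real N)\<^sup>2 / (4 * c) - c * t\<^sup>2)" using le by simp
  also have "\<dots> = exp ((real N)\<^sup>2 / (4 * c)) * exp (- (c * t\<^sup>2))"
    by (simp only: diff_conv_add_uminus exp_add)
  finally show ?thesis .
qed

lemma integrable_power_gauss:
  assumes "e > 0"
  shows "integrable lborel (\<lambda>x::'a::euclidean_space. (1 + norm x) ^ N * exp (- (e\<^sup>2 * (norm x)\<^sup>2)))"
proof -
  define c where "c = e\<^sup>2 / 2"
  have c: "c > 0" "e\<^sup>2 = 2 * c" "(e / sqrt 2)\<^sup>2 = c" using assms by (auto simp: c_def power_divide)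
  have "integrable lborel (\<lambda>x::'a. exp ((real N)\<^sup>2 / (4 * c)) * exp (- (c * (norm x)\<^sup>2)))"
    using integrable_gauss_scaled[of "e / sqrt 2", where 'a='a] assms unfolding c(3) by (intro integrable_mult_right) simp
  thus ?thesis
  proof (rule Bochner_Integration.integrable_bound)
    show "AE x in lborel. norm ((1 + norm x) ^ N * exp (- (e\<^sup>2 * (norm x)\<^sup>2))) \<le> norm (exp ((real N)\<^sup>2 / (4 * c)) * exp (- (c * (norm (x::'a))\<^sup>2)))"
      using one_plus_power_gauss_le[OF norm_ge_zero c(1)] unfolding c(2) by (intro AE_I2) (simp add: abs_mult)
  qed measurable
qed

abbreviation cut :: "real \<Rightarrow> 'a::real_normed_vector \<Rightarrow> real" where "cut e v \<equiv> exp (- (e\<^sup>2 * (norm v)\<^sup>2))"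

lemma osc_cutoff_eq: "osc_cutoff (e *\<^sub>R y, e *\<^sub>R \<zeta>) = complex_of_real (cut e y) * complex_of_real (cut e \<zeta>)"
proof -
  have "exp (- ((norm (e *\<^sub>R y))\<^sup>2 + (norm (e *\<^sub>R \<zeta>))\<^sup>2)) = cut e y * cut e \<zeta>"
    by (simp add: power_mult_distrib exp_add[symmetric])
  thus ?thesis by (simp add: osc_cutoff_def)
qed

context wave_symbol
begin

lemma measurable_\<phi>[measurable]: "\<phi> \<in> borel_measurable borel"
  by (intro borel_measurable_continuous_onI schwartz_continuous \<phi>)

lemma measurable_\<eta>[measurable]: "\<eta> \<in> borel_measurable borel"
  by (intro borel_measurable_continuous_onI schwartz_continuous \<eta>)

lemma measurable_\<Phi>[measurable]: "\<Phi> \<in> borel_measurable borel"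
  by (rule schwartz_measurable[OF schwartz_\<Phi>])

lemma measurable_packet[measurable]: "packet j \<in> borel_measurable borel"
  unfolding packet_def[abs_def] by measurable

lemma integrable_\<phi>_shift: "integrable lborel (\<lambda>\<omega>. \<bar>\<phi> (\<omega> - k)\<bar>)"
  using integrable_norm[OF schwartz_integrable[OF schwartz_shift[OF \<phi>, of "- k"]]] by simp

text \<open>A bound of \<open>\<eta>\<close> fixed once by choice, so that later estimates can name
  the same constant in different proofs.\<close>

definition \<eta>bd :: real where "\<eta>bd = (SOME C. C \<ge> 0 \<and> (\<forall>\<xi>. \<bar>\<eta> \<xi>\<bar> \<le> C))"

lemma \<eta>bd: "\<eta>bd \<ge> 0" "\<bar>\<eta> \<xi>\<bar> \<le> \<eta>bd"
proof -
  obtain C where "C \<ge> 0" "dbd 0 (\<lambda>x. C) \<eta>" using schwartz_bounded[OF \<eta>] by blast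
  hence "\<exists>C. C \<ge> 0 \<and> (\<forall>\<xi>. \<bar>\<eta> \<xi>\<bar> \<le> C)" using dbd_bound[of 0 "\<lambda>x. C" \<eta>] by auto
  from someI_ex[OF this] show "\<eta>bd \<ge> 0" "\<bar>\<eta> \<xi>\<bar> \<le> \<eta>bd" unfolding \<eta>bd_def by auto
qed

definition g :: "real \<Rightarrow> nat \<Rightarrow> real^'n \<Rightarrow> real^'n \<Rightarrow> real" where
  "g e j \<xi> \<zeta> = cut e \<zeta> * \<eta> (dil j *\<^sub>R (\<xi> + \<zeta>))"

lemma measurable_g[measurable]: "g e j \<xi> \<in> borel_measurable borel"
  unfolding g_def[abs_def] by measurable

lemma g_le: "\<bar>g e j \<xi> \<zeta>\<bar> \<le> cut e \<zeta> * \<eta>bd"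
  unfolding g_def abs_mult using \<eta>bd by (simp add: mult_left_mono)

lemma g_le': "\<bar>g e j \<xi> \<zeta>\<bar> \<le> \<eta>bd"
proof -
  have "cut e \<zeta> * \<eta>bd \<le> 1 * \<eta>bd" using \<eta>bd(1) by (intro mult_right_mono) auto
  with g_le[of e j \<xi> \<zeta>] show ?thesis by linarith
qed

text \<open>As a function of the displacement \<open>y\<close>, the packet is a superposition of
  plane waves of frequencies \<open>lam j *\<^sub>R \<omega>\<close>; this is what lets the integral
  over \<open>y\<close> be computed exactly.\<close>

lemma packet_eq_integral:
  "packet j (x + y) = (\<Sum>k\<in>K j. \<integral>\<omega>. (wave (lam j *\<^sub>R x - k) \<omega> * complex_of_real (\<phi> (\<omega> - k))) * wave (lam j *\<^sub>R \<omega>) y \<partial>lborel) / complex_of_real (cpi TYPE('n))"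
proof -
  have eq: "(wave (lam j *\<^sub>R x - k) \<omega> * complex_of_real (\<phi> (\<omega> - k))) * wave (lam j *\<^sub>R \<omega>) y
     = wave (lam j *\<^sub>R (x + y) - k) \<omega> * complex_of_real (\<phi> (\<omega> - k))" for k \<omega>
  proof -
    have "lam j *\<^sub>R (x + y) - k = (lam j *\<^sub>R x - k) + lam j *\<^sub>R y" by (simp add: algebra_simps)
    hence "wave (lam j *\<^sub>R (x + y) - k) \<omega> = wave (lam j *\<^sub>R x - k) \<omega> * wave (lam j *\<^sub>R y) \<omega>" by (simp only: wave_add_left)
    moreover have "wave (lam j *\<^sub>R y) \<omega> = wave (lam j *\<^sub>R \<omega>) y" by (simp add: inner_commute)
    ultimately show ?thesis by (simp only: mult_ac)
  qed
  show ?thesis unfolding eq integral_wave_shifted_\<phi> packet_def sum_distrib_left[symmetric] by simp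
qed

text \<open>Against the Gaussian cut-off each plane wave integrates to a Gaussian in \<zeta> centred
  at \<open>lam j *\<^sub>R \<omega>\<close> with width proportional to \<open>e\<close>.\<close>

lemma inner_integral:
  assumes e: "e > 0"
  shows "(\<integral>y. wave (- \<zeta>) y * (complex_of_real (cut e y) * packet j (x + y)) \<partial>lborel)
   = (\<Sum>k\<in>K j. \<integral>\<omega>. (wave (lam j *\<^sub>R x - k) \<omega> * complex_of_real (\<phi> (\<omega> - k))) *
        complex_of_real ((sqrt pi / e) ^ CARD('n) * exp (- (norm ((1 / (2 * e)) *\<^sub>R (lam j *\<^sub>R \<omega> - \<zeta>)))\<^sup>2)) \<partial>lborel) / complex_of_real (cpi TYPE('n))"
proof -
  let ?w = "\<lambda>k \<omega>. wave (lam j *\<^sub>R x - k) \<omega> * complex_of_real (\<phi> (\<omega> - k))"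
  let ?c = "complex_of_real (cpi TYPE('n))"
  let ?H = "\<lambda>k y \<omega>. ?w k \<omega> * (wave (lam j *\<^sub>R \<omega> - \<zeta>) y * complex_of_real (cut e y))"
  have pt: "wave (- \<zeta>) y * (complex_of_real (cut e y) * packet j (x + y)) = (\<Sum>k\<in>K j. \<integral>\<omega>. ?H k y \<omega> \<partial>lborel) / ?c" for y
  proof -
    have "(\<integral>\<omega>. ?H k y \<omega> \<partial>lborel) = (wave (- \<zeta>) y * complex_of_real (cut e y)) * (\<integral>\<omega>. ?w k \<omega> * wave (lam j *\<^sub>R \<omega>) y \<partial>lborel)" for k
    proof -
      have "(\<lambda>\<omega>. ?H k y \<omega>) = (\<lambda>\<omega>. (wave (- \<zeta>) y * complex_of_real (cut e y)) * (?w k \<omega> * wave (lam j *\<^sub>R \<omega>) y))"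
      proof
        fix \<omega>
        have "wave (lam j *\<^sub>R \<omega> - \<zeta>) y = wave (- \<zeta>) y * wave (lam j *\<^sub>R \<omega>) y"
          unfolding wave_add_left[symmetric] by simp
        thus "?H k y \<omega> = (wave (- \<zeta>) y * complex_of_real (cut e y)) * (?w k \<omega> * wave (lam j *\<^sub>R \<omega>) y)" by (simp only: mult_ac)
      qed
      thus ?thesis by (simp only: integral_mult_right_zero)
    qed
    thus ?thesis unfolding packet_eq_integral by (simp only: sum_distrib_left[symmetric] times_divide_eq_right mult.assoc)
  qed
  have meas: "(\<lambda>(y, \<omega>). ?H k y \<omega>) \<in> borel_measurable (lborel \<Otimes>\<^sub>M lborel)" for k by measurable
  have bd: "norm (?H k y \<omega>) \<le> cut e y * \<bar>\<phi> (\<omega> - k)\<bar>" for k y \<omega> by (simp add: norm_mult)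
  have int: "integrable lborel (\<lambda>y. \<integral>\<omega>. ?H k y \<omega> \<partial>lborel)" for k
    using lborel_pair.integrable_fst[OF integrable_pair_bound[OF meas[of k] integrable_gauss_scaled[OF e] integrable_\<phi>_shift[of k]]] bd by simp
  have "(\<integral>y. wave (- \<zeta>) y * (complex_of_real (cut e y) * packet j (x + y)) \<partial>lborel) = (\<Sum>k\<in>K j. \<integral>y. \<integral>\<omega>. ?H k y \<omega> \<partial>lborel \<partial>lborel) / ?c"
    unfolding pt using int by simp
  also have "(\<Sum>k\<in>K j. \<integral>y. \<integral>\<omega>. ?H k y \<omega> \<partial>lborel \<partial>lborel) = (\<Sum>k\<in>K j. \<integral>\<omega>. \<integral>y. ?H k y \<omega> \<partial>lborel \<partial>lborel)"
    by (intro sum.cong refl Fubini_bound[OF meas integrable_gauss_scaled[OF e] integrable_\<phi>_shift bd])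
  finally show ?thesis unfolding integral_mult_right_zero gauss_fourier_scaled[OF e] by simp
qed

text \<open>The average of \<open>g\<close> around \<open>lam j *\<^sub>R \<omega>\<close> against a
  Gaussian of scale \<open>2 * e\<close>, normalised to total mass 1.\<close>

definition R :: "real \<Rightarrow> nat \<Rightarrow> real^'n \<Rightarrow> real^'n \<Rightarrow> complex" where
  "R e j \<xi> \<omega> = (\<integral>u. complex_of_real (exp (- (norm u)\<^sup>2)) * complex_of_real (g e j \<xi> ((2 * e) *\<^sub>R u + lam j *\<^sub>R \<omega>)) \<partial>lborel) / complex_of_real (sqrt pi ^ CARD('n))"

lemma R_eq:
  assumes e: "e > 0"
  shows "(\<integral>\<zeta>. complex_of_real (g e j \<xi> \<zeta>) * complex_of_real ((sqrt pi / e) ^ CARD('n) * exp (- (norm ((1 / (2 * e)) *\<^sub>R (lam j *\<^sub>R \<omega> - \<zeta>)))\<^sup>2)) \<partial>lborel)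
    = complex_of_real (cpi TYPE('n)) * R e j \<xi> \<omega>"
proof -
  let ?G = "\<lambda>u. complex_of_real (exp (- (norm u)\<^sup>2)) * complex_of_real (g e j \<xi> ((2 * e) *\<^sub>R u + lam j *\<^sub>R \<omega>))"
  have "(\<integral>\<zeta>. complex_of_real (g e j \<xi> \<zeta>) * complex_of_real ((sqrt pi / e) ^ CARD('n) * exp (- (norm ((1 / (2 * e)) *\<^sub>R (lam j *\<^sub>R \<omega> - \<zeta>)))\<^sup>2)) \<partial>lborel)
    = \<bar>2 * e\<bar> ^ DIM(real^'n) *\<^sub>R (\<integral>u. complex_of_real (g e j \<xi> ((2 * e) *\<^sub>R u + lam j *\<^sub>R \<omega>)) * complex_of_real ((sqrt pi / e) ^ CARD('n)
        * exp (- (norm ((1 / (2 * e)) *\<^sub>R (lam j *\<^sub>R \<omega> - ((2 * e) *\<^sub>R u + lam j *\<^sub>R \<omega>))))\<^sup>2)) \<partial>lborel)"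
    using e by (intro integral_affine) auto
  also have "(\<lambda>u. complex_of_real (g e j \<xi> ((2 * e) *\<^sub>R u + lam j *\<^sub>R \<omega>)) * complex_of_real ((sqrt pi / e) ^ CARD('n)
        * exp (- (norm ((1 / (2 * e)) *\<^sub>R (lam j *\<^sub>R \<omega> - ((2 * e) *\<^sub>R u + lam j *\<^sub>R \<omega>))))\<^sup>2)))
     = (\<lambda>u. complex_of_real ((sqrt pi / e) ^ CARD('n)) * ?G u)"
  proof
    fix u
    have "(1 / (2 * e)) *\<^sub>R (lam j *\<^sub>R \<omega> - ((2 * e) *\<^sub>R u + lam j *\<^sub>R \<omega>)) = - u" using e by simp
    thus "complex_of_real (g e j \<xi> ((2 * e) *\<^sub>R u + lam j *\<^sub>R \<omega>)) * complex_of_real ((sqrt pi / e) ^ CARD('n)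
        * exp (- (norm ((1 / (2 * e)) *\<^sub>R (lam j *\<^sub>R \<omega> - ((2 * e) *\<^sub>R u + lam j *\<^sub>R \<omega>))))\<^sup>2))
      = complex_of_real ((sqrt pi / e) ^ CARD('n)) * ?G u" by (simp only: norm_minus_cancel of_real_mult mult_ac)
  qed
  also have "\<bar>2 * e\<bar> ^ DIM(real^'n) *\<^sub>R (\<integral>u. complex_of_real ((sqrt pi / e) ^ CARD('n)) * ?G u \<partial>lborel)
     = complex_of_real (\<bar>2 * e\<bar> ^ CARD('n) * (sqrt pi / e) ^ CARD('n)) * (\<integral>u. ?G u \<partial>lborel)"
    unfolding integral_mult_right_zero scaleR_conv_of_real by simp
  also have "\<bar>2 * e\<bar> ^ CARD('n) * (sqrt pi / e) ^ CARD('n) = (2 * sqrt pi) ^ CARD('n)"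
    using e unfolding power_mult_distrib[symmetric] by simp
  also have "complex_of_real ((2 * sqrt pi) ^ CARD('n)) = complex_of_real (cpi TYPE('n)) / complex_of_real (sqrt pi ^ CARD('n))"
  proof -
    have "(2 * sqrt pi) ^ CARD('n) * sqrt pi ^ CARD('n) = cpi TYPE('n)"
      unfolding cpi_def power_mult_distrib[symmetric] by (simp only: mult.assoc real_sqrt_mult_self abs_of_pos pi_gt_zero)
    hence "complex_of_real ((2 * sqrt pi) ^ CARD('n)) * complex_of_real (sqrt pi ^ CARD('n)) = complex_of_real (cpi TYPE('n))"
      by (simp only: of_real_mult[symmetric])
    thus ?thesis by (simp add: eq_divide_eq)
  qed
  finally show ?thesis unfolding R_def by simp
qed

text \<open>The contribution of the index \<open>j\<close> to the regularised integrand of the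
  adjoint symbol.\<close>

definition Q :: "real \<Rightarrow> nat \<Rightarrow> real^'n \<Rightarrow> real^'n \<Rightarrow> (real^'n) \<times> (real^'n) \<Rightarrow> complex" where
  "Q e j x \<xi> z = exp (- \<i> * complex_of_real (fst z \<bullet> snd z)) * osc_cutoff (e *\<^sub>R fst z, e *\<^sub>R snd z) * F 0 [] [] j (x + fst z, \<xi> + snd z)"

lemma Q_eq: "Q e j x \<xi> (y, \<zeta>) = (if j0 \<le> j then complex_of_real (2 powr (real j * m)) *
   (complex_of_real (g e j \<xi> \<zeta>) * (wave (- \<zeta>) y * (complex_of_real (cut e y) * packet j (x + y)))) else 0)"
  unfolding Q_def F_0_eq osc_cutoff_eq g_def by (simp add: inner_commute mult_ac)

lemma measurable_Q: "Q e j x \<xi> \<in> borel_measurable (lborel \<Otimes>\<^sub>M lborel)"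
proof -
  have "(\<lambda>z. if j0 \<le> j then complex_of_real (2 powr (real j * m)) *
   (complex_of_real (g e j \<xi> (snd z)) * (wave (- snd z) (fst z) * (complex_of_real (cut e (fst z)) * packet j (x + fst z)))) else 0)
     \<in> borel_measurable (lborel \<Otimes>\<^sub>M lborel)" by measurable
  also have "(\<lambda>z. if j0 \<le> j then complex_of_real (2 powr (real j * m)) *
   (complex_of_real (g e j \<xi> (snd z)) * (wave (- snd z) (fst z) * (complex_of_real (cut e (fst z)) * packet j (x + fst z)))) else 0) = Q e j x \<xi>"
  proof
    fix z show "(if j0 \<le> j then complex_of_real (2 powr (real j * m)) *
   (complex_of_real (g e j \<xi> (snd z)) * (wave (- snd z) (fst z) * (complex_of_real (cut e (fst z)) * packet j (x + fst z)))) else 0) = Q e j x \<xi> z"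
      unfolding Q_eq[symmetric] by simp
  qed
  finally show ?thesis .
qed

text \<open>A nonzero term has \<open>2^j \<le> 2 * norm (\<xi> + \<zeta>)\<close>, so the growth
  \<open>2 powr (j m)\<close> can be traded for \<open>2 powr -j\<close> times a power of
  \<open>1 + norm \<zeta>\<close>, which the cut-off makes integrable. This gives summability in
  \<open>j\<close> for each fixed \<open>e\<close>.\<close>

lemma Q_bound:
  obtains C N where "C \<ge> 0" "\<And>e j y \<zeta>. norm (Q e j x \<xi> (y, \<zeta>)) \<le> (C * (1 / 2) ^ j) * (cut e y * ((1 + norm \<zeta>) ^ N * cut e \<zeta>))"
proof -
  obtain C where C: "C \<ge> 0" "\<And>j x \<xi>. norm (F 0 [] [] j (x, \<xi>)) \<le> C * (2 ^ j) powr (m - real (length ([] :: (real^'n) list)) + \<delta> * real (length ([] :: 'n list)))"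
    using F_bound[of 0 "[]" "[]"] by auto
  \<comment> \<open>Large enough that \<open>m - N \<le> -1\<close>, which leaves the geometric
    factor \<open>(1 / 2)^j\<close>.\<close>
  define N where "N = nat \<lceil>m + 1\<rceil>"
  have N: "m \<le> real N - 1" unfolding N_def by linarith
  show ?thesis
  proof (rule that[of "C * (2 * (1 + norm \<xi>)) ^ N" N])
    show "C * (2 * (1 + norm \<xi>)) ^ N \<ge> 0" using C(1) by simp
    fix e j y \<zeta>
    have F: "norm (F 0 [] [] j (x + y, \<xi> + \<zeta>)) \<le> (C * (2 * (1 + norm \<xi>)) ^ N * (1 / 2) ^ j) * (1 + norm \<zeta>) ^ N"
    proof (cases "F 0 [] [] j (x + y, \<xi> + \<zeta>) = 0")
      case True
      thus ?thesis using C(1) by simp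
    next
      case False
      have "norm (\<xi> + \<zeta>) \<le> norm \<xi> + norm \<zeta>" by (rule norm_triangle_ineq)
      also have "\<dots> \<le> (1 + norm \<xi>) * (1 + norm \<zeta>)" by (simp add: algebra_simps)
      finally have "2 ^ j \<le> 2 * ((1 + norm \<xi>) * (1 + norm \<zeta>))"
        using F_supp(2)[OF _ _ False] by linarith
      hence 1: "(2 ^ j) ^ N \<le> (2 * ((1 + norm \<xi>) * (1 + norm \<zeta>))) ^ N" by (intro power_mono) auto
      have "(2 ^ j :: real) powr m \<le> (2 ^ j) powr (real N - 1)" using N by (intro powr_mono) auto
      also have "\<dots> = (1 / 2) ^ j * (2 ^ j) ^ N" by (simp add: powr_diff powr_realpow power_one_over)
      also have "\<dots> \<le> (1 / 2) ^ j * (2 * ((1 + norm \<xi>) * (1 + norm \<zeta>))) ^ N" by (intro mult_left_mono 1) auto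
      finally have "C * (2 ^ j) powr m \<le> C * ((1 / 2) ^ j * (2 * ((1 + norm \<xi>) * (1 + norm \<zeta>))) ^ N)" using C(1) by (rule mult_left_mono)
      also have "\<dots> = (C * (2 * (1 + norm \<xi>)) ^ N * (1 / 2) ^ j) * (1 + norm \<zeta>) ^ N" by (simp only: power_mult_distrib mult_ac)
      finally show ?thesis using C(2)[of j "x + y" "\<xi> + \<zeta>"] by (simp only: list.size of_nat_0 mult_zero_right add_0_right diff_zero) 
    qed
    have "norm (Q e j x \<xi> (y, \<zeta>)) = (cut e y * cut e \<zeta>) * norm (F 0 [] [] j (x + y, \<xi> + \<zeta>))"
      unfolding Q_def osc_cutoff_eq by (simp add: norm_mult)
    also have "\<dots> \<le> (cut e y * cut e \<zeta>) * ((C * (2 * (1 + norm \<xi>)) ^ N * (1 / 2) ^ j) * (1 + norm \<zeta>) ^ N)"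
      by (intro mult_left_mono F) auto
    finally show "norm (Q e j x \<xi> (y, \<zeta>)) \<le> (C * (2 * (1 + norm \<xi>)) ^ N * (1 / 2) ^ j) * (cut e y * ((1 + norm \<zeta>) ^ N * cut e \<zeta>))"
      by (simp only: mult_ac)
  qed
qed

lemma integrable_Q:
  assumes e: "e > 0" shows "integrable (lborel \<Otimes>\<^sub>M lborel) (Q e j x \<xi>)"
proof -
  obtain C N where C: "C \<ge> 0" "\<And>e j y \<zeta>. norm (Q e j x \<xi> (y, \<zeta>)) \<le> (C * (1 / 2) ^ j) * (cut e y * ((1 + norm \<zeta>) ^ N * cut e \<zeta>))"
    by (rule Q_bound[of x \<xi>]) blast
  show ?thesis
    by (rule integrable_pair_bound[OF measurable_Q integrable_mult_right[OF integrable_gauss_scaled[OF e], of "C * (1 / 2) ^ j"] integrable_power_gauss[OF e, of N]])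
       (use C(2) in \<open>simp only: mult.assoc\<close>)
qed

lemma integral_Q:
  assumes e: "e > 0"
  shows "(\<integral>z. Q e j x \<xi> z \<partial>lborel) = (if j0 \<le> j then complex_of_real (2 powr (real j * m)) *
    (\<Sum>k\<in>K j. \<integral>\<omega>. (wave (lam j *\<^sub>R x - k) \<omega> * complex_of_real (\<phi> (\<omega> - k))) * R e j \<xi> \<omega> \<partial>lborel) else 0)"
proof (cases "j0 \<le> j")
  case True
  let ?w = "\<lambda>k \<omega>. wave (lam j *\<^sub>R x - k) \<omega> * complex_of_real (\<phi> (\<omega> - k))"
  let ?E = "\<lambda>\<omega> \<zeta>. complex_of_real ((sqrt pi / e) ^ CARD('n) * exp (- (norm ((1 / (2 * e)) *\<^sub>R (lam j *\<^sub>R \<omega> - \<zeta>)))\<^sup>2))"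
  let ?H = "\<lambda>k \<zeta> \<omega>. ?w k \<omega> * (complex_of_real (g e j \<xi> \<zeta>) * ?E \<omega> \<zeta>)"
  let ?c = "complex_of_real (cpi TYPE('n))" and ?m = "complex_of_real (2 powr (real j * m))"
  have meas: "(\<lambda>(\<zeta>, \<omega>). ?H k \<zeta> \<omega>) \<in> borel_measurable (lborel \<Otimes>\<^sub>M lborel)" for k by measurable
  have bd: "norm (?H k \<zeta> \<omega>) \<le> (cut e \<zeta> * \<eta>bd) * ((sqrt pi / e) ^ CARD('n) * \<bar>\<phi> (\<omega> - k)\<bar>)" for k \<zeta> \<omega>
  proof -
    have p: "0 \<le> (sqrt pi / e) ^ CARD('n)" using e by simp
    have "norm (?E \<omega> \<zeta>) = (sqrt pi / e) ^ CARD('n) * exp (- (norm ((1 / (2 * e)) *\<^sub>R (lam j *\<^sub>R \<omega> - \<zeta>)))\<^sup>2)"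
      using p by (simp only: norm_of_real abs_mult abs_of_nonneg abs_exp_cancel)
    also have "\<dots> \<le> (sqrt pi / e) ^ CARD('n) * 1" using p by (intro mult_left_mono) auto
    finally have E: "norm (?E \<omega> \<zeta>) \<le> (sqrt pi / e) ^ CARD('n)" by simp
    have "norm (?H k \<zeta> \<omega>) = \<bar>\<phi> (\<omega> - k)\<bar> * (\<bar>g e j \<xi> \<zeta>\<bar> * norm (?E \<omega> \<zeta>))"
      by (simp only: norm_mult norm_exp_i_times norm_of_real mult_1_left)
    also have "\<dots> \<le> \<bar>\<phi> (\<omega> - k)\<bar> * ((cut e \<zeta> * \<eta>bd) * (sqrt pi / e) ^ CARD('n))"
      using \<eta>bd(1) by (intro mult_left_mono mult_mono g_le E) auto
    finally show ?thesis by (simp only: mult_ac)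
  qed
  note iz = integrable_mult_left[OF integrable_gauss_scaled[OF e, where 'a="real^'n"], of \<eta>bd]
  note io = integrable_mult_right[OF integrable_\<phi>_shift, of "(sqrt pi / e) ^ CARD('n)"]
  have int: "integrable lborel (\<lambda>\<zeta>. \<integral>\<omega>. ?H k \<zeta> \<omega> \<partial>lborel)" for k
    using lborel_pair.integrable_fst[OF integrable_pair_bound[OF meas[of k] iz io[of k]]] bd by simp
  have "(\<integral>z. Q e j x \<xi> z \<partial>lborel) = (\<integral>z. Q e j x \<xi> z \<partial>(lborel \<Otimes>\<^sub>M lborel))" by (simp only: lborel_prod)
  also have "\<dots> = (\<integral>\<zeta>. \<integral>y. Q e j x \<xi> (y, \<zeta>) \<partial>lborel \<partial>lborel)"
    using lborel_pair.integral_snd[of "\<lambda>y \<zeta>. Q e j x \<xi> (y, \<zeta>)"] integrable_Q[OF e, of j x \<xi>] by simp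
  also have "\<dots> = (\<integral>\<zeta>. ?m * ((\<Sum>k\<in>K j. \<integral>\<omega>. ?H k \<zeta> \<omega> \<partial>lborel) / ?c) \<partial>lborel)"
  proof (intro Bochner_Integration.integral_cong refl)
    fix \<zeta>
    have eq: "(\<integral>\<omega>. ?H k \<zeta> \<omega> \<partial>lborel) = complex_of_real (g e j \<xi> \<zeta>) * (\<integral>\<omega>. ?w k \<omega> * ?E \<omega> \<zeta> \<partial>lborel)" for k
      unfolding integral_mult_right_zero[symmetric] by (simp only: mult_ac)
    show "(\<integral>y. Q e j x \<xi> (y, \<zeta>) \<partial>lborel) = ?m * ((\<Sum>k\<in>K j. \<integral>\<omega>. ?H k \<zeta> \<omega> \<partial>lborel) / ?c)"
      unfolding Q_eq if_P[OF True] integral_mult_right_zero inner_integral[OF e] eq sum_distrib_left[symmetric]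
      by (simp only: times_divide_eq_right)
  qed
  also have "\<dots> = ?m * ((\<Sum>k\<in>K j. \<integral>\<zeta>. \<integral>\<omega>. ?H k \<zeta> \<omega> \<partial>lborel \<partial>lborel) / ?c)"
    using int by simp
  also have "(\<Sum>k\<in>K j. \<integral>\<zeta>. \<integral>\<omega>. ?H k \<zeta> \<omega> \<partial>lborel \<partial>lborel) = (\<Sum>k\<in>K j. \<integral>\<omega>. \<integral>\<zeta>. ?H k \<zeta> \<omega> \<partial>lborel \<partial>lborel)"
    by (intro sum.cong refl Fubini_bound[OF meas iz io bd])
  also have "\<dots> = (\<Sum>k\<in>K j. ?c * (\<integral>\<omega>. ?w k \<omega> * R e j \<xi> \<omega> \<partial>lborel))"
  proof (intro sum.cong refl)
    fix k
    have "(\<integral>\<omega>. \<integral>\<zeta>. ?H k \<zeta> \<omega> \<partial>lborel \<partial>lborel) = (\<integral>\<omega>. ?w k \<omega> * (?c * R e j \<xi> \<omega>) \<partial>lborel)"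
      by (simp only: integral_mult_right_zero R_eq[OF e])
    also have "\<dots> = ?c * (\<integral>\<omega>. ?w k \<omega> * R e j \<xi> \<omega> \<partial>lborel)"
      unfolding integral_mult_right_zero[symmetric] by (simp only: mult_ac)
    finally show "(\<integral>\<omega>. \<integral>\<zeta>. ?H k \<zeta> \<omega> \<partial>lborel \<partial>lborel) = ?c * (\<integral>\<omega>. ?w k \<omega> * R e j \<xi> \<omega> \<partial>lborel)" .
  qed
  finally show ?thesis using True by (simp add: sum_distrib_left[symmetric])
next
  case False
  have "Q e j x \<xi> z = 0" for z using Q_eq[of e j x \<xi> "fst z" "snd z"] False by simp
  thus ?thesis using False by simp
qed

lemma measurable_R[measurable]: "R e j \<xi> \<in> borel_measurable borel"
proof -
  have "(\<lambda>\<omega>. \<integral>u. complex_of_real (exp (- (norm u)\<^sup>2)) * complex_of_real (g e j \<xi> ((2 * e) *\<^sub>R u + lam j *\<^sub>R \<omega>)) \<partial>lborel) \<in> borel_measurable borel"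
    by (rule lborel.borel_measurable_lebesgue_integral) measurable
  thus ?thesis unfolding R_def[abs_def] by measurable
qed

text \<open>The Gaussian integrates every power of \<open>1 + norm u\<close>. With
  \<open>N = 0\<close> this gives the uniform bound on \<open>R\<close>; with large \<open>N\<close>
  it gives decay in \<open>j\<close>.\<close>

lemma norm_R_le:
  assumes "\<And>u. \<bar>g e j \<xi> ((2 * e) *\<^sub>R u + lam j *\<^sub>R \<omega>)\<bar> \<le> B * (1 + norm u) ^ N"
  shows "norm (R e j \<xi> \<omega>) \<le> B * (\<integral>u. (1 + norm u) ^ N * exp (- (norm (u::real^'n))\<^sup>2) \<partial>lborel) / sqrt pi ^ CARD('n)"
proof -
  have B: "0 \<le> B" using order_trans[OF abs_ge_zero assms[of 0]] by simp
  have i: "integrable lborel (\<lambda>u::real^'n. B * ((1 + norm u) ^ N * exp (- (norm u)\<^sup>2)))"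
    using integrable_power_gauss[of 1, where 'a="real^'n"] by (intro integrable_mult_right) simp
  have "norm (\<integral>u. complex_of_real (exp (- (norm u)\<^sup>2)) * complex_of_real (g e j \<xi> ((2 * e) *\<^sub>R u + lam j *\<^sub>R \<omega>)) \<partial>lborel)
    \<le> (\<integral>u. norm (complex_of_real (exp (- (norm u)\<^sup>2)) * complex_of_real (g e j \<xi> ((2 * e) *\<^sub>R u + lam j *\<^sub>R \<omega>))) \<partial>lborel)"
    by (rule integral_norm_bound)
  also have "\<dots> \<le> (\<integral>u. B * ((1 + norm u) ^ N * exp (- (norm (u::real^'n))\<^sup>2)) \<partial>lborel)"
  proof (rule integral_mono')
    fix u :: "real^'n"
    show "norm (complex_of_real (exp (- (norm u)\<^sup>2)) * complex_of_real (g e j \<xi> ((2 * e) *\<^sub>R u + lam j *\<^sub>R \<omega>))) \<le> B * ((1 + norm u) ^ N * exp (- (norm u)\<^sup>2))"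
      using mult_left_mono[OF assms[of u], of "exp (- (norm u)\<^sup>2)"] by (simp add: norm_mult mult_ac)
  qed (use i B in auto)
  also have "\<dots> = B * (\<integral>u. (1 + norm u) ^ N * exp (- (norm (u::real^'n))\<^sup>2) \<partial>lborel)" by simp
  finally show ?thesis unfolding R_def by (simp add: norm_divide norm_power divide_right_mono)
qed

text \<open>As \<open>e\<close> tends to 0 the cut-off tends to 1 and the average concentrates at
  \<open>lam j *\<^sub>R \<omega>\<close>; this is where the argument of \<open>\<eta>\<close>
  acquires the shift of the adjoint symbol.\<close>

lemma R_limit:
  assumes e: "e \<longlonglongrightarrow> 0"
  shows "(\<lambda>n. R (e n) j \<xi> \<omega>) \<longlonglongrightarrow> complex_of_real (\<eta> (dil j *\<^sub>R (\<xi> + lam j *\<^sub>R \<omega>)))"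
proof -
  let ?v = "\<eta> (dil j *\<^sub>R (\<xi> + lam j *\<^sub>R \<omega>))"
  have "(\<lambda>n. \<integral>u. complex_of_real (exp (- (norm u)\<^sup>2)) * complex_of_real (g (e n) j \<xi> ((2 * e n) *\<^sub>R u + lam j *\<^sub>R \<omega>)) \<partial>lborel)
     \<longlonglongrightarrow> (\<integral>u. complex_of_real (exp (- (norm (u::real^'n))\<^sup>2)) * complex_of_real ?v \<partial>lborel)"
  proof (rule integral_dominated_convergence[where w="\<lambda>u. exp (- (norm u)\<^sup>2) * \<eta>bd"])
    show "integrable lborel (\<lambda>u::real^'n. exp (- (norm u)\<^sup>2) * \<eta>bd)" by (intro integrable_mult_left gauss_has_integral(1))
    show "AE u in lborel. norm (complex_of_real (exp (- (norm u)\<^sup>2)) * complex_of_real (g (e n) j \<xi> ((2 * e n) *\<^sub>R u + lam j *\<^sub>R \<omega>))) \<le> exp (- (norm u)\<^sup>2) * \<eta>bd" for n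
      using g_le' by (intro AE_I2) (simp add: norm_mult)
    show "AE u in lborel. (\<lambda>n. complex_of_real (exp (- (norm u)\<^sup>2)) * complex_of_real (g (e n) j \<xi> ((2 * e n) *\<^sub>R u + lam j *\<^sub>R \<omega>))) \<longlonglongrightarrow> complex_of_real (exp (- (norm u)\<^sup>2)) * complex_of_real ?v"
    proof (rule AE_I2)
      fix u :: "real^'n"
      let ?s = "\<lambda>n. (2 * e n) *\<^sub>R u + lam j *\<^sub>R \<omega>"
      have s: "?s \<longlonglongrightarrow> (2 * 0) *\<^sub>R u + lam j *\<^sub>R \<omega>" by (intro tendsto_intros e)
      have "isCont \<eta> y" for y using schwartz_continuous[OF \<eta>] by (simp add: continuous_on_eq_continuous_at)
      hence "(\<lambda>n. cut (e n) (?s n) * \<eta> (dil j *\<^sub>R (\<xi> + ?s n))) \<longlonglongrightarrow> cut 0 ((2 * 0) *\<^sub>R u + lam j *\<^sub>R \<omega>) * \<eta> (dil j *\<^sub>R (\<xi> + ((2 * 0) *\<^sub>R u + lam j *\<^sub>R \<omega>)))"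
        by (intro tendsto_intros s e isCont_tendsto_compose[of _ \<eta>])
      hence "(\<lambda>n. g (e n) j \<xi> (?s n)) \<longlonglongrightarrow> ?v" by (simp add: g_def)
      thus "(\<lambda>n. complex_of_real (exp (- (norm u)\<^sup>2)) * complex_of_real (g (e n) j \<xi> (?s n))) \<longlonglongrightarrow> complex_of_real (exp (- (norm u)\<^sup>2)) * complex_of_real ?v"
        by (intro tendsto_intros)
    qed
  qed measurable
  also have "(\<integral>u. complex_of_real (exp (- (norm (u::real^'n))\<^sup>2)) * complex_of_real ?v \<partial>lborel) = complex_of_real (sqrt pi ^ CARD('n)) * complex_of_real ?v"
    unfolding integral_mult_left_zero integral_complex_of_real gauss_has_integral(2) by simp
  finally have "(\<lambda>n. R (e n) j \<xi> \<omega>) \<longlonglongrightarrow> (complex_of_real (sqrt pi ^ CARD('n)) * complex_of_real ?v) / complex_of_real (sqrt pi ^ CARD('n))"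
    unfolding R_def by (intro tendsto_intros) auto
  thus ?thesis by simp
qed

lemma norm_R_le_\<eta>bd:
  obtains B where "\<And>e j \<xi> \<omega>. norm (R e j \<xi> \<omega>) \<le> B"
proof -
  have "norm (R e j \<xi> \<omega>) \<le> \<eta>bd * (\<integral>u. (1 + norm u) ^ 0 * exp (- (norm (u::real^'n))\<^sup>2) \<partial>lborel) / sqrt pi ^ CARD('n)" for e j \<xi> \<omega>
    by (rule norm_R_le) (use g_le' in simp)
  thus ?thesis by (rule that)
qed

lemma integral_Q_limit:
  assumes e: "\<And>n. e n > 0" "e \<longlonglongrightarrow> 0"
  shows "(\<lambda>n. \<integral>z. Q (e n) j x \<xi> z \<partial>lborel) \<longlonglongrightarrow> complex_of_real (cpi TYPE('n)) * F 1 [] [] j (x, \<xi>)"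
proof (cases "j0 \<le> j")
  case True
  let ?w = "\<lambda>k \<omega>. wave (lam j *\<^sub>R x - k) \<omega> * complex_of_real (\<phi> (\<omega> - k))"
  obtain B where B: "\<And>e j \<xi> \<omega>. norm (R e j \<xi> \<omega>) \<le> B" using norm_R_le_\<eta>bd by blast
  have lim: "(\<lambda>n. \<integral>\<omega>. ?w k \<omega> * R (e n) j \<xi> \<omega> \<partial>lborel) \<longlonglongrightarrow> osc \<phi> \<eta> (lam j) (dil j) (dil j * (1 * lam j)) k [] [] (x, \<xi>)" for k
  proof -
    have "(\<lambda>n. \<integral>\<omega>. ?w k \<omega> * R (e n) j \<xi> \<omega> \<partial>lborel) \<longlonglongrightarrow> (\<integral>\<omega>. ?w k \<omega> * complex_of_real (\<eta> (dil j *\<^sub>R (\<xi> + lam j *\<^sub>R \<omega>))) \<partial>lborel)"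
    proof (rule integral_dominated_convergence[where w="\<lambda>\<omega>. \<bar>\<phi> (\<omega> - k)\<bar> * B"])
      show "integrable lborel (\<lambda>\<omega>. \<bar>\<phi> (\<omega> - k)\<bar> * B)" by (intro integrable_mult_left integrable_\<phi>_shift)
      show "AE \<omega> in lborel. norm (?w k \<omega> * R (e n) j \<xi> \<omega>) \<le> \<bar>\<phi> (\<omega> - k)\<bar> * B" for n
        using B by (intro AE_I2) (simp add: norm_mult mult_left_mono)
      show "AE \<omega> in lborel. (\<lambda>n. ?w k \<omega> * R (e n) j \<xi> \<omega>) \<longlonglongrightarrow> ?w k \<omega> * complex_of_real (\<eta> (dil j *\<^sub>R (\<xi> + lam j *\<^sub>R \<omega>)))"
        by (intro AE_I2 tendsto_intros R_limit e)
    qed measurable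
    also have "(\<integral>\<omega>. ?w k \<omega> * complex_of_real (\<eta> (dil j *\<^sub>R (\<xi> + lam j *\<^sub>R \<omega>))) \<partial>lborel) = osc \<phi> \<eta> (lam j) (dil j) (dil j * (1 * lam j)) k [] [] (x, \<xi>)"
      unfolding osc_def by (simp add: mult.assoc scaleR_add_right)
    finally show ?thesis .
  qed
  have "(\<lambda>n. complex_of_real (2 powr (real j * m)) * (\<Sum>k\<in>K j. \<integral>\<omega>. ?w k \<omega> * R (e n) j \<xi> \<omega> \<partial>lborel))
      \<longlonglongrightarrow> complex_of_real (2 powr (real j * m)) * (\<Sum>k\<in>K j. osc \<phi> \<eta> (lam j) (dil j) (dil j * (1 * lam j)) k [] [] (x, \<xi>))"
    by (intro tendsto_intros lim)
  thus ?thesis using True by (simp add: integral_Q[OF e(1)] F_def)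
qed (simp add: integral_Q[OF e(1)] F_def)

text \<open>The integrated bound from \<open>Q_bound\<close> blows up as \<open>e\<close> tends to
  0, so uniformity comes from \<open>R\<close>. Where the cut-off is nonzero,
  \<open>0.7 * 2^j \<le> norm \<xi> + norm u + 0.16 * 2^j\<close>, so \<open>2^j\<close> is
  controlled by \<open>norm \<xi> + norm u\<close>. The Gaussian in \<open>u\<close> therefore makes
  the average as small as any power of \<open>2 powr -j\<close>.\<close>

lemma integral_Q_bound:
  obtains M where "summable M" "\<And>e j. 0 < e \<Longrightarrow> e \<le> 1 / 2 \<Longrightarrow> norm (\<integral>z. Q e j x \<xi> z \<partial>lborel) \<le> M j"
proof -
  \<comment> \<open>Besides \<open>2 powr (j m)\<close> the decay must beat the number of lattice
    points, which is at most \<open>(3 * 2^j)^n\<close>; one more power gives geometric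
    convergence.\<close>
  define N where "N = nat \<lceil>m + real CARD('n) + 1\<rceil>"
  have N: "m + real CARD('n) \<le> real N - 1" unfolding N_def by linarith
  define G where "G = (\<integral>u. (1 + norm u) ^ N * exp (- (norm (u::real^'n))\<^sup>2) \<partial>lborel) / sqrt pi ^ CARD('n)"
  have G: "G \<ge> 0" unfolding G_def by (intro divide_nonneg_nonneg Bochner_Integration.integral_nonneg) auto
  define A where "A = \<eta>bd * (2 * (1 + norm \<xi>)) ^ N"
  have A: "A \<ge> 0" unfolding A_def using \<eta>bd(1) by simp
  define P where "P = (\<integral>\<omega>. \<bar>\<phi> \<omega>\<bar> \<partial>lborel)"
  have P: "P \<ge> 0" unfolding P_def by simp
  have Rb: "norm (R e j \<xi> \<omega>) \<le> A / (2 ^ j) ^ N * G"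
    if e: "0 < e" "e \<le> 1 / 2" and j: "j0 \<le> j" and k: "k \<in> K j" "\<phi> (\<omega> - k) \<noteq> 0" for e j k \<omega>
  proof -
    have "\<bar>g e j \<xi> ((2 * e) *\<^sub>R u + lam j *\<^sub>R \<omega>)\<bar> \<le> A / (2 ^ j) ^ N * (1 + norm u) ^ N" for u
    proof (cases "\<eta> (dil j *\<^sub>R (\<xi> + ((2 * e) *\<^sub>R u + lam j *\<^sub>R \<omega>))) = 0")
      case True
      thus ?thesis using A by (simp add: g_def)
    next
      case False
      let ?W = "\<xi> + ((2 * e) *\<^sub>R u + lam j *\<^sub>R \<omega>)"
      have "7 / 10 \<le> norm (dil j *\<^sub>R ?W)" "norm (dil j *\<^sub>R ?W) \<le> 142 / 100"
        using diffs_\<eta>_supp[of "[]" "dil j *\<^sub>R ?W"] False by auto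
      from dil_norm_bounds(1)[OF this] have "7 / 10 * 2 ^ j \<le> norm ?W" .
      also have "norm ?W \<le> norm \<xi> + (norm ((2 * e) *\<^sub>R u) + norm (lam j *\<^sub>R \<omega>))"
        by (intro order_trans[OF norm_triangle_ineq] add_left_mono norm_triangle_ineq)
      also have "norm ((2 * e) *\<^sub>R u) \<le> norm u"
        using e mult_right_mono[of "2 * e" 1 "norm u"] by simp
      finally have "7 / 10 * 2 ^ j \<le> norm \<xi> + (norm u + norm (lam j *\<^sub>R \<omega>))" by simp
      moreover have "norm (lam j *\<^sub>R \<omega>) \<le> 16 / 100 * 2 ^ j" using scaled_freq_le[of 1, OF _ _ j k] by simp
      ultimately have "2 ^ j \<le> 2 * norm \<xi> + 2 * norm u" using zero_le_power[of "2::real" j] by linarith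
      hence "2 ^ j \<le> 2 * (norm \<xi> + norm u)" by simp
      also have "\<dots> \<le> 2 * (1 + norm \<xi>) * (1 + norm u)" by (simp add: algebra_simps)
      finally have "(2 ^ j) ^ N \<le> (2 * (1 + norm \<xi>) * (1 + norm u)) ^ N" by (intro power_mono) auto
      hence "1 \<le> (2 * (1 + norm \<xi>)) ^ N * (1 + norm u) ^ N / (2 ^ j) ^ N" by (simp add: power_mult_distrib)
      from mult_left_mono[OF this \<eta>bd(1)] have "\<eta>bd \<le> A / (2 ^ j) ^ N * (1 + norm u) ^ N" by (simp add: A_def)
      with g_le'[of e j \<xi> "(2 * e) *\<^sub>R u + lam j *\<^sub>R \<omega>"] show ?thesis by (rule order_trans)
    qed
    from norm_R_le[OF this] show ?thesis unfolding G_def by (simp only: times_divide_eq_right)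
  qed
  define M where "M j = (3 ^ CARD('n) * (A * G * P)) * (1 / 2) ^ j" for j :: nat
  have "summable M" unfolding M_def by (intro summable_mult summable_geometric) simp
  moreover have "norm (\<integral>z. Q e j x \<xi> z \<partial>lborel) \<le> M j" if e: "0 < e" "e \<le> 1 / 2" for e j
  proof (cases "j0 \<le> j")
    case j: True
    let ?w = "\<lambda>k \<omega>. wave (lam j *\<^sub>R x - k) \<omega> * complex_of_real (\<phi> (\<omega> - k))"
    let ?B = "A / (2 ^ j) ^ N * G"
    have B: "?B \<ge> 0" using A G by simp
    have one: "norm (\<integral>\<omega>. ?w k \<omega> * R e j \<xi> \<omega> \<partial>lborel) \<le> P * ?B" if k: "k \<in> K j" for k
    proof -
      have "norm (\<integral>\<omega>. ?w k \<omega> * R e j \<xi> \<omega> \<partial>lborel) \<le> (\<integral>\<omega>. norm (?w k \<omega> * R e j \<xi> \<omega>) \<partial>lborel)" by (rule integral_norm_bound)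
      also have "\<dots> \<le> (\<integral>\<omega>. \<bar>\<phi> (\<omega> - k)\<bar> * ?B \<partial>lborel)"
      proof (rule integral_mono')
        show "integrable lborel (\<lambda>\<omega>. \<bar>\<phi> (\<omega> - k)\<bar> * ?B)" by (intro integrable_mult_left integrable_\<phi>_shift)
        show "norm (?w k \<omega> * R e j \<xi> \<omega>) \<le> \<bar>\<phi> (\<omega> - k)\<bar> * ?B" for \<omega>
        proof (cases "\<phi> (\<omega> - k) = 0")
          case False
          from mult_left_mono[OF Rb[OF e j k this], of "\<bar>\<phi> (\<omega> - k)\<bar>"] show ?thesis
            by (simp only: norm_mult norm_exp_i_times norm_of_real mult_1_left abs_ge_zero)
        qed simp
        show "0 \<le> \<bar>\<phi> (\<omega> - k)\<bar> * ?B" for \<omega> by (rule mult_nonneg_nonneg[OF abs_ge_zero B])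
      qed
      also have "\<dots> = P * ?B" unfolding P_def integral_mult_left_zero using integral_translate[of "\<lambda>\<omega>. \<bar>\<phi> \<omega>\<bar>" "- k"] by simp
      finally show ?thesis .
    qed
    have "norm (\<Sum>k\<in>K j. \<integral>\<omega>. ?w k \<omega> * R e j \<xi> \<omega> \<partial>lborel) \<le> (\<Sum>k\<in>K j. P * ?B)" by (rule sum_norm_le) (rule one)
    also have "\<dots> = real (card (K j)) * (P * ?B)" by (rule sum_constant)
    also have "\<dots> \<le> (3 ^ CARD('n) * (2 ^ j) ^ CARD('n)) * (P * ?B)"
    proof (rule mult_right_mono)
      have "real (card (K j)) \<le> real (card (lat (lam j) :: (real^'n) set))" using card_mono[OF finite_lat K_subset] by simp
      also have "\<dots> \<le> (3 * lam j) ^ CARD('n)" by (rule card_lat[OF lam_ge_1])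
      also have "\<dots> \<le> (3 * 2 ^ j) ^ CARD('n)"
      proof (rule power_mono)
        have "lam j \<le> 2 * lam j ^ 2" using lam_ge_1[of j] by (simp add: power2_eq_square)
        thus "3 * lam j \<le> 3 * 2 ^ j" using lam_sq_le[OF j] zero_le_power[of "2::real" j] by linarith
      qed (use lam_ge_1[of j] in simp)
      finally show "real (card (K j)) \<le> 3 ^ CARD('n) * (2 ^ j) ^ CARD('n)" by (simp only: power_mult_distrib)
    qed (rule mult_nonneg_nonneg[OF P B])
    finally have b: "norm (\<Sum>k\<in>K j. \<integral>\<omega>. ?w k \<omega> * R e j \<xi> \<omega> \<partial>lborel) \<le> (3 ^ CARD('n) * (2 ^ j) ^ CARD('n)) * (P * ?B)" .
    have "norm (\<integral>z. Q e j x \<xi> z \<partial>lborel) = 2 powr (real j * m) * norm (\<Sum>k\<in>K j. \<integral>\<omega>. ?w k \<omega> * R e j \<xi> \<omega> \<partial>lborel)"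
      unfolding integral_Q[OF e(1)] if_P[OF j] norm_mult norm_of_real by simp
    also have "\<dots> \<le> 2 powr (real j * m) * ((3 ^ CARD('n) * (2 ^ j) ^ CARD('n)) * (P * ?B))"
      by (rule mult_left_mono[OF b]) simp
    also have "\<dots> = (3 ^ CARD('n) * (A * G * P)) * (2 powr (real j * m) * (2 ^ j) ^ CARD('n) / (2 ^ j) ^ N)" by simp
    also have "\<dots> \<le> (3 ^ CARD('n) * (A * G * P)) * (1 / 2) ^ j"
    proof (rule mult_left_mono)
      have "2 powr (real j * m) * (2 ^ j) ^ CARD('n) / (2 ^ j) ^ N = (2 ^ j) powr (m + real CARD('n) - real N)"
        by (simp add: powr_add powr_diff powr_realpow powr_powr[symmetric])
      also have "\<dots> \<le> (2 ^ j) powr (- 1)" using N by (intro powr_mono) auto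
      also have "\<dots> = (1 / 2) ^ j" by (simp add: powr_minus_divide power_one_over)
      finally show "2 powr (real j * m) * (2 ^ j) ^ CARD('n) / (2 ^ j) ^ N \<le> (1 / 2) ^ j" .
    qed (use A G P in simp)
    finally show ?thesis unfolding M_def .
  next
    case False
    thus ?thesis unfolding integral_Q[OF e(1)] M_def using A G P by simp
  qed
  ultimately show ?thesis by (rule that)
qed

text \<open>Two interchanges rest on two different majorants: for fixed \<open>e\<close> the
  integral passes through the series by the absolute bound of \<open>Q_bound\<close>, and for
  \<open>e\<close> tending to 0 the limit passes through it by the bound of
  \<open>integral_Q_bound\<close>, which is uniform in \<open>e\<close>.\<close>

theorem adjoint_symbol: "is_adjoint_symbol (sigma_delta \<phi> \<eta> m \<delta> j0) (\<lambda>x \<xi>. T 1 [] [] (x, \<xi>))"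
  unfolding is_adjoint_symbol_def
proof (intro allI)
  fix x \<xi> :: "real^'n"
  let ?c = "complex_of_real (cpi TYPE('n))"
  let ?f = "\<lambda>e z. case z of (y, \<zeta>) \<Rightarrow> exp (- \<i> * complex_of_real (y \<bullet> \<zeta>)) * osc_cutoff (e *\<^sub>R y, e *\<^sub>R \<zeta>) * cnj (sigma_delta \<phi> \<eta> m \<delta> j0 (x + y) (\<xi> + \<zeta>))"
  have sum: "(\<integral>z. ?f e z \<partial>lborel) = (\<Sum>j. \<integral>z. Q e j x \<xi> z \<partial>lborel)" if e: "e > 0" for e
  proof -
    have pt: "?f e z = (\<Sum>j. Q e j x \<xi> z)" for z
    proof -
      have "(\<lambda>j. Q e j x \<xi> z) sums (exp (- \<i> * complex_of_real (fst z \<bullet> snd z)) * osc_cutoff (e *\<^sub>R fst z, e *\<^sub>R snd z) * T 0 [] [] (x + fst z, \<xi> + snd z))"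
        unfolding Q_def by (intro sums_mult T_sums) auto
      from sums_unique[OF this] show ?thesis by (simp add: sigma_delta_eq case_prod_beta)
    qed
    obtain C N where C: "C \<ge> 0" "\<And>e j y \<zeta>. norm (Q e j x \<xi> (y, \<zeta>)) \<le> (C * (1 / 2) ^ j) * (cut e y * ((1 + norm \<zeta>) ^ N * cut e \<zeta>))"
      by (rule Q_bound[of x \<xi>]) blast
    let ?B = "\<lambda>z::(real^'n) \<times> (real^'n). cut e (fst z) * ((1 + norm (snd z)) ^ N * cut e (snd z))"
    have le: "norm (Q e j x \<xi> z) \<le> (C * (1 / 2) ^ j) * ?B z" for j z
      using C(2)[of e j "fst z" "snd z"] by simp
    have iQ: "integrable lborel (Q e j x \<xi>)" for j using integrable_Q[OF e, of j x \<xi>] by (simp only: lborel_prod)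
    have "integrable (lborel \<Otimes>\<^sub>M lborel) ?B"
    proof (rule integrable_pair_bound[OF _ integrable_gauss_scaled[OF e] integrable_power_gauss[OF e, of N]])
      fix y \<zeta> :: "real^'n"
      have "0 \<le> ?B (y, \<zeta>)" by (intro mult_nonneg_nonneg zero_le_power) auto
      thus "norm (?B (y, \<zeta>)) \<le> cut e y * ((1 + norm \<zeta>) ^ N * cut e \<zeta>)" by simp
    qed measurable
    hence iB: "integrable lborel ?B" by (simp only: lborel_prod)
    have geo: "summable (\<lambda>j. (C * (1 / 2) ^ j) * b)" for b :: real
      by (intro summable_mult summable_mult2 summable_geometric) simp
    show ?thesis unfolding pt
    proof (rule integral_suminf[OF iQ])
      show "AE z in lborel. summable (\<lambda>j. norm (Q e j x \<xi> z))"
        by (intro AE_I2 summable_comparison_test'[OF geo, where N=0]) (use le in simp)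
      show "summable (\<lambda>j. \<integral>z. norm (Q e j x \<xi> z) \<partial>lborel)"
      proof (rule summable_comparison_test'[OF geo[of "\<integral>z. ?B z \<partial>lborel"], where N=0])
        fix j
        have "(\<integral>z. norm (Q e j x \<xi> z) \<partial>lborel) \<le> (\<integral>z. (C * (1 / 2) ^ j) * ?B z \<partial>lborel)"
          by (intro integral_mono integrable_norm iQ integrable_mult_right iB le)
        also have "\<dots> = (C * (1 / 2) ^ j) * (\<integral>z. ?B z \<partial>lborel)" by (rule integral_mult_right_zero)
        finally show "norm (\<integral>z. norm (Q e j x \<xi> z) \<partial>lborel) \<le> (C * (1 / 2) ^ j) * (\<integral>z. ?B z \<partial>lborel)" by simp
      qed
    qed
  qed
  obtain M where M: "summable M" "\<And>e j. 0 < e \<Longrightarrow> e \<le> 1 / 2 \<Longrightarrow> norm (\<integral>z. Q e j x \<xi> z \<partial>lborel) \<le> M j"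
    by (rule integral_Q_bound[of x \<xi>]) blast
  show "((\<lambda>e. complex_of_real ((2 * pi) powr (- real CARD('n))) * (\<integral>z. ?f e z \<partial>lborel)) \<longlongrightarrow> T 1 [] [] (x, \<xi>)) (at_right 0)"
  \<comment> \<open>Sequences below 1/2 ensure \<open>2 * e \<le> 1\<close>, as the uniform majorant
    requires.\<close>
  proof (rule tendsto_at_right_sequentially[of 0 "1/2"])
    fix S :: "nat \<Rightarrow> real" assume S: "\<And>n. 0 < S n" "\<And>n. S n < 1 / 2" "S \<longlonglongrightarrow> 0"
    have "(\<lambda>n. \<Sum>j. \<integral>z. Q (S n) j x \<xi> z \<partial>lborel) \<longlonglongrightarrow> (\<Sum>j. ?c * F 1 [] [] j (x, \<xi>))"
    proof (rule tannerys_theorem[THEN conjunct2, THEN conjunct2])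
      show "(\<lambda>n. \<integral>z. Q (S n) j x \<xi> z \<partial>lborel) \<longlonglongrightarrow> ?c * F 1 [] [] j (x, \<xi>)" for j
        by (rule integral_Q_limit[OF S(1,3)])
      show "\<forall>\<^sub>F (j, n) in at_top \<times>\<^sub>F sequentially. norm (\<integral>z. Q (S n) j x \<xi> z \<partial>lborel) \<le> M j"
        using M(2)[OF S(1) less_imp_le[OF S(2)]] by (intro always_eventually) auto
    qed (use M(1) in auto)
    also have "(\<Sum>j. ?c * F 1 [] [] j (x, \<xi>)) = ?c * T 1 [] [] (x, \<xi>)"
      by (rule sums_unique[symmetric]) (intro sums_mult T_sums, auto)
    finally have "(\<lambda>n. complex_of_real ((2 * pi) powr (- real CARD('n))) * (\<integral>z. ?f (S n) z \<partial>lborel)) \<longlonglongrightarrow> complex_of_real ((2 * pi) powr (- real CARD('n))) * (?c * T 1 [] [] (x, \<xi>))"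
      unfolding sum[OF S(1)] by (intro tendsto_intros)
    thus "(\<lambda>n. complex_of_real ((2 * pi) powr (- real CARD('n))) * (\<integral>z. ?f (S n) z \<partial>lborel)) \<longlonglongrightarrow> T 1 [] [] (x, \<xi>)"
      unfolding cpi_powr by simp
  qed simp
qed

end


section \<open>Localized test functions\<close>


lemma diffs_wave:
  assumes "set vs \<subseteq> Basis"
  shows "\<exists>c. norm c \<le> norm w ^ length vs \<and> diffs vs (wave w) = (\<lambda>x. c * wave w x)"
  using assms
proof (induction vs)
  case (Cons v vs)
  then obtain c where c: "norm c \<le> norm w ^ length vs" "diffs vs (wave w) = (\<lambda>x. c * wave w x)" by auto
  have "((\<lambda>t. c * wave w (x + t *\<^sub>R v)) has_vector_derivative c * (\<i> * complex_of_real (w \<bullet> v) * wave w x)) (at 0)" for x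
    using has_vector_derivative_mult_right[OF cexp_has_vector_derivative[of w x v 0], of c] by simp
  hence "dirderiv v (\<lambda>x. c * wave w x) = (\<lambda>x. c * (\<i> * complex_of_real (w \<bullet> v) * wave w x))" by (intro ext dirderivI)
  hence "diffs (v # vs) (wave w) = (\<lambda>x. (c * (\<i> * complex_of_real (w \<bullet> v))) * wave w x)" using c(2) by (simp add: mult.assoc)
  moreover have "norm (c * (\<i> * complex_of_real (w \<bullet> v))) \<le> norm w ^ length (v # vs)"
  proof -
    have "\<bar>w \<bullet> v\<bar> \<le> norm w" using Cons.prems by (intro Basis_le_norm) auto
    hence "norm c * \<bar>w \<bullet> v\<bar> \<le> norm w ^ length vs * norm w" using c(1) by (intro mult_mono) auto
    thus ?thesis by (simp add: norm_mult mult.commute)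
  qed
  ultimately show ?case by blast
qed (auto intro: exI[of _ 1])

lemma smooth_wave: "smooth (wave w)"
proof (rule smooth_coinduct[where P="\<lambda>f. \<exists>c. f = (\<lambda>x. c * wave w x)"])
  show "\<exists>c. wave w = (\<lambda>x. c * wave w x)" by (rule exI[of _ 1]) simp
next
  fix f assume "\<exists>c. f = (\<lambda>x. c * wave w x)"
  thus "continuous_on UNIV f" by (auto intro!: continuous_intros)
next
  fix f v x assume "\<exists>c. f = (\<lambda>x. c * wave w x)"
  then obtain c where f: "f = (\<lambda>x. c * wave w x)" by blast
  have *: "((\<lambda>t. f (x + t *\<^sub>R v)) has_vector_derivative c * (\<i> * complex_of_real (w \<bullet> v) * wave w x)) (at 0)" for x
    unfolding f using has_vector_derivative_mult_right[OF cexp_has_vector_derivative[of w x v 0], of c] by simp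
  thus "\<exists>d. ((\<lambda>t. f (x + t *\<^sub>R v)) has_vector_derivative d) (at 0)" by blast
  have "dirderiv v f = (\<lambda>x. (c * (\<i> * complex_of_real (w \<bullet> v))) * wave w x)"
    by (intro ext dirderivI) (use * in \<open>simp add: mult.assoc\<close>)
  thus "\<exists>c. dirderiv v f = (\<lambda>x. c * wave w x)" by blast
qed

lemma dbd_wave: "dbd N (\<lambda>x. (1 + norm w) ^ N) (wave w)"
  unfolding dbd_def
proof (intro conjI allI impI smooth_wave)
  fix vs :: "'a list" and x assume vs: "set vs \<subseteq> Basis \<and> length vs \<le> N"
  then obtain c where c: "norm c \<le> norm w ^ length vs" "diffs vs (wave w) = (\<lambda>x. c * wave w x)" using diffs_wave by blast
  have "norm (diffs vs (wave w) x) = norm c" unfolding c(2) by (simp add: norm_mult)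
  also have "\<dots> \<le> norm w ^ length vs" by (rule c(1))
  also have "\<dots> \<le> (1 + norm w) ^ length vs" by (intro power_mono) auto
  also have "\<dots> \<le> (1 + norm w) ^ N" using vs by (intro power_increasing) auto
  finally show "norm (diffs vs (wave w) x) \<le> (1 + norm w) ^ N" .
qed

lemma schwartz_wave_mult: "schwartz f \<Longrightarrow> schwartz (\<lambda>x. wave w x * f x)"
  using schwartz_mult_dbd[of f "wave w"] dbd_wave[of _ w] by (simp add: mult.commute) blast

text \<open>Unlike the contractions of \<open>dbd_affine\<close>, an expansion costs
  \<open>L ^ N\<close> in the derivatives while it only improves the decay; the constant may depend
  on \<open>L\<close> because only membership is asserted.\<close>

lemma schwartz_dilation:
  fixes f :: "'a::euclidean_space \<Rightarrow> 'b::real_normed_vector"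
  assumes f: "schwartz f" and L: "1 \<le> L" shows "schwartz (\<lambda>x. f (L *\<^sub>R x))"
proof (rule schwartzI)
  fix N M
  obtain C where C: "C \<ge> 0" "dbd N (\<lambda>x. C / (1 + norm x) ^ M) f" using schwartz_dbd[OF f] by blast
  have "norm (diffs vs (\<lambda>x. f (L *\<^sub>R x)) x) \<le> L ^ N * C / (1 + norm x) ^ M" if vs: "set vs \<subseteq> Basis" "length vs \<le> N" for vs x
  proof -
    have "norm (diffs vs (\<lambda>x. f (L *\<^sub>R x)) x) = L ^ length vs * norm (diffs vs f (L *\<^sub>R x))"
      using diffs_affine[OF schwartz_smooth[OF f] vs(1), of L 0] L by simp
    also have "\<dots> \<le> L ^ N * (C / (1 + norm (L *\<^sub>R x)) ^ M)"
      using L vs by (intro mult_mono power_increasing dbdD[OF C(2)]) auto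
    also have "\<dots> \<le> L ^ N * (C / (1 + norm x) ^ M)"
    proof (intro mult_left_mono divide_left_mono power_mono mult_pos_pos zero_less_power)
      show "1 + norm x \<le> 1 + norm (L *\<^sub>R x)" using L mult_right_mono[of 1 L "norm x"] by simp
    qed (use C(1) L in \<open>auto simp: add_pos_nonneg\<close>)
    finally show ?thesis by simp
  qed
  moreover have "smooth (\<lambda>x. f (L *\<^sub>R x))" using smooth_affine[OF schwartz_smooth[OF f], of L 0] by simp
  ultimately show "\<exists>C. dbd N (\<lambda>x. C / (1 + norm x) ^ M) (\<lambda>x. f (L *\<^sub>R x))" unfolding dbd_def by blast
qed

lemma schwartz_sum:
  fixes f :: "'i \<Rightarrow> 'a::euclidean_space \<Rightarrow> 'b::real_normed_vector"
  assumes "finite I" "\<And>i. i \<in> I \<Longrightarrow> schwartz (f i)"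
  shows "schwartz (\<lambda>x. \<Sum>i\<in>I. f i x)"
proof (rule schwartzI)
  fix N M
  have "\<forall>i\<in>I. \<exists>C. dbd N (\<lambda>x. C / (1 + norm x) ^ M) (f i)" using schwartz_dbd[OF assms(2)] by metis
  then obtain C where C: "\<And>i. i \<in> I \<Longrightarrow> dbd N (\<lambda>x. C i / (1 + norm x) ^ M) (f i)" by metis
  have "norm (diffs vs (\<lambda>x. \<Sum>i\<in>I. f i x) x) \<le> (\<Sum>i\<in>I. C i) / (1 + norm x) ^ M" if "set vs \<subseteq> Basis" "length vs \<le> N" for vs x
    using diffs_sum[of I f vs] dbdD[OF C that] that schwartz_smooth[OF assms(2)]
    by (simp add: sum_divide_distrib sum_norm_le)
  thus "\<exists>C. dbd N (\<lambda>x. C / (1 + norm x) ^ M) (\<lambda>x. \<Sum>i\<in>I. f i x)"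
    unfolding dbd_def using smooth_sum[of I f] schwartz_smooth[OF assms(2)] by blast
qed

lemma fourier_wave_mult: "fourier (\<lambda>t. wave a t * f t) \<xi> = fourier f (\<xi> - a)"
proof -
  have "wave (- \<xi>) t * (wave a t * f t) = wave (- (\<xi> - a)) t * f t" for t
  proof -
    have "wave (- (\<xi> - a)) t = wave (- \<xi>) t * wave a t" unfolding wave_add_left[symmetric] by simp
    thus ?thesis by (simp only: mult.assoc)
  qed
  thus ?thesis unfolding fourier_wave by (simp only:)
qed

lemma fourier_dilation_eq_0:
  fixes f :: "real^'n \<Rightarrow> complex"
  assumes L: "L > 0" and "fourier f ((1 / L) *\<^sub>R \<xi>) = 0"
  shows "fourier (\<lambda>t. f (L *\<^sub>R t - b)) \<xi> = 0"
proof -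
  have "fourier (\<lambda>t. f (L *\<^sub>R t - b)) \<xi> = \<bar>1 / L\<bar> ^ DIM(real^'n) *\<^sub>R (\<integral>s. wave (- \<xi>) ((1 / L) *\<^sub>R s + (1 / L) *\<^sub>R b) * f (L *\<^sub>R ((1 / L) *\<^sub>R s + (1 / L) *\<^sub>R b) - b) \<partial>lborel)"
    unfolding fourier_wave using L by (intro integral_affine) auto
  also have "(\<lambda>s. wave (- \<xi>) ((1 / L) *\<^sub>R s + (1 / L) *\<^sub>R b) * f (L *\<^sub>R ((1 / L) *\<^sub>R s + (1 / L) *\<^sub>R b) - b))
    = (\<lambda>s. wave (- \<xi>) ((1 / L) *\<^sub>R b) * (wave (- ((1 / L) *\<^sub>R \<xi>)) s * f s))"
  proof
    fix s
    have 1: "L *\<^sub>R ((1 / L) *\<^sub>R s + (1 / L) *\<^sub>R b) - b = s" using L by (simp add: algebra_simps)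
    have 2: "wave (- \<xi>) ((1 / L) *\<^sub>R s + (1 / L) *\<^sub>R b) = wave (- \<xi>) ((1 / L) *\<^sub>R b) * wave (- ((1 / L) *\<^sub>R \<xi>)) s"
      unfolding wave_add_right by simp
    show "wave (- \<xi>) ((1 / L) *\<^sub>R s + (1 / L) *\<^sub>R b) * f (L *\<^sub>R ((1 / L) *\<^sub>R s + (1 / L) *\<^sub>R b) - b) = wave (- \<xi>) ((1 / L) *\<^sub>R b) * (wave (- ((1 / L) *\<^sub>R \<xi>)) s * f s)"
      unfolding 1 2 by (simp only: mult.assoc)
  qed
  also have "(\<integral>s. wave (- \<xi>) ((1 / L) *\<^sub>R b) * (wave (- ((1 / L) *\<^sub>R \<xi>)) s * f s) \<partial>lborel) = wave (- \<xi>) ((1 / L) *\<^sub>R b) * fourier f ((1 / L) *\<^sub>R \<xi>)"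
    unfolding fourier_wave by (rule integral_mult_right_zero)
  finally show ?thesis using assms(2) by simp
qed

text \<open>For the given \<open>x\<close> the symbol is the constant \<open>c\<close> on the
  spectrum of \<open>f\<close>, so it leaves the integral and Fourier inversion returns
  \<open>f x\<close>. Since \<open>x\<close> is fixed, \<open>c\<close> may depend on it.\<close>

lemma psido_localized:
  fixes f :: "real^'n \<Rightarrow> complex"
  assumes f: "schwartz f" and c: "\<And>\<xi>. fourier f \<xi> \<noteq> 0 \<Longrightarrow> \<sigma> x \<xi> = c"
  shows "psido \<sigma> f x = c * f x"
proof -
  have "exp (\<i> * complex_of_real (x \<bullet> \<xi>)) * \<sigma> x \<xi> * fourier f \<xi> = c * (wave x \<xi> * fourier f \<xi>)" for \<xi>
    using c[of \<xi>] by (cases "fourier f \<xi> = 0") auto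
  hence "psido \<sigma> f x = complex_of_real ((2 * pi) powr (- real CARD('n))) * (\<integral>\<xi>. c * (wave x \<xi> * fourier f \<xi>) \<partial>lborel)"
    unfolding psido_def by (simp only:)
  also have "\<dots> = c * inv_fourier (fourier f) x"
    unfolding inv_fourier_def integral_mult_right_zero by (simp only: mult.left_commute)
  finally show ?thesis by (simp only: schwartz_fourier_inversion[OF f])
qed

lemma norm_lower_bound_near:
  fixes f :: "'a::euclidean_space \<Rightarrow> complex"
  assumes "continuous_on UNIV f" "f x0 \<noteq> 0"
  obtains r c where "0 < r" "r \<le> 1" "0 < c" "\<And>x. norm (x - x0) \<le> r \<Longrightarrow> c \<le> (norm (f x))\<^sup>2"
proof -
  let ?e = "norm (f x0) / 2"
  have "isCont f x0" using assms(1) by (simp add: continuous_on_eq_continuous_at)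
  then obtain d where d: "d > 0" "\<And>x. dist x x0 < d \<Longrightarrow> dist (f x) (f x0) < ?e"
    unfolding continuous_at_eps_delta using assms(2) by (metis half_gt_zero zero_less_norm_iff)
  have "?e\<^sup>2 \<le> (norm (f x))\<^sup>2" if "norm (x - x0) \<le> min (d / 2) 1" for x
  proof (rule power_mono)
    have "dist (f x) (f x0) < ?e" using that d(1) by (intro d(2)) (auto simp: dist_norm)
    hence "norm (f x0 - f x) < ?e" by (simp add: dist_norm norm_minus_commute)
    thus "?e \<le> norm (f x)" using norm_triangle_ineq2[of "f x0" "f x"] by linarith
  qed simp
  thus ?thesis using d(1) assms(2) by (intro that[of "min (d / 2) 1" "?e\<^sup>2"]) auto
qed

lemma integral_ge_on_ball:
  fixes f :: "'a::euclidean_space \<Rightarrow> real"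
  assumes f: "integrable lborel f" "\<And>x. 0 \<le> f x" and r: "0 < r" "\<And>x. norm (x - x0) \<le> r \<Longrightarrow> c \<le> f x"
  shows "c * measure lborel (cball x0 r) \<le> (\<integral>x. f x \<partial>lborel)"
proof -
  have e: "emeasure lborel (cball x0 r) < \<infinity>" by (rule emeasure_lborel_cball_finite)
  have i: "integrable lborel (\<lambda>x. c * indicator (cball x0 r) x)"
    using e by (intro integrable_mult_right integrable_real_indicator) auto
  have "(\<integral>x. c * indicator (cball x0 r) x \<partial>lborel) \<le> (\<integral>x. f x \<partial>lborel)"
    by (rule integral_mono[OF i f(1)]) (use f(2) r(2) in \<open>auto simp: indicator_def dist_norm norm_minus_commute\<close>)
  thus ?thesis by simp
qed

lemma measure_cball_pos: "0 < r \<Longrightarrow> 0 < measure lborel (cball (x0::'a::euclidean_space) r)"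
  using content_cball_pos[of r x0] by simp

text \<open>The points with all coordinates in \<open>{1..M}\<close> are nonzero and have l1-norm at
  most \<open>n M\<close>, so they lie in the ball.\<close>

lemma card_lattice_box:
  assumes "M \<ge> 1" and "real CARD('n) * real M \<le> r"
  shows "M ^ CARD('n) \<le> card {k :: real^'n. (\<forall>i. k $ i \<in> \<int>) \<and> 0 < norm k \<and> norm k \<le> r}"
proof -
  let ?e = "\<lambda>f. (\<chi> i. real (f i)) :: real^'n"
  let ?P = "(UNIV::'n set) \<rightarrow>\<^sub>E {1..M}"
  have fin: "finite {k :: real^'n. (\<forall>i. k $ i \<in> \<int>) \<and> 0 < norm k \<and> norm k \<le> r}"
    by (rule finite_subset[OF _ finite_lat[of r]]) (auto simp: lat_def)
  have "?e ` ?P \<subseteq> {k :: real^'n. (\<forall>i. k $ i \<in> \<int>) \<and> 0 < norm k \<and> norm k \<le> r}"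
  proof clarify
    fix f assume f: "f \<in> ?P"
    hence f1: "1 \<le> f i" "f i \<le> M" for i by (auto simp: PiE_def Pi_def)
    have "norm (?e f) \<le> (\<Sum>i\<in>UNIV. \<bar>?e f $ i\<bar>)" by (rule norm_le_l1_cart)
    also have "\<dots> \<le> (\<Sum>i\<in>(UNIV::'n set). real M)" using f1(2) by (intro sum_mono) simp
    also have "\<dots> \<le> r" using assms(2) by simp
    finally have 1: "norm (?e f) \<le> r" .
    \<comment> \<open>\<open>undefined\<close> stands for an arbitrary coordinate; all coordinates
      are at least 1.\<close>
    have "?e f $ undefined \<noteq> 0" using f1(1)[of undefined] by simp
    hence "?e f \<noteq> 0" by (metis zero_index)
    thus "(\<forall>i. ?e f $ i \<in> \<int>) \<and> 0 < norm (?e f) \<and> norm (?e f) \<le> r" using 1 by simp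
  qed
  hence "card (?e ` ?P) \<le> card {k :: real^'n. (\<forall>i. k $ i \<in> \<int>) \<and> 0 < norm k \<and> norm k \<le> r}"
    by (rule card_mono[OF fin])
  moreover have "card (?e ` ?P) = card ?P"
    by (rule card_image) (auto simp: inj_on_def vec_eq_iff fun_eq_iff)
  moreover have "card ?P = M ^ CARD('n)" by (simp add: card_PiE)
  ultimately show ?thesis by simp
qed

lemma lattice_dist_ge_1:
  assumes "k \<in> lat L" "k' \<in> lat L'" "k \<noteq> (k' :: real^'n)" shows "1 \<le> norm (k - k')"
proof -
  obtain i where i: "k $ i \<noteq> k' $ i" using assms(3) by (auto simp: vec_eq_iff)
  have "(k - k') $ i \<in> \<int>" using assms by (auto simp: lat_def)
  moreover have "(k - k') $ i \<noteq> 0" using i by simp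
  ultimately have "1 \<le> \<bar>(k - k') $ i\<bar>" by (rule Ints_nonzero_abs_ge1)
  thus ?thesis using component_le_norm_cart[of "k - k'" i] by linarith
qed

locale wave_symbol_normalized = wave_symbol \<phi> \<eta> m \<delta> j0
  for \<phi> \<eta> :: "real^'n \<Rightarrow> real" and m \<delta> :: real and j0 :: nat +
  assumes j0': "1 + 2 powr (real j0 * (\<delta> - 1) + 1) \<le> 2 powr (1 / 4)"
    and \<eta>_one: "\<And>\<xi>. 2 powr (- 1 / 4) \<le> norm \<xi> \<Longrightarrow> norm \<xi> \<le> 2 powr (1 / 4) \<Longrightarrow> \<eta> \<xi> = 1"
    and integral_\<phi>: "(\<integral>\<xi>. \<phi> \<xi> \<partial>lborel) = 1"
begin

text \<open>The relative radius of the ball around \<open>ctr J\<close> on which the dilated cut-off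
  equals 1; both conditions on \<open>j0\<close> are stated in terms of this number.\<close>

definition \<kappa> :: real where "\<kappa> = 2 powr (real j0 * (\<delta> - 1) + 1)"

lemma lam_sq_le_\<kappa>: "j0 \<le> j \<Longrightarrow> 2 * lam j ^ 2 \<le> \<kappa> * 2 ^ j"
proof -
  assume j: "j0 \<le> j"
  have "2 * lam j ^ 2 = 2 powr (real j * \<delta> + 1)" by (simp add: lam_sq powr_add)
  also have "\<dots> = 2 powr (real j * (\<delta> - 1) + 1) * 2 ^ j"
  proof -
    have "2 ^ j = 2 powr real j" by (simp add: powr_realpow)
    thus ?thesis by (simp add: powr_add[symmetric] algebra_simps)
  qed
  also have "\<dots> \<le> \<kappa> * 2 ^ j"
    unfolding \<kappa>_def using j \<delta> by (intro mult_right_mono powr_mono add_right_mono mult_right_mono_neg) auto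
  finally show ?thesis .
qed

text \<open>A vector of length \<open>2^J\<close> on an arbitrary coordinate axis, in the middle of
  the region where the \<open>J\<close>-th cut-off equals 1.\<close>

definition ctr :: "nat \<Rightarrow> real^'n" where "ctr J = 2 ^ J *\<^sub>R axis undefined 1"

lemma norm_ctr: "norm (ctr J) = 2 ^ J"
  by (simp add: ctr_def norm_axis_1)

lemma \<eta>_eq_1:
  assumes "norm (w - ctr J) \<le> \<kappa> * 2 ^ J" shows "\<eta> (dil J *\<^sub>R w) = 1"
proof (rule \<eta>_one)
  have n: "norm (dil J *\<^sub>R w) = norm w / 2 ^ J" using dil[of J] by simp
  have "norm w \<le> norm (w - ctr J) + norm (ctr J)" using norm_triangle_ineq[of "w - ctr J" "ctr J"] by simp
  hence "norm w \<le> (1 + \<kappa>) * 2 ^ J" using assms by (simp add: norm_ctr algebra_simps)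
  hence "norm w / 2 ^ J \<le> 1 + \<kappa>" by (simp add: divide_le_eq)
  thus "norm (dil J *\<^sub>R w) \<le> 2 powr (1 / 4)" unfolding n using j0' by (simp add: \<kappa>_def)
  have "norm (ctr J) \<le> norm w + norm (w - ctr J)" using norm_triangle_ineq4[of w "w - ctr J"] by simp
  hence "(1 - \<kappa>) * 2 ^ J \<le> norm w" using assms by (simp add: norm_ctr algebra_simps)
  hence "1 - \<kappa> \<le> norm w / 2 ^ J" by (simp add: le_divide_eq)
  thus "2 powr (- 1 / 4) \<le> norm (dil J *\<^sub>R w)" unfolding n using j0 by (simp add: \<kappa>_def)
qed

lemma \<eta>_eq_0:
  assumes "norm w > 142 / 100 * 2 ^ j \<or> norm w < 7 / 10 * 2 ^ j" shows "\<eta> (dil j *\<^sub>R w) = 0"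
proof (rule ccontr)
  assume "\<eta> (dil j *\<^sub>R w) \<noteq> 0"
  hence "7 / 10 \<le> norm (dil j *\<^sub>R w)" "norm (dil j *\<^sub>R w) \<le> 142 / 100"
    using diffs_\<eta>_supp[of "[]" "dil j *\<^sub>R w"] by auto
  from dil_norm_bounds[OF this] assms show False by linarith
qed

text \<open>If, over the spectra of the packets, the cut-off is 1 at scale \<open>J\<close> and 0 at
  every other scale, it disappears from the oscillatory integrals and the series collapses to one
  packet sum.\<close>

lemma T_localized:
  assumes J: "j0 \<le> J" and s: "0 \<le> s" "s \<le> 1"
    and loc: "\<And>j k \<omega>. j0 \<le> j \<Longrightarrow> k \<in> K j \<Longrightarrow> \<phi> (\<omega> - k) \<noteq> 0 \<Longrightarrow> \<eta> (dil j *\<^sub>R (\<xi> + (s * lam j) *\<^sub>R \<omega>)) = (if j = J then 1 else 0)"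
  shows "T s [] [] (x, \<xi>) = complex_of_real (2 powr (real J * m)) * packet J x"
proof -
  have e: "complex_of_real (\<phi> (\<omega> - k)) * complex_of_real (\<eta> (dil j *\<^sub>R \<xi> + (dil j * (s * lam j)) *\<^sub>R \<omega>)) = (if j = J then complex_of_real (\<phi> (\<omega> - k)) else 0)"
    if "j0 \<le> j" "k \<in> K j" for j k \<omega>
    using loc[OF that, of \<omega>] by (cases "\<phi> (\<omega> - k) = 0") (auto simp: scaleR_add_right)
  have osc: "osc \<phi> \<eta> (lam j) (dil j) (dil j * (s * lam j)) k [] [] (x, \<xi>) = (if j = J then complex_of_real (cpi TYPE('n)) * (wave k (lam j *\<^sub>R x - k) * \<Phi> (lam j *\<^sub>R x - k)) else 0)"
    if "j0 \<le> j" "k \<in> K j" for j k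
  proof -
    have "osc \<phi> \<eta> (lam j) (dil j) (dil j * (s * lam j)) k [] [] (x, \<xi>)
      = (\<integral>\<omega>. wave (lam j *\<^sub>R x - k) \<omega> * (complex_of_real (\<phi> (\<omega> - k)) * complex_of_real (\<eta> (dil j *\<^sub>R \<xi> + (dil j * (s * lam j)) *\<^sub>R \<omega>))) \<partial>lborel)"
      unfolding osc_def by simp
    also have "\<dots> = (\<integral>\<omega>. wave (lam j *\<^sub>R x - k) \<omega> * (if j = J then complex_of_real (\<phi> (\<omega> - k)) else 0) \<partial>lborel)"
      unfolding e[OF that] ..
    finally show ?thesis using integral_wave_shifted_\<phi>[of "lam j *\<^sub>R x - k" k] by (cases "j = J") auto
  qed
  have F: "F s [] [] j (x, \<xi>) = (if j = J then complex_of_real (2 powr (real J * m)) * packet J x else 0)" for j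
  proof (cases "j0 \<le> j")
    case True
    have "(\<Sum>k\<in>K j. osc \<phi> \<eta> (lam j) (dil j) (dil j * (s * lam j)) k [] [] (x, \<xi>))
      = (\<Sum>k\<in>K j. if j = J then complex_of_real (cpi TYPE('n)) * (wave k (lam j *\<^sub>R x - k) * \<Phi> (lam j *\<^sub>R x - k)) else 0)"
      by (intro sum.cong refl osc True)
    also have "\<dots> = (if j = J then complex_of_real (cpi TYPE('n)) * packet J x else 0)"
      by (simp add: packet_def sum_distrib_left)
    finally show ?thesis unfolding F_def using True by simp
  qed (use J in \<open>auto simp: F_def\<close>)
  have "T s [] [] (x, \<xi>) = (\<Sum>j\<in>{J}. F s [] [] j (x, \<xi>))"
    unfolding T_def by (rule suminf_finite) (auto simp: F)
  thus ?thesis by (simp add: F)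
qed

section \<open>The test functions and their spectra\<close>

definition piece :: "nat \<Rightarrow> real^'n \<Rightarrow> real^'n \<Rightarrow> complex" where
  "piece J k x = wave k (lam J *\<^sub>R x - k) * \<Phi> (lam J *\<^sub>R x - k)"

lemma packet_piece: "packet J = (\<lambda>x. \<Sum>k\<in>K J. piece J k x)"
  by (auto simp: packet_def piece_def)

lemma fourier_\<Phi>: "fourier \<Phi> \<xi> = complex_of_real (\<phi> \<xi>)"
  unfolding \<Phi>_def schwartz_fourier_inv_fourier[OF schwartz_of_real[OF \<phi>]] ..

lemma schwartz_piece: "schwartz (piece J k)"
proof -
  have "schwartz (\<lambda>x. wave k (x + - k) * \<Phi> (x + - k))"
    by (rule schwartz_shift[OF schwartz_wave_mult[OF schwartz_\<Phi>]])
  from schwartz_dilation[OF this lam_ge_1] show ?thesis unfolding piece_def[abs_def] by simp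
qed

lemma schwartz_packet: "schwartz (packet J)"
  unfolding packet_piece by (intro schwartz_sum finite_K schwartz_piece)

lemma fourier_piece_eq_0: "\<phi> ((1 / lam J) *\<^sub>R \<xi> - k) = 0 \<Longrightarrow> fourier (piece J k) \<xi> = 0"
  unfolding piece_def[abs_def] using lam_ge_1[of J]
  by (intro fourier_dilation_eq_0[where f="\<lambda>x. wave k x * \<Phi> x"]) (auto simp: fourier_wave_mult fourier_\<Phi>)

lemma fourier_packet_eq_0:
  assumes "\<And>k. k \<in> K J \<Longrightarrow> \<phi> ((1 / lam J) *\<^sub>R \<xi> - k) = 0" shows "fourier (packet J) \<xi> = 0"
proof -
  have "fourier (packet J) \<xi> = (\<Sum>k\<in>K J. fourier (piece J k) \<xi>)"
    unfolding packet_piece fourier_wave sum_distrib_left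
    by (intro Bochner_Integration.integral_sum integrable_wave schwartz_integrable schwartz_piece)
  also have "\<dots> = 0" using fourier_piece_eq_0 assms by simp
  finally show ?thesis .
qed

definition fJ :: "nat \<Rightarrow> real^'n \<Rightarrow> complex" where "fJ J x = wave (ctr J) x * packet J x"

text \<open>The square of \<open>\<Phi>\<close> makes the pairing an integral of
  \<open>packet J\<close> times \<open>\<Phi>\<close> in absolute value squared, to which Parseval
  can be applied piece by piece.\<close>

definition gJ :: "nat \<Rightarrow> real^'n \<Rightarrow> complex" where "gJ J x = wave (ctr J) x * (\<Phi> x * \<Phi> x)"

lemma schwartz_fJ: "schwartz (fJ J)"
  unfolding fJ_def[abs_def] by (intro schwartz_wave_mult schwartz_packet)

lemma schwartz_gJ: "schwartz (gJ J)"
  unfolding gJ_def[abs_def] by (intro schwartz_wave_mult schwartz_mult schwartz_\<Phi>)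

lemma fourier_fJ_supp:
  assumes "fourier (fJ J) \<xi> \<noteq> 0" shows "norm (\<xi> - ctr J) \<le> 2 * lam J ^ 2"
proof -
  have "fourier (packet J) (\<xi> - ctr J) \<noteq> 0" using assms unfolding fJ_def[abs_def] fourier_wave_mult .
  then obtain k where k: "k \<in> K J" "\<phi> ((1 / lam J) *\<^sub>R (\<xi> - ctr J) - k) \<noteq> 0" using fourier_packet_eq_0 by blast
  from freq_le[OF this] show ?thesis using lam_ge_1[of J] by simp
qed

text \<open>Two spectra of radius 1/8 add up to radius 1/4.\<close>

lemma fourier_gJ_supp:
  assumes "fourier (gJ J) \<xi> \<noteq> 0" shows "norm (\<xi> - ctr J) \<le> 1 / 4"
proof (rule ccontr)
  assume "\<not> norm (\<xi> - ctr J) \<le> 1 / 4"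
  hence "fourier (\<lambda>x. inv_fourier (\<lambda>\<zeta>. complex_of_real (\<phi> \<zeta>)) x * \<Phi> x) (\<xi> - ctr J) = 0"
    by (intro fourier_mult_support[where a=0 and b=0 and r="1/8" and s="1/8"] schwartz_integrable schwartz_of_real \<phi> schwartz_\<Phi>)
       (auto simp: fourier_\<Phi> \<phi>_supp)
  moreover have "fourier (gJ J) \<xi> = fourier (\<lambda>x. \<Phi> x * \<Phi> x) (\<xi> - ctr J)"
    unfolding gJ_def[abs_def] by (rule fourier_wave_mult)
  ultimately show False using assms unfolding \<Phi>_def by simp
qed

text \<open>On the spectrum of \<open>fJ J\<close> the norm of \<xi> lies between 0.84 and 1.16
  times \<open>2^J\<close>. The annulus of the scale below ends at 0.71 times \<open>2^J\<close> and
  that of the scale above begins at 1.4 times \<open>2^J\<close>, so only \<open>J\<close>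
  contributes, with cut-off equal to 1.\<close>

lemma psido_sigma_fJ:
  assumes J: "j0 \<le> J"
  shows "psido (sigma_delta \<phi> \<eta> m \<delta> j0) (fJ J) x = complex_of_real (2 powr (real J * m)) * cnj (packet J x) * fJ J x"
proof (rule psido_localized[OF schwartz_fJ])
  fix \<xi> assume "fourier (fJ J) \<xi> \<noteq> 0"
  hence d: "norm (\<xi> - ctr J) \<le> 2 * lam J ^ 2" by (rule fourier_fJ_supp)
  hence d1: "norm (\<xi> - ctr J) \<le> \<kappa> * 2 ^ J" and d2: "norm (\<xi> - ctr J) \<le> 16 / 100 * 2 ^ J"
    using lam_sq_le_\<kappa>[OF J] lam_sq_le[OF J] by linarith+
  have n: "norm \<xi> \<le> 116 / 100 * 2 ^ J" "84 / 100 * 2 ^ J \<le> norm \<xi>"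
    using norm_triangle_ineq[of "\<xi> - ctr J" "ctr J"] norm_triangle_ineq4[of \<xi> "\<xi> - ctr J"] d2 norm_ctr[of J] by auto
  have "\<eta> (dil j *\<^sub>R (\<xi> + (0 * lam j) *\<^sub>R \<omega>)) = (if j = J then 1 else 0)" for j \<omega>
  proof (cases j J rule: linorder_cases)
    case less
    hence "(2::real) ^ Suc j \<le> 2 ^ J" by (intro power_increasing) auto
    hence "2 * 2 ^ j \<le> (2::real) ^ J" by simp
    moreover have "(0::real) < 2 ^ j" by simp
    ultimately have "norm \<xi> > 142 / 100 * 2 ^ j" using n(2) by linarith
    thus ?thesis using less by (simp add: \<eta>_eq_0)
  next
    case equal
    thus ?thesis using \<eta>_eq_1[OF d1] by simp
  next
    case greater
    hence "(2::real) ^ Suc J \<le> 2 ^ j" by (intro power_increasing) auto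
    hence "2 * 2 ^ J \<le> (2::real) ^ j" by simp
    moreover have "(0::real) < 2 ^ J" by simp
    ultimately have "norm \<xi> < 7 / 10 * 2 ^ j" using n(1) by linarith
    thus ?thesis using greater by (simp add: \<eta>_eq_0)
  qed
  from T_localized[OF J _ _ this, of x]
  show "sigma_delta \<phi> \<eta> m \<delta> j0 x \<xi> = complex_of_real (2 powr (real J * m)) * cnj (packet J x)"
    unfolding sigma_delta_eq by simp
qed

text \<open>The cut-off is now evaluated at the shifted point, whose distance from
  \<open>ctr J\<close> is at most 1/4 plus 0.16 times \<open>2^j\<close>. The scale \<open>J\<close>
  must be at least 2: for \<open>j > J\<close> one needs \<open>1/4 < 0.04 * 2^j\<close>, which
  holds since then \<open>2^j \<ge> 8\<close>.\<close>

lemma psido_adjoint_gJ: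
  assumes J: "j0 \<le> J" "2 \<le> J"
  shows "psido (\<lambda>x \<xi>. T 1 [] [] (x, \<xi>)) (gJ J) x = complex_of_real (2 powr (real J * m)) * packet J x * gJ J x"
proof (rule psido_localized[OF schwartz_gJ])
  fix \<xi> assume "fourier (gJ J) \<xi> \<noteq> 0"
  hence d: "norm (\<xi> - ctr J) \<le> 1 / 4" by (rule fourier_gJ_supp)
  have J4: "(4::real) \<le> 2 ^ J" using power_increasing[OF J(2), of "2::real"] by simp
  have "\<eta> (dil j *\<^sub>R (\<xi> + (1 * lam j) *\<^sub>R \<omega>)) = (if j = J then 1 else 0)" if j: "j0 \<le> j" and k: "k \<in> K j" "\<phi> (\<omega> - k) \<noteq> 0" for j k \<omega>
  proof -
    let ?w = "\<xi> + (1 * lam j) *\<^sub>R \<omega>"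
    have l: "norm ((1 * lam j) *\<^sub>R \<omega>) \<le> 16 / 100 * 2 ^ j" by (rule scaled_freq_le[OF _ _ j k]) auto
    have "?w - ctr J = (\<xi> - ctr J) + (1 * lam j) *\<^sub>R \<omega>" by simp
    hence dw: "norm (?w - ctr J) \<le> 1 / 4 + norm ((1 * lam j) *\<^sub>R \<omega>)"
      using norm_triangle_ineq[of "\<xi> - ctr J" "(1 * lam j) *\<^sub>R \<omega>"] d by (simp only:)
    have n: "norm ?w \<le> 2 ^ J + norm (?w - ctr J)" "2 ^ J \<le> norm ?w + norm (?w - ctr J)"
      using norm_triangle_ineq[of "ctr J" "?w - ctr J"] norm_triangle_ineq4[of ?w "?w - ctr J"] norm_ctr[of J] by auto
    show ?thesis
    proof (cases j J rule: linorder_cases)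
      case less
      hence "(2::real) ^ Suc j \<le> 2 ^ J" by (intro power_increasing) auto
      hence "2 * 2 ^ j \<le> (2::real) ^ J" by simp
      moreover have "(1::real) \<le> 2 ^ j" by simp
      ultimately have "norm ?w > 142 / 100 * 2 ^ j" using n(2) dw l by linarith
      thus ?thesis using less \<eta>_eq_0[of j ?w] by simp
    next
      case equal
      have "norm (\<omega> - k) \<le> 1 / 8" using \<phi>_supp k(2) not_less by blast
      moreover have "norm \<omega> \<le> norm (\<omega> - k) + norm k" using norm_triangle_ineq[of "\<omega> - k" k] by simp
      \<comment> \<open>\<open>freq_le\<close> would already use up all of
        \<open>2 * lam j ^ 2\<close>; this sharper bound leaves room for the offset 1/4 of \<xi>
        from \<open>ctr J\<close>.\<close>
      ultimately have "norm \<omega> \<le> lam j + 1 / 8" using norm_K[OF k(1)] by linarith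
      hence "lam j * norm \<omega> \<le> lam j * (lam j + 1 / 8)" using lam_ge_1[of j] by (intro mult_left_mono) auto
      hence "norm ((1 * lam j) *\<^sub>R \<omega>) \<le> lam j ^ 2 + lam j / 8" using lam_ge_1[of j] by (simp add: power2_eq_square algebra_simps)
      moreover have "1 \<le> lam j ^ 2" "lam j \<le> lam j ^ 2" using one_le_power[OF lam_ge_1[of j], of 2] lam_ge_1[of j] by (simp_all add: power2_eq_square)
      ultimately have "norm (?w - ctr J) \<le> 2 * lam j ^ 2" using dw by linarith
      also have "\<dots> \<le> \<kappa> * 2 ^ J" using lam_sq_le_\<kappa>[OF j] equal by simp
      finally show ?thesis using \<eta>_eq_1[of ?w J] equal by simp
    next
      case greater
      hence "(2::real) ^ Suc J \<le> 2 ^ j" by (intro power_increasing) auto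
      hence "2 * 2 ^ J \<le> (2::real) ^ j" by simp
      hence "norm ?w < 7 / 10 * 2 ^ j" using n(1) dw l J4 by linarith
      thus ?thesis using greater \<eta>_eq_0[of j ?w] by simp
    qed
  qed
  from T_localized[OF J(1) _ _ this, where x=x]
  show "T 1 [] [] (x, \<xi>) = complex_of_real (2 powr (real J * m)) * packet J x" by simp
qed

section \<open>Lower bound for the pairing\<close>

lemma pieces_orthogonal:
  assumes "k \<in> K J" "k' \<in> K J" "k \<noteq> k'"
  shows "(\<integral>x. (\<Phi> x * piece J k x) * cnj (\<Phi> x * piece J k' x) \<partial>lborel) = 0"
proof -
  let ?l = "lam J"
  \<comment> \<open>Multiplication by \<open>\<Phi>\<close> enlarges the spectral radius from
    \<open>?l / 8\<close> to \<open>1 / 8 + ?l / 8\<close>, which is at most \<open>?l / 4\<close>.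
    The centres are at least \<open>?l\<close> apart, so the spectra of different pieces are
    disjoint.\<close>
  have z: "fourier (\<lambda>x. \<Phi> x * piece J k x) \<xi> = 0" if "norm (\<xi> - ?l *\<^sub>R k) > ?l / 4" for k \<xi>
  proof -
    have "fourier (\<lambda>x. inv_fourier (\<lambda>\<zeta>. complex_of_real (\<phi> \<zeta>)) x * piece J k x) \<xi> = 0"
    proof (rule fourier_mult_support[where a=0 and b="?l *\<^sub>R k" and r="1/8" and s="?l/8"])
      show "fourier (piece J k) \<omega> = 0" if "norm (\<omega> - ?l *\<^sub>R k) > ?l / 8" for \<omega>
      proof (rule fourier_piece_eq_0, rule \<phi>_supp)
        have "\<omega> - ?l *\<^sub>R k = ?l *\<^sub>R ((1 / ?l) *\<^sub>R \<omega> - k)" using lam_ge_1[of J] by (simp add: algebra_simps)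
        hence "norm (\<omega> - ?l *\<^sub>R k) = ?l * norm ((1 / ?l) *\<^sub>R \<omega> - k)" using lam_ge_1[of J] by simp
        hence "?l * (1 / 8) < ?l * norm ((1 / ?l) *\<^sub>R \<omega> - k)" using that by simp
        thus "1 / 8 < norm ((1 / ?l) *\<^sub>R \<omega> - k)" using lam_ge_1[of J] mult_less_cancel_left_pos[of ?l] by simp
      qed
      show "1 / 8 + ?l / 8 < norm (\<xi> - (0 + ?l *\<^sub>R k))" using that lam_ge_1[of J] by simp
    qed (auto intro: schwartz_integrable schwartz_of_real \<phi> schwartz_piece \<phi>_supp)
    thus ?thesis unfolding \<Phi>_def .
  qed
  have "fourier (\<lambda>x. \<Phi> x * piece J k x) \<xi> * cnj (fourier (\<lambda>x. \<Phi> x * piece J k' x) \<xi>) = 0" for \<xi>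
  proof (cases "norm (\<xi> - ?l *\<^sub>R k) > ?l / 4 \<or> norm (\<xi> - ?l *\<^sub>R k') > ?l / 4")
    case True
    thus ?thesis using z by auto
  next
    case False
    have "?l *\<^sub>R (k - k') = (\<xi> - ?l *\<^sub>R k') - (\<xi> - ?l *\<^sub>R k)" by (simp add: algebra_simps)
    hence "norm (?l *\<^sub>R (k - k')) \<le> norm (\<xi> - ?l *\<^sub>R k') + norm (\<xi> - ?l *\<^sub>R k)" by (metis norm_triangle_ineq4)
    moreover have "norm (?l *\<^sub>R (k - k')) = ?l * norm (k - k')" using lam_ge_1[of J] by simp
    ultimately have "?l * norm (k - k') \<le> ?l / 2" using False by linarith
    moreover have "?l * 1 \<le> ?l * norm (k - k')"
      using lattice_dist_ge_1[of k _ k'] assms K_subset lam_ge_1[of J] by (intro mult_left_mono) auto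
    ultimately show ?thesis using lam_ge_1[of J] by linarith
  qed
  hence "(\<integral>\<xi>. fourier (\<lambda>x. \<Phi> x * piece J k x) \<xi> * cnj (fourier (\<lambda>x. \<Phi> x * piece J k' x) \<xi>) \<partial>lborel) = 0"
    by (simp only: Bochner_Integration.integral_zero)
  thus ?thesis
    using schwartz_parseval[OF schwartz_mult[OF schwartz_\<Phi> schwartz_piece] schwartz_mult[OF schwartz_\<Phi> schwartz_piece], of J k J k'] by simp
qed

text \<open>Because \<open>\<Phi>\<close> is real, the integrand is a square in absolute value. It
  expands into a double sum over the lattice whose off-diagonal terms integrate to 0 by
  orthogonality.\<close>

lemma pairing_eq:
  "(\<integral>x. (packet J x * cnj (packet J x)) * (\<Phi> x * \<Phi> x) \<partial>lborel)
    = complex_of_real (\<Sum>k\<in>K J. \<integral>x. (norm (\<Phi> (lam J *\<^sub>R x - k)))\<^sup>2 * (norm (\<Phi> x))\<^sup>2 \<partial>lborel)"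
proof -
  let ?h = "\<lambda>k k' x. (\<Phi> x * piece J k x) * cnj (\<Phi> x * piece J k' x)"
  have int: "integrable lborel (?h k k')" for k k'
    by (intro schwartz_integrable schwartz_mult schwartz_cnj[OF schwartz_mult, unfolded complex_cnj_mult] schwartz_\<Phi> schwartz_piece)
       (auto intro!: schwartz_cnj schwartz_mult schwartz_\<Phi> schwartz_piece)
  have "(packet J x * cnj (packet J x)) * (\<Phi> x * \<Phi> x) = (\<Sum>k\<in>K J. \<Sum>k'\<in>K J. ?h k k' x)" for x
  proof -
    have "(packet J x * cnj (packet J x)) * (\<Phi> x * \<Phi> x) = (\<Phi> x * packet J x) * cnj (\<Phi> x * packet J x)"
      by (simp add: cnj_\<Phi> mult_ac)
    also have "\<Phi> x * packet J x = (\<Sum>k\<in>K J. \<Phi> x * piece J k x)" by (simp add: packet_piece sum_distrib_left)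
    finally show ?thesis by (simp only: cnj_sum sum_product)
  qed
  hence "(\<integral>x. (packet J x * cnj (packet J x)) * (\<Phi> x * \<Phi> x) \<partial>lborel) = (\<Sum>k\<in>K J. \<Sum>k'\<in>K J. \<integral>x. ?h k k' x \<partial>lborel)"
    using int by simp
  also have "\<dots> = (\<Sum>k\<in>K J. \<Sum>k'\<in>K J. if k' = k then \<integral>x. ?h k k x \<partial>lborel else 0)"
  proof (intro sum.cong refl)
    fix k k' assume "k \<in> K J" "k' \<in> K J"
    thus "(\<integral>x. ?h k k' x \<partial>lborel) = (if k' = k then \<integral>x. ?h k k x \<partial>lborel else 0)"
      using pieces_orthogonal[of k J k'] by (cases "k' = k") (simp_all del: complex_cnj_mult)
  qed
  also have "\<dots> = (\<Sum>k\<in>K J. \<integral>x. ?h k k x \<partial>lborel)"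
    by (simp add: sum.delta finite_K)
  also have "\<dots> = (\<Sum>k\<in>K J. complex_of_real (\<integral>x. (norm (\<Phi> (lam J *\<^sub>R x - k)))\<^sup>2 * (norm (\<Phi> x))\<^sup>2 \<partial>lborel))"
  proof (intro sum.cong refl)
    fix k
    have "?h k k x = complex_of_real ((norm (\<Phi> (lam J *\<^sub>R x - k)))\<^sup>2 * (norm (\<Phi> x))\<^sup>2)" for x
      unfolding complex_norm_square[symmetric] by (simp add: piece_def norm_mult power_mult_distrib mult.commute)
    thus "(\<integral>x. ?h k k x \<partial>lborel) = complex_of_real (\<integral>x. (norm (\<Phi> (lam J *\<^sub>R x - k)))\<^sup>2 * (norm (\<Phi> x))\<^sup>2 \<partial>lborel)"
      by (simp only: integral_complex_of_real)
  qed
  finally show ?thesis by simp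
qed

text \<open>The normalisation of the integral of \<open>\<phi>\<close> enters here: it keeps
  \<open>\<Phi>\<close> away from 0 near the origin, and the lower bound of the pairing rests on
  this.\<close>

lemma \<Phi>_0: "\<Phi> 0 \<noteq> 0"
proof -
  have "(\<integral>\<xi>. complex_of_real (\<phi> \<xi>) \<partial>lborel) = complex_of_real 1"
    unfolding integral_complex_of_real integral_\<phi> ..
  thus ?thesis unfolding \<Phi>_def inv_fourier_wave by simp
qed

text \<open>Each lattice point with \<open>norm k \<le> \<rho> * lam J\<close> contributes at least
  a constant times \<open>lam J powr -n\<close>, and the number of such points is at least a
  constant times \<open>lam J powr n\<close>; the powers cancel.\<close>

lemma pairing_lower_bound:
  obtains c J1 where "c > 0" "\<And>J. J \<ge> J1 \<Longrightarrow> c \<le> (\<Sum>k\<in>K J. \<integral>x. (norm (\<Phi> (lam J *\<^sub>R x - k)))\<^sup>2 * (norm (\<Phi> x))\<^sup>2 \<partial>lborel)"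
proof -
  obtain r c0 where r: "0 < r" "r \<le> 1" "0 < c0" and lb: "\<And>x. norm (x - 0) \<le> r \<Longrightarrow> c0 \<le> (norm (\<Phi> x))\<^sup>2"
    using norm_lower_bound_near[OF schwartz_continuous[OF schwartz_\<Phi>] \<Phi>_0] by blast
  \<comment> \<open>Half of \<open>r\<close>, because \<open>s / lam J\<close> and
    \<open>k / lam J\<close> each take up to \<open>\<rho>\<close> and their sum has to stay in the
    ball where \<open>\<Phi>\<close> is bounded below.\<close>
  define \<rho> where "\<rho> = r / 2"
  define B where "B = c0 * c0 * measure lborel (cball (0::real^'n) \<rho>)"
  have \<rho>: "0 < \<rho>" "\<rho> \<le> 1" using r by (auto simp: \<rho>_def)
  have B: "B > 0" unfolding B_def using r \<rho> measure_cball_pos[of \<rho> "0::real^'n"] by simp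
  let ?n = "real CARD('n)"
  have n: "?n \<ge> 1" by (simp add: Suc_le_eq)
  define I where "I J k = (\<integral>x. (norm (\<Phi> (lam J *\<^sub>R x - k)))\<^sup>2 * (norm (\<Phi> x))\<^sup>2 \<partial>lborel)" for J k
  have I0: "0 \<le> I J k" for J k unfolding I_def by simp
  have IB: "B / lam J ^ CARD('n) \<le> I J k" if k: "norm k \<le> \<rho> * lam J" for J k
  proof -
    let ?l = "lam J"
    have l: "?l \<ge> 1" by (rule lam_ge_1)
    let ?q = "\<lambda>s. (norm (\<Phi> s))\<^sup>2 * (norm (\<Phi> ((1 / ?l) *\<^sub>R s + (1 / ?l) *\<^sub>R k)))\<^sup>2"
    have "I J k = \<bar>1 / ?l\<bar> ^ DIM(real^'n) *\<^sub>R (\<integral>s. (norm (\<Phi> (?l *\<^sub>R ((1 / ?l) *\<^sub>R s + (1 / ?l) *\<^sub>R k) - k)))\<^sup>2 * (norm (\<Phi> ((1 / ?l) *\<^sub>R s + (1 / ?l) *\<^sub>R k)))\<^sup>2 \<partial>lborel)"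
      unfolding I_def using l by (intro integral_affine) auto
    also have "(\<lambda>s. (norm (\<Phi> (?l *\<^sub>R ((1 / ?l) *\<^sub>R s + (1 / ?l) *\<^sub>R k) - k)))\<^sup>2 * (norm (\<Phi> ((1 / ?l) *\<^sub>R s + (1 / ?l) *\<^sub>R k)))\<^sup>2) = ?q"
    proof
      fix s
      have "?l *\<^sub>R ((1 / ?l) *\<^sub>R s + (1 / ?l) *\<^sub>R k) - k = s" using l by (simp add: algebra_simps)
      thus "(norm (\<Phi> (?l *\<^sub>R ((1 / ?l) *\<^sub>R s + (1 / ?l) *\<^sub>R k) - k)))\<^sup>2 * (norm (\<Phi> ((1 / ?l) *\<^sub>R s + (1 / ?l) *\<^sub>R k)))\<^sup>2 = ?q s" by (simp only:)
    qed
    finally have e: "I J k = (1 / ?l) ^ CARD('n) * (\<integral>s. ?q s \<partial>lborel)" using l by simp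
    have iq: "integrable lborel ?q"
    proof -
      obtain C where C: "C \<ge> 0" "dbd 0 (\<lambda>x. C) \<Phi>" using schwartz_bounded[OF schwartz_\<Phi>] by blast
      have i: "integrable lborel (\<lambda>s. norm (\<Phi> s) * (C * C\<^sup>2))"
        by (intro integrable_mult_left integrable_norm schwartz_integrable schwartz_\<Phi>)
      show ?thesis
      proof (rule Bochner_Integration.integrable_bound[OF i])
        have "?q s \<le> norm (\<Phi> s) * (C * C\<^sup>2)" for s
        proof -
          have "(norm (\<Phi> s))\<^sup>2 \<le> norm (\<Phi> s) * C" unfolding power2_eq_square using dbd_bound[OF C(2)] by (intro mult_left_mono) auto
          moreover have "(norm (\<Phi> ((1 / ?l) *\<^sub>R s + (1 / ?l) *\<^sub>R k)))\<^sup>2 \<le> C\<^sup>2" using dbd_bound[OF C(2)] by (intro power_mono) auto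
          ultimately have "?q s \<le> (norm (\<Phi> s) * C) * C\<^sup>2" using C(1) by (intro mult_mono) auto
          thus ?thesis by (simp only: mult.assoc)
        qed
        thus "AE s in lborel. norm (?q s) \<le> norm (norm (\<Phi> s) * (C * C\<^sup>2))"
          using C(1) by (intro AE_I2) (simp add: abs_mult)
      qed measurable
    qed
    have "B \<le> (\<integral>s. ?q s \<partial>lborel)"
      unfolding B_def
    proof (rule integral_ge_on_ball[OF iq _ \<rho>(1)])
      fix s :: "real^'n" assume s: "norm (s - 0) \<le> \<rho>"
      have "norm ((1 / ?l) *\<^sub>R s + (1 / ?l) *\<^sub>R k) \<le> norm s / ?l + norm k / ?l"
        using norm_triangle_ineq[of "(1 / ?l) *\<^sub>R s" "(1 / ?l) *\<^sub>R k"] l by simp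
      also have "norm s / ?l \<le> norm s" using l by (simp add: divide_le_eq mult_le_cancel_left1)
      also have "norm s \<le> \<rho>" using s by simp
      also have "norm k / ?l \<le> \<rho>" using k l by (simp add: divide_le_eq)
      finally have "norm ((1 / ?l) *\<^sub>R s + (1 / ?l) *\<^sub>R k) \<le> r" by (simp add: \<rho>_def)
      hence "c0 \<le> (norm (\<Phi> ((1 / ?l) *\<^sub>R s + (1 / ?l) *\<^sub>R k)))\<^sup>2" by (intro lb) simp
      moreover have "c0 \<le> (norm (\<Phi> s))\<^sup>2" using s r(1) by (intro lb) (simp add: \<rho>_def)
      ultimately show "c0 * c0 \<le> ?q s" using r(3) by (intro mult_mono) auto
    qed simp
    hence "(1 / ?l) ^ CARD('n) * B \<le> I J k" unfolding e using l by (intro mult_left_mono) auto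
    thus ?thesis by (simp add: power_one_over)
  qed
  obtain J1 where J1: "\<And>J. J \<ge> J1 \<Longrightarrow> ?n / \<rho> \<le> lam J"
  proof -
    have "filterlim (\<lambda>J. 2 powr (real J * \<delta> / 2)) at_top sequentially" using \<delta> by real_asymp
    hence "eventually (\<lambda>J. ?n / \<rho> \<le> lam J) sequentially" unfolding lam_def filterlim_at_top by blast
    thus ?thesis using that unfolding eventually_sequentially by blast
  qed
  show ?thesis
  proof (rule that[of "B * (\<rho> / (2 * ?n)) ^ CARD('n)" J1])
    show "B * (\<rho> / (2 * ?n)) ^ CARD('n) > 0" using B \<rho> n by simp
    fix J assume "J \<ge> J1"
    hence lJ: "?n / \<rho> \<le> lam J" by (rule J1)
    let ?a = "\<rho> * lam J / ?n"
    have a1: "1 \<le> ?a" using lJ \<rho> n by (simp add: divide_le_eq le_divide_eq mult.commute)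
    \<comment> \<open>Since \<open>?a \<ge> 1\<close>, rounding down loses at most a factor 2, so
      the box still contains a fixed multiple of \<open>lam J ^ n\<close> points.\<close>
    define M where "M = nat \<lfloor>?a\<rfloor>"
    have rM: "real M = real_of_int \<lfloor>?a\<rfloor>" unfolding M_def using a1 by simp
    have "1 \<le> \<lfloor>?a\<rfloor>" using a1 by (simp only: le_floor_iff of_int_1)
    hence f1: "1 \<le> real_of_int \<lfloor>?a\<rfloor>" by linarith
    have f2: "real_of_int \<lfloor>?a\<rfloor> \<le> ?a" "?a < real_of_int \<lfloor>?a\<rfloor> + 1" using floor_correct[of ?a] by auto
    have "1 \<le> real M" unfolding rM by (rule f1)
    hence M1: "M \<ge> 1" by simp
    have M: "M \<ge> 1" "real M \<le> ?a" "?a / 2 \<le> real M"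
    proof -
      have "b / 2 \<le> c" if "1 \<le> c" "b < c + 1" for b c :: real using that by simp
      from this[OF f1 f2(2)] show "M \<ge> 1" "real M \<le> ?a" "?a / 2 \<le> real M" using M1 f2(1) unfolding rM by simp_all
    qed
    let ?S = "{k :: real^'n. (\<forall>i. k $ i \<in> \<int>) \<and> 0 < norm k \<and> norm k \<le> \<rho> * lam J}"
    have "?n * real M \<le> \<rho> * lam J" using M(2) n by (simp add: le_divide_eq mult.commute)
    from card_lattice_box[OF M(1) this] have "real (M ^ CARD('n)) \<le> real (card ?S)" by (simp only: of_nat_le_iff)
    have "(?a / 2) ^ CARD('n) \<le> real M ^ CARD('n)" using a1 by (intro power_mono M(3)) auto
    also have "\<dots> = real (M ^ CARD('n))" by simp
    also have "\<dots> \<le> real (card ?S)" by fact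
    finally have cS: "(?a / 2) ^ CARD('n) \<le> real (card ?S)" .
    have S: "?S \<subseteq> K J"
    proof -
      have "\<rho> * lam J \<le> lam J" using \<rho> lam_ge_1[of J] by (simp add: mult_le_cancel_right1)
      thus ?thesis unfolding K_def by auto
    qed
    have l0: "lam J > 0" using lam_ge_1[of J] by linarith
    have "B * (\<rho> / (2 * ?n)) ^ CARD('n) = (?a / 2) ^ CARD('n) * (B / lam J ^ CARD('n))"
      using l0 n by (simp add: power_mult_distrib power_divide mult.commute)
    also have "\<dots> \<le> real (card ?S) * (B / lam J ^ CARD('n))" using cS B l0 by (intro mult_right_mono) auto
    also have "\<dots> = (\<Sum>k\<in>?S. B / lam J ^ CARD('n))" by simp
    also have "\<dots> \<le> (\<Sum>k\<in>?S. I J k)" by (intro sum_mono IB) auto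
    also have "\<dots> \<le> (\<Sum>k\<in>K J. I J k)" using S I0 by (intro sum_mono2 finite_K) auto
    finally show "B * (\<rho> / (2 * ?n)) ^ CARD('n) \<le> (\<Sum>k\<in>K J. \<integral>x. (norm (\<Phi> (lam J *\<^sub>R x - k)))\<^sup>2 * (norm (\<Phi> x))\<^sup>2 \<partial>lborel)"
      unfolding I_def .
  qed
qed

end


section \<open>Unboundedness\<close>


lemma window_norm_pos:
  fixes \<gamma> :: "real^'n \<Rightarrow> complex"
  assumes \<gamma>: "schwartz \<gamma>" "\<gamma> \<noteq> (\<lambda>_. 0)"
  shows "0 < (\<integral>x. (norm (\<gamma> x))\<^sup>2 \<partial>lborel)"
proof -
  obtain x0 where "\<gamma> x0 \<noteq> 0" using \<gamma>(2) by blast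
  then obtain r c where r: "0 < r" "0 < c" "\<And>x. norm (x - x0) \<le> r \<Longrightarrow> c \<le> (norm (\<gamma> x))\<^sup>2"
    using norm_lower_bound_near[OF schwartz_continuous[OF \<gamma>(1)]] by metis
  have i: "integrable lborel (\<lambda>x. (norm (\<gamma> x))\<^sup>2)"
    using integrable_norm[OF schwartz_integrable[OF schwartz_mult[OF \<gamma>(1) \<gamma>(1)]]] by (simp add: norm_mult power2_eq_square)
  have "0 < c * measure lborel (cball x0 r)" using r(2) measure_cball_pos[OF r(1)] by simp
  also have "\<dots> \<le> (\<integral>x. (norm (\<gamma> x))\<^sup>2 \<partial>lborel)" by (rule integral_ge_on_ball[OF i _ r(1,3)]) simp_all
  finally show ?thesis .
qed

lemma powr_growth:
  fixes A B \<theta> :: real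
  assumes "0 < B" "0 < \<theta>" obtains J where "N \<le> J" "A < B * 2 powr (real J * \<theta>)"
proof -
  have "filterlim (\<lambda>J. B * 2 powr (real J * \<theta>)) at_top sequentially" using assms by real_asymp
  hence "eventually (\<lambda>J. A < B * 2 powr (real J * \<theta>)) sequentially" unfolding filterlim_at_top_dense by blast
  then obtain N' where "\<And>J. J \<ge> N' \<Longrightarrow> A < B * 2 powr (real J * \<theta>)" unfolding eventually_sequentially by blast
  thus ?thesis using that[of "max N N'"] by simp
qed

text \<open>A bounded operator would keep the pairing of \<open>Op (u J)\<close> with \<open>v J\<close> below the product of the norms of \<open>u J\<close> and \<open>v J\<close>.\<close>
lemma not_bounded_on_mod:
  fixes u v :: "nat \<Rightarrow> real^'n \<Rightarrow> complex"
  assumes \<gamma>: "schwartz \<gamma>" "\<gamma> \<noteq> (\<lambda>_. 0)"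
    and p: "1 < p" "1 < p'" "1 / p + 1 / p' = 1" and q: "1 < q" "1 < q'" "1 / q + 1 / q' = 1"
    and c: "0 < c" and \<theta>: "0 < \<theta>" and C: "0 \<le> Cu" "0 \<le> Cv" and AB: "\<And>J. 0 \<le> A J" "\<And>J. 0 \<le> B J"
    and test: "\<And>J. N \<le> J \<Longrightarrow> schwartz (u J)" "\<And>J. N \<le> J \<Longrightarrow> schwartz (v J)" "\<And>J. N \<le> J \<Longrightarrow> schwartz (psido \<sigma> (u J))"
    and pairing: "\<And>J. N \<le> J \<Longrightarrow> c * (A J * B J * 2 powr (real J * \<theta>)) \<le> norm (\<integral>x. psido \<sigma> (u J) x * cnj (v J x) \<partial>lborel)"
    and u: "\<And>J. mod_norm \<gamma> p q (u J) \<le> ennreal (Cu * A J)" and v: "\<And>J. mod_norm \<gamma> p' q' (v J) \<le> ennreal (Cv * B J)"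
    and pos: "\<And>J. 0 < A J * B J"
  shows "\<not> bounded_on_mod \<gamma> p q \<sigma>"
proof
  assume "bounded_on_mod \<gamma> p q \<sigma>"
  then obtain D where D: "\<And>f. schwartz f \<Longrightarrow> mod_norm \<gamma> p q (psido \<sigma> f) \<le> ennreal D * mod_norm \<gamma> p q f"
    unfolding bounded_on_mod_def by blast
  \<comment> \<open>The constant in \<open>bounded_on_mod\<close> is an arbitrary real; a negative
    one acts as 0 under \<open>ennreal\<close>, so it can be replaced by its positive part.\<close>
  define D' where "D' = max D 0"
  have D': "0 \<le> D'" "ennreal D = ennreal D'" unfolding D'_def by (auto simp: max_def ennreal_neg)
  define \<kappa> where "\<kappa> = cpi TYPE('n) * (\<integral>x. (norm (\<gamma> x))\<^sup>2 \<partial>lborel)"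
  have \<kappa>: "0 < \<kappa>" unfolding \<kappa>_def by (intro mult_pos_pos cpi_pos window_norm_pos[OF \<gamma>])
  \<comment> \<open>Chosen so that the growth \<open>2 powr (J \<theta>)\<close> exceeds the
    constants that remain once the norms \<open>A J * B J\<close> cancel.\<close>
  obtain J where J: "N \<le> J" and large: "D' * Cu * Cv < \<kappa> * c * 2 powr (real J * \<theta>)"
    using powr_growth[of "\<kappa> * c" \<theta>] \<kappa> c \<theta> by (metis mult_pos_pos)
  let ?I = "norm (\<integral>x. psido \<sigma> (u J) x * cnj (v J x) \<partial>lborel)"
  have "ennreal (\<kappa> * ?I) \<le> mod_norm \<gamma> p q (psido \<sigma> (u J)) * mod_norm \<gamma> p' q' (v J)"
    unfolding \<kappa>_def by (rule mod_norm_duality[OF test(3)[OF J] test(2)[OF J] \<gamma>(1) p q])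
  also have "\<dots> \<le> (ennreal D' * ennreal (Cu * A J)) * ennreal (Cv * B J)"
  proof (rule mult_mono[OF _ v])
    show "mod_norm \<gamma> p q (psido \<sigma> (u J)) \<le> ennreal D' * ennreal (Cu * A J)"
      using D[OF test(1)[OF J]] mult_left_mono[OF u[of J], of "ennreal D'"] unfolding D'(2) by (auto intro: order_trans)
  qed auto
  also have "\<dots> = ennreal ((D' * Cu * Cv) * (A J * B J))"
    using D'(1) C AB by (simp add: mult_ac flip: ennreal_mult)
  finally have "\<kappa> * ?I \<le> (D' * Cu * Cv) * (A J * B J)"
    using D'(1) C AB by (subst (asm) ennreal_le_iff) auto
  moreover have "\<kappa> * (c * (A J * B J * 2 powr (real J * \<theta>))) \<le> \<kappa> * ?I" using \<kappa> by (intro mult_left_mono pairing J) auto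
  ultimately have "(\<kappa> * c * 2 powr (real J * \<theta>)) * (A J * B J) \<le> (D' * Cu * Cv) * (A J * B J)" by (simp add: mult_ac)
  hence "\<kappa> * c * 2 powr (real J * \<theta>) \<le> D' * Cu * Cv" using pos[of J] by (rule mult_right_le_imp_le)
  with large show False by linarith
qed

context wave_symbol_normalized
begin

lemma lam_powr: "lam J powr r = 2 powr (real J * (\<delta> / 2 * r))"
  by (simp add: lam_def powr_powr mult_ac)

lemma mod_norm_fJ:
  assumes "schwartz \<gamma>" "1 \<le> p" "1 \<le> q"
  obtains C where "0 \<le> C" "\<And>J. mod_norm \<gamma> p q (fJ J) \<le> ennreal (C * lam J powr (2 * real CARD('n) / q - real CARD('n)))"
proof -
  obtain C where C: "C \<ge> 0" "\<And>L Ks (a::real^'n). L \<ge> 1 \<Longrightarrow> Ks \<subseteq> lat L \<Longrightarrow>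
    mod_norm \<gamma> p q (\<lambda>t. wave a t * (\<Sum>k\<in>Ks. wave k (L *\<^sub>R t - k) * \<Phi> (L *\<^sub>R t - k))) \<le> ennreal (C * L powr (2 * CARD('n) / q - CARD('n)))"
    using mod_norm_wave_packets_le[OF schwartz_\<Phi> assms] by blast
  show ?thesis
  proof (rule that[OF C(1)])
    fix J
    show "mod_norm \<gamma> p q (fJ J) \<le> ennreal (C * lam J powr (2 * real CARD('n) / q - real CARD('n)))"
      using C(2)[OF lam_ge_1[of J] K_subset[of J], of "ctr J"] unfolding fJ_def[abs_def] packet_def by simp
  qed
qed

text \<open>\<open>gJ J\<close> is a modulated packet sum over \<open>{0}\<close> at scale
  \<open>L = 1\<close> with \<open>\<Phi>^2\<close> in the role of \<open>\<Phi>\<close>, and the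
  bound for packet sums is uniform in the modulation.\<close>

lemma mod_norm_gJ:
  assumes "schwartz \<gamma>" "1 \<le> p" "1 \<le> q"
  obtains C where "0 \<le> C" "\<And>J. mod_norm \<gamma> p q (gJ J) \<le> ennreal (C * 1)"
proof -
  obtain C where C: "C \<ge> 0" "\<And>L Ks (a::real^'n). L \<ge> 1 \<Longrightarrow> Ks \<subseteq> lat L \<Longrightarrow>
    mod_norm \<gamma> p q (\<lambda>t. wave a t * (\<Sum>k\<in>Ks. wave k (L *\<^sub>R t - k) * (\<Phi> (L *\<^sub>R t - k) * \<Phi> (L *\<^sub>R t - k)))) \<le> ennreal (C * L powr (2 * CARD('n) / q - CARD('n)))"
    using mod_norm_wave_packets_le[OF schwartz_mult[OF schwartz_\<Phi> schwartz_\<Phi>] assms] by blast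
  have "{0} \<subseteq> (lat 1 :: (real^'n) set)" by (simp add: lat_def)
  show ?thesis
  proof (rule that[OF C(1)])
    fix J
    show "mod_norm \<gamma> p q (gJ J) \<le> ennreal (C * 1)"
      using C(2)[OF order_refl \<open>{0} \<subseteq> lat 1\<close>, of "ctr J"] unfolding gJ_def[abs_def] by simp
  qed
qed

definition P :: "nat \<Rightarrow> real" where
  "P J = (\<Sum>k\<in>K J. \<integral>x. (norm (\<Phi> (lam J *\<^sub>R x - k)))\<^sup>2 * (norm (\<Phi> x))\<^sup>2 \<partial>lborel)"

lemma pairing_sigma:
  assumes "j0 \<le> J"
  shows "(\<integral>x. psido (sigma_delta \<phi> \<eta> m \<delta> j0) (fJ J) x * cnj (gJ J x) \<partial>lborel) = complex_of_real (2 powr (real J * m) * P J)"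
proof -
  have "psido (sigma_delta \<phi> \<eta> m \<delta> j0) (fJ J) x * cnj (gJ J x)
     = complex_of_real (2 powr (real J * m)) * ((packet J x * cnj (packet J x)) * (\<Phi> x * \<Phi> x))" for x
    unfolding psido_sigma_fJ[OF assms] fJ_def gJ_def complex_cnj_mult cnj_wave cnj_\<Phi>
    by (simp add: mult_ac exp_minus)
  thus ?thesis unfolding P_def by (simp only: integral_mult_right_zero pairing_eq of_real_mult)
qed

lemma pairing_adjoint:
  assumes "j0 \<le> J" "2 \<le> J"
  shows "(\<integral>x. psido (\<lambda>x \<xi>. T 1 [] [] (x, \<xi>)) (gJ J) x * cnj (fJ J x) \<partial>lborel) = complex_of_real (2 powr (real J * m) * P J)"
proof -
  have "psido (\<lambda>x \<xi>. T 1 [] [] (x, \<xi>)) (gJ J) x * cnj (fJ J x)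
     = complex_of_real (2 powr (real J * m)) * ((packet J x * cnj (packet J x)) * (\<Phi> x * \<Phi> x))" for x
    unfolding psido_adjoint_gJ[OF assms] fJ_def gJ_def complex_cnj_mult cnj_wave
    by (simp add: mult_ac exp_minus)
  thus ?thesis unfolding P_def by (simp only: integral_mult_right_zero pairing_eq of_real_mult)
qed

text \<open>\<theta> is the surplus in the exponent of the pairing over the norm growth
  \<open>lam J powr r\<close>: the product of that growth with \<open>2 powr (J \<theta>)\<close> is
  exactly \<open>2 powr (J m)\<close>.\<close>

lemma pairing_growth:
  assumes "c \<le> P J" "0 < c" and r: "\<theta> = m - \<delta> / 2 * r"
  shows "c * (lam J powr r * 1 * 2 powr (real J * \<theta>)) \<le> norm (complex_of_real (2 powr (real J * m) * P J))"
proof -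
  have e: "lam J powr r * 1 * 2 powr (real J * \<theta>) = 2 powr (real J * m)"
    unfolding lam_powr r by (simp add: powr_add[symmetric] algebra_simps)
  have "norm (complex_of_real (2 powr (real J * m) * P J)) = 2 powr (real J * m) * P J"
    using assms(1,2) by (simp only: norm_of_real abs_mult abs_of_nonneg powr_ge_zero)
  moreover have "c * 2 powr (real J * m) \<le> 2 powr (real J * m) * P J"
    using mult_left_mono[OF assms(1), of "2 powr (real J * m)"] by (simp add: mult.commute)
  ultimately show ?thesis unfolding e by simp
qed

text \<open>For \<open>q \<ge> 2\<close> the number \<open>1/q - 1/2\<close> is nonpositive, so the
  assumption on \<open>m\<close> says exactly that \<open>m - \<delta> n (1/q - 1/2)\<close> is
  positive, and this number is \<theta>.\<close>

lemma sigma_not_bounded: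
  assumes \<gamma>: "schwartz \<gamma>" "\<gamma> \<noteq> (\<lambda>_. 0)" and p: "1 < p" and q: "1 < q" "2 \<le> q"
    and m: "m > - \<bar>1 / q - 1 / 2\<bar> * \<delta> * real CARD('n)"
  shows "\<not> bounded_on_mod \<gamma> p q (sigma_delta \<phi> \<eta> m \<delta> j0)"
proof -
  define p' where "p' = p / (p - 1)"
  define q' where "q' = q / (q - 1)"
  have p': "1 < p'" "1 / p + 1 / p' = 1" and q': "1 < q'" "1 / q + 1 / q' = 1"
    using p q by (auto simp: p'_def q'_def field_simps)
  let ?r = "2 * real CARD('n) / q - real CARD('n)"
  define \<theta> where "\<theta> = m - \<delta> / 2 * ?r"
  have "1 / q - 1 / 2 \<le> 0" using q by simp
  hence "m > (1 / q - 1 / 2) * \<delta> * real CARD('n)" using m by simp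
  hence \<theta>: "0 < \<theta>" unfolding \<theta>_def by (simp add: algebra_simps)
  obtain c J1 where c: "c > 0" "\<And>J. J \<ge> J1 \<Longrightarrow> c \<le> P J" unfolding P_def by (rule pairing_lower_bound) blast
  obtain Cf where Cf: "0 \<le> Cf" "\<And>J. mod_norm \<gamma> p q (fJ J) \<le> ennreal (Cf * lam J powr ?r)"
    using mod_norm_fJ[OF \<gamma>(1), of p q] p q by auto
  obtain Cg where Cg: "0 \<le> Cg" "\<And>J. mod_norm \<gamma> p' q' (gJ J) \<le> ennreal (Cg * 1)"
    using mod_norm_gJ[OF \<gamma>(1), of p' q'] p' q' by auto
  show ?thesis
  proof (rule not_bounded_on_mod[OF \<gamma> p p' q(1) q' c(1) \<theta> Cf(1) Cg(1) _ _ schwartz_fJ schwartz_gJ _ _ Cf(2) Cg(2), where N="max j0 J1"])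
    fix J assume J: "max j0 J1 \<le> J"
    hence e: "psido (sigma_delta \<phi> \<eta> m \<delta> j0) (fJ J) = (\<lambda>x. complex_of_real (2 powr (real J * m)) * (cnj (packet J x) * fJ J x))"
      by (intro ext) (simp add: psido_sigma_fJ)
    show "schwartz (psido (sigma_delta \<phi> \<eta> m \<delta> j0) (fJ J))" unfolding e
      by (intro schwartz_cmult schwartz_mult schwartz_cnj schwartz_packet schwartz_fJ)
    have "j0 \<le> J" "c \<le> P J" using J c(2) by auto
    thus "c * (lam J powr ?r * 1 * 2 powr (real J * \<theta>)) \<le> norm (\<integral>x. psido (sigma_delta \<phi> \<eta> m \<delta> j0) (fJ J) x * cnj (gJ J x) \<partial>lborel)"
      unfolding pairing_sigma[OF \<open>j0 \<le> J\<close>] by (intro pairing_growth[OF _ c(1) \<theta>_def])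
  qed (use lam_ge_1 in \<open>auto simp: lam_powr\<close>)
qed

text \<open>Here \<open>gJ\<close> is the input, with bounded norm in \<open>(p, q)\<close>, and
  \<open>fJ\<close> is tested in the dual norm \<open>(p', q')\<close>. As
  \<open>1/q' = 1 - 1/q\<close>, the norm exponent of \<open>fJ\<close> is
  \<open>n (1 - 2/q)\<close>, so \<theta> becomes \<open>m + \<delta> n (1/q - 1/2)\<close>, which
  is positive for \<open>q \<le> 2\<close>.\<close>

lemma adjoint_not_bounded:
  assumes \<gamma>: "schwartz \<gamma>" "\<gamma> \<noteq> (\<lambda>_. 0)" and p: "1 < p" and q: "1 < q" "q \<le> 2"
    and m: "m > - \<bar>1 / q - 1 / 2\<bar> * \<delta> * real CARD('n)"
  shows "\<not> bounded_on_mod \<gamma> p q (\<lambda>x \<xi>. T 1 [] [] (x, \<xi>))"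
proof -
  define p' where "p' = p / (p - 1)"
  define q' where "q' = q / (q - 1)"
  have p': "1 < p'" "1 / p + 1 / p' = 1" and q': "1 < q'" "1 / q + 1 / q' = 1"
    using p q by (auto simp: p'_def q'_def field_simps)
  let ?r = "2 * real CARD('n) / q' - real CARD('n)"
  define \<theta> where "\<theta> = m - \<delta> / 2 * ?r"
  have "1 / 2 \<le> 1 / q" using q by (intro divide_left_mono) auto
  hence m': "m > - (1 / q - 1 / 2) * \<delta> * real CARD('n)" using m by simp
  have r: "?r = (1 - 2 * (1 / q)) * real CARD('n)"
  proof -
    have "1 / q' = 1 - 1 / q" using q'(2) by linarith
    hence "?r = 2 * real CARD('n) * (1 - 1 / q) - real CARD('n)" by (metis times_divide_eq_right mult.right_neutral)
    thus ?thesis by (simp add: algebra_simps)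
  qed
  have "m - \<delta> / 2 * ((1 - 2 * y) * N) = m - - (y - 1 / 2) * \<delta> * N" for y N :: real by (simp add: algebra_simps)
  hence "\<theta> = m - - (1 / q - 1 / 2) * \<delta> * real CARD('n)" unfolding \<theta>_def r .
  with m' have \<theta>: "0 < \<theta>" by linarith
  obtain c J1 where c: "c > 0" "\<And>J. J \<ge> J1 \<Longrightarrow> c \<le> P J" unfolding P_def by (rule pairing_lower_bound) blast
  obtain Cf where Cf: "0 \<le> Cf" "\<And>J. mod_norm \<gamma> p' q' (fJ J) \<le> ennreal (Cf * lam J powr ?r)"
    using mod_norm_fJ[OF \<gamma>(1), of p' q'] p' q' by auto
  obtain Cg where Cg: "0 \<le> Cg" "\<And>J. mod_norm \<gamma> p q (gJ J) \<le> ennreal (Cg * 1)"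
    using mod_norm_gJ[OF \<gamma>(1), of p q] p q by auto
  show ?thesis
  proof (rule not_bounded_on_mod[OF \<gamma> p p' q(1) q' c(1) \<theta> Cg(1) Cf(1) _ _ schwartz_gJ schwartz_fJ _ _ Cg(2) Cf(2), where N="max j0 (max 2 J1)"])
    fix J assume J: "max j0 (max 2 J1) \<le> J"
    hence e: "psido (\<lambda>x \<xi>. T 1 [] [] (x, \<xi>)) (gJ J) = (\<lambda>x. complex_of_real (2 powr (real J * m)) * (packet J x * gJ J x))"
      by (intro ext) (simp add: psido_adjoint_gJ)
    show "schwartz (psido (\<lambda>x \<xi>. T 1 [] [] (x, \<xi>)) (gJ J))" unfolding e
      by (intro schwartz_cmult schwartz_mult schwartz_packet schwartz_gJ)
    have J': "j0 \<le> J" "2 \<le> J" and cP: "c \<le> P J" using J c(2) by auto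
    show "c * (1 * lam J powr ?r * 2 powr (real J * \<theta>)) \<le> norm (\<integral>x. psido (\<lambda>x \<xi>. T 1 [] [] (x, \<xi>)) (gJ J) x * cnj (fJ J x) \<partial>lborel)"
      unfolding pairing_adjoint[OF J'] using pairing_growth[OF cP c(1) \<theta>_def] by simp
  qed (use lam_ge_1 in \<open>auto simp: lam_powr\<close>)
qed

end

text \<open>\<open>is_adjoint_symbol\<close> prescribes \<tau> as a pointwise limit, which
  determines it uniquely; the existential therefore speaks about the adjoint symbol itself and
  includes the existence of the oscillatory integral.\<close>

theorem theorem2p1:
  fixes p q \<delta> m :: real
    and \<phi> \<eta> :: "real^'n::finite \<Rightarrow> real"
    and j0 :: nat
    and \<gamma> :: "real^'n \<Rightarrow> complex"
  assumes hp: "1 < p" and hq: "1 < q"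
    and h\<delta>: "0 < \<delta>" "\<delta> < 1"
    and hm: "m > - \<bar>1 / q - 1 / 2\<bar> * \<delta> * real CARD('n)"
    and h\<phi>: "schwartz \<phi>"
      "\<forall>x y. norm x = norm y \<longrightarrow> \<phi> x = \<phi> y"
      "closure {\<xi>. \<phi> \<xi> \<noteq> 0} \<subseteq> {\<xi>. norm \<xi> \<le> 1 / 8}"
      "(LINT \<xi>|lborel. \<phi> \<xi>) = 1"
    and h\<eta>: "schwartz \<eta>"
      "closure {\<xi>. \<eta> \<xi> \<noteq> 0} \<subseteq> {\<xi>. 2 powr (- 1 / 2) \<le> norm \<xi> \<and> norm \<xi> \<le> 2 powr (1 / 2)}"
      "\<forall>\<xi>. 2 powr (- 1 / 4) \<le> norm \<xi> \<and> norm \<xi> \<le> 2 powr (1 / 4) \<longrightarrow> \<eta> \<xi> = 1"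
    and hj0: "1 + 2 powr (real j0 * (\<delta> - 1) + 1) \<le> 2 powr (1 / 4)"
      "1 - 2 powr (real j0 * (\<delta> - 1) + 1) \<ge> 2 powr (- 1 / 4)"
      "2 powr (- real j0 * \<delta> / 2) * sqrt (real CARD('n)) \<le> 2 powr (- 3)"
    and h\<gamma>: "schwartz \<gamma>" "\<gamma> \<noteq> (\<lambda>_. 0)"
  shows "sigma_delta \<phi> \<eta> m \<delta> j0 \<in> symbol_class m 1 \<delta>
       \<and> (\<exists>\<tau>. is_adjoint_symbol (sigma_delta \<phi> \<eta> m \<delta> j0) \<tau> \<and> \<tau> \<in> symbol_class m 1 \<delta>
              \<and> (q \<le> 2 \<longrightarrow> \<not> bounded_on_mod \<gamma> p q \<tau>))
       \<and> (q \<ge> 2 \<longrightarrow> \<not> bounded_on_mod \<gamma> p q (sigma_delta \<phi> \<eta> m \<delta> j0))"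
proof -
  \<comment> \<open>The support conditions concern closures of the sets where \<open>\<phi>\<close>
    and \<open>\<eta>\<close> are nonzero; the locale works with their pointwise
    consequences.\<close>
  have \<phi>_supp: "\<phi> \<zeta> = 0" if "norm \<zeta> > 1 / 8" for \<zeta>
    using h\<phi>(3) closure_subset[of "{\<xi>. \<phi> \<xi> \<noteq> 0}"] that by force
  have \<eta>_supp: "2 powr (- 1 / 2) \<le> norm \<xi> \<and> norm \<xi> \<le> 2 powr (1 / 2)" if "\<eta> \<xi> \<noteq> 0" for \<xi>
    using h\<eta>(2) closure_subset[of "{\<xi>. \<eta> \<xi> \<noteq> 0}"] that by blast
  have even: "\<phi> (- \<zeta>) = \<phi> \<zeta>" for \<zeta>
    using h\<phi>(2)[rule_format, of "- \<zeta>" \<zeta>] by simp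
  interpret wave_symbol_normalized \<phi> \<eta> m \<delta> j0
  proof unfold_locales
    show "\<eta> \<xi> = 1" if "2 powr (- 1 / 4) \<le> norm \<xi>" "norm \<xi> \<le> 2 powr (1 / 4)" for \<xi>
      using h\<eta>(3)[rule_format, OF conjI[OF that]] .
  qed (fact h\<phi>(1,4) h\<eta>(1) h\<delta> hj0(1,2) even | erule \<phi>_supp \<eta>_supp)+
  have "(\<lambda>x \<xi>. T 1 [] [] (x, \<xi>)) \<in> symbol_class m 1 \<delta>" by (rule T_symbol_class) auto
  with sigma_delta_symbol_class adjoint_symbol show ?thesis
    using adjoint_not_bounded[OF h\<gamma> hp hq _ hm] sigma_not_bounded[OF h\<gamma> hp hq _ hm]
    by (intro conjI exI[of _ "\<lambda>x \<xi>. T 1 [] [] (x, \<xi>)"] impI)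
qed

end
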